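(* Let $n\ge 1$ and $0\le p\le n+1$ be integers with $p\neq\frac{n+1}{2}$, and let $x_0\in H^{n+1}$. Then Huygens' principle (as defined in the context) does not hold for the wave equation for $p$-forms on the real hyperbolic space $H^{n+1}$.
   Context: $H^{n+1}$ is the real hyperbolic space of dimension $n+1$, e.g. the half-space $\{(x_1,\dots,x_{n+1})\in\mathbb R^{n+1}: x_{n+1}>0\}$ with the metric $ds^2=(dx_1^2+\dots+dx_{n+1}^2)/x_{n+1}^2$. $B_{H^{n+1}}(x_0,r)$ is the geodesic ball of center $x_0$ and radius $r$ (empty if $r\le 0$). $\Delta_p=d\delta+\delta d$ is the nonnegative Laplace-Beltrami operator on $p$-forms, $\delta$ being the formal adjoint of $d$. The wave equation for $p$-forms is the Cauchy problem $\Delta_p\omega+\partial_{tt}^2\omega=0$, $\omega(0)=\omega_1$, $\partial_t\omega(0)=\omega_2$, with smooth initial $p$-forms $\omega_1,\omega_2$ on $H^{n+1}$. With $x_0\in H^{n+1}$ fixed, Huygens' principle is said to hold if both of the following conditions are fulfilled (for all smooth initial data $\omega_1,\omega_2$, all $R>0$ and all times $t$): (1) if the initial data are zero in $B_{H^{n+1}}(x_0,R)$, then the solution $\omega(x,t)$ at time $t$ is zero in $B_{H^{n+1}}(x_0,R-|t|)$; (2) if the initial data vanish outside $B_{H^{n+1}}(x_0,R)$, then the solution $\omega(x,t)$ at time $t$ vanishes in $B_{H^{n+1}}(x_0,|t|-R)$. *)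

theory Defs
  imports "HOL-Analysis.Analysis"
begin

section \<open>Smooth functions on open sets\<close>

text \<open>The sets \<open>S\<close> below are always open, so derivatives are taken at full neighbourhoods.\<close>

primrec Ck_on :: "nat \<Rightarrow> 'a::real_normed_vector set \<Rightarrow> ('a \<Rightarrow> real) \<Rightarrow> bool" where
  "Ck_on 0 S f \<longleftrightarrow> continuous_on S f"
| "Ck_on (Suc k) S f \<longleftrightarrow>
     (\<forall>x\<in>S. f differentiable (at x)) \<and>
     (\<forall>v. Ck_on k S (\<lambda>x. frechet_derivative f (at x) v))"

definition smooth_on :: "'a::real_normed_vector set \<Rightarrow> ('a \<Rightarrow> real) \<Rightarrow> bool" where
  "smooth_on S f \<longleftrightarrow> (\<forall>k. Ck_on k S f)"


section \<open>The half-space model of hyperbolic space\<close>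

text \<open>With \<open>n = CARD('n)\<close>, a point of \<open>\<real>\<^sup>n\<^sup>+\<^sup>1\<close> is a pair of \<open>(x\<^sub>1, \<dots>, x\<^sub>n)\<close> and the
  last coordinate, which is \<open>snd x\<close>. Tangent vectors have the same type as points.\<close>

type_synonym 'n point = "(real ^ 'n) \<times> real"

definition hyp_space :: "'n::finite point set" where
  "hyp_space = {x. snd x > 0}"

definition hyp_metric :: "'n::finite point \<Rightarrow> 'n point \<Rightarrow> 'n point \<Rightarrow> real" where
  "hyp_metric x u v = (u \<bullet> v) / (snd x)\<^sup>2"

definition hyp_length :: "(real \<Rightarrow> 'n::finite point) \<Rightarrow> real" where
  "hyp_length \<gamma> = integral {0..1}
     (\<lambda>t. sqrt (hyp_metric (\<gamma> t) (vector_derivative \<gamma> (at t)) (vector_derivative \<gamma> (at t))))"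

text \<open>The Riemannian distance. The curves are \<open>C\<^sup>1\<close> on all of \<open>[0,1]\<close> and not merely
  \<^const>\<open>valid_path\<close>, because the speed of the latter need not be integrable near the
  exceptional points, in which case \<^const>\<open>integral\<close> would return 0.\<close>

definition hyp_dist :: "'n::finite point \<Rightarrow> 'n point \<Rightarrow> real" where
  "hyp_dist x y = Inf {hyp_length \<gamma> | \<gamma>.
     \<gamma> C1_differentiable_on {0..1} \<and> \<gamma> ` {0..1} \<subseteq> hyp_space \<and> \<gamma> 0 = x \<and> \<gamma> 1 = y}"

definition hyp_ball :: "'n::finite point \<Rightarrow> real \<Rightarrow> 'n point set" where
  "hyp_ball x r = {y \<in> hyp_space. hyp_dist x y < r}"


section \<open>Differential forms\<close>

text \<open>A \<open>p\<close>-covector takes a sequence of vectors, of which only the first \<open>p\<close> entries matter.\<close>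

definition alternating :: "nat \<Rightarrow> ((nat \<Rightarrow> 'v::real_vector) \<Rightarrow> real) \<Rightarrow> bool" where
  "alternating p A \<longleftrightarrow>
     (\<forall>v w. (\<forall>i<p. v i = w i) \<longrightarrow> A v = A w) \<and>
     (\<forall>v. \<forall>i<p. linear (\<lambda>y. A (v(i := y)))) \<and>
     (\<forall>v. \<forall>i<p. \<forall>j<p. i \<noteq> j \<and> v i = v j \<longrightarrow> A v = 0)"

text \<open>The values of a form at points outside \<^const>\<open>hyp_space\<close> are irrelevant junk.\<close>

type_synonym 'n form = "'n point \<Rightarrow> (nat \<Rightarrow> 'n point) \<Rightarrow> real"

definition smooth_form :: "nat \<Rightarrow> 'n::finite form \<Rightarrow> bool" where
  "smooth_form p \<omega> \<longleftrightarrow>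
     (\<forall>x\<in>hyp_space. alternating p (\<omega> x)) \<and> (\<forall>v. smooth_on hyp_space (\<lambda>x. \<omega> x v))"

definition vanishes_on :: "'n::finite point set \<Rightarrow> 'n form \<Rightarrow> bool" where
  "vanishes_on S \<omega> \<longleftrightarrow> (\<forall>x\<in>S. \<forall>v. \<omega> x v = 0)"

definition compactly_supported :: "'n::finite form \<Rightarrow> bool" where
  "compactly_supported \<omega> \<longleftrightarrow>
     (\<exists>K. compact K \<and> K \<subseteq> hyp_space \<and> vanishes_on (hyp_space - K) \<omega>)"

definition omit :: "nat \<Rightarrow> (nat \<Rightarrow> 'v) \<Rightarrow> nat \<Rightarrow> 'v" where
  "omit i v = (\<lambda>j. if j < i then v j else v (Suc j))"

text \<open>The exterior derivative of a \<open>p\<close>-form, evaluated on constant vector fields (whose Lie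
  brackets vanish).\<close>

definition ext_deriv :: "nat \<Rightarrow> 'n::finite form \<Rightarrow> 'n form" where
  "ext_deriv p \<omega> x v =
     (\<Sum>i\<le>p. (- 1) ^ i * frechet_derivative (\<lambda>y. \<omega> y (omit i v)) (at x) (v i))"

text \<open>The vectors \<open>snd x *\<^sub>R b\<close> with \<open>b \<in> Basis\<close> are orthonormal for \<^term>\<open>hyp_metric x\<close>.
  Summing over all \<open>p\<close>-tuples of them counts each increasing tuple \<open>p!\<close> times, so the
  inner product is the one for which the wedge products of an orthonormal coframe over
  increasing tuples form an orthonormal basis.\<close>

definition form_inner ::
    "nat \<Rightarrow> 'n::finite point \<Rightarrow> ((nat \<Rightarrow> 'n point) \<Rightarrow> real) \<Rightarrow> ((nat \<Rightarrow> 'n point) \<Rightarrow> real) \<Rightarrow> real" where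
  "form_inner p x A B =
     (\<Sum>e \<in> {..<p} \<rightarrow>\<^sub>E Basis. A (\<lambda>i. snd x *\<^sub>R e i) * B (\<lambda>i. snd x *\<^sub>R e i)) / fact p"

text \<open>The Riemannian volume density is \<open>sqrt (det g) = 1 / (snd x) ^ (n + 1)\<close>.\<close>

definition form_L2_inner :: "nat \<Rightarrow> 'n::finite form \<Rightarrow> 'n form \<Rightarrow> real" where
  "form_L2_inner p \<alpha> \<beta> =
     (LINT x:hyp_space|lborel. form_inner p x (\<alpha> x) (\<beta> x) / snd x ^ (CARD('n) + 1))"

text \<open>\<open>\<eta> = \<delta>\<omega>\<close> for a \<open>(p + 1)\<close>-form \<open>\<omega>\<close>, where \<open>\<delta>\<close> is the formal adjoint of the exterior
  derivative on \<open>p\<close>-forms. This determines \<open>\<eta>\<close> on \<^const>\<open>hyp_space\<close>.\<close>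

definition is_codiff :: "nat \<Rightarrow> 'n::finite form \<Rightarrow> 'n form \<Rightarrow> bool" where
  "is_codiff p \<omega> \<eta> \<longleftrightarrow> smooth_form p \<eta> \<and>
     (\<forall>\<alpha>. smooth_form p \<alpha> \<and> compactly_supported \<alpha> \<longrightarrow>
        form_L2_inner (Suc p) (ext_deriv p \<alpha>) \<omega> = form_L2_inner p \<alpha> \<eta>)"

text \<open>\<open>\<theta> = d\<delta>\<omega> + \<delta>d\<omega>\<close> on \<^const>\<open>hyp_space\<close> for a \<open>p\<close>-form \<open>\<omega>\<close>; on functions \<open>\<delta> = 0\<close>.\<close>

definition is_laplacian :: "nat \<Rightarrow> 'n::finite form \<Rightarrow> 'n form \<Rightarrow> bool" where
  "is_laplacian p \<omega> \<theta> \<longleftrightarrow>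
     (\<exists>\<zeta>. is_codiff p (ext_deriv p \<omega>) \<zeta> \<and>
        (case p of
           0 \<Rightarrow> \<forall>x\<in>hyp_space. \<forall>v. \<theta> x v = \<zeta> x v
         | Suc q \<Rightarrow> \<exists>\<eta>. is_codiff q \<omega> \<eta> \<and>
             (\<forall>x\<in>hyp_space. \<forall>v. \<theta> x v = ext_deriv q \<eta> x v + \<zeta> x v)))"


section \<open>The wave equation and Huygens' principle\<close>

definition wave_solution ::
    "nat \<Rightarrow> 'n::finite form \<Rightarrow> 'n form \<Rightarrow> (real \<Rightarrow> 'n form) \<Rightarrow> bool" where
  "wave_solution p \<omega>\<^sub>1 \<omega>\<^sub>2 \<omega> \<longleftrightarrow>
     (\<forall>t. \<forall>x\<in>hyp_space. alternating p (\<omega> t x)) \<and>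
     (\<forall>v. smooth_on (UNIV \<times> hyp_space) (\<lambda>(t, x). \<omega> t x v)) \<and>
     (\<forall>t. \<exists>\<theta>. is_laplacian p (\<omega> t) \<theta> \<and>
        (\<forall>x\<in>hyp_space. \<forall>v. \<theta> x v + deriv (deriv (\<lambda>s. \<omega> s x v)) t = 0)) \<and>
     (\<forall>x\<in>hyp_space. \<forall>v. \<omega> 0 x v = \<omega>\<^sub>1 x v \<and> deriv (\<lambda>s. \<omega> s x v) 0 = \<omega>\<^sub>2 x v)"

definition huygens_principle :: "nat \<Rightarrow> 'n::finite point \<Rightarrow> bool" where
  "huygens_principle p x\<^sub>0 \<longleftrightarrow>
     (\<forall>\<omega>\<^sub>1 \<omega>\<^sub>2 \<omega> R t.
        smooth_form p \<omega>\<^sub>1 \<and> smooth_form p \<omega>\<^sub>2 \<and> wave_solution p \<omega>\<^sub>1 \<omega>\<^sub>2 \<omega> \<and> R > 0 \<longrightarrow>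
        (vanishes_on (hyp_ball x\<^sub>0 R) \<omega>\<^sub>1 \<and> vanishes_on (hyp_ball x\<^sub>0 R) \<omega>\<^sub>2 \<longrightarrow>
           vanishes_on (hyp_ball x\<^sub>0 (R - \<bar>t\<bar>)) (\<omega> t)) \<and>
        (vanishes_on (hyp_space - hyp_ball x\<^sub>0 R) \<omega>\<^sub>1 \<and>
         vanishes_on (hyp_space - hyp_ball x\<^sub>0 R) \<omega>\<^sub>2 \<longrightarrow>
           vanishes_on (hyp_ball x\<^sub>0 (\<bar>t\<bar> - R)) (\<omega> t)))"

end

(*
  Let s be the distance to x0 = (a, b), xi = x - a the horizontal displacement, y the height and
  A a constant horizontal (p+1)-form. The p-form y^(-p-1) k(t, s) i_xi A is coclosed, and it solves
  the wave equation exactly if k solves a radial Klein-Gordon equation of mass M = |n/2 - p|, shifted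
  by the bottom of the spectrum.  If M > 0, then k cannot have a lacuna {s < |t| - R}: otherwise the time moments
  int t^j k(t, s) dt are finite, and by induction on j they solve the static equation, whose nonzero
  regular solutions grow exponentially, whereas conservation of energy bounds them polynomially (after
  weighting). So all moments vanish, hence k = 0.  A nonzero k with smooth compactly
  supported data comes from the Klein-Gordon equation on the line, from descent to change the parity of the
  dimension, and from the operator (1 / sinh s) d/ds, which raises the dimension by two.
  Condition (2) of Huygens' principle would give such a lacuna; as R is arbitrary, crude upper bounds for
  the hyperbolic distance suffice.  The remaining degrees are reached from such forms: for p = n/2 by
  the exterior derivative of the form in degree p - 1, and for p = n and p = n + 1 by *du and *u with a
  scalar wave u.
*)
theory Submission
  imports Defs "HOL-Analysis.Analysis"
begin

section \<open>Calculus of smooth functions\<close>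

text \<open>For p = 0 the function y^(-1) (xi . e) is sinh s times a spherical harmonic of degree
  one. Such a factor raises the dimension of the radial equation by two, so k lives on
  \<open>H^(n+3)\<close>, and m = n in \<open>radial_wave\<close>. The weight y^(-p-1) contributes
  the constant (p + 1)(n + 1 - p) = ((n + 2)/2)^2 - (n/2 - p)^2, whence the mass |n/2 - p|. A
  positive mass is used twice: static solutions then grow exponentially even after weighting by
  (sinh s)^((n+2)/2), and the energy then bounds the weighted wave pointwise. Hence the detour for p
  = n/2; for p = n and p = n + 1 the obstacle is that R^n carries no nonzero A.

  The distance s is not smooth at x0, but cosh s is. Radial functions are therefore taken even in s,
  and their equations are written with d/dt and with D = (1 / sinh s) d/ds, which is the derivative
  with respect to cosh s. In these terms every equation is regular at s = 0.\<close>

abbreviation pd :: "'a::real_normed_vector \<Rightarrow> ('a \<Rightarrow> real) \<Rightarrow> 'a \<Rightarrow> real" where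
  "pd v f x \<equiv> frechet_derivative f (at x) v"

lemma differentiable_has_pd:
  fixes f :: "'a::real_normed_vector \<Rightarrow> real"
  shows "f differentiable (at x) \<Longrightarrow> (f has_derivative (\<lambda>v. pd v f x)) (at x)"
  by (simp add: frechet_derivative_works)

text \<open>\<open>frechet_derivative\<close> is a choice among the derivatives, and two functions
  that agree near x have the same derivatives. The equality therefore holds even where neither is
  differentiable.\<close>

lemma frechet_cong:
  fixes f g :: "'a::real_normed_vector \<Rightarrow> real"
  assumes "open S" "x \<in> S" "\<And>y. y \<in> S \<Longrightarrow> f y = g y"
  shows "frechet_derivative f (at x) = frechet_derivative g (at x)"
proof -
  have "(f has_derivative F) (at x) \<longleftrightarrow> (g has_derivative F) (at x)" for F
    using has_derivative_transform_within_open[of f F x UNIV S g]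
      has_derivative_transform_within_open[of g F x UNIV S f] assms by auto
  then show ?thesis by (simp add: frechet_derivative_def)
qed

lemma differentiable_cong:
  fixes f g :: "'a::real_normed_vector \<Rightarrow> real"
  assumes "open S" "x \<in> S" "\<And>y. y \<in> S \<Longrightarrow> f y = g y" "f differentiable (at x)"
  shows "g differentiable (at x)"
  using assms has_derivative_transform_within_open[of f _ x UNIV S g]
  unfolding differentiable_def by blast

lemma Ck_on_cong:
  assumes "open S" "\<And>y. y \<in> S \<Longrightarrow> f y = g y" "Ck_on k S f"
  shows "Ck_on k S g"
  using assms(2,3)
proof (induction k arbitrary: f g)
  case 0
  then show ?case by (simp cong: continuous_on_cong)
next
  case (Suc k)
  have eq: "pd v f x = pd v g x" if "x \<in> S" for v x
    using frechet_cong[OF assms(1) that Suc.prems(1)] by simp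
  have "Ck_on k S (pd v g)" for v
    by (rule Suc.IH[of "pd v f"]) (use eq Suc.prems(2) in simp_all)
  moreover have "g differentiable (at x)" if "x \<in> S" for x
    by (rule differentiable_cong[OF assms(1) that Suc.prems(1)]) (use Suc.prems(2) that in simp_all)
  ultimately show ?case by simp
qed

lemma Ck_on_mono: "Ck_on k S f \<Longrightarrow> j \<le> k \<Longrightarrow> Ck_on j S f"
proof (induction k arbitrary: j f)
  case (Suc k)
  have "Ck_on k S f"
  proof (cases k)
    case 0
    then show ?thesis using Suc.prems(1)
      by (auto intro!: differentiable_imp_continuous_on simp: differentiable_on_def differentiable_at_withinI)
  next
    case (Suc k')
    then have "Ck_on k' S (pd v f)" for v
      using Suc.prems(1) Suc.IH[of "pd v f" k'] \<open>k = Suc k'\<close> by auto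
    with Suc.prems(1) \<open>k = Suc k'\<close> show ?thesis by auto
  qed
  then show ?case using Suc.IH[of f j] Suc.prems by (cases "j = Suc k") (simp_all add: le_Suc_eq)
qed simp

text \<open>Used to glue a function with its extension by zero in \<open>extend_by_zero\<close>, and
  the slabs |t| < T in \<open>descent_smooth\<close>.\<close>

lemma Ck_on_Un: "(\<And>i. i \<in> I \<Longrightarrow> open (S i)) \<Longrightarrow> (\<And>i. i \<in> I \<Longrightarrow> Ck_on k (S i) f) \<Longrightarrow> Ck_on k (\<Union>i\<in>I. S i) f"
proof (induction k arbitrary: f)
  case 0
  then show ?case by (simp add: continuous_on_open_UN)
next
  case (Suc k)
  have "Ck_on k (\<Union>i\<in>I. S i) (pd v f)" for v
    using Suc.prems by (intro Suc.IH) auto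
  then show ?case using Suc.prems by auto
qed

lemma smooth_on_UN:
  "(\<And>i. i \<in> I \<Longrightarrow> open (S i)) \<Longrightarrow> (\<And>i. i \<in> I \<Longrightarrow> smooth_on (S i) f) \<Longrightarrow> smooth_on (\<Union>i\<in>I. S i) f"
  unfolding smooth_on_def by (intro allI Ck_on_Un) simp_all

lemma Ck_on_subset: "Ck_on k S f \<Longrightarrow> T \<subseteq> S \<Longrightarrow> Ck_on k T f"
proof (induction k arbitrary: f)
  case 0
  then show ?case using continuous_on_subset by auto
next
  case (Suc k)
  have "Ck_on k T (pd v f)" for v
    by (rule Suc.IH) (use Suc.prems in auto)
  then show ?case using Suc.prems by auto
qed

lemma smooth_on_subset: "smooth_on S f \<Longrightarrow> T \<subseteq> S \<Longrightarrow> smooth_on T f"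
  unfolding smooth_on_def by (intro allI Ck_on_subset[of _ S f T]) simp_all

lemma smooth_on_cong:
  assumes "open S" "\<And>y. y \<in> S \<Longrightarrow> f y = g y" "smooth_on S f"
  shows "smooth_on S g"
  using assms(3) unfolding smooth_on_def by (intro allI Ck_on_cong[OF assms(1,2)]) simp_all

lemma smooth_on_differentiable: "smooth_on S f \<Longrightarrow> x \<in> S \<Longrightarrow> f differentiable (at x)"
  unfolding smooth_on_def by (drule spec[of _ 1]) auto

lemma smooth_on_has_derivative:
  "smooth_on S f \<Longrightarrow> x \<in> S \<Longrightarrow> (f has_derivative (\<lambda>v. pd v f x)) (at x)"
  by (rule differentiable_has_pd[OF smooth_on_differentiable])

lemma smooth_on_pd: "smooth_on S f \<Longrightarrow> smooth_on S (pd v f)"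
  unfolding smooth_on_def
proof
  fix k assume "\<forall>k. Ck_on k S f"
  then have "Ck_on (Suc k) S f" ..
  then show "Ck_on k S (pd v f)" by simp
qed

lemma smooth_on_continuous: "smooth_on S f \<Longrightarrow> continuous_on S f"
  unfolding smooth_on_def by (drule spec[of _ 0]) simp

lemma pd_eq: "(f has_derivative F) (at x) \<Longrightarrow> pd v f x = F v"
  by (simp add: frechet_derivative_at[symmetric])

section \<open>Closure under sums, products and composition\<close>

lemma Ck_on_const [simp]: "Ck_on k S (\<lambda>x. c)"
  by (induction k arbitrary: c) auto

lemma smooth_on_const [simp, intro]: "smooth_on S (\<lambda>x. c)"
  by (simp add: smooth_on_def)

lemma smooth_on_bounded_linear:
  assumes "bounded_linear f" shows "smooth_on S f"
proof -
  have "pd v f x = f v" for v x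
    by (rule pd_eq) (rule bounded_linear_imp_has_derivative[OF assms])
  then have "Ck_on k S f" for k
    by (cases k) (auto simp: bounded_linear_imp_differentiable[OF assms]
        linear_continuous_on[OF assms])
  then show ?thesis by (simp add: smooth_on_def)
qed

lemma pd_add:
  "f differentiable (at x) \<Longrightarrow> g differentiable (at x) \<Longrightarrow> pd v (\<lambda>x. f x + g x) x = pd v f x + pd v g x"
  by (auto simp: frechet_derivative_works intro!: pd_eq[THEN trans] derivative_eq_intros)

lemma pd_mult:
  "f differentiable (at x) \<Longrightarrow> g differentiable (at x) \<Longrightarrow>
    pd v (\<lambda>x. f x * g x) x = f x * pd v g x + pd v f x * g x"
  by (auto simp: frechet_derivative_works intro!: pd_eq[THEN trans] derivative_eq_intros)

lemma Ck_on_add: "open S \<Longrightarrow> Ck_on k S f \<Longrightarrow> Ck_on k S g \<Longrightarrow> Ck_on k S (\<lambda>x. f x + g x)"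
proof (induction k arbitrary: f g)
  case (Suc k)
  have "Ck_on k S (pd v (\<lambda>x. f x + g x))" for v
  proof (rule Ck_on_cong[OF Suc.prems(1)])
    show "Ck_on k S (\<lambda>x. pd v f x + pd v g x)"
      using Suc.prems by (intro Suc.IH) simp_all
    show "pd v f x + pd v g x = pd v (\<lambda>x. f x + g x) x" if "x \<in> S" for x
      using Suc.prems that by (simp add: pd_add)
  qed
  then show ?case using Suc.prems by simp
qed (auto intro!: continuous_intros)

lemma Ck_on_mult: "open S \<Longrightarrow> Ck_on k S f \<Longrightarrow> Ck_on k S g \<Longrightarrow> Ck_on k S (\<lambda>x. f x * g x)"
proof (induction k arbitrary: f g)
  case (Suc k)
  have k: "Ck_on k S f" "Ck_on k S g"
    using Suc.prems Ck_on_mono[of "Suc k" S _ k] by auto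
  have "Ck_on k S (pd v (\<lambda>x. f x * g x))" for v
  proof (rule Ck_on_cong[OF Suc.prems(1)])
    show "Ck_on k S (\<lambda>x. f x * pd v g x + pd v f x * g x)"
      using Suc.prems by (intro Ck_on_add Suc.IH k) simp_all
    show "f x * pd v g x + pd v f x * g x = pd v (\<lambda>x. f x * g x) x" if "x \<in> S" for x
      using Suc.prems that by (simp add: pd_mult)
  qed
  then show ?case using Suc.prems by simp
qed (auto intro!: continuous_intros)

lemma Ck_on_sum:
  "open S \<Longrightarrow> (\<And>i. i \<in> I \<Longrightarrow> Ck_on k S (f i)) \<Longrightarrow> Ck_on k S (\<lambda>x. \<Sum>i\<in>I. f i x)"
  by (induction I rule: infinite_finite_induct) (auto intro: Ck_on_add)

lemma smooth_on_add: "open S \<Longrightarrow> smooth_on S f \<Longrightarrow> smooth_on S g \<Longrightarrow> smooth_on S (\<lambda>x. f x + g x)"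
  by (simp add: smooth_on_def Ck_on_add)

lemma smooth_on_mult: "open S \<Longrightarrow> smooth_on S f \<Longrightarrow> smooth_on S g \<Longrightarrow> smooth_on S (\<lambda>x. f x * g x)"
  by (simp add: smooth_on_def Ck_on_mult)

lemma smooth_on_minus: "open S \<Longrightarrow> smooth_on S f \<Longrightarrow> smooth_on S (\<lambda>x. - f x)"
  using smooth_on_mult[of S "\<lambda>_. -1" f] by simp

lemma smooth_on_diff: "open S \<Longrightarrow> smooth_on S f \<Longrightarrow> smooth_on S g \<Longrightarrow> smooth_on S (\<lambda>x. f x - g x)"
  using smooth_on_add[of S f "\<lambda>x. - g x"] smooth_on_minus by auto

lemma smooth_on_sum:
  "open S \<Longrightarrow> (\<And>i. i \<in> I \<Longrightarrow> smooth_on S (f i)) \<Longrightarrow> smooth_on S (\<lambda>x. \<Sum>i\<in>I. f i x)"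
  by (simp add: smooth_on_def Ck_on_sum)

lemma smooth_on_power: "open S \<Longrightarrow> smooth_on S f \<Longrightarrow> smooth_on S (\<lambda>x. f x ^ n)"
  by (induction n) (simp_all add: smooth_on_mult)

lemma pd_minus: "f differentiable (at x) \<Longrightarrow> pd v (\<lambda>x. - f x) x = - pd v f x"
  by (auto simp: frechet_derivative_works intro!: pd_eq[THEN trans] derivative_eq_intros)

lemma pd_cmult: "f differentiable (at x) \<Longrightarrow> pd v (\<lambda>x. c * f x) x = c * pd v f x"
  by (subst pd_mult) auto

lemma pd_sum:
  assumes "\<And>i. i \<in> I \<Longrightarrow> f i differentiable (at x)"
  shows "pd v (\<lambda>x. \<Sum>i\<in>I. f i x) x = (\<Sum>i\<in>I. pd v (f i) x)"
  using assms by (auto simp: frechet_derivative_works intro!: pd_eq[THEN trans] has_derivative_sum)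

lemma differentiable_euclidean:
  fixes g :: "'a::real_normed_vector \<Rightarrow> 'b::euclidean_space"
  assumes "\<And>b. b \<in> Basis \<Longrightarrow> (\<lambda>x. g x \<bullet> b) differentiable (at x)"
  shows "(g has_derivative (\<lambda>v. \<Sum>b\<in>Basis. pd v (\<lambda>x. g x \<bullet> b) x *\<^sub>R b)) (at x)"
proof (subst has_derivative_componentwise_within, intro ballI)
  fix b :: 'b assume b: "b \<in> Basis"
  have "((\<lambda>x. g x \<bullet> b) has_derivative (\<lambda>v. pd v (\<lambda>x. g x \<bullet> b) x)) (at x)"
    by (rule differentiable_has_pd[OF assms[OF b]])
  then show "((\<lambda>x. g x \<bullet> b) has_derivative (\<lambda>v. (\<Sum>c\<in>Basis. pd v (\<lambda>x. g x \<bullet> c) x *\<^sub>R c) \<bullet> b)) (at x)"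
    by (simp add: b inner_sum_left inner_Basis if_distrib sum.delta cong: if_cong)
qed

lemma pd_compose:
  fixes g :: "'a::real_normed_vector \<Rightarrow> 'b::euclidean_space"
  assumes "\<And>b. b \<in> Basis \<Longrightarrow> (\<lambda>x. g x \<bullet> b) differentiable (at x)" "f differentiable (at (g x))"
  shows "(\<lambda>x. f (g x)) differentiable (at x)"
    and "pd v (\<lambda>x. f (g x)) x = (\<Sum>b\<in>Basis. pd v (\<lambda>x. g x \<bullet> b) x * pd b f (g x))"
proof -
  have f: "(f has_derivative (\<lambda>v. pd v f (g x))) (at (g x))"
    by (rule differentiable_has_pd[OF assms(2)])
  have h: "((\<lambda>x. f (g x)) has_derivative (\<lambda>v. pd (\<Sum>b\<in>Basis. pd v (\<lambda>x. g x \<bullet> b) x *\<^sub>R b) f (g x))) (at x)"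
    by (rule has_derivative_compose[where f=g and g=f, OF _ f], rule differentiable_euclidean, rule assms(1))
  interpret linear "\<lambda>v. pd v f (g x)"
    by (rule has_derivative_linear[OF f])
  show "(\<lambda>x. f (g x)) differentiable (at x)" by (rule differentiableI[OF h])
  show "pd v (\<lambda>x. f (g x)) x = (\<Sum>b\<in>Basis. pd v (\<lambda>x. g x \<bullet> b) x * pd b f (g x))"
    unfolding pd_eq[OF h] sum scale real_scaleR_def ..
qed

text \<open>\<open>Ck_on\<close> speaks of real-valued functions, so the inner map enters through
  its coordinates. The chain rule in coordinates is a finite sum of products, and the induction
  hypothesis applies to the partial derivatives of f.\<close>

lemma Ck_on_compose:
  fixes g :: "'a::real_normed_vector \<Rightarrow> 'b::euclidean_space"
  assumes "open S" "\<And>x. x \<in> S \<Longrightarrow> g x \<in> T"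
  shows "(\<And>b. b \<in> Basis \<Longrightarrow> Ck_on k S (\<lambda>x. g x \<bullet> b)) \<Longrightarrow> Ck_on k T f \<Longrightarrow> Ck_on k S (\<lambda>x. f (g x))"
proof (induction k arbitrary: f)
  case 0
  have "continuous_on S g"
    by (subst continuous_on_componentwise) (use 0 in simp)
  moreover have "continuous_on T f" "g ` S \<subseteq> T" using 0 assms(2) by auto
  ultimately show ?case by (simp add: continuous_on_compose2[of T f S g])
next
  case (Suc k)
  have k: "\<And>b. b \<in> Basis \<Longrightarrow> Ck_on k S (\<lambda>x. g x \<bullet> b)"
    using Suc.prems Ck_on_mono[of "Suc k" S _ k] by auto
  have d: "x \<in> S \<Longrightarrow> b \<in> Basis \<Longrightarrow> (\<lambda>x. g x \<bullet> b) differentiable (at x)" for x b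
    using Suc.prems(1)[of b] by simp
  have d': "x \<in> S \<Longrightarrow> f differentiable (at (g x))" for x
    using Suc.prems(2) assms(2) by simp
  have f: "Ck_on k S (\<lambda>x. pd b f (g x))" for b
    by (rule Suc.IH[OF k]) (use Suc.prems(2) in simp_all)
  have g: "Ck_on k S (\<lambda>x. pd v (\<lambda>x. g x \<bullet> b) x)" if "b \<in> Basis" for b v
    using Suc.prems(1)[OF that] by simp
  have "Ck_on k S (\<lambda>x. \<Sum>b\<in>Basis. pd v (\<lambda>x. g x \<bullet> b) x * pd b f (g x))" for v
    by (rule Ck_on_sum[OF assms(1)]) (intro Ck_on_mult assms(1) f g)
  then have "Ck_on k S (pd v (\<lambda>x. f (g x)))" for v
    by (rule Ck_on_cong[OF assms(1), rotated]) (use d d' in \<open>simp add: pd_compose(2)\<close>)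
  moreover have "(\<lambda>x. f (g x)) differentiable (at x)" if "x \<in> S" for x
    by (rule pd_compose(1)[where f=f and g=g]) (use d d' that in simp_all)
  ultimately show ?case by simp
qed

lemma smooth_on_compose:
  fixes g :: "'a::real_normed_vector \<Rightarrow> 'b::euclidean_space"
  assumes "open S" "\<And>b. b \<in> Basis \<Longrightarrow> smooth_on S (\<lambda>x. g x \<bullet> b)" "smooth_on T f" "\<And>x. x \<in> S \<Longrightarrow> g x \<in> T"
  shows "smooth_on S (\<lambda>x. f (g x))"
  unfolding smooth_on_def
  by (intro allI, rule Ck_on_compose[where f=f and g=g, OF assms(1,4)])
    (use assms(2,3) in \<open>simp_all add: smooth_on_def\<close>)

lemma smooth_on_compose_real:
  fixes g :: "'a::real_normed_vector \<Rightarrow> real"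
  assumes "open S" "smooth_on S g" "smooth_on T f" "\<And>x. x \<in> S \<Longrightarrow> g x \<in> T"
  shows "smooth_on S (\<lambda>x. f (g x))"
  by (rule smooth_on_compose[where f=f and g=g, OF assms(1) _ assms(3,4)]) (use assms(2) in simp_all)

lemma smooth_on_compose_Pair:
  fixes g :: "'a::real_normed_vector \<Rightarrow> 'b::euclidean_space" and h :: "'a \<Rightarrow> 'c::euclidean_space"
  assumes "open S" "\<And>b. b \<in> Basis \<Longrightarrow> smooth_on S (\<lambda>x. g x \<bullet> b)" "\<And>b. b \<in> Basis \<Longrightarrow> smooth_on S (\<lambda>x. h x \<bullet> b)"
    "smooth_on T f" "\<And>x. x \<in> S \<Longrightarrow> (g x, h x) \<in> T"
  shows "smooth_on S (\<lambda>x. f (g x, h x))"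
  by (rule smooth_on_compose[where f=f and g="\<lambda>x. (g x, h x)", OF assms(1) _ assms(4,5)])
    (use assms(2,3) in \<open>auto simp: Basis_prod_def\<close>)

section \<open>Functions of one real variable\<close>

lemma Ck_on_real:
  fixes f :: "real \<Rightarrow> real"
  assumes "open S" "\<And>x. x \<in> S \<Longrightarrow> (f has_real_derivative f' x) (at x)" "Ck_on k S f'"
  shows "Ck_on (Suc k) S f"
proof -
  have d: "(f has_derivative (\<lambda>v. f' x * v)) (at x)" if "x \<in> S" for x
    using assms(2)[OF that] by (simp add: has_field_derivative_def)
  have "Ck_on k S (pd v f)" for v
    by (rule Ck_on_cong[OF assms(1), of "\<lambda>x. f' x * v"])
      (simp_all add: pd_eq[OF d] Ck_on_mult assms)
  then show ?thesis using d by (auto simp: differentiable_def)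
qed

text \<open>One induction on k for the whole family at once: it suffices that each derivative is k
  times differentiable whenever all members are. This covers cosh and sinh, 1/x, the functions
  \<open>flat j\<close> and everywhere convergent power series.\<close>

lemma smooth_on_real_family:
  fixes f :: "'i \<Rightarrow> real \<Rightarrow> real"
  assumes "open S" "\<And>i. i \<in> I \<Longrightarrow> \<exists>f'. (\<forall>x\<in>S. (f i has_real_derivative f' x) (at x)) \<and>
     (\<forall>k. (\<forall>i\<in>I. Ck_on k S (f i)) \<longrightarrow> Ck_on k S f')"
  shows "i \<in> I \<Longrightarrow> smooth_on S (f i)"
proof -
  have "\<forall>i\<in>I. Ck_on k S (f i)" for k
  proof (induction k)
    case 0
    have "continuous_on S (f i)" if "i \<in> I" for i
      using assms(2)[OF that] by (auto intro!: continuous_at_imp_continuous_on dest: DERIV_isCont)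
    then show ?case by auto
  next
    case (Suc k)
    then show ?case using assms(2) Ck_on_real[OF assms(1)] by meson
  qed
  then show "i \<in> I \<Longrightarrow> smooth_on S (f i)" by (auto simp: smooth_on_def)
qed

lemma smooth_on_cosh_sinh: "smooth_on UNIV (cosh :: real \<Rightarrow> real)" "smooth_on UNIV (sinh :: real \<Rightarrow> real)"
proof -
  have "smooth_on UNIV ((\<lambda>b. if b then cosh else sinh) b :: real \<Rightarrow> real)" for b :: bool
  proof (rule smooth_on_real_family[of UNIV UNIV])
    fix b :: bool
    show "\<exists>f'. (\<forall>x\<in>UNIV. ((if b then cosh else sinh) has_real_derivative f' x) (at x)) \<and>
      (\<forall>k. (\<forall>i\<in>UNIV. Ck_on k UNIV (if i then cosh else sinh :: real \<Rightarrow> real)) \<longrightarrow> Ck_on k UNIV f')"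
      by (rule exI[of _ "if \<not> b then cosh else sinh"], cases b)
        (auto intro!: derivative_eq_intros dest: spec[of _ True] spec[of _ False])
  qed auto
  from this[of True] this[of False]
  show "smooth_on UNIV (cosh :: real \<Rightarrow> real)" "smooth_on UNIV (sinh :: real \<Rightarrow> real)" by simp_all
qed

lemma smooth_on_inverse: "smooth_on {x. x \<noteq> 0} (inverse :: real \<Rightarrow> real)"
  by (rule smooth_on_real_family[of _ "{()}" "\<lambda>_. inverse", simplified])
    (auto intro!: exI[of _ "\<lambda>x. (-1) * (inverse x * inverse x)"] derivative_eq_intros Ck_on_mult Ck_on_const
      open_Collect_neq continuous_intros simp del: mult_minus1 mult_minus_left)

lemma smooth_on_divide:
  assumes "open S" "smooth_on S f" "smooth_on S g" "\<And>x. x \<in> S \<Longrightarrow> g x \<noteq> 0"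
  shows "smooth_on S (\<lambda>x. f x / g x)"
  using smooth_on_mult[OF assms(1,2) smooth_on_compose_real[OF assms(1,3) smooth_on_inverse]] assms(4)
  by (simp add: divide_inverse)

lemma smooth_on_powi:
  assumes "open S" "smooth_on S f" "\<And>x. x \<in> S \<Longrightarrow> f x \<noteq> 0"
  shows "smooth_on S (\<lambda>x. f x powi a)"
proof (cases "a \<ge> 0")
  case True
  then show ?thesis using smooth_on_power[OF assms(1,2)] by (simp add: power_int_def)
next
  case False
  then show ?thesis
    using smooth_on_power[OF assms(1) smooth_on_compose_real[OF assms(1,2) smooth_on_inverse]] assms(3)
    by (simp add: power_int_def)
qed

text \<open>The second difference of f over the parallelogram spanned by e u and e v equals e^2
  times a mixed derivative at a nearby point, in either order of differentiation. Continuity of both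
  mixed derivatives and e -> 0 give the claim.\<close>

lemma pd_symmetric:
  fixes f :: "'a::real_normed_vector \<Rightarrow> real"
  assumes "open S" "smooth_on S f" "x \<in> S"
  shows "pd u (pd v f) x = pd v (pd u f) x"
proof -
  have key: "\<exists>p q. norm (p - x) \<le> e * (norm u + norm v) \<and> norm (q - x) \<le> e * (norm u + norm v) \<and>
      pd v (pd u f) p = pd u (pd v f) q" if e: "e > 0" "\<And>y. norm (y - x) \<le> e * (norm u + norm v) \<Longrightarrow> y \<in> S" for e
  proof -
    have line: "((\<lambda>h. g (x + h *\<^sub>R a + k *\<^sub>R b)) has_real_derivative pd a g (x + h *\<^sub>R a + k *\<^sub>R b)) (at h)"
      if "smooth_on S g" "x + h *\<^sub>R a + k *\<^sub>R b \<in> S" for g a b h k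
    proof -
      have g: "(g has_derivative (\<lambda>v. pd v g (x + h *\<^sub>R a + k *\<^sub>R b))) (at (x + h *\<^sub>R a + k *\<^sub>R b))"
        using smooth_on_has_derivative[OF that] .
      interpret linear "\<lambda>v. pd v g (x + h *\<^sub>R a + k *\<^sub>R b)" by (rule has_derivative_linear[OF g])
      have "((\<lambda>h. x + h *\<^sub>R a + k *\<^sub>R b) has_derivative (\<lambda>t. t *\<^sub>R a)) (at h)"
        by (auto intro!: derivative_eq_intros)
      from has_derivative_compose[OF this g] show ?thesis
        by (simp add: has_field_derivative_def scale mult.commute[of _ "pd a g _"])
    qed
    have main: "\<exists>p. norm (p - x) \<le> e * (norm a + norm b) \<and>
      f (x + e *\<^sub>R a + e *\<^sub>R b) - f (x + e *\<^sub>R a) - f (x + e *\<^sub>R b) + f x = e * e * pd b (pd a f) p"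
      if S: "\<And>y. norm (y - x) \<le> e * (norm a + norm b) \<Longrightarrow> y \<in> S" for a b
    proof -
      have n: "norm ((x + h *\<^sub>R a + k *\<^sub>R b) - x) \<le> e * (norm a + norm b)" if "0 \<le> h" "h \<le> e" "0 \<le> k" "k \<le> e" for h k
        using that norm_triangle_ineq[of "h *\<^sub>R a" "k *\<^sub>R b"] mult_right_mono[of h e "norm a"] mult_right_mono[of k e "norm b"]
        by (simp add: algebra_simps)
      \<comment> \<open>Mean value theorem along a, applied to the difference of f at the two levels
        of b; a second one along b, applied to \<open>pd a f\<close>, follows.\<close>
      have "\<exists>z. 0 < z \<and> z < e \<and> (f (x + e *\<^sub>R a + e *\<^sub>R b) - f (x + e *\<^sub>R a + 0 *\<^sub>R b)) - (f (x + 0 *\<^sub>R a + e *\<^sub>R b) - f (x + 0 *\<^sub>R a + 0 *\<^sub>R b)) =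
          (e - 0) * (pd a f (x + z *\<^sub>R a + e *\<^sub>R b) - pd a f (x + z *\<^sub>R a + 0 *\<^sub>R b))"
        using e(1) by (intro MVT2[of 0 e "\<lambda>h. f (x + h *\<^sub>R a + e *\<^sub>R b) - f (x + h *\<^sub>R a + 0 *\<^sub>R b)"])
          (auto intro!: DERIV_diff line assms S n simp del: scaleR_zero_left)
      then obtain z where z: "0 < z" "z < e" and z': "(f (x + e *\<^sub>R a + e *\<^sub>R b) - f (x + e *\<^sub>R a)) - (f (x + e *\<^sub>R b) - f x) =
          e * (pd a f (x + z *\<^sub>R a + e *\<^sub>R b) - pd a f (x + z *\<^sub>R a))"
        by auto
      have eq: "x + h *\<^sub>R b + z *\<^sub>R a = x + z *\<^sub>R a + h *\<^sub>R b" for h by simp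
      have "\<exists>y. 0 < y \<and> y < e \<and> pd a f (x + e *\<^sub>R b + z *\<^sub>R a) - pd a f (x + 0 *\<^sub>R b + z *\<^sub>R a) =
          (e - 0) * pd b (pd a f) (x + y *\<^sub>R b + z *\<^sub>R a)"
      proof (rule MVT2[OF e(1)])
        fix h assume h: "0 \<le> h" "h \<le> e"
        show "((\<lambda>h. pd a f (x + h *\<^sub>R b + z *\<^sub>R a)) has_real_derivative pd b (pd a f) (x + h *\<^sub>R b + z *\<^sub>R a)) (at h)"
          by (rule line[OF smooth_on_pd[OF assms(2)]], subst eq, rule S, rule n) (use h z in auto)
      qed
      then obtain y where y: "0 < y" "y < e" "pd a f (x + z *\<^sub>R a + e *\<^sub>R b) - pd a f (x + z *\<^sub>R a) =
          e * pd b (pd a f) (x + z *\<^sub>R a + y *\<^sub>R b)"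
        by (auto simp: algebra_simps)
      show ?thesis
        by (rule exI[of _ "x + z *\<^sub>R a + y *\<^sub>R b"])
          (use z z' y n[of z y] in \<open>auto simp: algebra_simps\<close>)
    qed
    obtain p where p: "norm (p - x) \<le> e * (norm u + norm v)"
      "f (x + e *\<^sub>R u + e *\<^sub>R v) - f (x + e *\<^sub>R u) - f (x + e *\<^sub>R v) + f x = e * e * pd v (pd u f) p"
      using main[of u v] e(2) by auto
    obtain q where q: "norm (q - x) \<le> e * (norm u + norm v)"
      "f (x + e *\<^sub>R v + e *\<^sub>R u) - f (x + e *\<^sub>R v) - f (x + e *\<^sub>R u) + f x = e * e * pd u (pd v f) q"
      using main[of v u] e(2) by (auto simp: add.commute)
    have "e * e * pd v (pd u f) p = e * e * pd u (pd v f) q"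
      using p(2) q(2) by (simp add: algebra_simps)
    then show ?thesis using e p q by auto
  qed
  obtain d where d: "d > 0" "ball x d \<subseteq> S" using assms openE by blast
  \<comment> \<open>The added 1 keeps N positive when u and v are both 0, and makes e n (norm u +
    norm v) strictly smaller than d.\<close>
  define N where "N = norm u + norm v + 1"
  have N: "N > 0" "norm u + norm v < N" by (auto simp: N_def add_nonneg_pos)
  define e where "e n = d / (N * (real n + 1))" for n
  have e0: "e n > 0" for n using d N by (simp add: e_def)
  have eb: "e n * (norm u + norm v) \<le> d / (real n + 1)" for n
  proof -
    have "e n * (norm u + norm v) \<le> e n * N" using e0[of n] N by (intro mult_left_mono) auto
    also have "\<dots> = d / (real n + 1)" using N by (simp add: e_def)
    finally show ?thesis .
  qed
  have lt: "e n * (norm u + norm v) < d" for n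
  proof -
    have "e n * (norm u + norm v) < e n * N" using e0[of n] N by (intro mult_strict_left_mono) auto
    also have "\<dots> = d / (real n + 1)" using N by (simp add: e_def)
    also have "\<dots> \<le> d" using d(1) by (simp add: divide_le_eq)
    finally show ?thesis .
  qed
  have "\<exists>p q. norm (p - x) \<le> e n * (norm u + norm v) \<and> norm (q - x) \<le> e n * (norm u + norm v) \<and>
      pd v (pd u f) p = pd u (pd v f) q" for n
    using e0 lt[of n] d by (intro key) (auto simp: dist_norm norm_minus_commute subset_iff)
  then obtain p q where pq: "\<And>n. norm (p n - x) \<le> e n * (norm u + norm v)" "\<And>n. norm (q n - x) \<le> e n * (norm u + norm v)"
      "\<And>n. pd v (pd u f) (p n) = pd u (pd v f) (q n)"
    by metis
  have lim: "r \<longlonglongrightarrow> x" if "\<And>n. norm (r n - x) \<le> e n * (norm u + norm v)" for r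
  proof -
    have "(\<lambda>n. d / (real n + 1)) \<longlonglongrightarrow> 0"
      using LIMSEQ_ignore_initial_segment[OF lim_const_over_n[of d], of 1] by (simp add: add.commute)
    then have "(\<lambda>n. r n - x) \<longlonglongrightarrow> 0"
      by (rule Lim_null_comparison[rotated]) (use order_trans[OF that eb] in \<open>simp add: always_eventually\<close>)
    then show ?thesis using LIM_zero_iff by blast
  qed
  have c: "isCont (pd v (pd u f)) x" "isCont (pd u (pd v f)) x"
    using assms by (auto intro!: continuous_on_interior smooth_on_continuous smooth_on_pd simp: interior_open)
  have "(\<lambda>n. pd v (pd u f) (p n)) \<longlonglongrightarrow> pd v (pd u f) x" "(\<lambda>n. pd u (pd v f) (q n)) \<longlonglongrightarrow> pd u (pd v f) x"
    using c lim pq isCont_tendsto_compose by blast+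
  then show ?thesis unfolding pq(3) by (metis LIMSEQ_unique)
qed

lemma smooth_on_compose2:
  fixes g h :: "'a::real_normed_vector \<Rightarrow> real"
  assumes "smooth_on UNIV f" "open S" "smooth_on S g" "smooth_on S h"
  shows "smooth_on S (\<lambda>x. f (g x, h x))"
  by (rule smooth_on_compose_Pair[where f=f and g=g and h=h, OF assms(2) _ _ assms(1)])
    (use assms(3,4) in simp_all)

lemma smooth_on_compose1:
  fixes g :: "'a::real_normed_vector \<Rightarrow> real"
  assumes "smooth_on UNIV f" "open S" "smooth_on S g"
  shows "smooth_on S (\<lambda>x. f (g x))"
  by (rule smooth_on_compose_real[where f=f and g=g, OF assms(2,3,1)]) simp

lemma smooth_on_id: "smooth_on S (\<lambda>x::real. x)"
  by (rule smooth_on_bounded_linear[OF bounded_linear_ident])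

lemma smooth_on_fst: "smooth_on S (fst :: real \<times> 'b::real_normed_vector \<Rightarrow> real)"
  by (rule smooth_on_bounded_linear[OF bounded_linear_fst])

lemma smooth_on_snd: "smooth_on S (snd :: 'b::real_normed_vector \<times> real \<Rightarrow> real)"
  by (rule smooth_on_bounded_linear[OF bounded_linear_snd])

lemma smooth_on_fst_fst: "smooth_on S (\<lambda>x::(real \<times> real) \<times> real. fst (fst x))"
  and smooth_on_snd_fst: "smooth_on S (\<lambda>x::(real \<times> real) \<times> real. snd (fst x))"
  by (auto intro!: smooth_on_bounded_linear bounded_linear_intros)

lemmas smooth_intros = smooth_on_add smooth_on_diff smooth_on_minus smooth_on_mult smooth_on_power smooth_on_const
  smooth_on_id smooth_on_fst smooth_on_snd smooth_on_fst_fst smooth_on_snd_fst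
  smooth_on_compose1[OF smooth_on_cosh_sinh(1)] smooth_on_compose1[OF smooth_on_cosh_sinh(2)]

section \<open>Linearity in the direction, and differentiation under the integral sign\<close>

lemma pd_scaleR:
  assumes "f differentiable (at x)" shows "pd (c *\<^sub>R v) f x = c * pd v f x"
proof -
  interpret linear "\<lambda>v. pd v f x" by (rule has_derivative_linear[OF differentiable_has_pd[OF assms]])
  show ?thesis by (simp add: scale)
qed

lemma pd_sum_vector:
  assumes "f differentiable (at x)" shows "pd (\<Sum>i\<in>I. v i) f x = (\<Sum>i\<in>I. pd (v i) f x)"
proof -
  interpret linear "\<lambda>v. pd v f x" by (rule has_derivative_linear[OF differentiable_has_pd[OF assms]])
  show ?thesis by (simp add: sum)
qed

lemma pd_plus_vector:
  assumes "f differentiable (at x)" shows "pd (u + v) f x = pd u f x + pd v f x"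
proof -
  interpret linear "\<lambda>v. pd v f x" by (rule has_derivative_linear[OF differentiable_has_pd[OF assms]])
  show ?thesis by (simp add: add)
qed

text \<open>\<open>leibniz_rule\<close> wants the derivative as a jointly continuous map into
  bounded linear functions; in finite dimension this continuity can be tested on basis
  vectors.\<close>

lemma pd_smooth_integral:
  fixes f :: "'a::euclidean_space \<times> real \<Rightarrow> real"
  assumes S: "open S" and f: "smooth_on (S \<times> UNIV) f" and x: "x0 \<in> S"
  shows "((\<lambda>x. integral {a..b} (\<lambda>s. f (x, s))) has_derivative
    (\<lambda>v. integral {a..b} (\<lambda>s. pd (v, 0) f (x0, s)))) (at x0)"
proof -
  obtain d where d: "d > 0" "ball x0 d \<subseteq> S" using S x openE by blast
  define fx where "fx x s = Blinfun (\<lambda>v. pd (v, 0) f (x, s))" for x s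
  have der: "((\<lambda>x. f (x, s)) has_derivative (\<lambda>v. pd (v, 0) f (x, s))) (at x)" if "x \<in> S" for x s
  proof -
    have "(f has_derivative (\<lambda>v. pd v f (x, s))) (at (x, s))"
      by (rule smooth_on_has_derivative[OF f]) (use that in simp)
    then show ?thesis
      by (rule has_derivative_compose[rotated]) (auto intro!: derivative_eq_intros)
  qed
  have bl: "blinfun_apply (fx x s) = (\<lambda>v. pd (v, 0) f (x, s))" if "x \<in> S" for x s
    unfolding fx_def by (rule bounded_linear_Blinfun_apply[OF has_derivative_bounded_linear[OF der[OF that]]])
  have cf: "continuous_on (S \<times> UNIV) (pd (v, 0) f)" for v
    by (rule smooth_on_continuous[OF smooth_on_pd[OF f]])
  have cont: "continuous_on (ball x0 d \<times> cbox a b) (\<lambda>(x, s). fx x s)"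
  proof (rule continuous_on_blinfun_componentwise)
    fix i :: 'a assume "i \<in> Basis"
    have "continuous_on (ball x0 d \<times> cbox a b) (pd (i, 0) f)"
      by (rule continuous_on_subset[OF cf]) (use d in auto)
    then show "continuous_on (ball x0 d \<times> cbox a b) (\<lambda>x. blinfun_apply (case x of (x, s) \<Rightarrow> fx x s) i)"
      by (rule continuous_on_eq) (use d in \<open>auto simp: bl subset_iff\<close>)
  qed
  have int: "(\<lambda>s. f (x, s)) integrable_on cbox a b" if "x \<in> ball x0 d" for x
  proof (rule integrable_continuous)
    show "continuous_on (cbox a b) (\<lambda>s. f (x, s))"
      by (rule continuous_on_compose2[OF smooth_on_continuous[OF f]])
        (use that d in \<open>auto intro!: continuous_intros\<close>)
  qed
  have "((\<lambda>x. integral (cbox a b) (\<lambda>s. f (x, s))) has_derivative integral (cbox a b) (fx x0)) (at x0 within ball x0 d)"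
  proof (rule leibniz_rule[OF _ int cont])
    fix x t assume "x \<in> ball x0 d" "t \<in> cbox a b"
    then have "x \<in> S" using d by auto
    show "((\<lambda>x. f (x, t)) has_derivative blinfun_apply (fx x t)) (at x within ball x0 d)"
      unfolding bl[OF \<open>x \<in> S\<close>] by (rule has_derivative_at_withinI[OF der[OF \<open>x \<in> S\<close>]])
  qed (use d in auto)
  then have *: "((\<lambda>x. integral {a..b} (\<lambda>s. f (x, s))) has_derivative integral (cbox a b) (fx x0)) (at x0)"
    using d by (simp add: at_within_open[OF centre_in_ball[THEN iffD2] open_ball])
  have "fx x0 integrable_on cbox a b"
  proof (rule integrable_continuous)
    show "continuous_on (cbox a b) (fx x0)"
      using continuous_on_compose2[OF cont, of "cbox a b" "\<lambda>s. (x0, s)"] d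
      by (auto simp: image_subset_iff continuous_on_Pair)
  qed
  then have "blinfun_apply (integral (cbox a b) (fx x0)) v = integral {a..b} (\<lambda>s. pd (v, 0) f (x0, s))" for v
    by (simp add: blinfun_apply_integral bl[OF x])
  then have "blinfun_apply (integral (cbox a b) (fx x0)) = (\<lambda>v. integral {a..b} (\<lambda>s. pd (v, 0) f (x0, s)))"
    by auto
  with * show ?thesis by simp
qed

lemma pd_integral:
  fixes f :: "'a::euclidean_space \<times> real \<Rightarrow> real"
  assumes "open S" "smooth_on (S \<times> UNIV) f" "x \<in> S"
  shows "pd v (\<lambda>x. integral {a..b} (\<lambda>s. f (x, s))) x = integral {a..b} (\<lambda>s. pd (v, 0) f (x, s))"
  by (rule pd_eq[OF pd_smooth_integral[OF assms]])

lemma smooth_on_integral: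
  fixes f :: "'a::euclidean_space \<times> real \<Rightarrow> real"
  assumes S: "open S" and "smooth_on (S \<times> UNIV) f"
  shows "smooth_on S (\<lambda>x. integral {a..b} (\<lambda>s. f (x, s)))"
proof -
  have "Ck_on k S (\<lambda>x. integral {a..b} (\<lambda>s. f (x, s)))" for k
    using assms(2)
  proof (induction k arbitrary: f)
    case 0
    have "continuous (at x) (\<lambda>x. integral {a..b} (\<lambda>s. f (x, s)))" if "x \<in> S" for x
      by (rule has_derivative_continuous[OF pd_smooth_integral[OF S 0 that]])
    then show ?case by (simp add: continuous_at_imp_continuous_on)
  next
    case (Suc k)
    have "Ck_on k S (pd v (\<lambda>x. integral {a..b} (\<lambda>s. f (x, s))))" for v
    proof (rule Ck_on_cong[OF S])
      show "Ck_on k S (\<lambda>x. integral {a..b} (\<lambda>s. pd (v, 0) f (x, s)))"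
        by (rule Suc.IH[OF smooth_on_pd[OF Suc.prems]])
    qed (rule pd_integral[OF S Suc.prems, symmetric])
    moreover have "(\<lambda>x. integral {a..b} (\<lambda>s. f (x, s))) differentiable (at x)" if "x \<in> S" for x
      by (rule differentiableI[OF pd_smooth_integral[OF S Suc.prems that]])
    ultimately show ?case by simp
  qed
  then show ?thesis by (simp add: smooth_on_def)
qed

section \<open>Partial derivatives in time and distance\<close>

abbreviation dt :: "(real \<times> real \<Rightarrow> real) \<Rightarrow> real \<times> real \<Rightarrow> real" where "dt \<equiv> pd (1, 0)"
abbreviation ds :: "(real \<times> real \<Rightarrow> real) \<Rightarrow> real \<times> real \<Rightarrow> real" where "ds \<equiv> pd (0, 1)"

lemma pd_plane:
  fixes \<phi> :: "real \<times> real \<Rightarrow> real"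
  assumes "\<phi> differentiable (at x)"
  shows "pd (a, b) \<phi> x = a * dt \<phi> x + b * ds \<phi> x"
proof -
  have "(a, b) = a *\<^sub>R (1, 0) + b *\<^sub>R (0, 1::real)" by simp
  then show ?thesis by (simp only: pd_plus_vector[OF assms] pd_scaleR[OF assms])
qed

lemma plane_deriv:
  assumes \<phi>: "smooth_on S \<phi>" "(t, s) \<in> S"
  shows "((\<lambda>t. \<phi> (t, s)) has_real_derivative dt \<phi> (t, s)) (at t)"
    and "((\<lambda>s. \<phi> (t, s)) has_real_derivative ds \<phi> (t, s)) (at s)"
proof -
  note d = smooth_on_has_derivative[OF \<phi>] and df = smooth_on_differentiable[OF \<phi>]
  have "((\<lambda>t. \<phi> (t, s)) has_derivative (\<lambda>h. pd (h, 0) \<phi> (t, s))) (at t)"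
    by (rule has_derivative_compose[where f="\<lambda>t. (t, s)" and g=\<phi>, OF _ d]) (auto intro!: derivative_eq_intros)
  moreover have "(\<lambda>h. pd (h, 0) \<phi> (t, s)) = (\<lambda>h. dt \<phi> (t, s) * h)"
    by (rule ext, subst pd_plane[OF df]) simp
  ultimately show "((\<lambda>t. \<phi> (t, s)) has_real_derivative dt \<phi> (t, s)) (at t)"
    by (simp only: has_field_derivative_def)
  have "((\<lambda>s. \<phi> (t, s)) has_derivative (\<lambda>h. pd (0, h) \<phi> (t, s))) (at s)"
    by (rule has_derivative_compose[where f="\<lambda>s. (t, s)" and g=\<phi>, OF _ d]) (auto intro!: derivative_eq_intros)
  moreover have "(\<lambda>h. pd (0, h) \<phi> (t, s)) = (\<lambda>h. ds \<phi> (t, s) * h)"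
    by (rule ext, subst pd_plane[OF df]) simp
  ultimately show "((\<lambda>s. \<phi> (t, s)) has_real_derivative ds \<phi> (t, s)) (at s)"
    by (simp only: has_field_derivative_def)
qed

lemma plane_pd_eq:
  assumes \<phi>: "smooth_on S \<phi>" "(t, s) \<in> S"
  shows "((\<lambda>t. \<phi> (t, s)) has_real_derivative D) (at t) \<Longrightarrow> dt \<phi> (t, s) = D"
    and "((\<lambda>s. \<phi> (t, s)) has_real_derivative D) (at s) \<Longrightarrow> ds \<phi> (t, s) = D"
  using plane_deriv[OF assms] DERIV_unique by blast+

section \<open>Functions of time and distance\<close>

text \<open>Evenness in s is what makes phi (t, distance) smooth at the centre, where the distance
  itself is not differentiable. The class is closed under \<open>dt\<close> and
  \<open>sinh_deriv\<close>.\<close>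

definition even_smooth :: "(real \<times> real \<Rightarrow> real) \<Rightarrow> bool" where
  "even_smooth \<phi> \<longleftrightarrow> smooth_on UNIV \<phi> \<and> (\<forall>t s. \<phi> (t, - s) = \<phi> (t, s))"

text \<open>The operator \<open>D = (1 / sinh s) \<partial>\<^sub>s\<close> on functions even in \<open>s\<close>, written so that it is smooth across \<open>s = 0\<close>.\<close>

definition sinh_deriv :: "(real \<times> real \<Rightarrow> real) \<Rightarrow> real \<times> real \<Rightarrow> real" where
  "sinh_deriv \<phi> x = integral {0..1} (\<lambda>\<sigma>. ds (ds \<phi>) (fst x, \<sigma> * snd x)) / integral {0..1} (\<lambda>\<sigma>. cosh (\<sigma> * snd x))"

lemma even_smooth_smooth: "even_smooth \<phi> \<Longrightarrow> smooth_on UNIV \<phi>" by (simp add: even_smooth_def)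
lemma even_smooth_even: "even_smooth \<phi> \<Longrightarrow> \<phi> (t, - s) = \<phi> (t, s)" by (simp add: even_smooth_def)

lemma even_smooth_dt: assumes "even_smooth \<phi>" shows "even_smooth (dt \<phi>)"
proof -
  note sm = even_smooth_smooth[OF assms]
  have "dt \<phi> (t, - s) = dt \<phi> (t, s)" for t s
  proof (rule plane_pd_eq(1)[OF sm])
    have "(\<lambda>t. \<phi> (t, - s)) = (\<lambda>t. \<phi> (t, s))" by (auto simp: even_smooth_even[OF assms])
    then show "((\<lambda>t. \<phi> (t, - s)) has_real_derivative dt \<phi> (t, s)) (at t)"
      using plane_deriv(1)[OF sm, of t s] by simp
  qed simp
  then show ?thesis using smooth_on_pd[OF sm] by (simp add: even_smooth_def)
qed

lemma ds_odd: assumes "even_smooth \<phi>" shows "ds \<phi> (t, - s) = - ds \<phi> (t, s)"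
proof (rule plane_pd_eq(2)[OF even_smooth_smooth[OF assms]])
  have "((\<lambda>s. \<phi> (t, - s)) has_real_derivative ds \<phi> (t, - (- s)) * - 1) (at (- s))"
    by (rule DERIV_chain2[OF plane_deriv(2)[OF even_smooth_smooth[OF assms]]]) (auto intro!: derivative_eq_intros)
  then show "((\<lambda>s. \<phi> (t, s)) has_real_derivative - ds \<phi> (t, s)) (at (- s))"
    by (simp add: even_smooth_even[OF assms])
qed simp

text \<open>The denominator in \<open>sinh_deriv\<close> is thus sinh s / s, continued by 1 to s =
  0.\<close>

lemma integral_cosh_scaled:
  "s * integral {0..1} (\<lambda>\<sigma>. cosh (\<sigma> * s)) = sinh (s::real)" "integral {0..1} (\<lambda>\<sigma>. cosh (\<sigma> * s)) > 0"
proof -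
  have "((\<lambda>\<sigma>. s * cosh (\<sigma> * s)) has_integral sinh (1 * s) - sinh (0 * s)) {0..1}"
    by (rule fundamental_theorem_of_calculus)
      (auto intro!: derivative_eq_intros simp: has_real_derivative_iff_has_vector_derivative[symmetric])
  then show "s * integral {0..1} (\<lambda>\<sigma>. cosh (\<sigma> * s)) = sinh s"
    by (simp add: integral_unique flip: integral_mult_right)
  have "integral {0..1::real} (\<lambda>\<sigma>. 1::real) \<le> integral {0..1} (\<lambda>\<sigma>. cosh (\<sigma> * s))"
    by (rule integral_le) (auto intro!: integrable_continuous_interval continuous_intros cosh_real_ge_1)
  then show "integral {0..1} (\<lambda>\<sigma>. cosh (\<sigma> * s)) > 0" by simp
qed

text \<open>\<open>ds phi\<close> is odd in s, so it vanishes at 0 and equals s times the average of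
  the second derivative over the segment from 0 to s. The factor s is absorbed because sinh s is s
  times the denominator.\<close>

lemma ds_eq_sinh_sinh_deriv: assumes "even_smooth \<phi>" shows "ds \<phi> (t, s) = sinh s * sinh_deriv \<phi> (t, s)"
proof -
  have sm: "smooth_on UNIV (ds \<phi>)" by (rule smooth_on_pd[OF even_smooth_smooth[OF assms]])
  have "((\<lambda>\<sigma>. s * ds (ds \<phi>) (t, \<sigma> * s)) has_integral ds \<phi> (t, 1 * s) - ds \<phi> (t, 0 * s)) {0..1}"
  proof (rule fundamental_theorem_of_calculus)
    fix x :: real
    have "((\<lambda>\<sigma>. ds \<phi> (t, \<sigma> * s)) has_real_derivative ds (ds \<phi>) (t, x * s) * s) (at x within {0..1})"
      by (rule DERIV_chain2[OF plane_deriv(2)[OF sm]]) (auto intro!: derivative_eq_intros)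
    then show "((\<lambda>\<sigma>. ds \<phi> (t, \<sigma> * s)) has_vector_derivative s * ds (ds \<phi>) (t, x * s)) (at x within {0..1})"
      by (simp add: has_real_derivative_iff_has_vector_derivative mult.commute)
  qed simp
  moreover have "ds \<phi> (t, 0) = 0" using ds_odd[OF assms, of t 0] by simp
  ultimately have "s * integral {0..1} (\<lambda>\<sigma>. ds (ds \<phi>) (t, \<sigma> * s)) = ds \<phi> (t, s)"
    by (simp add: integral_unique flip: integral_mult_right)
  then have "sinh s * sinh_deriv \<phi> (t, s) * integral {0..1} (\<lambda>\<sigma>. cosh (\<sigma> * s)) =
      ds \<phi> (t, s) * integral {0..1} (\<lambda>\<sigma>. cosh (\<sigma> * s))"
    using integral_cosh_scaled(2)[of s] by (simp add: sinh_deriv_def flip: integral_cosh_scaled(1))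
  then show ?thesis using integral_cosh_scaled(2)[of s] by simp
qed

lemma sinh_deriv_smooth: assumes "smooth_on UNIV \<phi>" shows "smooth_on UNIV (sinh_deriv \<phi>)"
proof -
  have "smooth_on (UNIV \<times> UNIV) (\<lambda>y::(real \<times> real) \<times> real. ds (ds \<phi>) (fst (fst y), snd y * snd (fst y)))"
    by (intro smooth_on_compose2 smooth_on_pd assms smooth_intros open_Times open_UNIV)
  from smooth_on_integral[OF open_UNIV this, of 0 1]
  have "smooth_on UNIV (\<lambda>x::real \<times> real. integral {0..1} (\<lambda>\<sigma>. ds (ds \<phi>) (fst x, \<sigma> * snd x)))" by simp
  moreover have "smooth_on (UNIV \<times> UNIV) (\<lambda>y::(real \<times> real) \<times> real. cosh (snd y * snd (fst y)))"
    by (intro smooth_intros open_Times open_UNIV)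
  from smooth_on_integral[OF open_UNIV this, of 0 1]
  have "smooth_on UNIV (\<lambda>x::real \<times> real. integral {0..1} (\<lambda>\<sigma>. cosh (\<sigma> * snd x)))" by simp
  ultimately have "smooth_on UNIV (\<lambda>x::real \<times> real. integral {0..1} (\<lambda>\<sigma>. ds (ds \<phi>) (fst x, \<sigma> * snd x)) /
      integral {0..1} (\<lambda>\<sigma>. cosh (\<sigma> * snd x)))"
    by (rule smooth_on_divide[OF open_UNIV]) (use integral_cosh_scaled(2) in \<open>simp add: less_imp_neq[symmetric]\<close>)
  then show ?thesis by (simp add: sinh_deriv_def[abs_def])
qed

lemma even_smooth_eqI:
  assumes "continuous_on UNIV \<phi>" "continuous_on UNIV \<psi>" "\<And>t s. s \<noteq> 0 \<Longrightarrow> \<phi> (t, s) = \<psi> (t, s)"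
  shows "\<phi> (t :: real, s :: real) = (\<psi> (t, s) :: real)"
proof -
  have *: "continuous_on UNIV (\<lambda>s. f (t, s))" if "continuous_on UNIV f" for f :: "real \<times> real \<Rightarrow> real"
    by (rule continuous_on_compose2[OF that]) (auto intro!: continuous_intros)
  have "{s::real. s \<noteq> 0} = - {0}" by auto
  then have "closure {s::real. s \<noteq> 0} = UNIV" by (simp add: closure_complement)
  then show ?thesis
    using continuous_constant_on_closure[of "{s. s \<noteq> 0}" "\<lambda>s. \<phi> (t, s) - \<psi> (t, s)" 0 s] assms(3)
      continuous_on_diff[OF *[OF assms(1)] *[OF assms(2)]]
    by simp
qed

text \<open>Division by sinh s settles s different from 0, and continuity the rest. Later
  computations identify \<open>sinh_deriv\<close> in this way, without its integral formula.\<close>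

lemma sinh_deriv_unique:
  assumes "even_smooth \<phi>" "continuous_on UNIV \<psi>" "\<And>t s. s \<noteq> 0 \<Longrightarrow> ds \<phi> (t, s) = sinh s * \<psi> (t, s)"
  shows "sinh_deriv \<phi> (t, s) = \<psi> (t, s)"
proof (rule even_smooth_eqI[OF _ assms(2)])
  show "continuous_on UNIV (sinh_deriv \<phi>)" by (rule smooth_on_continuous[OF sinh_deriv_smooth[OF even_smooth_smooth[OF assms(1)]]])
  fix t s :: real assume that: "s \<noteq> 0"
  show "sinh_deriv \<phi> (t, s) = \<psi> (t, s)"
    using assms(3)[OF that] ds_eq_sinh_sinh_deriv[OF assms(1)] that by simp
qed

lemma even_smooth_sinh_deriv: assumes "even_smooth \<phi>" shows "even_smooth (sinh_deriv \<phi>)"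
proof -
  have sm: "smooth_on UNIV (sinh_deriv \<phi>)" by (rule sinh_deriv_smooth[OF even_smooth_smooth[OF assms]])
  have "sinh_deriv \<phi> (t, - s) = sinh_deriv \<phi> (t, s)" for t s
    using ds_odd[OF assms, of t s] ds_eq_sinh_sinh_deriv[OF assms, of t s] ds_eq_sinh_sinh_deriv[OF assms, of t "-s"]
    by (cases "s = 0") simp_all
  with sm show ?thesis by (simp add: even_smooth_def)
qed

text \<open>In the variable z = cosh s the operator D is d/dz. As arcosh is not differentiable at z
  = 1, the fundamental theorem is first used with derivatives in the interior only; differentiating
  the resulting integral of a continuous function then gives the one-sided derivative at 1.\<close>

lemma arcosh_partial:
  assumes "even_smooth \<phi>" "z \<ge> 1"
  shows "((\<lambda>z. \<phi> (t, arcosh z)) has_real_derivative sinh_deriv \<phi> (t, arcosh z)) (at z within {1..})"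
proof -
  have cont: "continuous_on {1..z+1} (\<lambda>z. f (t, arcosh z))" if "even_smooth f" for f
    by (rule continuous_on_compose2[OF smooth_on_continuous[OF even_smooth_smooth[OF that]]])
      (auto intro!: continuous_intros)
  define F where "F u = \<phi> (t, 0) + integral {1..u} (\<lambda>z. sinh_deriv \<phi> (t, arcosh z))" for u
  have eq: "\<phi> (t, arcosh u) = F u" if u: "1 \<le> u" "u \<le> z + 1" for u
  proof -
    have "((\<lambda>z. sinh_deriv \<phi> (t, arcosh z)) has_integral \<phi> (t, arcosh u) - \<phi> (t, arcosh 1)) {1..u}"
    proof (rule fundamental_theorem_of_calculus_interior[OF u(1)])
      show "continuous_on {1..u} (\<lambda>z. \<phi> (t, arcosh z))"
        by (rule continuous_on_subset[OF cont[OF assms(1)]]) (use u in auto)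
      fix x assume x: "x \<in> {1<..<u}"
      have "((\<lambda>z. \<phi> (t, arcosh z)) has_real_derivative ds \<phi> (t, arcosh x) * (1 / sqrt (x\<^sup>2 - 1))) (at x)"
        by (rule DERIV_chain2[OF plane_deriv(2)[OF even_smooth_smooth[OF assms(1)]]])
          (use x in \<open>auto intro!: arcosh_real_has_field_derivative\<close>)
      moreover have "ds \<phi> (t, arcosh x) * (1 / sqrt (x\<^sup>2 - 1)) = sinh_deriv \<phi> (t, arcosh x)"
        using x by (simp add: ds_eq_sinh_sinh_deriv[OF assms(1)] sinh_arcosh_real power2_eq_1_iff)
      ultimately show "((\<lambda>z. \<phi> (t, arcosh z)) has_vector_derivative sinh_deriv \<phi> (t, arcosh x)) (at x)"
        by (simp add: has_real_derivative_iff_has_vector_derivative)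
    qed
    then show ?thesis by (simp add: F_def integral_unique)
  qed
  have "(F has_real_derivative sinh_deriv \<phi> (t, arcosh z)) (at z within {1..z+1})"
    unfolding F_def
    by (auto intro!: derivative_eq_intros integral_has_real_derivative cont even_smooth_sinh_deriv assms)
  then have "((\<lambda>z. \<phi> (t, arcosh z)) has_real_derivative sinh_deriv \<phi> (t, arcosh z)) (at z within {1..z+1})"
    by (rule has_field_derivative_transform_within[where d=1]) (use assms eq in auto)
  moreover have "at z within {1..z+1} = at z within {1..}"
    by (rule at_within_nhd[of z "{z-1<..<z+1}"]) auto
  ultimately show ?thesis by simp
qed

text \<open>Where Z = 1 only a one-sided derivative in z is available. Since Z maps S into {1..},
  the chain rule can be used within that half-line, and openness of S removes the restriction at
  x.\<close>

lemma even_smooth_arcosh: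
  fixes T Z :: "'a::real_normed_vector \<Rightarrow> real"
  assumes \<phi>: "even_smooth \<phi>" and dT: "T differentiable (at x)" and dZ: "Z differentiable (at x)"
    and S: "open S" "x \<in> S" and Z1: "\<And>x. x \<in> S \<Longrightarrow> Z x \<ge> 1"
  shows "((\<lambda>x. \<phi> (T x, arcosh (Z x))) has_derivative
     (\<lambda>v. dt \<phi> (T x, arcosh (Z x)) * pd v T x + sinh_deriv \<phi> (T x, arcosh (Z x)) * pd v Z x)) (at x)"
proof -
  let ?t = "T x" and ?z = "Z x"
  have z: "?z \<ge> 1" using Z1 S by simp
  have A: "continuous_on (UNIV \<times> {1..}) (\<lambda>x::real \<times> real. arcosh (snd x))"
    by (rule continuous_on_compose2[OF continuous_on_arcosh[of "{1..}"] continuous_on_snd[OF continuous_on_id]]) auto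
  have c: "continuous_on (UNIV \<times> {1..}) (\<lambda>(t, z). blinfun_mult_right (sinh_deriv \<phi> (t, arcosh z)))"
    unfolding case_prod_unfold
    by (intro A bounded_linear.continuous_on[OF bounded_linear_blinfun_mult_right]
        continuous_on_compose2[OF smooth_on_continuous[OF even_smooth_smooth[OF even_smooth_sinh_deriv[OF \<phi>]]]]
        continuous_on_Pair continuous_on_fst continuous_on_snd continuous_on_id) auto
  have "((\<lambda>(t, z). \<phi> (t, arcosh z)) has_derivative
      (\<lambda>(tx, ty). dt \<phi> (?t, arcosh ?z) * tx + blinfun_mult_right (sinh_deriv \<phi> (?t, arcosh ?z)) ty)) (at (?t, ?z) within UNIV \<times> {1..})"
  proof (rule has_derivative_partialsI)
    show "((\<lambda>t. \<phi> (t, arcosh ?z)) has_derivative (\<lambda>tx. dt \<phi> (?t, arcosh ?z) * tx)) (at ?t within UNIV)"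
      using plane_deriv(1)[OF even_smooth_smooth[OF \<phi>], of ?t "arcosh ?z"] by (simp add: has_field_derivative_def)
    show "((\<lambda>y. \<phi> (t, arcosh y)) has_derivative blinfun_apply (blinfun_mult_right (sinh_deriv \<phi> (t, arcosh y)))) (at y within {1..})"
      if "y \<in> {1..}" for t y
      using arcosh_partial[OF \<phi>, of y t] that
      by (simp add: has_field_derivative_def)
    show "continuous (at (?t, ?z) within UNIV \<times> {1..}) (\<lambda>(t, z). blinfun_mult_right (sinh_deriv \<phi> (t, arcosh z)))"
      using c z by (simp add: continuous_on_eq_continuous_within)
  qed (use z in auto)
  then have F: "((\<lambda>p. \<phi> (fst p, arcosh (snd p))) has_derivative
      (\<lambda>p. dt \<phi> (?t, arcosh ?z) * fst p + sinh_deriv \<phi> (?t, arcosh ?z) * snd p)) (at (?t, ?z) within UNIV \<times> {1..})"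
    by (simp add: case_prod_unfold)
  have "((\<lambda>x. (T x, Z x)) has_derivative (\<lambda>v. (pd v T x, pd v Z x))) (at x within S)"
    by (intro has_derivative_Pair has_derivative_at_withinI[OF differentiable_has_pd] dT dZ)
  then have "((\<lambda>p. \<phi> (fst p, arcosh (snd p))) \<circ> (\<lambda>x. (T x, Z x)) has_derivative
      (\<lambda>p. dt \<phi> (?t, arcosh ?z) * fst p + sinh_deriv \<phi> (?t, arcosh ?z) * snd p) \<circ> (\<lambda>v. (pd v T x, pd v Z x))) (at x within S)"
    by (rule diff_chain_within) (rule has_derivative_subset[OF F], use Z1 in auto)
  then show ?thesis by (simp only: o_def fst_conv snd_conv at_within_open[OF S(2,1)])
qed

text \<open>The derivative is built from functions of the same kind, with \<open>dt phi\<close> and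
  \<open>sinh_deriv phi\<close> in place of phi; hence an induction on the order with phi
  arbitrary.\<close>

lemma smooth_on_even_smooth_arcosh:
  fixes T Z :: "'a::real_normed_vector \<Rightarrow> real"
  assumes "even_smooth \<phi>" and S: "open S" and T: "smooth_on S T" and Z: "smooth_on S Z" and Z1: "\<And>x. x \<in> S \<Longrightarrow> Z x \<ge> 1"
  shows "smooth_on S (\<lambda>x. \<phi> (T x, arcosh (Z x)))"
proof -
  note d = smooth_on_differentiable[OF T] smooth_on_differentiable[OF Z]
  have "Ck_on k S (\<lambda>x. \<phi> (T x, arcosh (Z x)))" for k
    using assms(1)
  proof (induction k arbitrary: \<phi>)
    case 0
    have "continuous (at x) (\<lambda>x. \<phi> (T x, arcosh (Z x)))" if "x \<in> S" for x
      by (rule has_derivative_continuous[OF even_smooth_arcosh[OF 0 d(1)[OF that] d(2)[OF that] S that Z1]])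
    then show ?case by (simp add: continuous_at_imp_continuous_on)
  next
    case (Suc k)
    note der = even_smooth_arcosh[OF Suc.prems d S _ Z1]
    have TZ: "Ck_on k S (pd v T)" "Ck_on k S (pd v Z)" for v
      using smooth_on_pd[OF T] smooth_on_pd[OF Z] by (simp_all add: smooth_on_def)
    have "Ck_on k S (pd v (\<lambda>x. \<phi> (T x, arcosh (Z x))))" for v
    proof (rule Ck_on_cong[OF S])
      show "Ck_on k S (\<lambda>x. dt \<phi> (T x, arcosh (Z x)) * pd v T x + sinh_deriv \<phi> (T x, arcosh (Z x)) * pd v Z x)"
        by (rule Ck_on_add[OF S Ck_on_mult[OF S Suc.IH[OF even_smooth_dt[OF Suc.prems]] TZ(1)] Ck_on_mult[OF S Suc.IH[OF even_smooth_sinh_deriv[OF Suc.prems]] TZ(2)]])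
      show "dt \<phi> (T x, arcosh (Z x)) * pd v T x + sinh_deriv \<phi> (T x, arcosh (Z x)) * pd v Z x = pd v (\<lambda>x. \<phi> (T x, arcosh (Z x))) x"
        if "x \<in> S" for x
        using pd_eq[OF der[OF that that that]] by simp
    qed
    moreover have "(\<lambda>x. \<phi> (T x, arcosh (Z x))) differentiable (at x)" if "x \<in> S" for x
      by (rule differentiableI[OF der[OF that that that]])
    ultimately show ?case by simp
  qed
  then show ?thesis by (simp add: smooth_on_def)
qed

text \<open>f is orthogonal to all polynomials. If a polynomial g is within e of f, the integral of
  f^2 equals that of (f - g) f and is at most e times the integral of |f|.\<close>

lemma moments_zero:
  fixes f :: "real \<Rightarrow> real"
  assumes ab: "a < b" and f: "continuous_on {a..b} f" and moment: "\<And>j::nat. integral {a..b} (\<lambda>t. t ^ j * f t) = 0" and t: "t \<in> {a..b}"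
  shows "f t = 0"
proof -
  define B where "B = integral {a..b} (\<lambda>t. \<bar>f t\<bar>)"
  have "integral {a..b} (\<lambda>t. f t * f t) \<le> e * B" if e: "e > 0" for e
  proof -
    obtain g where g: "real_polynomial_function g" "\<And>x. x \<in> {a..b} \<Longrightarrow> \<bar>f x - g x\<bar> < e"
      by (rule Stone_Weierstrass_real_polynomial_function[OF compact_Icc f e]) (rule that, auto)
    obtain c n where gs: "g = (\<lambda>x. \<Sum>i\<le>n. c i * x ^ i)" using g(1) real_polynomial_function_iff_sum by auto
    have cg: "continuous_on {a..b} g" unfolding gs by (intro continuous_intros)
    have "integral {a..b} (\<lambda>t. g t * f t) = integral {a..b} (\<lambda>t. \<Sum>i\<le>n. c i * (t ^ i * f t))"
      by (simp add: gs sum_distrib_right mult.assoc)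
    also have "\<dots> = (\<Sum>i\<le>n. integral {a..b} (\<lambda>t. c i * (t ^ i * f t)))"
      by (rule integral_sum) (auto intro!: integrable_continuous_interval continuous_intros f)
    also have "\<dots> = 0" by (simp add: moment)
    finally have g0: "integral {a..b} (\<lambda>t. g t * f t) = 0" .
    have "integral {a..b} (\<lambda>t. f t * f t) = integral {a..b} (\<lambda>t. f t * f t) - integral {a..b} (\<lambda>t. g t * f t)"
      by (simp add: g0)
    also have "\<dots> = integral {a..b} (\<lambda>t. f t * f t - g t * f t)"
      by (rule integral_diff[symmetric]) (auto intro!: integrable_continuous_interval continuous_intros f cg)
    also have "\<dots> \<le> integral {a..b} (\<lambda>t. e * \<bar>f t\<bar>)"
    proof (rule integral_le)
      fix x assume "x \<in> {a..b}"
      have "f x * f x - g x * f x \<le> \<bar>f x - g x\<bar> * \<bar>f x\<bar>"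
        by (metis abs_ge_self abs_mult left_diff_distrib)
      also have "\<dots> \<le> e * \<bar>f x\<bar>" using g(2)[OF \<open>x \<in> {a..b}\<close>] by (intro mult_right_mono) auto
      finally show "f x * f x - g x * f x \<le> e * \<bar>f x\<bar>" .
    qed (auto intro!: integrable_continuous_interval continuous_intros f cg)
    finally show ?thesis by (simp add: B_def)
  qed
  note le = this
  have "B \<ge> 0" unfolding B_def by (rule integral_nonneg) (auto intro!: integrable_continuous_interval continuous_intros f)
  have "integral {a..b} (\<lambda>t. f t * f t) \<le> 0"
  proof (rule field_le_epsilon)
    fix e :: real assume "e > 0"
    have "integral {a..b} (\<lambda>t. f t * f t) \<le> e / (B + 1) * B" using \<open>e > 0\<close> \<open>B \<ge> 0\<close> by (intro le) simp
    also have "\<dots> \<le> e" using \<open>e > 0\<close> \<open>B \<ge> 0\<close> by (simp add: divide_le_eq)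
    finally show "integral {a..b} (\<lambda>t. f t * f t) \<le> 0 + e" by simp
  qed
  moreover have "integral {a..b} (\<lambda>t. f t * f t) \<ge> 0"
    by (rule integral_nonneg) (auto intro!: integrable_continuous_interval continuous_intros f)
  ultimately have z: "integral {a..b} (\<lambda>t. f t * f t) = 0" by simp
  have "continuous_on {a..b} (\<lambda>t. f t * f t)" by (intro continuous_intros f)
  from integral_eq_0_iff[OF this ab] z t show ?thesis by simp
qed

lemma deriv_integral_param:
  assumes "smooth_on UNIV f"
  shows "((\<lambda>t. integral {a..b} (\<lambda>s. f (t, s))) has_real_derivative integral {a..b} (\<lambda>s. dt f (t, s))) (at t)"
proof -
  have f: "smooth_on (UNIV \<times> UNIV) f" using assms by simp
  have pdv: "pd (v, 0) f (t, s) = dt f (t, s) * v" for v s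
    by (subst pd_plane) (use smooth_on_differentiable[OF assms] in auto)
  have "integral {a..b} (\<lambda>s. pd (v, 0) f (t, s)) = integral {a..b} (\<lambda>s. dt f (t, s)) * v" for v
    by (subst integral_mult_left[symmetric], rule integral_cong, rule pdv)
  then have "(\<lambda>v. integral {a..b} (\<lambda>s. pd (v, 0) f (t, s))) = (*) (integral {a..b} (\<lambda>s. dt f (t, s)))"
    by (rule ext)
  with pd_smooth_integral[OF open_UNIV f UNIV_I, of a b t] show ?thesis
    by (simp only: has_field_derivative_def)
qed

lemma sinh_deriv_dt: assumes "even_smooth \<phi>" shows "sinh_deriv (dt \<phi>) (t, s) = dt (sinh_deriv \<phi>) (t, s)"
proof (rule sinh_deriv_unique[OF even_smooth_dt[OF assms]])
  show "continuous_on UNIV (dt (sinh_deriv \<phi>))"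
    by (rule smooth_on_continuous[OF smooth_on_pd[OF even_smooth_smooth[OF even_smooth_sinh_deriv[OF assms]]]])
  fix t s :: real
  have "ds (dt \<phi>) (t, s) = dt (ds \<phi>) (t, s)"
    by (rule pd_symmetric[OF open_UNIV even_smooth_smooth[OF assms]]) simp
  also have "\<dots> = sinh s * dt (sinh_deriv \<phi>) (t, s)"
  proof (rule plane_pd_eq(1)[OF smooth_on_pd[OF even_smooth_smooth[OF assms]]])
    show "((\<lambda>t. ds \<phi> (t, s)) has_real_derivative sinh s * dt (sinh_deriv \<phi>) (t, s)) (at t)"
      unfolding ds_eq_sinh_sinh_deriv[OF assms]
      by (rule DERIV_cmult[OF plane_deriv(1)[OF even_smooth_smooth[OF even_smooth_sinh_deriv[OF assms]]]]) simp
  qed simp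
  finally show "ds (dt \<phi>) (t, s) = sinh s * dt (sinh_deriv \<phi>) (t, s)" .
qed

lemma even_smooth_deriv:
  assumes "even_smooth \<phi>"
  shows "((\<lambda>s. \<phi> (t, s)) has_real_derivative sinh s * sinh_deriv \<phi> (t, s)) (at s)"
    and "((\<lambda>t. \<phi> (t, s)) has_real_derivative dt \<phi> (t, s)) (at t)"
  using plane_deriv[OF even_smooth_smooth[OF assms]] by (simp_all add: ds_eq_sinh_sinh_deriv[OF assms])

section \<open>Radial waves have no lacuna\<close>

text \<open>With v = (sinh s)^((m+2)/2) U the equation is v'' = (M^2 + gamma / (sinh s)^2) v, where
  gamma >= 0. In the proof G = v^2, H = v v', and q is v' divided by (sinh s)^(m/2). H vanishes at 0
  and H' >= 2 M |H|, so either H is 0 on the half-line or it eventually dominates a multiple of exp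
  (2 M s). In the second case so does G, against the polynomial bound.\<close>

lemma static_growth:
  fixes U V W :: "real \<Rightarrow> real" and m :: nat and M :: real
  defines "\<nu> \<equiv> real m + 2"
  assumes U: "\<And>s. (U has_real_derivative sinh s * V s) (at s)"
    and V: "\<And>s. (V has_real_derivative sinh s * W s) (at s)"
    and ode: "\<And>s. (sinh s)\<^sup>2 * W s + (\<nu> + 1) * cosh s * V s + (\<nu>\<^sup>2 / 4 - M\<^sup>2) * U s = 0"
    and M: "M > 0"
    and bound: "\<And>s. s > 0 \<Longrightarrow> sinh s ^ (m + 2) * (U s)\<^sup>2 \<le> A * (s + R) ^ j"
    and s: "s > 0"
  shows "U s = 0"
proof -
  define q where "q s = (sinh s)\<^sup>2 * V s + \<nu> / 2 * cosh s * U s" for s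
  define G where "G s = sinh s ^ (m + 2) * (U s)\<^sup>2" for s
  define H where "H s = sinh s ^ (m + 1) * U s * q s" for s
  define \<gamma> where "\<gamma> = \<nu> / 2 * (\<nu> / 2 - 1)"
  define H' where "H' s = sinh s ^ m * (q s)\<^sup>2 + (M\<^sup>2 * sinh s ^ (m + 2) + \<gamma> * sinh s ^ m) * (U s)\<^sup>2" for s
  have \<gamma>: "\<gamma> \<ge> 0" by (simp add: \<gamma>_def \<nu>_def)
  have P: "((\<lambda>s. sinh s ^ Suc k) has_real_derivative (real k + 1) * sinh s ^ k * cosh s) (at s)" for s :: real and k
    using DERIV_power_Suc[where n=k and x=s, OF has_field_derivative_sinh[OF DERIV_ident]] by (simp add: algebra_simps)
  have G: "(G has_real_derivative 2 * H s) (at s)" for s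
    unfolding G_def H_def q_def \<nu>_def add_2_eq_Suc'
    by (rule derivative_eq_intros P U refl)+ (simp add: power2_eq_square algebra_simps)
  have H: "(H has_real_derivative H' s) (at s)" for s
  proof -
    have q: "(q has_real_derivative 2 * sinh s * cosh s * V s + (sinh s)\<^sup>2 * (sinh s * W s)
        + \<nu> / 2 * (sinh s * U s + cosh s * (sinh s * V s))) (at s)"
      unfolding q_def by (auto intro!: derivative_eq_intros U V simp: power2_eq_square algebra_simps)
    define q' where "q' = 2 * sinh s * cosh s * V s + (sinh s)\<^sup>2 * (sinh s * W s)
        + \<nu> / 2 * (sinh s * U s + cosh s * (sinh s * V s))"
    have "(H has_real_derivative (real m + 1) * sinh s ^ m * cosh s * U s * q s + sinh s ^ (m + 1) * (sinh s * V s) * q s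
        + sinh s ^ (m + 1) * U s * q') (at s)"
      unfolding H_def Suc_eq_plus1[symmetric]
      by (rule derivative_eq_intros P U q[folded q'_def] refl)+ (simp add: algebra_simps)
    moreover have "(real m + 1) * sinh s ^ m * cosh s * U s * q s + sinh s ^ (m + 1) * (sinh s * V s) * q s
        + sinh s ^ (m + 1) * U s * q' = H' s"
    proof -
      have c2: "(cosh s)\<^sup>2 = 1 + (sinh s)\<^sup>2" by (simp add: cosh_square_eq)
      \<comment> \<open>Up to the factor (sinh s)^(m/2 - 1) the left side is v''; the static
        equation eliminates W.\<close>
      have "(\<nu> / 2 - 1) * cosh s * q s + sinh s * q' =
         (sinh s)\<^sup>2 * ((sinh s)\<^sup>2 * W s + (\<nu> + 1) * cosh s * V s + (\<nu>\<^sup>2 / 4 - M\<^sup>2) * U s)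
          + (\<nu> / 2 * (\<nu> / 2 - 1) * (cosh s)\<^sup>2 + \<nu> / 2 * (sinh s)\<^sup>2 - (\<nu>\<^sup>2 / 4 - M\<^sup>2) * (sinh s)\<^sup>2) * U s"
        unfolding q_def q'_def by (simp add: field_simps power2_eq_square)
      also have "\<dots> = (M\<^sup>2 * (sinh s)\<^sup>2 + \<gamma>) * U s"
        unfolding ode c2 \<gamma>_def by (simp add: field_simps power2_eq_square)
      finally have key: "(\<nu> / 2 - 1) * cosh s * q s + sinh s * q' = (M\<^sup>2 * (sinh s)\<^sup>2 + \<gamma>) * U s" .
      have q2: "(sinh s)\<^sup>2 * V s = q s - \<nu> / 2 * cosh s * U s" by (simp add: q_def)
      have "(real m + 1) * sinh s ^ m * cosh s * U s * q s + sinh s ^ (m + 1) * (sinh s * V s) * q s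
        + sinh s ^ (m + 1) * U s * q' = sinh s ^ m * ((real m + 1) * cosh s * U s * q s + ((sinh s)\<^sup>2 * V s) * q s + U s * (sinh s * q'))"
        by (simp add: algebra_simps power2_eq_square)
      also have "\<dots> = sinh s ^ m * ((q s)\<^sup>2 + U s * ((\<nu> / 2 - 1) * cosh s * q s + sinh s * q'))"
        unfolding q2 \<nu>_def by (simp add: field_simps power2_eq_square)
      also have "\<dots> = H' s" unfolding key H'_def by (simp add: algebra_simps power2_eq_square)
      finally show ?thesis .
    qed
    ultimately show ?thesis by simp
  qed
  \<comment> \<open>Here H' = v'^2 + (M^2 + gamma / (sinh s)^2) v^2, and completing the square in v'
    and M v gives the first bound.\<close>
  have HH: "H' s \<ge> 2 * M * \<bar>H s\<bar>" and HU: "H' s \<ge> M\<^sup>2 * sinh s ^ (m + 2) * (U s)\<^sup>2" if "s \<ge> 0" for s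
  proof -
    have S: "sinh s \<ge> 0" using that by simp
    have g0: "0 \<le> \<gamma> * sinh s ^ m * (U s)\<^sup>2" "0 \<le> sinh s ^ m * (q s)\<^sup>2" using S \<gamma> by simp_all
    have e: "H' s = sinh s ^ m * (q s)\<^sup>2 + M\<^sup>2 * sinh s ^ (m + 2) * (U s)\<^sup>2 + \<gamma> * sinh s ^ m * (U s)\<^sup>2"
      by (simp only: H'_def ring_distribs add.assoc)
    have "0 \<le> sinh s ^ m * (\<bar>q s\<bar> - M * sinh s * \<bar>U s\<bar>)\<^sup>2" using S by simp
    also have "\<dots> = sinh s ^ m * (q s)\<^sup>2 + M\<^sup>2 * sinh s ^ (m + 2) * (U s)\<^sup>2 - 2 * M * \<bar>H s\<bar>"
      using S by (simp add: H_def abs_mult power2_diff power_mult_distrib algebra_simps power2_eq_square[of "sinh s"])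
    finally show "H' s \<ge> 2 * M * \<bar>H s\<bar>" unfolding e using g0 by linarith
    show "H' s \<ge> M\<^sup>2 * sinh s ^ (m + 2) * (U s)\<^sup>2" unfolding e using g0 by linarith
  qed
  have mono: "H a \<le> H b" if "0 \<le> a" "a \<le> b" for a b
    by (rule DERIV_nonneg_imp_nondecreasing[OF that(2)]) (use H HH M that in \<open>meson abs_ge_zero mult_nonneg_nonneg order_trans less_imp_le zero_le_numeral\<close>)
  have "H 0 = 0" by (simp add: H_def)
  then have Hpos: "H s \<ge> 0" if "s \<ge> 0" for s using mono[of 0 s] that by simp
  have Hz: "H s1 = 0" if s1: "s1 > 0" for s1
  proof (rule ccontr)
    assume "H s1 \<noteq> 0"
    then have h1: "H s1 > 0" using Hpos[of s1] s1 by simp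
    define h where "h = H s1 * exp (- 2 * M * s1)"
    have h: "h > 0" using h1 by (simp add: h_def)
    have H1: "h \<le> H s * exp (- 2 * M * s)" if "s1 \<le> s" for s
      unfolding h_def
    proof (rule DERIV_nonneg_imp_nondecreasing[OF that])
      fix x assume x: "s1 \<le> x" "x \<le> s"
      have "((\<lambda>s. H s * exp (- 2 * M * s)) has_real_derivative (H' x - 2 * M * H x) * exp (- 2 * M * x)) (at x)"
        by (auto intro!: derivative_eq_intros H simp: algebra_simps)
      moreover have "0 \<le> (H' x - 2 * M * H x) * exp (- 2 * M * x)"
        using HH[of x] Hpos[of x] x s1 by simp
      ultimately show "\<exists>y. ((\<lambda>s. H s * exp (- 2 * M * s)) has_real_derivative y) (at x) \<and> 0 \<le> y" by blast
    qed
    define K where "K = G s1 - h / M * exp (2 * M * s1)"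
    have G1: "K \<le> G s - h / M * exp (2 * M * s)" if "s1 \<le> s" for s
      unfolding K_def
    proof (rule DERIV_nonneg_imp_nondecreasing[OF that])
      fix x assume x: "s1 \<le> x" "x \<le> s"
      have "((\<lambda>s. G s - h / M * exp (2 * M * s)) has_real_derivative 2 * (H x - h * exp (2 * M * x))) (at x)"
        using M by (auto intro!: derivative_eq_intros G simp: field_simps)
      moreover have "h * exp (2 * M * x) \<le> H x"
        using mult_right_mono[OF H1[OF x(1)], of "exp (2 * M * x)"] by (simp add: mult.assoc flip: exp_add)
      ultimately show "\<exists>y. ((\<lambda>s. G s - h / M * exp (2 * M * s)) has_real_derivative y) (at x) \<and> 0 \<le> y" by force
    qed
    define A' where "A' = A / (2 * M) ^ j"
    define h' where "h' = h / M * exp (- 2 * M * R)"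
    have h': "h' > 0" using h M by (simp add: h'_def)
    have "h' \<le> A' * (x ^ j / exp x) - K * (x ^ 0 / exp x)" if x: "x \<ge> 2 * M * (s1 + R)" for x
    proof -
      \<comment> \<open>Chosen so that x = 2 M (s + R): the polynomial bound becomes A' x^j and the
        exponential becomes h' exp x.\<close>
      define s where "s = x / (2 * M) - R"
      have "s \<ge> s1" using x M by (simp add: s_def field_simps)
      have "K + h / M * exp (2 * M * s) \<le> A * (s + R) ^ j"
        using G1[OF \<open>s1 \<le> s\<close>] bound[of s] \<open>s1 \<le> s\<close> s1 by (simp add: G_def)
      also have "A * (s + R) ^ j = A' * x ^ j" using M by (simp add: A'_def s_def power_divide)
      also have "2 * M * s = x + (- 2 * M * R)" using M by (simp add: s_def field_simps)
      finally have "K + h' * exp x \<le> A' * x ^ j" by (simp only: h'_def exp_add mult.assoc mult.commute[of "exp x"])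
      then show ?thesis by (simp add: field_simps)
    qed
    then have "eventually (\<lambda>x. h' \<le> A' * (x ^ j / exp x) - K * (x ^ 0 / exp x)) at_top"
      using eventually_at_top_linorder by blast
    moreover have "((\<lambda>x. A' * (x ^ j / exp x) - K * (x ^ 0 / exp x)) \<longlongrightarrow> A' * 0 - K * 0) at_top"
      by (intro tendsto_intros tendsto_power_div_exp_0)
    ultimately have "h' \<le> A' * 0 - K * 0"
      using tendsto_lowerbound trivial_limit_at_top_linorder by blast
    then show False using h' by simp
  qed
  \<comment> \<open>H vanishes on the whole positive half-line, hence so does H', which dominates
    M^2 v^2.\<close>
  have "(H has_real_derivative 0) (at s)"
  proof (rule DERIV_cong_ev[THEN iffD2, OF refl _ refl, of _ "\<lambda>_. 0"])
    show "\<forall>\<^sub>F x in nhds s. H x = 0"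
      using eventually_nhds_in_open[of "{0<..}" s] s by (auto elim: eventually_mono simp: Hz)
  qed simp
  then have "H' s = 0" using H DERIV_unique by blast
  then have "M\<^sup>2 * sinh s ^ (m + 2) * (U s)\<^sup>2 \<le> 0" using HU[of s] s by simp
  moreover have "M\<^sup>2 * sinh s ^ (m + 2) > 0" using M s by simp
  ultimately have "(U s)\<^sup>2 \<le> 0" by (metis mult_le_0_iff not_less)
  then show ?thesis by simp
qed

lemma DERIV_locally_zero:
  fixes f :: "real \<Rightarrow> real"
  assumes "open A" "x \<in> A" "\<And>y. y \<in> A \<Longrightarrow> f y = 0"
  shows "(f has_real_derivative 0) (at x)"
  by (rule has_field_derivative_transform_within_open[where f="\<lambda>_. 0" and S=A]) (use assms in auto)

text \<open>With \<open>D = (1 / sinh s) \<partial>\<^sub>s\<close>, the radial Laplacian of \<open>H\<^sup>d\<close> is \<open>(sinh s)\<^sup>2 D\<^sup>2 + d cosh s D\<close>. So \<open>pde\<close> is the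
  radial Klein-Gordon equation of mass \<open>M\<close> on \<open>H\<^sup>m\<^sup>+\<^sup>3\<close>, shifted by the bottom \<open>(m + 2)\<^sup>2 / 4\<close> of the spectrum.\<close>

locale radial_wave =
  fixes k :: "real \<times> real \<Rightarrow> real" and m :: nat and M :: real
  assumes es: "even_smooth k" and M: "M > 0"
    and pde: "\<And>t s. dt (dt k) (t, s) = (sinh s)\<^sup>2 * sinh_deriv (sinh_deriv k) (t, s) + (real m + 3) * cosh s * sinh_deriv k (t, s)
        + ((real m + 2)\<^sup>2 / 4 - M\<^sup>2) * k (t, s)"
    and supp: "\<And>t s. s \<ge> \<bar>t\<bar> + 1 \<Longrightarrow> k (t, s) = 0"
begin

text \<open>The function \<open>v = (sinh s)\<^sup>(\<^sup>m\<^sup>+\<^sup>2\<^sup>)\<^sup>/\<^sup>2 k\<close> solves \<open>v\<^sub>t\<^sub>t = v\<^sub>s\<^sub>s - (M\<^sup>2 + m (m + 2) / (4 (sinh s)\<^sup>2)) v\<close>. Below is its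
  energy density, with \<open>v\<^sub>s = (sinh s)\<^sup>m\<^sup>/\<^sup>2 q\<close>.\<close>

definition q where "q x = (sinh (snd x))\<^sup>2 * sinh_deriv k x + (real m + 2) / 2 * cosh (snd x) * k x"

definition energy where
  "energy x = (sinh (snd x) ^ (m + 2) * (dt k x)\<^sup>2 + sinh (snd x) ^ m * (q x)\<^sup>2
     + (M\<^sup>2 * sinh (snd x) ^ (m + 2) + (real m + 2) / 2 * (real m / 2) * sinh (snd x) ^ m) * (k x)\<^sup>2) / 2"

lemmas sm = even_smooth_smooth[OF es] even_smooth_smooth[OF even_smooth_sinh_deriv[OF es]] smooth_on_pd[OF even_smooth_smooth[OF es]]

lemma smooth_q: "smooth_on UNIV q"
  unfolding q_def[abs_def] by (intro smooth_intros open_UNIV sm)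

lemma smooth_energy: "smooth_on UNIV energy"
  unfolding energy_def[abs_def] divide_inverse
  by (intro smooth_intros open_UNIV sm smooth_q)

section \<open>Conservation of energy and the pointwise bound\<close>

lemma energy_ge:
  assumes "s \<ge> 0"
  shows "energy (t, s) \<ge> (sinh s ^ m * (q (t, s))\<^sup>2 + M\<^sup>2 * sinh s ^ (m + 2) * (k (t, s))\<^sup>2) / 2"
    and "energy (t, s) \<ge> 0"
proof -
  have S: "sinh s \<ge> 0" using assms by simp
  have p: "0 \<le> sinh s ^ (m + 2) * (dt k (t, s))\<^sup>2" "0 \<le> (real m + 2) / 2 * (real m / 2) * sinh s ^ m * (k (t, s))\<^sup>2"
    "0 \<le> sinh s ^ m * (q (t, s))\<^sup>2" "0 \<le> M\<^sup>2 * sinh s ^ (m + 2) * (k (t, s))\<^sup>2"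
    using S by simp_all
  have e: "energy (t, s) = (sinh s ^ (m + 2) * (dt k (t, s))\<^sup>2 + sinh s ^ m * (q (t, s))\<^sup>2
      + (M\<^sup>2 * sinh s ^ (m + 2) * (k (t, s))\<^sup>2 + (real m + 2) / 2 * (real m / 2) * sinh s ^ m * (k (t, s))\<^sup>2)) / 2"
    by (simp only: energy_def ring_distribs snd_conv)
  have gen: "c + d \<le> a + c + (d + b)" if "0 \<le> a" "0 \<le> b" for a b c d :: real using that by simp
  show "energy (t, s) \<ge> (sinh s ^ m * (q (t, s))\<^sup>2 + M\<^sup>2 * sinh s ^ (m + 2) * (k (t, s))\<^sup>2) / 2"
    unfolding e by (intro divide_right_mono gen p) simp
  show "energy (t, s) \<ge> 0"
    unfolding e by (intro divide_nonneg_nonneg add_nonneg_nonneg p) simp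
qed

lemma dt_k_zero: assumes "s > \<bar>t\<bar> + 1" shows "dt k (t, s) = 0"
proof -
  have "((\<lambda>t. k (t, s)) has_real_derivative 0) (at t)"
    by (rule DERIV_locally_zero[of "{- (s - 1)<..<s - 1}"]) (use assms in \<open>auto intro!: supp\<close>)
  then show ?thesis using plane_pd_eq(1)[OF sm(1)] by simp
qed

lemma energy_zero: assumes "s > \<bar>t\<bar> + 1" shows "energy (t, s) = 0"
proof -
  have "((\<lambda>s. k (t, s)) has_real_derivative 0) (at s)"
    by (rule DERIV_locally_zero[of "{\<bar>t\<bar> + 1<..}"]) (use assms in \<open>auto intro!: supp\<close>)
  then have "sinh s * sinh_deriv k (t, s) = 0"
    using DERIV_unique[OF even_smooth_deriv(1)[OF es, of t s]] by simp
  moreover have "s > 0" using assms by linarith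
  ultimately have "sinh_deriv k (t, s) = 0" by simp
  then show ?thesis using assms supp[of t s] by (simp add: energy_def q_def dt_k_zero)
qed

text \<open>The local conservation law: the time derivative of the energy density is the
  s-derivative of v_t v_s, and v_t v_s = (sinh s)^(m+1) k_t q.\<close>

lemma energy_flux:
  "((\<lambda>s. sinh s ^ (m + 1) * dt k (t, s) * q (t, s)) has_real_derivative dt energy (t, s)) (at s)"
proof -
  define S C where "S = sinh s" and "C = cosh s"
  define k0 k1 D1 D2 Dt Q where "k0 = k (t, s)" and "k1 = dt k (t, s)" and "D1 = sinh_deriv k (t, s)"
    and "D2 = sinh_deriv (sinh_deriv k) (t, s)" and "Dt = dt (sinh_deriv k) (t, s)" and "Q = q (t, s)"
  note defs = S_def C_def k0_def k1_def D1_def D2_def Dt_def Q_def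
  define ktt where "ktt = dt (dt k) (t, s)"
  have pde': "ktt = S\<^sup>2 * D2 + (real m + 3) * C * D1 + ((real m + 2)\<^sup>2 / 4 - M\<^sup>2) * k0"
    unfolding ktt_def pde defs ..
  have C2: "C\<^sup>2 = 1 + S\<^sup>2" by (simp add: defs cosh_square_eq)
  have Qd: "Q = S\<^sup>2 * D1 + (real m + 2) / 2 * C * k0" by (simp add: defs q_def)
  have P: "((\<lambda>s. sinh s ^ Suc j) has_real_derivative (real j + 1) * S ^ j * C) (at s)" for j
    using DERIV_power_Suc[where n=j and x=s, OF has_field_derivative_sinh[OF DERIV_ident]] by (simp add: algebra_simps defs)
  have qs: "((\<lambda>s. q (t, s)) has_real_derivative 2 * S * C * D1 + S\<^sup>2 * (S * D2)
      + (real m + 2) / 2 * (S * k0 + C * (S * D1))) (at s)" (is "(_ has_real_derivative ?q') _")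
    unfolding q_def defs snd_conv
    by (auto intro!: derivative_eq_intros even_smooth_deriv es even_smooth_sinh_deriv simp: power2_eq_square field_simps)
  have qt: "((\<lambda>t. q (t, s)) has_real_derivative S\<^sup>2 * Dt + (real m + 2) / 2 * C * k1) (at t)"
    unfolding q_def defs snd_conv
    by (auto intro!: derivative_eq_intros even_smooth_deriv es even_smooth_sinh_deriv simp: algebra_simps)
  have ks: "((\<lambda>s. dt k (t, s)) has_real_derivative S * Dt) (at s)"
    using even_smooth_deriv(1)[OF even_smooth_dt[OF es], of t s] by (simp add: defs sinh_deriv_dt[OF es])
  have kt: "((\<lambda>t. dt k (t, s)) has_real_derivative ktt) (at t)"
    using even_smooth_deriv(2)[OF even_smooth_dt[OF es], of s t] by (simp add: ktt_def)
  have kt0: "((\<lambda>t. k (t, s)) has_real_derivative k1) (at t)"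
    using even_smooth_deriv(2)[OF es, of s t] by (simp add: defs)
  have "((\<lambda>t. energy (t, s)) has_real_derivative S ^ (m + 2) * k1 * ktt + S ^ m * Q * (S\<^sup>2 * Dt + (real m + 2) / 2 * C * k1)
      + (M\<^sup>2 * S ^ (m + 2) + (real m + 2) / 2 * (real m / 2) * S ^ m) * k0 * k1) (at t)"
    unfolding energy_def snd_conv
    by (auto intro!: derivative_eq_intros qt kt kt0 simp del: power_Suc)
      (simp add: defs field_simps del: power_Suc)
  then have e: "dt energy (t, s) = S ^ (m + 2) * k1 * ktt + S ^ m * Q * (S\<^sup>2 * Dt + (real m + 2) / 2 * C * k1)
      + (M\<^sup>2 * S ^ (m + 2) + (real m + 2) / 2 * (real m / 2) * S ^ m) * k0 * k1"
    by (rule plane_pd_eq(1)[OF smooth_energy, rotated]) simp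
  have "((\<lambda>s. sinh s ^ (m + 1) * dt k (t, s) * q (t, s)) has_real_derivative
      (real m + 1) * S ^ m * C * k1 * Q + S ^ (m + 1) * (S * Dt) * Q + S ^ (m + 1) * k1 * ?q') (at s)"
    unfolding Suc_eq_plus1[symmetric]
    by (rule derivative_eq_intros P ks qs refl)+ (simp add: defs algebra_simps)
  moreover have "(real m + 1) * S ^ m * C * k1 * Q + S ^ (m + 1) * (S * Dt) * Q + S ^ (m + 1) * k1 * ?q' = dt energy (t, s)"
  proof -
    \<comment> \<open>The wave equation for v, divided by (sinh s)^(m/2 - 1), with v_ss expressed
      through q and its s-derivative.\<close>
    have key: "(real m / 2) * C * Q + S * ?q' = S\<^sup>2 * ktt + (M\<^sup>2 * S\<^sup>2 + (real m + 2) / 2 * (real m / 2)) * k0"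
    proof -
      have "(real m / 2) * C * Q + S * ?q' = S\<^sup>2 * (S\<^sup>2 * D2 + (real m + 3) * C * D1)
          + (real m / 2 * ((real m + 2) / 2) * C\<^sup>2 + (real m + 2) / 2 * S\<^sup>2) * k0"
        unfolding Qd by (simp add: field_simps power2_eq_square)
      also have "S\<^sup>2 * D2 + (real m + 3) * C * D1 = ktt - ((real m + 2)\<^sup>2 / 4 - M\<^sup>2) * k0" unfolding pde' by simp
      finally show ?thesis unfolding C2 by (simp add: field_simps power2_eq_square)
    qed
    have "(real m + 1) * S ^ m * C * k1 * Q + S ^ (m + 1) * (S * Dt) * Q + S ^ (m + 1) * k1 * ?q'
       = S ^ m * (((real m + 2) / 2 * C * k1 * Q + S\<^sup>2 * Dt * Q) + k1 * ((real m / 2) * C * Q + S * ?q'))"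
      by (simp add: field_simps power2_eq_square)
    also have "\<dots> = dt energy (t, s)" unfolding key e by (simp add: field_simps power2_eq_square)
    finally show ?thesis .
  qed
  ultimately show ?thesis by simp
qed

text \<open>No energy crosses the ends of [0, L]: at 0 the flux contains a positive power of sinh 0,
  and at L the wave has not yet arrived.\<close>

lemma energy_conserved:
  assumes "\<bar>t\<bar> + 1 < L"
  shows "integral {0..L} (\<lambda>s. energy (t, s)) = integral {0..L} (\<lambda>s. energy (0, s))"
proof -
  have d: "((\<lambda>t. integral {0..L} (\<lambda>s. energy (t, s))) has_real_derivative 0) (at u)" if "\<bar>u\<bar> + 1 < L" for u
  proof -
    have "((\<lambda>s. dt energy (u, s)) has_integral
        sinh L ^ (m + 1) * dt k (u, L) * q (u, L) - sinh 0 ^ (m + 1) * dt k (u, 0) * q (u, 0)) {0..L}"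
      by (rule fundamental_theorem_of_calculus)
        (use that energy_flux in \<open>auto simp: has_real_derivative_iff_has_vector_derivative[symmetric] intro: has_field_derivative_at_within\<close>)
    then have "integral {0..L} (\<lambda>s. dt energy (u, s)) = 0"
      using dt_k_zero[of u L] that by (simp add: integral_unique)
    with deriv_integral_param[OF smooth_energy, of 0 L u] show ?thesis by simp
  qed
  show ?thesis
    by (rule DERIV_isconst3[where a="- (L - 1)" and b="L - 1" and f="\<lambda>t. integral {0..L} (\<lambda>s. energy (t, s))"])
      (use assms in \<open>auto intro!: d\<close>)
qed

text \<open>The data at time 0 live in s <= 1; the endpoint 2 leaves room beyond their
  support.\<close>

definition total_energy where "total_energy = integral {0..2} (\<lambda>s. energy (0, s))"

lemma continuous_slice:
  fixes f :: "real \<times> real \<Rightarrow> real"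
  assumes "smooth_on UNIV f"
  shows "continuous_on A (\<lambda>s. f (t, s))" "continuous_on A (\<lambda>t. f (t, s))"
  by (rule continuous_on_compose2[OF smooth_on_continuous[OF assms]]; auto intro!: continuous_intros)+

lemma energy_total:
  assumes "L \<ge> 2"
  shows "integral {0..L} (\<lambda>s. energy (0, s)) = total_energy"
proof -
  have "integral {0..2} (\<lambda>s. energy (0, s)) + integral {2..L} (\<lambda>s. energy (0, s)) = integral {0..L} (\<lambda>s. energy (0, s))"
    by (rule Henstock_Kurzweil_Integration.integral_combine)
      (use assms in \<open>auto intro!: integrable_continuous_interval continuous_slice smooth_energy\<close>)
  moreover have "integral {2..L} (\<lambda>s. energy (0, s)) = integral {2..L} (\<lambda>s. 0)"
    by (rule integral_cong) (auto intro!: energy_zero)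
  ultimately show ?thesis by (simp add: total_energy_def)
qed

text \<open>v vanishes at L, so v^2 at s is minus the integral of 2 v v_s over [s, L]. Moreover 2 M
  |v v_s| <= v_s^2 + M^2 v^2, which is at most twice the energy density. Here the positive mass
  turns an integral bound into one that is uniform in time.\<close>

lemma sup_bound:
  assumes "s > 0"
  shows "sinh s ^ (m + 2) * (k (t, s))\<^sup>2 \<le> 2 / M * total_energy"
proof -
  define L where "L = max 2 (\<bar>t\<bar> + 2) + s"
  have L: "L \<ge> 2" "\<bar>t\<bar> + 1 < L" "s \<le> L" using assms by (auto simp: L_def)
  have d: "((\<lambda>s. sinh s ^ (m + 2) * (k (t, s))\<^sup>2) has_real_derivative 2 * sinh s ^ (m + 1) * k (t, s) * q (t, s)) (at s)" for s
  proof -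
    have P: "((\<lambda>s. sinh s ^ Suc j) has_real_derivative (real j + 1) * sinh s ^ j * cosh s) (at s)" for j
      using DERIV_power_Suc[where n=j and x=s, OF has_field_derivative_sinh[OF DERIV_ident]] by (simp add: algebra_simps)
    show ?thesis
      unfolding q_def add_2_eq_Suc' snd_conv
      by (rule derivative_eq_intros P even_smooth_deriv(1)[OF es] refl)+ (simp add: power2_eq_square field_simps)
  qed
  have hi: "((\<lambda>s. 2 * sinh s ^ (m + 1) * k (t, s) * q (t, s)) has_integral
      sinh L ^ (m + 2) * (k (t, L))\<^sup>2 - sinh s ^ (m + 2) * (k (t, s))\<^sup>2) {s..L}"
    by (rule fundamental_theorem_of_calculus)
      (use L d in \<open>auto simp: has_real_derivative_iff_has_vector_derivative[symmetric] intro: has_field_derivative_at_within\<close>)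
  have kL: "k (t, L) = 0" using L by (intro supp) simp
  have "sinh s ^ (m + 2) * (k (t, s))\<^sup>2 = integral {s..L} (\<lambda>s. - (2 * sinh s ^ (m + 1) * k (t, s) * q (t, s)))"
    using integral_unique[OF has_integral_neg[OF hi]] kL by simp
  also have "\<dots> \<le> integral {s..L} (\<lambda>s. 2 / M * energy (t, s))"
  proof (rule integral_le)
    fix x assume "x \<in> {s..L}"
    then have x: "x \<ge> 0" "sinh x \<ge> 0" using assms by auto
    have "0 \<le> sinh x ^ m * (q (t, x) + M * sinh x * k (t, x))\<^sup>2" using x by simp
    also have "\<dots> = 2 * ((sinh x ^ m * (q (t, x))\<^sup>2 + M\<^sup>2 * sinh x ^ (m + 2) * (k (t, x))\<^sup>2) / 2)
        + M * (2 * sinh x ^ (m + 1) * k (t, x) * q (t, x))"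
      by (simp add: field_simps power2_eq_square)
    also have "\<dots> \<le> 2 * energy (t, x) + M * (2 * sinh x ^ (m + 1) * k (t, x) * q (t, x))"
      using energy_ge(1)[OF x(1), of t] by simp
    finally show "- (2 * sinh x ^ (m + 1) * k (t, x) * q (t, x)) \<le> 2 / M * energy (t, x)"
      using M by (simp add: field_simps)
  qed (intro integrable_continuous_interval continuous_intros continuous_slice smooth_energy smooth_q sm)+
  also have "\<dots> = 2 / M * integral {s..L} (\<lambda>s. energy (t, s))" by simp
  also have "\<dots> \<le> 2 / M * integral {0..L} (\<lambda>s. energy (t, s))"
    using M assms L
    by (intro mult_left_mono integral_subset_le)
      (auto intro!: integrable_continuous_interval continuous_slice smooth_energy energy_ge(2))
  also have "\<dots> = 2 / M * total_energy" using energy_conserved[OF L(2)] energy_total[OF L(1)] by simp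
  finally show ?thesis .
qed

lemma total_energy_nonneg: "total_energy \<ge> 0"
  using sup_bound[of 1 0] M mult_nonneg_nonneg[of "sinh 1 ^ (m + 2)" "(k (0, 1))\<^sup>2"]
  by (smt (verit) zero_le_mult_iff zero_le_power2 sinh_real_nonneg_iff zero_le_power divide_pos_pos)

end

section \<open>Waves with a lacuna, and their time moments\<close>

locale lacunary_wave = radial_wave +
  fixes R :: real
  assumes R: "R > 0" and lacuna_pos: "\<And>t s. 0 < s \<Longrightarrow> s < \<bar>t\<bar> - R \<Longrightarrow> k (t, s) = 0"
begin

text \<open>The lacuna is known for s > 0 only, which is what the vanishing of the forms yields off
  the centre. Evenness and continuity give the remaining s.\<close>

lemma lacuna: assumes "\<bar>s\<bar> < \<bar>t\<bar> - R" shows "k (t, s) = 0"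
proof (cases "s = 0")
  case False
  then show ?thesis using lacuna_pos[of "\<bar>s\<bar>" t] assms even_smooth_even[OF es, of t s] by (auto simp: abs_if split: if_splits)
next
  case True
  have "k (t, 0) = 0"
  proof (rule tendsto_unique[of "at_right 0"])
    have "isCont (\<lambda>s. k (t, s)) 0" using even_smooth_deriv(1)[OF es] DERIV_isCont by blast
    then show "((\<lambda>s. k (t, s)) \<longlongrightarrow> k (t, 0)) (at_right 0)"
      by (auto simp: isCont_def filterlim_at_split)
    show "((\<lambda>s. k (t, s)) \<longlongrightarrow> 0) (at_right 0)"
      by (rule tendsto_eventually, subst eventually_at_right[of 0 1])
        (use assms True in \<open>auto intro!: exI[of _ "\<bar>t\<bar> - R"] lacuna_pos\<close>)
  qed simp
  then show ?thesis using True by simp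
qed

text \<open>The moments \<open>\<integral> t\<^sup>j k(t, s) dt\<close> are finite by the vanishing for large \<open>\<bar>t\<bar>\<close>, and by induction on \<open>j\<close> they
  solve the static equation, all of whose nonzero regular solutions grow exponentially.\<close>

definition moment :: "nat \<Rightarrow> (real \<times> real \<Rightarrow> real) \<Rightarrow> real \<Rightarrow> real" where
  "moment j f s = integral UNIV (\<lambda>t. t ^ j * f (t, s))"

text \<open>Closed under \<open>sinh_deriv\<close>, so every moment occurring in the static equation
  is an integral over a bounded time interval.\<close>

definition lacunary_fun :: "(real \<times> real \<Rightarrow> real) \<Rightarrow> bool" where
  "lacunary_fun f \<longleftrightarrow> even_smooth f \<and> (\<forall>t s. \<bar>s\<bar> < \<bar>t\<bar> - R \<longrightarrow> f (t, s) = 0)"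

lemma lacunary_fun_k: "lacunary_fun k" using es lacuna by (simp add: lacunary_fun_def)

lemma lacunary_fun_sinh_deriv: assumes "lacunary_fun f" shows "lacunary_fun (sinh_deriv f)"
proof -
  have es: "even_smooth f" and z: "\<And>t s. \<bar>s\<bar> < \<bar>t\<bar> - R \<Longrightarrow> f (t, s) = 0" using assms by (auto simp: lacunary_fun_def)
  have nz: "sinh_deriv f (t, s) = 0" if "\<bar>s\<bar> < \<bar>t\<bar> - R" "s \<noteq> 0" for t s
  proof -
    have "((\<lambda>s. f (t, s)) has_real_derivative 0) (at s)"
      by (rule DERIV_locally_zero[of "{- (\<bar>t\<bar> - R)<..<\<bar>t\<bar> - R}"]) (use that in \<open>auto intro!: z\<close>)
    then have "sinh s * sinh_deriv f (t, s) = 0" by (rule DERIV_unique[OF even_smooth_deriv(1)[OF es]])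
    then show ?thesis using that by simp
  qed
  have "sinh_deriv f (t, 0) = 0" if "0 < \<bar>t\<bar> - R" for t
  proof (rule tendsto_unique[of "at_right 0"])
    have "isCont (\<lambda>s. sinh_deriv f (t, s)) 0" using even_smooth_deriv(1)[OF even_smooth_sinh_deriv[OF es]] DERIV_isCont by blast
    then show "((\<lambda>s. sinh_deriv f (t, s)) \<longlongrightarrow> sinh_deriv f (t, 0)) (at_right 0)"
      by (auto simp: isCont_def filterlim_at_split)
    show "((\<lambda>s. sinh_deriv f (t, s)) \<longlongrightarrow> 0) (at_right 0)"
      by (rule tendsto_eventually, subst eventually_at_right[of 0 1])
        (use that in \<open>auto intro!: exI[of _ "\<bar>t\<bar> - R"] nz\<close>)
  qed simp
  then have "sinh_deriv f (t, s) = 0" if "\<bar>s\<bar> < \<bar>t\<bar> - R" for t s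
    using nz[OF that] that by (cases "s = 0") auto
  then show ?thesis using even_smooth_sinh_deriv[OF es] by (simp add: lacunary_fun_def)
qed

lemma moment_eq:
  assumes "lacunary_fun f" "T \<ge> \<bar>s\<bar> + R"
  shows "moment j f s = integral {-T..T} (\<lambda>t. t ^ j * f (t, s))"
proof -
  have "(\<lambda>t. if t \<in> {-T..T} then t ^ j * f (t, s) else 0) = (\<lambda>t. t ^ j * f (t, s))"
    using assms by (auto simp: lacunary_fun_def fun_eq_iff)
  then show ?thesis unfolding moment_def by (metis integral_restrict_UNIV)
qed

lemma moment_deriv:
  assumes "lacunary_fun f"
  shows "(moment j f has_real_derivative sinh s * moment j (sinh_deriv f) s) (at s)"
proof -
  \<comment> \<open>The extra 1 lets one time window serve all distances near s, so the integral is
    differentiated over a fixed interval.\<close>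
  define T where "T = \<bar>s\<bar> + 1 + R"
  define g where "g x = snd x ^ j * f (snd x, fst x)" for x
  have es: "even_smooth f" using assms by (simp add: lacunary_fun_def)
  have sg: "smooth_on UNIV g"
    unfolding g_def[abs_def] by (intro smooth_intros smooth_on_compose2 even_smooth_smooth[OF es] open_UNIV)
  have "((\<lambda>s. integral {-T..T} (\<lambda>t. g (s, t))) has_real_derivative integral {-T..T} (\<lambda>t. dt g (s, t))) (at s)"
    by (rule deriv_integral_param[OF sg])
  also have "integral {-T..T} (\<lambda>t. dt g (s, t)) = integral {-T..T} (\<lambda>t. sinh s * (t ^ j * sinh_deriv f (t, s)))"
  proof (rule integral_cong)
    fix t
    show "dt g (s, t) = sinh s * (t ^ j * sinh_deriv f (t, s))"
      by (rule plane_pd_eq(1)[OF sg]) (auto simp: g_def intro!: derivative_eq_intros even_smooth_deriv(1)[OF es])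
  qed
  also have "integral {-T..T} (\<lambda>t. sinh s * (t ^ j * sinh_deriv f (t, s))) = sinh s * moment j (sinh_deriv f) s"
    by (simp add: moment_eq[OF lacunary_fun_sinh_deriv[OF assms], of s T] T_def)
  finally show ?thesis
    by (rule has_field_derivative_transform_within_open[where S="{- (\<bar>s\<bar> + 1)<..<\<bar>s\<bar> + 1}"])
      (auto simp: g_def T_def moment_eq[OF assms, of _ "\<bar>s\<bar> + 1 + R"])
qed

text \<open>Multiply the wave equation by t^j and integrate over time. Two integrations by parts
  move the time derivatives onto t^j, and the lacuna kills the boundary terms. The truncated j - 1
  and j - 2 do no harm, as the factor j (j - 1) is 0 for j < 2.\<close>

lemma moment_ode:
  "(sinh s)\<^sup>2 * moment j (sinh_deriv (sinh_deriv k)) s + (real m + 3) * cosh s * moment j (sinh_deriv k) s + ((real m + 2)\<^sup>2 / 4 - M\<^sup>2) * moment j k s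
     = real j * real (j - 1) * moment (j - 2) k s"
proof -
  define T where "T = \<bar>s\<bar> + 1 + R"
  have T: "T \<ge> \<bar>s\<bar> + R" "T > 0" using R by (simp_all add: T_def)
  have k0: "k (T, s) = 0" "k (-T, s) = 0" by (rule lacuna; simp add: T_def R)+
  have kt0: "dt k (u, s) = 0" if "\<bar>u\<bar> > \<bar>s\<bar> + R" for u
  proof -
    have "((\<lambda>t. k (t, s)) has_real_derivative 0) (at u)"
      by (rule DERIV_locally_zero[of "- {- (\<bar>s\<bar> + R)..\<bar>s\<bar> + R}"]) (use that in \<open>auto intro!: lacuna\<close>)
    then show ?thesis using plane_pd_eq(1)[OF sm(1)] by simp
  qed
  define I where "I f j = integral {-T..T} (\<lambda>t. t ^ j * f (t, s))" for f :: "real \<times> real \<Rightarrow> real" and j :: nat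
  have int: "(\<lambda>t. t ^ j * f (t, s)) integrable_on {-T..T}" if "smooth_on UNIV f" for f and j :: nat
    by (auto intro!: integrable_continuous_interval continuous_intros continuous_slice(2) that)
  have hi: "((\<lambda>t. t ^ j * f (t, s)) has_integral I f j) {-T..T}" if "smooth_on UNIV f" for f
    unfolding I_def by (rule integrable_integral[OF int[OF that]])
  \<comment> \<open>Both integrations by parts at once: the primitive is t^j k_t - j t^(j-1)
    k.\<close>
  have "((\<lambda>t. t ^ j * dt (dt k) (t, s) - real j * real (j - 1) * (t ^ (j - 2) * k (t, s))) has_integral
      (T ^ j * dt k (T, s) - real j * T ^ (j - 1) * k (T, s)) - ((-T) ^ j * dt k (-T, s) - real j * (-T) ^ (j - 1) * k (-T, s))) {-T..T}"
  proof (rule fundamental_theorem_of_calculus)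
    fix x :: real
    have "((\<lambda>t. t ^ j * dt k (t, s) - real j * t ^ (j - 1) * k (t, s)) has_real_derivative
       (x ^ j * dt (dt k) (x, s) - real j * real (j - 1) * (x ^ (j - 2) * k (x, s)))) (at x)"
      by (auto intro!: derivative_eq_intros even_smooth_deriv(2) es even_smooth_dt simp: algebra_simps numeral_2_eq_2)
    then show "((\<lambda>t. t ^ j * dt k (t, s) - real j * t ^ (j - 1) * k (t, s)) has_vector_derivative
       (x ^ j * dt (dt k) (x, s) - real j * real (j - 1) * (x ^ (j - 2) * k (x, s)))) (at x within {-T..T})"
      by (simp add: has_real_derivative_iff_has_vector_derivative[symmetric] has_field_derivative_at_within)
  qed (use T in simp)
  then have "integral {-T..T} (\<lambda>t. t ^ j * dt (dt k) (t, s) - real j * real (j - 1) * (t ^ (j - 2) * k (t, s))) = 0"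
    using kt0[of T] kt0[of "-T"] k0 R by (simp add: integral_unique T_def)
  then have "I (dt (dt k)) j = real j * real (j - 1) * I k (j - 2)"
    unfolding I_def
    by (subst (asm) integral_diff)
      ((intro integrable_continuous_interval continuous_intros continuous_slice(2) smooth_on_pd sm)+, simp)
  moreover have "I (dt (dt k)) j = (sinh s)\<^sup>2 * I (sinh_deriv (sinh_deriv k)) j + (real m + 3) * cosh s * I (sinh_deriv k) j + ((real m + 2)\<^sup>2 / 4 - M\<^sup>2) * I k j"
  proof -
    have "I (dt (dt k)) j = integral {-T..T} (\<lambda>t. (sinh s)\<^sup>2 * (t ^ j * sinh_deriv (sinh_deriv k) (t, s)) +
        (real m + 3) * cosh s * (t ^ j * sinh_deriv k (t, s)) + ((real m + 2)\<^sup>2 / 4 - M\<^sup>2) * (t ^ j * k (t, s)))"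
      unfolding I_def pde by (rule integral_cong) (simp add: algebra_simps)
    also have "\<dots> = (sinh s)\<^sup>2 * I (sinh_deriv (sinh_deriv k)) j + (real m + 3) * cosh s * I (sinh_deriv k) j + ((real m + 2)\<^sup>2 / 4 - M\<^sup>2) * I k j"
      by (intro integral_unique has_integral_add has_integral_mult_right hi even_smooth_smooth even_smooth_sinh_deriv es)
    finally show ?thesis .
  qed
  ultimately show ?thesis
    unfolding moment_eq[OF lacunary_fun_k T(1)] moment_eq[OF lacunary_fun_sinh_deriv[OF lacunary_fun_k] T(1)] moment_eq[OF lacunary_fun_sinh_deriv[OF lacunary_fun_sinh_deriv[OF lacunary_fun_k]] T(1)] I_def[symmetric]
    by simp
qed

text \<open>\<open>sup_bound\<close> controls k uniformly in time by a multiple of (sinh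
  s)^(-(m+2)/2), and the time window has length 2 (s + R). After weighting only a power of s + R is
  left.\<close>

lemma moment_bound:
  assumes "s > 0"
  shows "sinh s ^ (m + 2) * (moment j k s)\<^sup>2 \<le> (4 * (2 / M * total_energy)) * (s + R) ^ (2 * j + 2)"
proof -
  define T where "T = s + R"
  define a where "a = sqrt (2 / M * total_energy / sinh s ^ (m + 2))"
  have T: "T \<ge> \<bar>s\<bar> + R" "T > 0" using R assms by (simp_all add: T_def)
  have S: "sinh s ^ (m + 2) > 0" using assms by simp
  have a: "\<bar>k (t, s)\<bar> \<le> a" for t
    unfolding a_def by (rule real_le_rsqrt) (use sup_bound[OF assms, of t] in \<open>simp only: pos_le_divide_eq[OF S] power2_abs mult.commute\<close>)
  have "a \<ge> 0" using a[of 0] by linarith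
  have "norm (integral {-T..T} (\<lambda>t. t ^ j * k (t, s))) \<le> integral {-T..T} (\<lambda>t. T ^ j * a)"
  proof (rule integral_norm_bound_integral)
    show "(\<lambda>t. t ^ j * k (t, s)) integrable_on {-T..T}"
      by (auto intro!: integrable_continuous_interval continuous_intros continuous_slice(2) sm)
    fix x assume "x \<in> {-T..T}"
    then have "\<bar>x\<bar> \<le> T" by auto
    then show "norm (x ^ j * k (x, s)) \<le> T ^ j * a"
      using a[of x] \<open>a \<ge> 0\<close> by (auto simp: abs_mult power_abs intro!: mult_mono power_mono)
  qed auto
  also have "\<dots> = 2 * T ^ (j + 1) * a" using T by simp
  finally have "\<bar>moment j k s\<bar> \<le> 2 * T ^ (j + 1) * a" by (simp add: moment_eq[OF lacunary_fun_k T(1)])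
  then have "(moment j k s)\<^sup>2 \<le> (2 * T ^ (j + 1) * a)\<^sup>2" by (rule power2_le_iff_abs_le[THEN iffD2, rotated]) (use T \<open>a \<ge> 0\<close> in simp)
  also have "\<dots> = 4 * T ^ (2 * j + 2) * a\<^sup>2"
  proof -
    have "(j + 1) * 2 = 2 * j + 2" by simp
    then have T2: "(T ^ (j + 1))\<^sup>2 = T ^ (2 * j + 2)" by (simp only: power_mult[symmetric])
    show ?thesis unfolding power_mult_distrib T2 by simp
  qed
  also have "a\<^sup>2 = 2 / M * total_energy / sinh s ^ (m + 2)" using total_energy_nonneg M S by (simp add: a_def)
  finally have fin: "(moment j k s)\<^sup>2 \<le> 4 * T ^ (2 * j + 2) * (2 / M * total_energy / sinh s ^ (m + 2))" .
  have gen: "x * (4 * p * (c / x)) = 4 * c * p" if "x > 0" for x p c :: real using that by simp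
  show ?thesis
    using mult_left_mono[OF fin less_imp_le[OF S]] unfolding gen[OF S] T_def .
qed

text \<open>By the induction hypothesis the right side of \<open>moment_ode\<close> vanishes, so
  this moment is a static solution; \<open>moment_bound\<close> is the growth condition that
  excludes a nonzero one.\<close>

lemma moment_zero: "s > 0 \<Longrightarrow> moment j k s = 0"
proof (induction j arbitrary: s rule: less_induct)
  case (less j)
  have even: "moment i f (- s) = moment i f s" if "lacunary_fun f" for i f s
    using that by (simp add: moment_def lacunary_fun_def even_smooth_even)
  \<comment> \<open>\<open>static_growth\<close> wants the equation on the whole line, so s <= 0 is
    supplied by evenness and continuity.\<close>
  have z: "real j * real (j - 1) * moment (j - 2) k s = 0" for s
  proof (cases "j \<ge> 2")
    case True
    then have pos: "moment (j - 2) k s = 0" if "s > 0" for s using less.IH[of "j - 2" s] that by simp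
    then have nz: "moment (j - 2) k s = 0" if "s \<noteq> 0" for s
      using even[OF lacunary_fun_k, of "j - 2" s] pos[of s] pos[of "-s"] that by (cases "s > 0") auto
    have "moment (j - 2) k 0 = 0"
    proof (rule tendsto_unique[of "at_right 0"])
      have "isCont (moment (j - 2) k) 0" using moment_deriv[OF lacunary_fun_k] DERIV_isCont by blast
      then show "(moment (j - 2) k \<longlongrightarrow> moment (j - 2) k 0) (at_right 0)"
        by (auto simp: isCont_def filterlim_at_split)
      show "(moment (j - 2) k \<longlongrightarrow> 0) (at_right 0)"
        by (rule tendsto_eventually, subst eventually_at_right[of 0 1]) (auto intro!: exI[of _ 1] pos)
    qed simp
    then show ?thesis using nz[of s] by (cases "s = 0") auto
  next
    case False
    then have "j = 0 \<or> j = 1" by auto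
    then show ?thesis by auto
  qed
  show ?case
    by (rule static_growth[OF moment_deriv[OF lacunary_fun_k] moment_deriv[OF lacunary_fun_sinh_deriv[OF lacunary_fun_k]] _ M moment_bound less.prems])
      (use moment_ode z in \<open>simp_all add: add.commute add.left_commute\<close>)
qed

theorem lacunary_trivial: assumes "s > 0" shows "k (t, s) = 0"
proof -
  define T where "T = \<bar>t\<bar> + s + R"
  have T: "T \<ge> \<bar>s\<bar> + R" "t \<in> {-T..T}" "-T < T" using assms R by (auto simp: T_def)
  show ?thesis
    by (rule moments_zero[OF T(3) _ _ T(2)])
      (use moment_zero[OF assms] moment_eq[OF lacunary_fun_k T(1)] in \<open>auto intro!: continuous_slice sm\<close>)
qed

end

section \<open>Existence of radial waves\<close>

text \<open>The powers of 1/x make the family closed under differentiation, as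
  \<open>smooth_on_real_family\<close> requires.\<close>

definition flat :: "nat \<Rightarrow> real \<Rightarrow> real" where
  "flat j x = (if x > 0 then exp (- inverse x) * inverse x ^ j else 0)"

lemma flat_tendsto_0: "(flat j \<longlongrightarrow> 0) (at 0)"
proof -
  have "((\<lambda>x::real. x ^ j / exp x) \<longlongrightarrow> 0) at_top" by (rule tendsto_power_div_exp_0)
  from filterlim_compose[OF this filterlim_inverse_at_top_right]
  have "((\<lambda>x::real. inverse x ^ j / exp (inverse x)) \<longlongrightarrow> 0) (at_right 0)" .
  then have "(flat j \<longlongrightarrow> 0) (at_right 0)"
    by (rule Lim_transform_eventually)
      (auto simp: eventually_at_right_less flat_def exp_minus divide_inverse intro!: eventually_mono[OF eventually_at_right_less])
  moreover have "(flat j \<longlongrightarrow> 0) (at_left 0)"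
    by (rule tendsto_eventually) (auto simp: eventually_at_filter flat_def)
  ultimately show ?thesis by (simp add: filterlim_at_split)
qed

lemma flat_deriv: "(flat j has_real_derivative flat (j + 2) x - real j * flat (j + 1) x) (at x)"
proof -
  consider "x > 0" | "x = 0" | "x < 0" by linarith
  then show ?thesis
  proof cases
    case 1
    have "((\<lambda>x. exp (- inverse x) * inverse x ^ j) has_real_derivative
        exp (- inverse x) * (inverse x * inverse x) * inverse x ^ j
         + exp (- inverse x) * (real j * (- (inverse x * inverse x)) * inverse x ^ (j - 1))) (at x)"
      using 1 by (auto intro!: derivative_eq_intros simp: algebra_simps)
    moreover have "exp (- inverse x) * (inverse x * inverse x) * inverse x ^ j
         + exp (- inverse x) * (real j * (- (inverse x * inverse x)) * inverse x ^ (j - 1)) = flat (j + 2) x - real j * flat (j + 1) x"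
      using 1 by (cases j) (simp_all add: flat_def algebra_simps)
    ultimately have "((\<lambda>x. exp (- inverse x) * inverse x ^ j) has_real_derivative
        flat (j + 2) x - real j * flat (j + 1) x) (at x)" by simp
    then show ?thesis
      by (rule has_field_derivative_transform_within_open[where S="{0<..}"]) (use 1 in \<open>auto simp: flat_def\<close>)
  next
    case 2
    \<comment> \<open>The difference quotient of \<open>flat j\<close> at 0 is
      \<open>flat (j + 1)\<close>, which tends to 0.\<close>
    have "((\<lambda>h. (flat j (0 + h) - flat j 0) / h) \<longlongrightarrow> 0) (at 0)"
      by (rule Lim_transform_eventually[OF flat_tendsto_0[of "j + 1"]])
        (auto simp: flat_def field_simps eventually_at_filter)
    then show ?thesis using 2 by (simp add: DERIV_def flat_def)
  next
    case 3
    then show ?thesis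
      using DERIV_locally_zero[of "{..<0}" x "flat j"] by (simp add: flat_def)
  qed
qed

lemma smooth_flat: "smooth_on UNIV (flat j)"
proof (rule smooth_on_real_family[of UNIV UNIV flat])
  fix j :: nat
  show "\<exists>f'. (\<forall>x\<in>UNIV. (flat j has_real_derivative f' x) (at x)) \<and>
      (\<forall>k. (\<forall>i\<in>UNIV. Ck_on k UNIV (flat i)) \<longrightarrow> Ck_on k UNIV f')"
  proof (intro exI[of _ "\<lambda>x. flat (j + 2) x + (- real j) * flat (j + 1) x"] conjI ballI allI impI)
    show "(flat j has_real_derivative flat (j + 2) x + (- real j) * flat (j + 1) x) (at x)" for x
      using flat_deriv[of j x] by simp
    show "Ck_on k UNIV (\<lambda>x. flat (j + 2) x + (- real j) * flat (j + 1) x)" if "\<forall>i\<in>UNIV. Ck_on k UNIV (flat i)" for k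
      by (intro Ck_on_add Ck_on_mult Ck_on_const open_UNIV) (use that in auto)
  qed
qed auto

definition bump :: "real \<Rightarrow> real" where "bump s = flat 0 (1 - s\<^sup>2)"

lemma smooth_bump: "smooth_on UNIV bump"
  unfolding bump_def[abs_def] by (intro smooth_on_compose1[OF smooth_flat] smooth_intros open_UNIV)

lemma bump_props: "bump (- s) = bump s" "bump s \<ge> 0" "bump 0 > 0" "\<bar>s\<bar> \<ge> 1 \<Longrightarrow> bump s = 0"
  by (auto simp: bump_def flat_def abs_square_less_1 not_less)

lemma smooth_powser:
  assumes "\<And>y. summable (\<lambda>n. c n * y ^ n)"
  shows "smooth_on UNIV (\<lambda>x::real. \<Sum>n. c n * x ^ n)"
proof (rule smooth_on_real_family[of UNIV "{c. \<forall>y. summable (\<lambda>n. c n * y ^ n)}" "\<lambda>c x. \<Sum>n. c n * x ^ n"])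
  fix c :: "nat \<Rightarrow> real" assume "c \<in> {c. \<forall>y. summable (\<lambda>n. c n * y ^ n)}"
  then have c: "summable (\<lambda>n. c n * y ^ n)" for y by auto
  show "\<exists>f'. (\<forall>x\<in>UNIV. ((\<lambda>x. \<Sum>n. c n * x ^ n) has_real_derivative f' x) (at x)) \<and>
      (\<forall>k. (\<forall>i\<in>{c. \<forall>y. summable (\<lambda>n. c n * y ^ n)}. Ck_on k UNIV (\<lambda>x. \<Sum>n. i n * x ^ n)) \<longrightarrow> Ck_on k UNIV f')"
  proof (intro exI[of _ "\<lambda>x. \<Sum>n. diffs c n * x ^ n"] conjI ballI allI impI)
    show "((\<lambda>x. \<Sum>n. c n * x ^ n) has_real_derivative (\<Sum>n. diffs c n * x ^ n)) (at x)" for x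
      by (rule termdiffs_strong_converges_everywhere[OF c])
    fix k assume "\<forall>i\<in>{c. \<forall>y. summable (\<lambda>n. c n * y ^ n)}. Ck_on k UNIV (\<lambda>x::real. \<Sum>n. i n * x ^ n)"
    then show "Ck_on k UNIV (\<lambda>x. \<Sum>n. diffs c n * x ^ n)"
      by (rule bspec) (use termdiff_converges_all[OF c] in simp)
  qed
qed (use assms in auto)

text \<open>In terms of the Bessel function, \<open>B(q) = J\<^sub>0(M \<surd>q)\<close>.\<close>

lemma bessel_kernel:
  fixes M :: real
  obtains B B1 B2 :: "real \<Rightarrow> real" where "smooth_on UNIV B" "smooth_on UNIV B1" "smooth_on UNIV B2"
    "\<And>x. (B has_real_derivative B1 x) (at x)" "\<And>x. (B1 has_real_derivative B2 x) (at x)"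
    "\<And>x. x * B2 x + B1 x + M\<^sup>2 / 4 * B x = 0" "B 0 = 1"
proof -
  define a where "a = M\<^sup>2 / 4"
  \<comment> \<open>In terms of coefficients the equation x B'' + B' + a B = 0 is the recursion (n +
    1)^2 c(n + 1) = - a c(n), started at c 0 = 1.\<close>
  define c where "c n = (- a) ^ n / (fact n)\<^sup>2" for n :: nat
  have c: "summable (\<lambda>n. c n * y ^ n)" for y
  proof (rule summable_comparison_test)
    show "summable (\<lambda>n. (\<bar>a\<bar> * \<bar>y\<bar>) ^ n /\<^sub>R fact n)" by (rule summable_exp_generic)
    have "norm (c n * y ^ n) \<le> (\<bar>a\<bar> * \<bar>y\<bar>) ^ n /\<^sub>R fact n" for n
    proof -
      have "norm (c n * y ^ n) = (\<bar>a\<bar> * \<bar>y\<bar>) ^ n / (fact n)\<^sup>2"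
        by (simp add: c_def abs_mult power_abs power_mult_distrib)
      also have "\<dots> \<le> (\<bar>a\<bar> * \<bar>y\<bar>) ^ n / fact n"
        by (rule divide_left_mono) (auto simp: self_le_power fact_ge_1)
      finally show ?thesis by (simp add: divide_inverse mult.commute)
    qed
    then show "\<exists>N. \<forall>n\<ge>N. norm (c n * y ^ n) \<le> (\<bar>a\<bar> * \<bar>y\<bar>) ^ n /\<^sub>R fact n" by blast
  qed
  have c1: "summable (\<lambda>n. diffs c n * y ^ n)" for y by (rule termdiff_converges_all[OF c])
  have c2: "summable (\<lambda>n. diffs (diffs c) n * y ^ n)" for y by (rule termdiff_converges_all[OF c1])
  have ode: "x * (\<Sum>n. diffs (diffs c) n * x ^ n) + (\<Sum>n. diffs c n * x ^ n) + a * (\<Sum>n. c n * x ^ n) = 0" for x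
  proof -
    have "(\<lambda>n. x * (real n * diffs c n * x ^ (n - Suc 0))) sums (x * (\<Sum>n. diffs (diffs c) n * x ^ n))"
      by (rule sums_mult[OF diffs_equiv[OF c2]])
    moreover have "x * (real n * diffs c n * x ^ (n - Suc 0)) = real n * diffs c n * x ^ n" for n by (cases n) auto
    ultimately have "(\<lambda>n. real n * diffs c n * x ^ n) sums (x * (\<Sum>n. diffs (diffs c) n * x ^ n))" by simp
    then have "(\<lambda>n. real n * diffs c n * x ^ n + diffs c n * x ^ n + a * (c n * x ^ n)) sums
       (x * (\<Sum>n. diffs (diffs c) n * x ^ n) + (\<Sum>n. diffs c n * x ^ n) + a * (\<Sum>n. c n * x ^ n))"
      by (intro sums_add sums_mult summable_sums c c1)
    moreover have "real n * diffs c n * x ^ n + diffs c n * x ^ n + a * (c n * x ^ n) = 0" for n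
    proof -
      have "c (Suc n) * (real n + 1)\<^sup>2 = - a * c n"
      proof -
        have gen: "- a * p / (x * f)\<^sup>2 * x\<^sup>2 = - a * (p / f\<^sup>2)" if "x \<noteq> 0" for p x f :: real
          using that by (simp add: power_mult_distrib)
        have f: "fact (Suc n) = (real n + 1) * fact n" by (simp add: algebra_simps)
        show ?thesis unfolding c_def power_Suc f by (rule gen) simp
      qed
      then have "(real n + 1) * diffs c n + a * c n = 0"
        by (simp add: diffs_def power2_eq_square algebra_simps)
      then have "((real n + 1) * diffs c n + a * c n) * x ^ n = 0" by simp
      then show ?thesis by (simp add: algebra_simps)
    qed
    ultimately show ?thesis using sums_unique by fastforce
  qed
  show thesis
  proof (rule that)
    show "smooth_on UNIV (\<lambda>x. \<Sum>n. c n * x ^ n)" by (rule smooth_powser[OF c])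
    show "smooth_on UNIV (\<lambda>x. \<Sum>n. diffs c n * x ^ n)" by (rule smooth_powser[OF c1])
    show "smooth_on UNIV (\<lambda>x. \<Sum>n. diffs (diffs c) n * x ^ n)" by (rule smooth_powser[OF c2])
    show "((\<lambda>x. \<Sum>n. c n * x ^ n) has_real_derivative (\<Sum>n. diffs c n * x ^ n)) (at x)" for x
      by (rule termdiffs_strong_converges_everywhere[OF c])
    show "((\<lambda>x. \<Sum>n. diffs c n * x ^ n) has_real_derivative (\<Sum>n. diffs (diffs c) n * x ^ n)) (at x)" for x
      by (rule termdiffs_strong_converges_everywhere[OF c1])
    show "x * (\<Sum>n. diffs (diffs c) n * x ^ n) + (\<Sum>n. diffs c n * x ^ n) + M\<^sup>2 / 4 * (\<Sum>n. c n * x ^ n) = 0" for x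
      using ode[of x] by (simp add: a_def)
    show "(\<Sum>n. c n * 0 ^ n) = 1" using powser_zero[of c] by (simp add: c_def)
  qed
qed

text \<open>The equation of \<open>radial_wave\<close> with \<open>\<nu> = m + 2\<close>. It is an ordinary Klein-Gordon equation for \<open>\<nu> = 0\<close>, and
  \<open>D\<close> maps solutions for \<open>\<nu>\<close> to solutions for \<open>\<nu> + 2\<close>.\<close>

definition pde_sol :: "real \<Rightarrow> real \<Rightarrow> (real \<times> real \<Rightarrow> real) \<Rightarrow> bool" where
  "pde_sol \<nu> M \<phi> \<longleftrightarrow> even_smooth \<phi> \<and>
     (\<forall>t s. dt (dt \<phi>) (t, s) = (sinh s)\<^sup>2 * sinh_deriv (sinh_deriv \<phi>) (t, s) + (\<nu> + 1) * cosh s * sinh_deriv \<phi> (t, s) + (\<nu>\<^sup>2 / 4 - M\<^sup>2) * \<phi> (t, s)) \<and>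
     (\<forall>t s. s > \<bar>t\<bar> + 1 \<longrightarrow> \<phi> (t, s) = 0)"

section \<open>The Klein-Gordon equation on the line\<close>

lemma smooth_deriv1:
  assumes "smooth_on UNIV (f :: real \<Rightarrow> real)"
  obtains f' where "smooth_on UNIV f'" "\<And>x. (f has_real_derivative f' x) (at x)"
proof (rule that)
  show "smooth_on UNIV (pd 1 f)" by (rule smooth_on_pd[OF assms])
  fix x :: real
  have d: "f differentiable (at x)" by (rule smooth_on_differentiable[OF assms]) simp
  have "(\<lambda>v. pd v f x) = (*) (pd 1 f x)"
  proof
    fix v :: real
    show "pd v f x = pd 1 f x * v" using pd_scaleR[OF d, of v 1] by simp
  qed
  then show "(f has_real_derivative pd 1 f x) (at x)"
    unfolding has_field_derivative_def by (rule has_derivative_eq_rhs[OF differentiable_has_pd[OF d]])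
qed

text \<open>The classical solution with initial value 0 and initial velocity 2 \<open>bump\<close>
  is the integral of B (t^2 - r^2) bump (s + r) over r from -t to t. The substitution r = t \<xi>
  fixes the limits, so that smoothness in t follows by differentiating under the integral.\<close>

lemma klein_gordon_line:
  fixes M :: real
  obtains w where "pde_sol 0 M w" "\<And>s. dt w (0, s) = 2 * bump s"
proof -
  obtain B B1 B2 where B0: "smooth_on UNIV B" "smooth_on UNIV B1" "smooth_on UNIV B2" and B:
    "\<And>x. (B has_real_derivative B1 x) (at x)" "\<And>x. (B1 has_real_derivative B2 x) (at x)"
    "\<And>x. x * B2 x + B1 x + M\<^sup>2 / 4 * B x = 0" "B 0 = 1"
    using bessel_kernel by blast
  obtain g1 where g1: "smooth_on UNIV g1" "\<And>x. (bump has_real_derivative g1 x) (at x)"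
    using smooth_deriv1[OF smooth_bump] by blast
  obtain g2 where g2: "smooth_on UNIV g2" "\<And>x. (g1 has_real_derivative g2 x) (at x)"
    using smooth_deriv1[OF g1(1)] by blast
  define F where "F t s \<xi> = t * B (t\<^sup>2 * (1 - \<xi>\<^sup>2)) * bump (s + t * \<xi>)" for t s \<xi>
  define F1 where "F1 t s \<xi> = B (t\<^sup>2 * (1 - \<xi>\<^sup>2)) * bump (s + t * \<xi>) + 2 * t\<^sup>2 * (1 - \<xi>\<^sup>2) * B1 (t\<^sup>2 * (1 - \<xi>\<^sup>2)) * bump (s + t * \<xi>)
     + t * \<xi> * B (t\<^sup>2 * (1 - \<xi>\<^sup>2)) * g1 (s + t * \<xi>)" for t s \<xi>
  define Fs where "Fs t s \<xi> = t * B (t\<^sup>2 * (1 - \<xi>\<^sup>2)) * g1 (s + t * \<xi>)" for t s \<xi>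
  define Fss where "Fss t s \<xi> = t * B (t\<^sup>2 * (1 - \<xi>\<^sup>2)) * g2 (s + t * \<xi>)" for t s \<xi>
  define w where "w x = integral {-1..1} (F (fst x) (snd x))" for x
  note c1 = smooth_on_compose1[OF B0(1)] smooth_on_compose1[OF B0(2)] smooth_on_compose1[OF B0(3)] smooth_on_compose1[OF smooth_bump]
    smooth_on_compose1[OF g1(1)] smooth_on_compose1[OF g2(1)]
  have "smooth_on (UNIV \<times> UNIV) (\<lambda>y::(real \<times> real) \<times> real. F (fst (fst y)) (snd (fst y)) (snd y))"
    unfolding F_def by (intro c1 smooth_intros open_Times open_UNIV)
  from smooth_on_integral[OF open_UNIV this, of "-1" 1]
  have sw: "smooth_on UNIV w" by (simp add: w_def[abs_def])
  have par: "((\<lambda>t. integral {-1..1} (G t)) has_real_derivative integral {-1..1} (G' t)) (at t)"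
    if "smooth_on UNIV (\<lambda>x::real \<times> real. G (fst x) (snd x))" "\<And>t \<xi>. ((\<lambda>t. G t \<xi>) has_real_derivative G' t \<xi>) (at t)" for G G' t
  proof -
    have "dt (\<lambda>x::real \<times> real. G (fst x) (snd x)) (t, \<xi>) = G' t \<xi>" for \<xi>
      by (rule plane_pd_eq(1)[OF that(1)]) (use that(2) in auto)
    then show ?thesis using deriv_integral_param[OF that(1), of "-1" 1 t] by simp
  qed
  define F2 where "F2 t s \<xi> = (let q = t\<^sup>2 * (1 - \<xi>\<^sup>2); x = s + t * \<xi>; p = 2 * t * (1 - \<xi>\<^sup>2) in
       B1 q * p * bump x + B q * \<xi> * g1 x
     + (4 * t * (1 - \<xi>\<^sup>2) * B1 q + 2 * t\<^sup>2 * (1 - \<xi>\<^sup>2) * (B2 q * p)) * bump x + 2 * t\<^sup>2 * (1 - \<xi>\<^sup>2) * B1 q * (\<xi> * g1 x)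
     + (\<xi> * B q + t * \<xi> * (B1 q * p)) * g1 x + t * \<xi> * B q * (\<xi> * g2 x))" for t s \<xi>
  have dF: "((\<lambda>t. F t s \<xi>) has_real_derivative F1 t s \<xi>) (at t)" for t s \<xi>
    unfolding F_def F1_def
    by (auto intro!: derivative_eq_intros DERIV_chain2[OF B(1)] DERIV_chain2[OF g1(2)] simp: algebra_simps power2_eq_square)
  have dF1: "((\<lambda>t. F1 t s \<xi>) has_real_derivative F2 t s \<xi>) (at t)" for t s \<xi>
    unfolding F1_def F2_def Let_def
    by (auto intro!: derivative_eq_intros DERIV_chain2[OF B(1)] DERIV_chain2[OF B(2)] DERIV_chain2[OF g1(2)] DERIV_chain2[OF g2(2)]
        simp: algebra_simps power2_eq_square)
  have dFs: "((\<lambda>s. F t s \<xi>) has_real_derivative Fs t s \<xi>) (at s)" for t s \<xi>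
    unfolding F_def Fs_def by (auto intro!: derivative_eq_intros DERIV_chain2[OF g1(2)])
  have dFss: "((\<lambda>s. Fs t s \<xi>) has_real_derivative Fss t s \<xi>) (at s)" for t s \<xi>
    unfolding Fs_def Fss_def by (auto intro!: derivative_eq_intros DERIV_chain2[OF g2(2)])
  have w1: "dt w (t, s) = integral {-1..1} (F1 t s)" for t s
  proof (rule plane_pd_eq(1)[OF sw])
    have "smooth_on UNIV (\<lambda>x::real \<times> real. F (fst x) s (snd x))"
      unfolding F_def by (intro c1 smooth_intros open_UNIV)
    from par[where G="\<lambda>t \<xi>. F t s \<xi>" and G'="\<lambda>t \<xi>. F1 t s \<xi>", OF this dF]
    show "((\<lambda>t. w (t, s)) has_real_derivative integral {-1..1} (F1 t s)) (at t)" by (simp add: w_def)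
  qed simp
  have w2: "dt (dt w) (t, s) = integral {-1..1} (F2 t s)" for t s
  proof (rule plane_pd_eq(1)[OF smooth_on_pd[OF sw]])
    have "smooth_on UNIV (\<lambda>x::real \<times> real. F1 (fst x) s (snd x))"
      unfolding F1_def by (intro c1 smooth_intros open_UNIV)
    from par[where G="\<lambda>t \<xi>. F1 t s \<xi>" and G'="\<lambda>t \<xi>. F2 t s \<xi>", OF this dF1]
    show "((\<lambda>t. dt w (t, s)) has_real_derivative integral {-1..1} (F2 t s)) (at t)" by (simp add: w1)
  qed simp
  have ws: "ds w (t, s) = integral {-1..1} (Fs t s)" for t s
  proof (rule plane_pd_eq(2)[OF sw])
    have "smooth_on UNIV (\<lambda>x::real \<times> real. F t (fst x) (snd x))"
      unfolding F_def by (intro c1 smooth_intros open_UNIV)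
    from par[where G="\<lambda>s \<xi>. F t s \<xi>" and G'="\<lambda>s \<xi>. Fs t s \<xi>", OF this dFs]
    show "((\<lambda>s. w (t, s)) has_real_derivative integral {-1..1} (Fs t s)) (at s)" by (simp add: w_def)
  qed simp
  have wss: "ds (ds w) (t, s) = integral {-1..1} (Fss t s)" for t s
  proof (rule plane_pd_eq(2)[OF smooth_on_pd[OF sw]])
    have "smooth_on UNIV (\<lambda>x::real \<times> real. Fs t (fst x) (snd x))"
      unfolding Fs_def by (intro c1 smooth_intros open_UNIV)
    from par[where G="\<lambda>s \<xi>. Fs t s \<xi>" and G'="\<lambda>s \<xi>. Fss t s \<xi>", OF this dFss]
    show "((\<lambda>s. ds w (t, s)) has_real_derivative integral {-1..1} (Fss t s)) (at s)" by (simp add: ws)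
  qed simp
  have kg: "dt (dt w) (t, s) = ds (ds w) (t, s) - M\<^sup>2 * w (t, s)" for t s
  proof -
    \<comment> \<open>The Klein-Gordon operator applied to the integrand F is the \<xi>-derivative
      of H, by the Bessel equation \<open>B(3)\<close>. The factor 1 - \<xi>^2 makes H vanish at
      both ends.\<close>
    define H where "H \<xi> = (1 - \<xi>\<^sup>2) * (2 * t * \<xi> * B1 (t\<^sup>2 * (1 - \<xi>\<^sup>2)) * bump (s + t * \<xi>) - B (t\<^sup>2 * (1 - \<xi>\<^sup>2)) * g1 (s + t * \<xi>))" for \<xi>
    have H: "(H has_real_derivative F2 t s \<xi> - Fss t s \<xi> + M\<^sup>2 * F t s \<xi>) (at \<xi>)" for \<xi>
    proof -
      define q x where "q = t\<^sup>2 * (1 - \<xi>\<^sup>2)" and "x = s + t * \<xi>"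
      define H' where "H' = - 2 * \<xi> * (2 * t * \<xi> * B1 q * bump x - B q * g1 x)
         + (1 - \<xi>\<^sup>2) * ((2 * t * B1 q + 2 * t * \<xi> * (B2 q * (- 2 * t\<^sup>2 * \<xi>))) * bump x + 2 * t * \<xi> * B1 q * (g1 x * t)
            - ((B1 q * (- 2 * t\<^sup>2 * \<xi>)) * g1 x + B q * (g2 x * t)))"
      have "(H has_real_derivative H') (at \<xi>)"
        unfolding H_def H'_def q_def x_def
        by (auto intro!: derivative_eq_intros DERIV_chain2[OF B(1)] DERIV_chain2[OF B(2)] DERIV_chain2[OF g1(2)] DERIV_chain2[OF g2(2)]
            simp: algebra_simps power2_eq_square)
      moreover have "F2 t s \<xi> - Fss t s \<xi> + M\<^sup>2 * F t s \<xi> - H' = 4 * t * bump x * (q * B2 q + B1 q + M\<^sup>2 / 4 * B q)"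
        unfolding F2_def Fss_def F_def H'_def Let_def q_def[symmetric] x_def[symmetric]
        by (simp add: q_def algebra_simps power2_eq_square)
      ultimately show ?thesis using B(3)[of q] by simp
    qed
    have "((\<lambda>\<xi>. F2 t s \<xi> - Fss t s \<xi> + M\<^sup>2 * F t s \<xi>) has_integral H 1 - H (-1)) {-1..1}"
      by (rule fundamental_theorem_of_calculus)
        (use H in \<open>auto simp: has_real_derivative_iff_has_vector_derivative[symmetric] intro: has_field_derivative_at_within\<close>)
    then have "integral {-1..1} (\<lambda>\<xi>. F2 t s \<xi> - Fss t s \<xi> + M\<^sup>2 * F t s \<xi>) = 0"
      by (simp add: integral_unique H_def)
    moreover have "integral {-1..1} (\<lambda>\<xi>. F2 t s \<xi> - Fss t s \<xi> + M\<^sup>2 * F t s \<xi>) =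
       integral {-1..1} (F2 t s) - integral {-1..1} (Fss t s) + M\<^sup>2 * integral {-1..1} (F t s)"
    proof -
      have int: "f integrable_on {-1..1}" if "smooth_on UNIV f" for f :: "real \<Rightarrow> real"
        by (rule integrable_continuous_interval[OF continuous_on_subset[OF smooth_on_continuous[OF that]]]) simp
      have i: "F2 t s integrable_on {-1..1}" "Fss t s integrable_on {-1..1}" "F t s integrable_on {-1..1}"
        unfolding F2_def Fss_def F_def Let_def by (intro int c1 g2(1)[THEN smooth_on_compose1] smooth_intros open_UNIV)+
      show ?thesis
        by (intro integral_unique has_integral_add has_integral_diff has_integral_mult_right integrable_integral i)
    qed
    ultimately show ?thesis by (simp add: w2 wss w_def)
  qed
  have even_smooth: "even_smooth w"
  proof -
    have "w (t, - s) = w (t, s)" for t s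
    proof -
      have "F t (- s) (- \<xi>) = F t s \<xi>" for \<xi>
        using bump_props(1)[of "s + t * \<xi>"] by (simp add: F_def)
      moreover have "integral {-1..1} (F t (- s)) = integral {-1..- (- 1)} (\<lambda>\<xi>. F t (- s) (- \<xi>))"
        by (rule Henstock_Kurzweil_Integration.integral_reflect_real[symmetric])
      ultimately show ?thesis by (simp add: w_def)
    qed
    with sw show ?thesis by (simp add: even_smooth_def)
  qed
  have "ds (ds w) (t, s) = cosh s * sinh_deriv w (t, s) + sinh s * (sinh s * sinh_deriv (sinh_deriv w) (t, s))" for t s
  proof (rule plane_pd_eq(2)[OF smooth_on_pd[OF sw]])
    show "((\<lambda>s. ds w (t, s)) has_real_derivative cosh s * sinh_deriv w (t, s) + sinh s * (sinh s * sinh_deriv (sinh_deriv w) (t, s))) (at s)"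
      unfolding ds_eq_sinh_sinh_deriv[OF even_smooth]
      by (auto intro!: derivative_eq_intros even_smooth_deriv even_smooth_sinh_deriv even_smooth)
  qed simp
  moreover have "w (t, s) = 0" if "s > \<bar>t\<bar> + 1" for t s
  proof -
    have "F t s \<xi> = 0" if "\<xi> \<in> {-1..1}" for \<xi>
    proof -
      have "\<bar>t * \<xi>\<bar> \<le> \<bar>t\<bar>" using that by (auto simp: abs_mult intro!: mult_left_le)
      then show ?thesis using \<open>s > \<bar>t\<bar> + 1\<close> by (simp add: F_def bump_props(4))
    qed
    then have "(F t s has_integral 0) {-1..1}" by (intro has_integral_is_0) simp
    then show ?thesis by (simp add: w_def integral_unique)
  qed
  ultimately have "pde_sol 0 M w"
    using even_smooth kg by (simp add: pde_sol_def power2_eq_square)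
  moreover have "dt w (0, s) = 2 * bump s" for s
    by (simp add: w1 F1_def[abs_def] B(4))
  ultimately show thesis by (rule that)
qed

section \<open>Raising the dimension by two\<close>

lemma even_smooth_vanish_boundary:
  assumes "even_smooth \<phi>" "\<And>s. s > c \<Longrightarrow> \<phi> (t, s) = 0"
  shows "\<phi> (t, c) = 0"
proof (rule tendsto_unique[of "at_right c"])
  have "isCont (\<lambda>s. \<phi> (t, s)) c" using even_smooth_deriv(1)[OF assms(1)] DERIV_isCont by blast
  then show "((\<lambda>s. \<phi> (t, s)) \<longlongrightarrow> \<phi> (t, c)) (at_right c)"
    by (auto simp: isCont_def filterlim_at_split)
  show "((\<lambda>s. \<phi> (t, s)) \<longlongrightarrow> 0) (at_right c)"
    by (rule tendsto_eventually) (auto simp: assms(2) eventually_at_filter)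
qed simp

lemma sinh_deriv_vanish:
  assumes "even_smooth \<phi>" "open A" "s \<in> A" "\<And>s. s \<in> A \<Longrightarrow> \<phi> (t, s) = 0" "s \<noteq> 0"
  shows "sinh_deriv \<phi> (t, s) = 0"
proof -
  have "((\<lambda>s. \<phi> (t, s)) has_real_derivative 0) (at s)"
    by (rule DERIV_locally_zero[OF assms(2,3,4)])
  then have "sinh s * sinh_deriv \<phi> (t, s) = 0" by (rule DERIV_unique[OF even_smooth_deriv(1)[OF assms(1)]])
  then show ?thesis using assms(5) by simp
qed

text \<open>Apply D to the equation. Since D cosh = 1 and D (sinh^2) = 2 cosh, the coefficient \<nu>
  + 1 becomes \<nu> + 3 and the constant gains \<nu> + 1. As \<nu>^2 / 4 + \<nu> + 1 = (\<nu> + 2)^2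
  / 4, the mass is unchanged.\<close>

lemma pde_sol_sinh_deriv:
  assumes "pde_sol \<nu> M \<phi>"
  shows "pde_sol (\<nu> + 2) M (sinh_deriv \<phi>)"
proof -
  have es: "even_smooth \<phi>" and supp: "s > \<bar>t\<bar> + 1 \<Longrightarrow> \<phi> (t, s) = 0"
    and pde: "dt (dt \<phi>) (t, s) = (sinh s)\<^sup>2 * sinh_deriv (sinh_deriv \<phi>) (t, s) + (\<nu> + 1) * cosh s * sinh_deriv \<phi> (t, s) + (\<nu>\<^sup>2 / 4 - M\<^sup>2) * \<phi> (t, s)" for t s
    using assms by (auto simp: pde_sol_def)
  note es2 = even_smooth_sinh_deriv[OF es] and es3 = even_smooth_sinh_deriv[OF even_smooth_sinh_deriv[OF es]] and es4 = even_smooth_sinh_deriv[OF even_smooth_sinh_deriv[OF even_smooth_sinh_deriv[OF es]]]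
  define c where "c = \<nu>\<^sup>2 / 4 - M\<^sup>2"
  define \<psi> where "\<psi> x = (sinh (snd x))\<^sup>2 * sinh_deriv (sinh_deriv (sinh_deriv \<phi>)) x + (\<nu> + 3) * cosh (snd x) * sinh_deriv (sinh_deriv \<phi>) x + (c + \<nu> + 1) * sinh_deriv \<phi> x" for x
  have "sinh_deriv (dt (dt \<phi>)) (t, s) = \<psi> (t, s)" for t s
  proof (rule sinh_deriv_unique[OF even_smooth_dt[OF even_smooth_dt[OF es]]])
    show "continuous_on UNIV \<psi>"
      unfolding \<psi>_def[abs_def]
      by (rule smooth_on_continuous) (intro smooth_intros open_UNIV even_smooth_smooth es2 es3 es4)
    fix t s :: real
    have "((\<lambda>s. dt (dt \<phi>) (t, s)) has_real_derivative sinh s * \<psi> (t, s)) (at s)"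
      unfolding pde c_def[symmetric] \<psi>_def snd_conv
      by (auto intro!: derivative_eq_intros even_smooth_deriv(1) es es2 es3 es4 simp: algebra_simps power2_eq_square)
    then show "ds (dt (dt \<phi>)) (t, s) = sinh s * \<psi> (t, s)"
      by (rule plane_pd_eq(2)[OF smooth_on_pd[OF smooth_on_pd[OF even_smooth_smooth[OF es]]], rotated]) simp
  qed
  moreover have "sinh_deriv (dt (dt \<phi>)) (t, s) = dt (dt (sinh_deriv \<phi>)) (t, s)" for t s
  proof -
    have "sinh_deriv (dt \<phi>) = dt (sinh_deriv \<phi>)" using sinh_deriv_dt[OF es] by (auto simp: fun_eq_iff)
    then show ?thesis using sinh_deriv_dt[OF even_smooth_dt[OF es], of t s] by simp
  qed
  moreover have "sinh_deriv \<phi> (t, s) = 0" if "s > \<bar>t\<bar> + 1" for t s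
    by (rule sinh_deriv_vanish[OF es, of "{\<bar>t\<bar> + 1<..}"]) (use that supp in auto)
  ultimately show ?thesis
    using es2 by (simp add: pde_sol_def \<psi>_def c_def power2_eq_square field_simps)
qed

text \<open>If D \<phi> = 0 then \<phi> is constant in s, and it vanishes beyond the light cone.
  Hence iterating D never destroys a nonzero solution.\<close>

lemma sinh_deriv_zero_imp_zero:
  assumes "pde_sol \<nu> M \<phi>" "\<And>t s. sinh_deriv \<phi> (t, s) = 0"
  shows "\<phi> (t, s) = 0"
proof -
  have es: "even_smooth \<phi>" and supp: "s > \<bar>t\<bar> + 1 \<Longrightarrow> \<phi> (t, s) = 0" for t s
    using assms by (auto simp: pde_sol_def)
  have "\<phi> (t, s) = \<phi> (t, \<bar>t\<bar> + 2)"
    using DERIV_isconst_all[of "\<lambda>s. \<phi> (t, s)"] even_smooth_deriv(1)[OF es] assms(2) by simp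
  then show ?thesis using supp by simp
qed

lemma pde_sol_iterate:
  assumes "pde_sol \<nu> M \<phi>" "\<phi> x \<noteq> 0"
  shows "\<exists>\<phi> x. pde_sol (\<nu> + 2 * real j) M \<phi> \<and> \<phi> x \<noteq> 0"
proof (induction j)
  case 0
  show ?case by (rule exI[of _ \<phi>], rule exI[of _ x]) (use assms in simp)
next
  case (Suc j)
  then obtain \<phi> t s where \<phi>: "pde_sol (\<nu> + 2 * real j) M \<phi>" "\<phi> (t, s) \<noteq> 0" by auto
  obtain t' s' where "sinh_deriv \<phi> (t', s') \<noteq> 0" using sinh_deriv_zero_imp_zero[OF \<phi>(1)] \<phi>(2) by blast
  with pde_sol_sinh_deriv[OF \<phi>(1)] show ?case by (auto simp: algebra_simps)
qed

text \<open>Hadamard's method of descent: integration over the extra coordinate lowers the dimension parameter by one.\<close>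

definition descent :: "(real \<times> real \<Rightarrow> real) \<Rightarrow> real \<times> real \<Rightarrow> real" where
  "descent \<phi> x = integral UNIV (\<lambda>\<rho>. \<phi> (fst x, arcosh (cosh (snd x) + \<rho>\<^sup>2)))"

definition supported :: "(real \<times> real \<Rightarrow> real) \<Rightarrow> bool" where
  "supported \<phi> \<longleftrightarrow> even_smooth \<phi> \<and> (\<forall>t s. s > \<bar>t\<bar> + 1 \<longrightarrow> \<phi> (t, s) = 0)"

text \<open>Outside [-A, A] one has \<rho>^2 >= A^2 >= A because A >= 1, and this puts the argument
  of \<phi> beyond the light cone.\<close>

lemma descent_eq:
  assumes "supported \<phi>" "A \<ge> cosh (\<bar>t\<bar> + 1)"
  shows "descent \<phi> (t, s) = integral {-A..A} (\<lambda>\<rho>. \<phi> (t, arcosh (cosh s + \<rho>\<^sup>2)))"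
proof -
  have "\<phi> (t, arcosh (cosh s + \<rho>\<^sup>2)) = 0" if "\<rho> \<notin> {-A..A}" for \<rho>
  proof -
    have A1: "A \<ge> 1" using assms(2) cosh_real_ge_1 order_trans by blast
    have "A * 1 \<le> A * A" using A1 by (intro mult_left_mono) auto
    also have "A * A \<le> \<bar>\<rho>\<bar> * \<bar>\<rho>\<bar>" using that A1 by (intro mult_mono) auto
    finally have "cosh (\<bar>t\<bar> + 1) < cosh s + \<rho>\<^sup>2"
      using assms(2) cosh_real_ge_1[of s] by (simp add: power2_eq_square)
    then have "arcosh (cosh (\<bar>t\<bar> + 1)) < arcosh (cosh s + \<rho>\<^sup>2)"
      by (intro arcosh_real_strict_mono) (auto simp: cosh_real_ge_1)
    then have "\<bar>t\<bar> + 1 < arcosh (cosh s + \<rho>\<^sup>2)" by (simp add: arcosh_cosh_real)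
    then show ?thesis using assms(1) by (simp add: supported_def)
  qed
  then have eq: "(\<lambda>\<rho>. if \<rho> \<in> {-A..A} then \<phi> (t, arcosh (cosh s + \<rho>\<^sup>2)) else 0) = (\<lambda>\<rho>. \<phi> (t, arcosh (cosh s + \<rho>\<^sup>2)))"
    by (intro ext) simp
  have "descent \<phi> (t, s) = integral UNIV (\<lambda>\<rho>. if \<rho> \<in> {-A..A} then \<phi> (t, arcosh (cosh s + \<rho>\<^sup>2)) else 0)"
    by (simp only: descent_def eq fst_conv snd_conv)
  then show ?thesis by (simp only: integral_restrict_UNIV)
qed

lemma cosh_plus_ge_1: "cosh (s::real) + \<rho>\<^sup>2 \<ge> 1"
  using cosh_real_ge_1[of s] zero_le_power2[of \<rho>] by linarith

lemma descent_integrand_smooth: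
  assumes "even_smooth \<phi>"
  shows "smooth_on UNIV (\<lambda>y::(real \<times> real) \<times> real. \<phi> (fst (fst y), arcosh (cosh (snd (fst y)) + (snd y)\<^sup>2)))"
  by (rule smooth_on_even_smooth_arcosh[OF assms open_UNIV]) (intro smooth_intros open_UNIV, intro smooth_intros open_UNIV, rule cosh_plus_ge_1)

text \<open>On a slab |t| < T a single \<rho>-interval serves all t, so
  \<open>smooth_on_integral\<close> applies there; the slabs are then glued.\<close>

lemma descent_smooth:
  assumes "supported \<phi>"
  shows "smooth_on UNIV (descent \<phi>)"
proof -
  have es: "even_smooth \<phi>" using assms by (simp add: supported_def)
  have op: "open {x::real \<times> real. \<bar>fst x\<bar> < T}" for T by (intro open_Collect_less continuous_intros)
  have "smooth_on {x. \<bar>fst x\<bar> < T} (descent \<phi>)" for T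
  proof (rule smooth_on_cong[OF op])
    let ?A = "cosh (T + 1)"
    show "smooth_on {x. \<bar>fst x\<bar> < T} (\<lambda>x. integral {-?A..?A} (\<lambda>\<rho>. \<phi> (fst x, arcosh (cosh (snd x) + \<rho>\<^sup>2))))"
      using smooth_on_integral[OF op smooth_on_subset[OF descent_integrand_smooth[OF es]], of T "-?A" ?A] by simp
    fix x :: "real \<times> real" assume "x \<in> {x. \<bar>fst x\<bar> < T}"
    then have "cosh (\<bar>fst x\<bar> + 1) \<le> ?A" by (subst cosh_real_nonneg_le_iff) auto
    from descent_eq[OF assms this, of "snd x"]
    show "integral {-?A..?A} (\<lambda>\<rho>. \<phi> (fst x, arcosh (cosh (snd x) + \<rho>\<^sup>2))) = descent \<phi> x" by simp
  qed
  then have "smooth_on (\<Union>T\<in>UNIV. {x. \<bar>fst x\<bar> < T}) (descent \<phi>)" by (intro smooth_on_UN op)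
  moreover have "(\<Union>T\<in>UNIV. {x::real \<times> real. \<bar>fst x\<bar> < T}) = UNIV" by (auto intro: gt_ex)
  ultimately show ?thesis by simp
qed

lemma descent_even_smooth: "supported \<phi> \<Longrightarrow> even_smooth (descent \<phi>)"
  using descent_smooth by (simp add: even_smooth_def descent_def)

lemma supported_dt: "supported \<phi> \<Longrightarrow> supported (dt \<phi>)"
  unfolding supported_def
proof (intro conjI allI impI)
  assume a: "even_smooth \<phi> \<and> (\<forall>t s. s > \<bar>t\<bar> + 1 \<longrightarrow> \<phi> (t, s) = 0)"
  then show "even_smooth (dt \<phi>)" by (simp add: even_smooth_dt)
  fix t s :: real assume s: "s > \<bar>t\<bar> + 1"
  have "((\<lambda>t. \<phi> (t, s)) has_real_derivative 0) (at t)"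
    by (rule DERIV_locally_zero[of "{- (s - 1)<..<s - 1}"]) (use s a in auto)
  then show "dt \<phi> (t, s) = 0" by (rule plane_pd_eq(1)[OF even_smooth_smooth, rotated 2]) (use a in auto)
qed

lemma supported_sinh_deriv: assumes "supported \<phi>" shows "supported (sinh_deriv \<phi>)"
proof -
  have "sinh_deriv \<phi> (t, s) = 0" if "s > \<bar>t\<bar> + 1" for t s
    by (rule sinh_deriv_vanish[of \<phi> "{\<bar>t\<bar> + 1<..}"]) (use that assms in \<open>auto simp: supported_def\<close>)
  then show ?thesis using assms by (simp add: supported_def even_smooth_sinh_deriv)
qed

lemma descent_dt:
  assumes "supported \<phi>"
  shows "dt (descent \<phi>) (t, s) = descent (dt \<phi>) (t, s)"
proof (rule plane_pd_eq(1)[OF descent_smooth[OF assms]])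
  have es: "even_smooth \<phi>" using assms by (simp add: supported_def)
  let ?A = "cosh (\<bar>t\<bar> + 1 + 1)" let ?G = "\<lambda>x::real \<times> real. \<phi> (fst x, arcosh (cosh s + (snd x)\<^sup>2))"
  have sm: "smooth_on UNIV ?G"
    by (rule smooth_on_even_smooth_arcosh[OF es open_UNIV]) (intro smooth_intros open_UNIV, intro smooth_intros open_UNIV, rule cosh_plus_ge_1)
  have "((\<lambda>t. integral {-?A..?A} (\<lambda>\<rho>. ?G (t, \<rho>))) has_real_derivative integral {-?A..?A} (\<lambda>\<rho>. dt ?G (t, \<rho>))) (at t)"
    by (rule deriv_integral_param[OF sm])
  also have "integral {-?A..?A} (\<lambda>\<rho>. dt ?G (t, \<rho>)) = integral {-?A..?A} (\<lambda>\<rho>. dt \<phi> (t, arcosh (cosh s + \<rho>\<^sup>2)))"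
    by (rule integral_cong, rule plane_pd_eq(1)[OF sm]) (use even_smooth_deriv(2)[OF es] in auto)
  also have "\<dots> = descent (dt \<phi>) (t, s)"
    by (rule descent_eq[OF supported_dt[OF assms], symmetric]) (subst cosh_real_nonneg_le_iff; simp)
  finally show "((\<lambda>t. descent \<phi> (t, s)) has_real_derivative descent (dt \<phi>) (t, s)) (at t)"
  proof (rule has_field_derivative_transform_within_open[where S="{t - 1<..<t + 1}"])
    fix u assume "u \<in> {t - 1<..<t + 1}"
    then have "cosh (\<bar>u\<bar> + 1) \<le> ?A" by (subst cosh_real_nonneg_le_iff) auto
    from descent_eq[OF assms this, of s]
    show "integral {-?A..?A} (\<lambda>\<rho>. ?G (u, \<rho>)) = descent \<phi> (u, s)" by simp
  qed auto
qed simp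

lemma descent_sinh_deriv:
  assumes "supported \<phi>"
  shows "sinh_deriv (descent \<phi>) (t, s) = descent (sinh_deriv \<phi>) (t, s)"
proof (rule sinh_deriv_unique[OF descent_even_smooth[OF assms] smooth_on_continuous[OF descent_smooth[OF supported_sinh_deriv[OF assms]]]])
  fix t s :: real
  have es: "even_smooth \<phi>" using assms by (simp add: supported_def)
  let ?A = "cosh (\<bar>t\<bar> + 1)" let ?G = "\<lambda>x::real \<times> real. \<phi> (t, arcosh (cosh (fst x) + (snd x)\<^sup>2))"
  have Z: "smooth_on UNIV (\<lambda>x::real \<times> real. cosh (fst x) + (snd x)\<^sup>2)" by (intro smooth_intros open_UNIV)
  have sm: "smooth_on UNIV ?G"
    by (rule smooth_on_even_smooth_arcosh[OF es open_UNIV smooth_on_const Z]) (rule cosh_plus_ge_1)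
  have dG: "dt ?G (s, \<rho>) = sinh s * sinh_deriv \<phi> (t, arcosh (cosh s + \<rho>\<^sup>2))" for s \<rho>
  proof (rule plane_pd_eq(1)[OF sm])
    have "((\<lambda>s. cosh s + \<rho>\<^sup>2) has_derivative (\<lambda>h. sinh s * h)) (at s)"
      by (auto intro!: derivative_eq_intros)
    then have Zd: "(\<lambda>s. cosh s + \<rho>\<^sup>2) differentiable (at s)" "pd v (\<lambda>s. cosh s + \<rho>\<^sup>2) s = sinh s * v" for v
      by (auto simp: differentiable_def pd_eq)
    have "((\<lambda>s. \<phi> (t, arcosh (cosh s + \<rho>\<^sup>2))) has_derivative
       (\<lambda>v. dt \<phi> (t, arcosh (cosh s + \<rho>\<^sup>2)) * pd v (\<lambda>s. t) s + sinh_deriv \<phi> (t, arcosh (cosh s + \<rho>\<^sup>2)) * pd v (\<lambda>s. cosh s + \<rho>\<^sup>2) s)) (at s)"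
      by (rule even_smooth_arcosh[OF es _ Zd(1) open_UNIV UNIV_I cosh_plus_ge_1]) simp
    then show "((\<lambda>s. ?G (s, \<rho>)) has_real_derivative sinh s * sinh_deriv \<phi> (t, arcosh (cosh s + \<rho>\<^sup>2))) (at s)"
      unfolding has_field_derivative_def fst_conv snd_conv
      by (rule has_derivative_eq_rhs) (simp add: Zd(2) fun_eq_iff)
  qed simp
  have "((\<lambda>s. integral {-?A..?A} (\<lambda>\<rho>. ?G (s, \<rho>))) has_real_derivative integral {-?A..?A} (\<lambda>\<rho>. dt ?G (s, \<rho>))) (at s)"
    by (rule deriv_integral_param[OF sm])
  then have "((\<lambda>s. descent \<phi> (t, s)) has_real_derivative integral {-?A..?A} (\<lambda>\<rho>. sinh s * sinh_deriv \<phi> (t, arcosh (cosh s + \<rho>\<^sup>2)))) (at s)"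
    by (simp only: dG descent_eq[OF assms order_refl] fst_conv snd_conv)
  then have "((\<lambda>s. descent \<phi> (t, s)) has_real_derivative sinh s * descent (sinh_deriv \<phi>) (t, s)) (at s)"
    by (simp add: descent_eq[OF supported_sinh_deriv[OF assms] order_refl])
  then show "ds (descent \<phi>) (t, s) = sinh s * descent (sinh_deriv \<phi>) (t, s)"
    by (rule plane_pd_eq(2)[OF descent_smooth[OF assms], rotated]) simp
qed

text \<open>In the half-space a displacement x in one more horizontal direction adds x^2 / (2 y b)
  to the cosh of the distance; this is the \<rho>^2 in \<open>descent\<close>. Evaluated at cosh s +
  \<rho>^2, the operator for \<nu> = 0 is the operator for \<nu> = -1 in s plus a \<rho>-derivative,
  which integrates to 0.\<close>

lemma pde_sol_descent:
  assumes "pde_sol 0 M \<phi>"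
  shows "pde_sol (-1) M (descent \<phi>)"
proof -
  have sup: "supported \<phi>" and es: "even_smooth \<phi>"
    and pde: "\<And>t s. dt (dt \<phi>) (t, s) = (sinh s)\<^sup>2 * sinh_deriv (sinh_deriv \<phi>) (t, s) + cosh s * sinh_deriv \<phi> (t, s) - M\<^sup>2 * \<phi> (t, s)"
    using assms by (auto simp: pde_sol_def supported_def)
  note sup1 = supported_sinh_deriv[OF sup] and sup2 = supported_sinh_deriv[OF supported_sinh_deriv[OF sup]]
  have "dt (dt (descent \<phi>)) (t, s) = (sinh s)\<^sup>2 * sinh_deriv (sinh_deriv (descent \<phi>)) (t, s) + (1 / 4 - M\<^sup>2) * descent \<phi> (t, s)" for t s
  proof -
    let ?A = "cosh (\<bar>t\<bar> + 1 + 1)" let ?r = "\<lambda>\<rho>. arcosh (cosh s + \<rho>\<^sup>2)"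
    have A: "?A \<ge> cosh (\<bar>t\<bar> + 1)" by (subst cosh_real_nonneg_le_iff) auto
    have A1: "?A \<ge> 1" by (rule cosh_real_ge_1)
    have dd: "dt (dt (descent \<phi>)) (t, s) = descent (dt (dt \<phi>)) (t, s)"
    proof -
      have "dt (descent \<phi>) = descent (dt \<phi>)" using descent_dt[OF sup] by (auto simp: fun_eq_iff)
      then show ?thesis using descent_dt[OF supported_dt[OF sup]] by simp
    qed
    have DD2: "sinh_deriv (sinh_deriv (descent \<phi>)) (t, s) = descent (sinh_deriv (sinh_deriv \<phi>)) (t, s)"
    proof -
      have "sinh_deriv (descent \<phi>) = descent (sinh_deriv \<phi>)" using descent_sinh_deriv[OF sup] by (auto simp: fun_eq_iff)
      then show ?thesis using descent_sinh_deriv[OF sup1] by simp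
    qed
    \<comment> \<open>Since d/d\<rho> acts as 2 \<rho> D, the surplus second-order coefficient 2
      cosh s \<rho>^2 + \<rho>^4 forces the factor cosh s \<rho> + \<rho>^3 / 2. The last term
      adjusts the first-order coefficient to cosh s + \<rho>^2, and the - \<phi> / 4 it leaves
      accounts for the constant \<nu>^2 / 4 at \<nu> = -1.\<close>
    define H where "H \<rho> = (cosh s * \<rho> + 1/2 * \<rho> ^ 3) * sinh_deriv \<phi> (t, ?r \<rho>) - 1/4 * \<rho> * \<phi> (t, ?r \<rho>)" for \<rho>
    have dr: "((\<lambda>\<rho>. \<psi> (t, ?r \<rho>)) has_real_derivative 2 * \<rho> * sinh_deriv \<psi> (t, ?r \<rho>)) (at \<rho>)" if "even_smooth \<psi>" for \<psi> \<rho>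
    proof -
      have "((\<lambda>\<rho>. cosh s + \<rho>\<^sup>2) has_derivative (\<lambda>h. 2 * \<rho> * h)) (at \<rho>)"
        by (auto intro!: derivative_eq_intros)
      then have Zd: "(\<lambda>\<rho>. cosh s + \<rho>\<^sup>2) differentiable (at \<rho>)" "pd v (\<lambda>\<rho>. cosh s + \<rho>\<^sup>2) \<rho> = 2 * \<rho> * v" for v
        by (auto simp: differentiable_def pd_eq)
      have "((\<lambda>\<rho>. \<psi> (t, ?r \<rho>)) has_derivative
         (\<lambda>v. dt \<psi> (t, ?r \<rho>) * pd v (\<lambda>s. t) \<rho> + sinh_deriv \<psi> (t, ?r \<rho>) * pd v (\<lambda>\<rho>. cosh s + \<rho>\<^sup>2) \<rho>)) (at \<rho>)"
        by (rule even_smooth_arcosh[OF that _ Zd(1) open_UNIV UNIV_I cosh_plus_ge_1]) simp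
      then show ?thesis
        unfolding has_field_derivative_def by (rule has_derivative_eq_rhs) (simp add: Zd(2) fun_eq_iff)
    qed
    have H: "(H has_real_derivative (2 * cosh s * \<rho>\<^sup>2 + \<rho> ^ 4) * sinh_deriv (sinh_deriv \<phi>) (t, ?r \<rho>) + (cosh s + \<rho>\<^sup>2) * sinh_deriv \<phi> (t, ?r \<rho>) - \<phi> (t, ?r \<rho>) / 4) (at \<rho>)" for \<rho>
      unfolding H_def
      by (rule dr[OF even_smooth_sinh_deriv[OF es]] dr[OF es] derivative_eq_intros refl)+
        (simp add: field_simps power2_eq_square power3_eq_cube power4_eq_xxxx)
    have z: "\<psi> (t, ?r ?A) = 0" "\<psi> (t, ?r (- ?A)) = 0" if "supported \<psi>" for \<psi>
    proof -
      have "cosh (\<bar>t\<bar> + 1) < cosh s + ?A\<^sup>2"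
        using A A1 cosh_real_ge_1[of s] self_le_power[OF A1, of 2] by simp
      then have "arcosh (cosh (\<bar>t\<bar> + 1)) < ?r ?A"
        by (intro arcosh_real_strict_mono) (auto simp: cosh_real_ge_1)
      then have "\<bar>t\<bar> + 1 < ?r ?A" by (simp add: arcosh_cosh_real)
      then show "\<psi> (t, ?r ?A) = 0" "\<psi> (t, ?r (- ?A)) = 0" using that by (auto simp: supported_def)
    qed
    have "((\<lambda>\<rho>. (2 * cosh s * \<rho>\<^sup>2 + \<rho> ^ 4) * sinh_deriv (sinh_deriv \<phi>) (t, ?r \<rho>) + (cosh s + \<rho>\<^sup>2) * sinh_deriv \<phi> (t, ?r \<rho>) - \<phi> (t, ?r \<rho>) / 4)
        has_integral H ?A - H (- ?A)) {-?A..?A}"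
      by (rule fundamental_theorem_of_calculus)
        (use H A1 in \<open>auto simp: has_real_derivative_iff_has_vector_derivative[symmetric] intro: has_field_derivative_at_within\<close>)
    then have h0: "((\<lambda>\<rho>. (2 * cosh s * \<rho>\<^sup>2 + \<rho> ^ 4) * sinh_deriv (sinh_deriv \<phi>) (t, ?r \<rho>) + (cosh s + \<rho>\<^sup>2) * sinh_deriv \<phi> (t, ?r \<rho>) - \<phi> (t, ?r \<rho>) / 4)
        has_integral 0) {-?A..?A}"
      by (simp only: H_def z[OF sup] z[OF sup1]) simp
    have hi: "((\<lambda>\<rho>. \<psi> (t, ?r \<rho>)) has_integral descent \<psi> (t, s)) {-?A..?A}" if "supported \<psi>" for \<psi>
      unfolding descent_eq[OF that A]
    proof (rule integrable_integral[OF integrable_continuous_interval[OF continuous_at_imp_continuous_on]], rule ballI)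
      show "isCont (\<lambda>\<rho>. \<psi> (t, ?r \<rho>)) \<rho>" for \<rho>
        by (rule DERIV_isCont[OF dr]) (use that in \<open>simp add: supported_def\<close>)
    qed
    have "((\<lambda>\<rho>. (2 * cosh s * \<rho>\<^sup>2 + \<rho> ^ 4) * sinh_deriv (sinh_deriv \<phi>) (t, ?r \<rho>) + (cosh s + \<rho>\<^sup>2) * sinh_deriv \<phi> (t, ?r \<rho>) - \<phi> (t, ?r \<rho>) / 4
        + ((sinh s)\<^sup>2 * sinh_deriv (sinh_deriv \<phi>) (t, ?r \<rho>) + (1 / 4 - M\<^sup>2) * \<phi> (t, ?r \<rho>)))
        has_integral 0 + ((sinh s)\<^sup>2 * descent (sinh_deriv (sinh_deriv \<phi>)) (t, s) + (1 / 4 - M\<^sup>2) * descent \<phi> (t, s))) {-?A..?A}"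
      by (intro has_integral_add has_integral_mult_right h0 hi sup sup2)
    moreover have "(2 * cosh s * \<rho>\<^sup>2 + \<rho> ^ 4) * sinh_deriv (sinh_deriv \<phi>) (t, ?r \<rho>) + (cosh s + \<rho>\<^sup>2) * sinh_deriv \<phi> (t, ?r \<rho>) - \<phi> (t, ?r \<rho>) / 4
        + ((sinh s)\<^sup>2 * sinh_deriv (sinh_deriv \<phi>) (t, ?r \<rho>) + (1 / 4 - M\<^sup>2) * \<phi> (t, ?r \<rho>)) = dt (dt \<phi>) (t, ?r \<rho>)" for \<rho>
    proof -
      have "(sinh (?r \<rho>))\<^sup>2 = (cosh s + \<rho>\<^sup>2)\<^sup>2 - 1" "cosh (?r \<rho>) = cosh s + \<rho>\<^sup>2"
        using cosh_plus_ge_1[of s \<rho>] by (simp_all add: sinh_square_eq)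
      moreover have "(cosh s + \<rho>\<^sup>2)\<^sup>2 - 1 = 2 * cosh s * \<rho>\<^sup>2 + \<rho> ^ 4 + (sinh s)\<^sup>2"
        unfolding sinh_square_eq[of s] by (simp add: power2_eq_square power4_eq_xxxx algebra_simps)
      ultimately show ?thesis unfolding pde by (simp add: algebra_simps)
    qed
    ultimately have "((\<lambda>\<rho>. dt (dt \<phi>) (t, ?r \<rho>)) has_integral (sinh s)\<^sup>2 * descent (sinh_deriv (sinh_deriv \<phi>)) (t, s) + (1 / 4 - M\<^sup>2) * descent \<phi> (t, s)) {-?A..?A}"
      by simp
    then show ?thesis
      unfolding dd DD2 descent_eq[OF supported_dt[OF supported_dt[OF sup]] A] by (rule integral_unique)
  qed
  moreover have "descent \<phi> (t, s) = 0" if "s > \<bar>t\<bar> + 1" for t s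
  proof -
    have "\<phi> (t, arcosh (cosh s + \<rho>\<^sup>2)) = 0" for \<rho>
    proof -
      have "\<not> arcosh (cosh s + \<rho>\<^sup>2) < arcosh (cosh s)"
        by (subst arcosh_less_iff_real) (auto simp: cosh_real_ge_1 cosh_plus_ge_1)
      moreover have "arcosh (cosh s) = s" using that by (intro arcosh_cosh_real) linarith
      ultimately show ?thesis using sup that unfolding supported_def by auto
    qed
    then show ?thesis by (simp add: descent_def)
  qed
  ultimately show ?thesis using descent_even_smooth[OF sup] by (simp add: pde_sol_def)
qed

text \<open>Even m starts from the wave on the line with \<nu> = 0, odd m from its descent with
  \<nu> = -1. Each application of D adds 2, until \<nu> = m + 2.\<close>

theorem radial_wave_exists:
  assumes "M > 0"
  obtains k t s where "radial_wave k m M" "s > 0" "k (t, s) \<noteq> 0"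
proof -
  obtain w where w: "pde_sol 0 M w" "\<And>s. dt w (0, s) = 2 * bump s" using klein_gordon_line by blast
  have sup: "supported w" using w(1) by (auto simp: pde_sol_def supported_def)
  have nz: "\<exists>x. \<phi> x \<noteq> 0" if "dt \<phi> (0, 0) \<noteq> 0" for \<phi>
  proof (rule ccontr)
    assume "\<not> ?thesis"
    then have "\<phi> = (\<lambda>_. 0)" by auto
    with that show False by simp
  qed
  have "\<exists>\<nu> \<phi> j x. pde_sol \<nu> M \<phi> \<and> \<phi> x \<noteq> 0 \<and> \<nu> + 2 * real j = real m + 2"
  proof (cases "even m")
    case True
    then obtain i where "m = 2 * i" by (elim evenE)
    then have "0 + 2 * real (i + 1) = real m + 2" by simp
    moreover obtain x where "w x \<noteq> 0" using nz[of w] w(2)[of 0] bump_props(3) by force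
    ultimately show ?thesis using w(1) by blast
  next
    case False
    then obtain i where "m = 2 * i + 1" by (elim oddE)
    then have "- 1 + 2 * real (i + 2) = real m + 2" by simp
    \<comment> \<open>At time 0 the descended velocity at the centre is the integral of a
      nonnegative bump that is positive at \<rho> = 0.\<close>
    moreover have "dt (descent w) (0, 0) > 0"
    proof -
      let ?f = "\<lambda>\<rho>. 2 * bump (arcosh (1 + \<rho>\<^sup>2))" and ?A = "cosh 1 :: real"
      have c: "continuous_on {-?A..?A} ?f"
        by (intro continuous_intros continuous_on_compose2[OF smooth_on_continuous[OF smooth_bump]]
          continuous_on_compose2[OF continuous_on_arcosh[of "{1..}"]]) auto
      have "dt (descent w) (0, 0) = integral {-?A..?A} ?f"
        unfolding descent_dt[OF sup] by (subst descent_eq[OF supported_dt[OF sup], where A="?A"]) (simp_all add: w(2))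
      moreover have "integral {-?A..?A} ?f \<ge> 0"
        by (rule integral_nonneg[OF integrable_continuous_interval[OF c]]) (simp add: bump_props)
      moreover have "integral {-?A..?A} ?f \<noteq> 0"
      proof
        assume "integral {-?A..?A} ?f = 0"
        then have "\<forall>x\<in>{-?A..?A}. ?f x = 0"
          by (subst (asm) integral_eq_0_iff[OF c]) (auto simp: bump_props cosh_real_pos intro: order.strict_trans)
        then have "?f 0 = 0" by (rule bspec) (simp add: less_imp_le)
        then show False using bump_props(3) by simp
      qed
      ultimately show ?thesis by simp
    qed
    then obtain x where "descent w x \<noteq> 0" using nz[of "descent w"] by force
    ultimately show ?thesis using pde_sol_descent[OF w(1)] by blast
  qed
  then obtain \<nu> \<phi> j x where "pde_sol \<nu> M \<phi>" "\<phi> x \<noteq> 0" "\<nu> + 2 * real j = real m + 2" by blast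
  from pde_sol_iterate[OF this(1,2), of j] this(3)
  obtain k x where k: "pde_sol (real m + 2) M k" "k x \<noteq> 0" by auto
  have kes: "even_smooth k" and supp: "\<And>t s. s > \<bar>t\<bar> + 1 \<Longrightarrow> k (t, s) = 0" using k(1) by (auto simp: pde_sol_def)
  have "k (t, s) = 0" if "s \<ge> \<bar>t\<bar> + 1" for t s
    using that supp[of t s] even_smooth_vanish_boundary[OF kes, of "\<bar>t\<bar> + 1" t] supp by (cases "s = \<bar>t\<bar> + 1") auto
  then have rw: "radial_wave k m M"
    using k(1) assms by unfold_locales (auto simp: pde_sol_def algebra_simps)
  have "\<exists>t s. s > 0 \<and> k (t, s) \<noteq> 0"
  proof (rule ccontr)
    assume "\<not> ?thesis"
    then have z: "k (t, s) = 0" if "s > 0" for t s using that by blast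
    have "k (t, s) = 0" for t s
      using z[of s t] z[of "-s" t] even_smooth_even[OF kes, of t s] even_smooth_vanish_boundary[OF kes, of 0 t] z
      by (cases s "0::real" rule: linorder_cases) auto
    then show False using k(2) by (cases x) simp
  qed
  then show thesis using that rw by blast
qed

section \<open>Alternating forms\<close>

lemma alternating_cong: "alternating p A \<Longrightarrow> (\<And>i. i < p \<Longrightarrow> v i = w i) \<Longrightarrow> A v = A w"
  by (simp add: alternating_def)

lemma alternating_linear: "alternating p A \<Longrightarrow> i < p \<Longrightarrow> linear (\<lambda>y. A (v(i := y)))"
  by (simp add: alternating_def)

lemma alternating_zero: "alternating p A \<Longrightarrow> i < p \<Longrightarrow> j < p \<Longrightarrow> i \<noteq> j \<Longrightarrow> v i = v j \<Longrightarrow> A v = 0"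
  unfolding alternating_def by blast

lemma alternatingI:
  fixes A :: "(nat \<Rightarrow> 'v::real_vector) \<Rightarrow> real"
  assumes "\<And>v w. (\<And>i. i < p \<Longrightarrow> v i = w i) \<Longrightarrow> A v = A w"
    and "\<And>v i. i < p \<Longrightarrow> linear (\<lambda>y. A (v(i := y)))"
    and "\<And>v i j. i < j \<Longrightarrow> j < p \<Longrightarrow> v i = v j \<Longrightarrow> A v = 0"
  shows "alternating p A"
  unfolding alternating_def
proof (intro conjI allI impI)
  show "A v = A w" if "\<forall>i<p. v i = w i" for v w using assms(1) that by blast
  show "linear (\<lambda>y. A (v(i := y)))" if "i < p" for v i using assms(2) that by blast
  show "A v = 0" if "i < p" "j < p" "i \<noteq> j \<and> v i = v j" for v i j
    using assms(3)[of i j v] assms(3)[of j i v] that by (cases i j rule: linorder_cases) auto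
qed

lemma alternating_sum:
  assumes "\<And>i. i \<in> I \<Longrightarrow> alternating p (A i)"
  shows "alternating p (\<lambda>v. \<Sum>i\<in>I. A i v)"
proof (rule alternatingI)
  show "(\<Sum>i\<in>I. A i v) = (\<Sum>i\<in>I. A i w)" if "\<And>i. i < p \<Longrightarrow> v i = w i" for v w
    by (rule sum.cong[OF refl]) (rule alternating_cong[OF assms that])
  show "linear (\<lambda>y. \<Sum>i\<in>I. A i (v(j := y)))" if "j < p" for v j
    by (intro linear_compose_sum ballI alternating_linear[OF assms that])
  show "(\<Sum>i\<in>I. A i v) = 0" if "i < j" "j < p" "v i = v j" for v i j
    by (intro sum.neutral ballI alternating_zero[OF assms, of _ i j]) (use that in auto)
qed

lemma alternating_cmult:
  assumes "alternating p A"
  shows "alternating p (\<lambda>v. c * A v)"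
proof (rule alternatingI)
  show "c * A v = c * A w" if "\<And>i. i < p \<Longrightarrow> v i = w i" for v w
    using alternating_cong[OF assms that] by simp
  show "linear (\<lambda>y. c * A (v(j := y)))" if "j < p" for v j
    using linear_compose_scale_right[OF alternating_linear[OF assms that, of v], of c] by simp
  show "c * A v = 0" if "i < j" "j < p" "v i = v j" for v i j
    using alternating_zero[OF assms, of i j v] that by simp
qed

lemma case_nat_upd: "case_nat b (v(i := y)) = (case_nat b v)(Suc i := y)"
  by (auto simp: fun_eq_iff split: nat.split)

lemma alternating_contract:
  assumes "alternating (Suc p) A"
  shows "alternating p (\<lambda>v. A (case_nat b v))"
proof (rule alternatingI)
  show "A (case_nat b v) = A (case_nat b w)" if "\<And>i. i < p \<Longrightarrow> v i = w i" for v w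
    by (rule alternating_cong[OF assms]) (use that in \<open>auto split: nat.split\<close>)
  show "linear (\<lambda>y. A (case_nat b (v(j := y))))" if "j < p" for v j
    unfolding case_nat_upd by (rule alternating_linear[OF assms]) (use that in simp)
  show "A (case_nat b v) = 0" if "i < j" "j < p" "v i = v j" for v i j
    by (rule alternating_zero[OF assms, of "Suc i" "Suc j"]) (use that in auto)
qed

lemma alternating_compose_linear:
  assumes "alternating p A" "linear L"
  shows "alternating p (\<lambda>v. A (\<lambda>i. L (v i)))"
proof (rule alternatingI)
  show "A (\<lambda>i. L (v i)) = A (\<lambda>i. L (w i))" if "\<And>i. i < p \<Longrightarrow> v i = w i" for v w
    by (rule alternating_cong[OF assms(1)]) (use that in auto)
  show "linear (\<lambda>y. A (\<lambda>i. L ((v(j := y)) i)))" if "j < p" for v j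
  proof -
    have "(\<lambda>i. L ((v(j := y)) i)) = (\<lambda>i. L (v i))(j := L y)" for y by auto
    then show ?thesis
      using linear_compose[OF assms(2) alternating_linear[OF assms(1) that, of "\<lambda>i. L (v i)"]] by (simp add: o_def)
  qed
  show "A (\<lambda>i. L (v i)) = 0" if "i < j" "j < p" "v i = v j" for v i j
    by (rule alternating_zero[OF assms(1), of i j]) (use that in auto)
qed

lemma alternating_pd:
  fixes \<omega> :: "'a::real_normed_vector \<Rightarrow> (nat \<Rightarrow> 'v::real_vector) \<Rightarrow> real"
  assumes S: "open S" "x \<in> S" and alt: "\<And>x. x \<in> S \<Longrightarrow> alternating p (\<omega> x)"
    and d: "\<And>v. (\<lambda>x. \<omega> x v) differentiable (at x)"
  shows "alternating p (\<lambda>v. pd u (\<lambda>x. \<omega> x v) x)"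
proof (rule alternatingI)
  have cong: "pd u f x = pd u g x" if "\<And>y. y \<in> S \<Longrightarrow> f y = g y" for f g :: "'a \<Rightarrow> real"
    using frechet_cong[OF S that] by simp
  show "pd u (\<lambda>x. \<omega> x v) x = pd u (\<lambda>x. \<omega> x w) x" if "\<And>i. i < p \<Longrightarrow> v i = w i" for v w
    by (rule cong) (rule alternating_cong[OF alt that])
  show "linear (\<lambda>y. pd u (\<lambda>x. \<omega> x (v(i := y))) x)" if i: "i < p" for v i
  proof (rule linearI)
    fix a b :: 'v and r :: real
    have "pd u (\<lambda>x. \<omega> x (v(i := a + b))) x = pd u (\<lambda>x. \<omega> x (v(i := a)) + \<omega> x (v(i := b))) x"
      by (rule cong) (rule linear_add[OF alternating_linear[OF alt i]])
    then show "pd u (\<lambda>x. \<omega> x (v(i := a + b))) x = pd u (\<lambda>x. \<omega> x (v(i := a))) x + pd u (\<lambda>x. \<omega> x (v(i := b))) x"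
      by (simp add: pd_add d)
    have "pd u (\<lambda>x. \<omega> x (v(i := r *\<^sub>R a))) x = pd u (\<lambda>x. r * \<omega> x (v(i := a))) x"
      by (rule cong) (use linear_scale[OF alternating_linear[OF alt i]] in simp)
    then show "pd u (\<lambda>x. \<omega> x (v(i := r *\<^sub>R a))) x = r *\<^sub>R pd u (\<lambda>x. \<omega> x (v(i := a))) x"
      by (simp add: pd_cmult d)
  qed
  show "pd u (\<lambda>x. \<omega> x v) x = 0" if "i < j" "j < p" "v i = v j" for v i j
  proof -
    have "pd u (\<lambda>x. \<omega> x v) x = pd u (\<lambda>x. 0) x"
      by (rule cong) (rule alternating_zero[OF alt, of _ i j]; use that in simp)
    then show ?thesis by simp
  qed
qed

lemma alternating_swap:
  assumes A: "alternating p A" and ij: "i < p" "j < p" "i \<noteq> j"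
  shows "A (v(i := v j, j := v i)) = - A v"
proof -
  define f where "f x y = A (v(i := x, j := y))" for x y
  have l1: "linear (\<lambda>x. f x y)" for y
    using alternating_linear[OF A ij(1), of "v(j := y)"] ij(3) by (simp add: f_def fun_upd_twist)
  have l2: "linear (\<lambda>y. f x y)" for x
    using alternating_linear[OF A ij(2), of "v(i := x)"] by (simp add: f_def)
  have z: "f x x = 0" for x
    unfolding f_def by (rule alternating_zero[OF A ij]) (use ij(3) in simp)
  have "f (v i + v j) (v i + v j) = f (v i) (v i) + f (v i) (v j) + (f (v j) (v i) + f (v j) (v j))"
    by (simp add: linear_add[OF l1] linear_add[OF l2])
  then have "f (v j) (v i) = - f (v i) (v j)" using z by simp
  moreover have "f (v i) (v j) = A v" by (simp add: f_def)
  ultimately show ?thesis by (simp add: f_def)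
qed

text \<open>As v a = v b, the tuple without b arises from the tuple without a by moving one entry
  past b - 1 - a neighbours. The induction exchanges v b with its predecessor, one sign at a
  time.\<close>

lemma alternating_omit_eq:
  assumes A: "alternating p A" and "b \<le> p" and "v a = v b" and "a < b"
  shows "A (omit b v) = (- 1) ^ (b - 1 - a) * A (omit a v)"
  using assms(2-4)
proof (induction "b - 1 - a" arbitrary: b v)
  case 0
  then have "b = Suc a" by simp
  then have "omit b v = omit a v" using 0 by (auto simp: omit_def fun_eq_iff less_Suc_eq)
  then show ?case using 0 by simp
next
  case (Suc d)
  define c where "c = b - 1"
  have b: "b = Suc c" "a < c" "d = c - 1 - a" using Suc by (auto simp: c_def)
  define v' where "v' = v(c := v b, b := v c)"
  have "A (omit c v') = (- 1) ^ (c - 1 - a) * A (omit a v')"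
    by (rule Suc.hyps(1)) (use Suc b in \<open>auto simp: v'_def\<close>)
  moreover have "omit c v' = omit b v"
    using b by (auto simp: omit_def v'_def fun_eq_iff less_Suc_eq)
  moreover have "omit a v' = (omit a v)(c - 1 := omit a v c, c := omit a v (c - 1))"
    using b by (auto simp: omit_def v'_def fun_eq_iff)
  moreover have "A ((omit a v)(c - 1 := omit a v c, c := omit a v (c - 1))) = - A (omit a v)"
    by (rule alternating_swap[OF A]) (use b Suc in auto)
  moreover have "b - 1 - a = Suc (c - 1 - a)" using b by simp
  ultimately show ?case by simp
qed

text \<open>Prepending w i to w yields a tuple with equal entries at the positions 0 and i + 1;
  compare omitting the one with omitting the other.\<close>

lemma alternating_move_front:
  assumes "alternating (Suc p) A" "i \<le> p"
  shows "A (case_nat (w i) (omit i w)) = (- 1) ^ i * A w"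
proof -
  have "omit (Suc i) (case_nat (w i) w) = case_nat (w i) (omit i w)" "omit 0 (case_nat (w i) w) = w"
    by (auto simp: omit_def fun_eq_iff split: nat.split)
  then show ?thesis
    using alternating_omit_eq[OF assms(1), of "Suc i" "case_nat (w i) w" 0] assms(2) by simp
qed

text \<open>With L u the derivative of a form along u this covers \<open>ext_deriv\<close>, and with
  L u a multiple of a fixed form it is the wedge product with a covector. If v a = v b, every term
  other than those for a and b still contains both vectors, and these two cancel by
  \<open>alternating_omit_eq\<close>.\<close>

lemma alternating_wedge:
  fixes L :: "'v::real_vector \<Rightarrow> (nat \<Rightarrow> 'v) \<Rightarrow> real"
  assumes alt: "\<And>u. alternating p (L u)" and lin: "\<And>w. linear (\<lambda>u. L u w)"
  shows "alternating (Suc p) (\<lambda>v. \<Sum>i\<le>p. (- 1) ^ i * L (v i) (omit i v))"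
proof (rule alternatingI)
  show "(\<Sum>i\<le>p. (- 1) ^ i * L (v i) (omit i v)) = (\<Sum>i\<le>p. (- 1) ^ i * L (w i) (omit i w))"
    if "\<And>i. i < Suc p \<Longrightarrow> v i = w i" for v w
  proof (rule sum.cong[OF refl])
    fix i assume "i \<in> {..p}"
    then have "v i = w i" "L (v i) (omit i v) = L (v i) (omit i w)"
      by (simp_all add: that) (rule alternating_cong[OF alt], simp add: omit_def that)
    then show "(- 1) ^ i * L (v i) (omit i v) = (- 1) ^ i * L (w i) (omit i w)" by simp
  qed
  show "linear (\<lambda>y. \<Sum>i\<le>p. (- 1) ^ i * L ((v(k := y)) i) (omit i (v(k := y))))" if k: "k < Suc p" for v k
  proof (intro linear_compose_sum ballI)
    fix i assume i: "i \<in> {..p}"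
    have "linear (\<lambda>y. L ((v(k := y)) i) (omit i (v(k := y))))"
    proof (cases "i = k")
      case True
      then have "omit i (v(k := y)) = omit i v" for y by (auto simp: omit_def fun_eq_iff)
      then show ?thesis using True lin by simp
    next
      case False
      then have "omit i (v(k := y)) = (omit i v)((if k < i then k else k - 1) := y)" for y
        by (auto simp: omit_def fun_eq_iff)
      then show ?thesis using False alternating_linear[OF alt, of "if k < i then k else k - 1" "v i" "omit i v"] k i
        by auto
    qed
    from linear_compose_scale_right[OF this, of "(- 1) ^ i"]
    show "linear (\<lambda>y. (- 1) ^ i * L ((v(k := y)) i) (omit i (v(k := y))))" by simp
  qed
  show "(\<Sum>i\<le>p. (- 1) ^ i * L (v i) (omit i v)) = 0" if ab: "a < b" "b < Suc p" "v a = v b" for v a b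
  proof -
    have z: "(- 1) ^ i * L (v i) (omit i v) = 0" if "i \<in> {..p} - {a, b}" for i
    proof -
      have "omit i v (if a < i then a else a - 1) = omit i v (if b < i then b else b - 1)"
        using that ab by (auto simp: omit_def)
      then have "L (v i) (omit i v) = 0"
        by (rule alternating_zero[OF alt, rotated -1]) (use that ab in auto)
      then show ?thesis by simp
    qed
    have "(\<Sum>i\<le>p. (- 1) ^ i * L (v i) (omit i v)) = (\<Sum>i\<in>{a, b}. (- 1) ^ i * L (v i) (omit i v))"
      by (rule sum.mono_neutral_right) (use ab z in auto)
    also have "\<dots> = (- 1) ^ a * L (v a) (omit a v) + (- 1) ^ b * L (v b) (omit b v)" using ab by simp
    also have "L (v b) (omit b v) = (- 1) ^ (b - 1 - a) * L (v a) (omit a v)"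
      using alternating_omit_eq[OF alt, of b v a "v b"] ab by simp
    also have "(- 1) ^ b * ((- 1) ^ (b - 1 - a) * L (v a) (omit a v)) = - ((- 1) ^ a * L (v a) (omit a v))"
    proof -
      obtain d where d: "b = Suc (a + d)" using ab(1) less_iff_Suc_add by blast
      have "(- 1) ^ b * (- 1) ^ (b - 1 - a) = - ((- 1) ^ a * ((- 1) ^ d * (- 1) ^ d) :: real)"
        by (simp add: d power_add)
      also have "(- 1) ^ d * (- 1) ^ d = (1::real)" by (simp flip: power_add mult_2)
      finally show ?thesis by (simp flip: mult.assoc)
    qed
    finally show ?thesis by simp
  qed
qed

lemma alternating_scale:
  fixes A :: "(nat \<Rightarrow> 'v::real_vector) \<Rightarrow> real"
  assumes "alternating p A"
  shows "A (\<lambda>i. c *\<^sub>R v i) = c ^ p * A v"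
proof -
  have "A (\<lambda>i. if i < k then c *\<^sub>R v i else v i) = c ^ k * A v" if "k \<le> p" for k
    using that
  proof (induction k)
    case (Suc k)
    define w where "w = (\<lambda>i. if i < k then c *\<^sub>R v i else v i)"
    have "(\<lambda>i. if i < Suc k then c *\<^sub>R v i else v i) = w(k := c *\<^sub>R v k)"
      by (auto simp: w_def less_Suc_eq)
    then have "A (\<lambda>i. if i < Suc k then c *\<^sub>R v i else v i) = c * A (w(k := v k))"
      using linear_scale[OF alternating_linear[OF assms, of k w]] Suc.prems by simp
    also have "w(k := v k) = w" by (auto simp: w_def)
    finally show ?case using Suc by (simp add: w_def)
  qed simp
  from this[of p] have "A (\<lambda>i. if i < p then c *\<^sub>R v i else v i) = c ^ p * A v" by simp
  moreover have "A (\<lambda>i. if i < p then c *\<^sub>R v i else v i) = A (\<lambda>i. c *\<^sub>R v i)"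
    by (rule alternating_cong[OF assms]) simp
  ultimately show ?thesis by simp
qed

text \<open>The slots are expanded in the basis one at a time; k counts the slots in which arbitrary
  vectors are already allowed.\<close>

lemma alternating_zero_on_Basis:
  fixes A :: "(nat \<Rightarrow> 'a::euclidean_space) \<Rightarrow> real"
  assumes A: "alternating p A" and B: "\<And>e. (\<And>i. i < p \<Longrightarrow> e i \<in> Basis) \<Longrightarrow> A e = 0"
  shows "A v = 0"
proof -
  have "\<forall>v. (\<forall>i. k \<le> i \<longrightarrow> i < p \<longrightarrow> v i \<in> Basis) \<longrightarrow> A v = 0" if "k \<le> p" for k
    using that
  proof (induction k)
    case 0
    then show ?case using B by simp
  next
    case (Suc k)
    show ?case
    proof (intro allI impI)
      fix v :: "nat \<Rightarrow> 'a" assume v: "\<forall>i. Suc k \<le> i \<longrightarrow> i < p \<longrightarrow> v i \<in> Basis"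
      have lin: "linear (\<lambda>y. A (v(k := y)))" using Suc.prems by (intro alternating_linear[OF A]) simp
      have "A v = A (v(k := \<Sum>b\<in>Basis. (v k \<bullet> b) *\<^sub>R b))" by (simp add: euclidean_representation)
      also have "\<dots> = (\<Sum>b\<in>Basis. (v k \<bullet> b) * A (v(k := b)))"
        by (simp add: linear_sum[OF lin] linear_scale[OF lin])
      also have "\<dots> = 0"
      proof (intro sum.neutral ballI)
        fix b :: 'a assume "b \<in> Basis"
        then have "A (v(k := b)) = 0" using Suc.IH Suc.prems v by auto
        then show "(v k \<bullet> b) * A (v(k := b)) = 0" by simp
      qed
      finally show "A v = 0" .
    qed
  qed
  from this[of p] show ?thesis by simp
qed

lemma alternating_above_dimension:
  fixes A :: "(nat \<Rightarrow> 'a::euclidean_space) \<Rightarrow> real"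
  assumes A: "alternating p A" and p: "p > DIM('a)"
  shows "A v = 0"
proof (rule alternating_zero_on_Basis[OF A])
  fix e :: "nat \<Rightarrow> 'a" assume e: "\<And>i. i < p \<Longrightarrow> e i \<in> Basis"
  have "card (e ` {..<p}) \<le> DIM('a)" by (rule card_mono) (use e in auto)
  then have "\<not> inj_on e {..<p}" using p card_image[of e "{..<p}"] by auto
  then obtain i j where "i < p" "j < p" "i \<noteq> j" "e i = e j" by (auto simp: inj_on_def)
  then show "A e = 0" by (rule alternating_zero[OF A])
qed

text \<open>The form is the successive wedge product of coordinate covectors.\<close>

lemma alternating_nontrivial_exists:
  assumes "q \<le> DIM('a)"
  obtains A :: "(nat \<Rightarrow> 'a::euclidean_space) \<Rightarrow> real" and v where "alternating q A" "A v \<noteq> 0"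
proof -
  obtain f where f: "bij_betw f {0..<DIM('a)} (Basis :: 'a set)"
    using ex_bij_betw_nat_finite[OF finite_Basis] by blast
  \<comment> \<open>The basis vectors are listed in descending order so that the newest covector f q
    meets f q in slot 0 only, and a single term of the wedge sum survives.\<close>
  have "\<exists>A::(nat \<Rightarrow> 'a) \<Rightarrow> real. alternating q A \<and> A (\<lambda>i. f (q - 1 - i)) \<noteq> 0"
    using assms
  proof (induction q)
    case 0
    show ?case by (rule exI[of _ "\<lambda>_. 1"]) (simp add: alternating_def)
  next
    case (Suc q)
    then obtain A :: "(nat \<Rightarrow> 'a) \<Rightarrow> real" where A: "alternating q A" "A (\<lambda>i. f (q - 1 - i)) \<noteq> 0" by auto
    define A' where "A' v = (\<Sum>i\<le>q. (- 1) ^ i * ((v i \<bullet> f q) * A (omit i v)))" for v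
    have "alternating (Suc q) A'"
      unfolding A'_def[abs_def]
      by (rule alternating_wedge, rule alternating_cmult[OF A(1)])
        (auto intro!: linearI simp: inner_left_distrib algebra_simps)
    moreover have "A' (\<lambda>i. f (q - i)) = A (\<lambda>i. f (q - 1 - i))"
    proof -
      have fB: "f i \<in> Basis" if "i \<le> q" for i
        using f that Suc.prems by (auto simp: bij_betw_def)
      have ne: "f (q - i) \<noteq> f q" if "0 < i" "i \<le> q" for i
      proof
        assume "f (q - i) = f q"
        then have "q - i = q"
          by (rule inj_onD[OF bij_betw_imp_inj_on[OF f]]) (use Suc.prems in auto)
        then show False using that by simp
      qed
      have "A' (\<lambda>i. f (q - i)) = (\<Sum>i\<in>{0}. (- 1) ^ i * ((f (q - i) \<bullet> f q) * A (omit i (\<lambda>i. f (q - i)))))"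
        unfolding A'_def by (rule sum.mono_neutral_right) (use fB ne in \<open>auto simp: inner_Basis\<close>)
      also have "\<dots> = A (\<lambda>i. f (q - 1 - i))"
        using fB[of q] by (simp add: omit_def)
      finally show ?thesis .
    qed
    ultimately show ?case using A(2) by auto
  qed
  then show thesis using that by blast
qed

text \<open>For a top-degree form, contraction with the endomorphism \<open>g\<close> in all slots is multiplication by the trace.\<close>

lemma alternating_trace:
  fixes A :: "(nat \<Rightarrow> 'a::euclidean_space) \<Rightarrow> real" and g :: "'a \<Rightarrow> 'a \<Rightarrow> real"
  assumes A: "alternating (Suc p) A" and p: "Suc p = DIM('a)" and lin: "\<And>b. linear (g b)"
  shows "(\<Sum>i\<le>p. (- 1) ^ i * (\<Sum>b\<in>Basis. g b (v i) * A (case_nat b (omit i v)))) = (\<Sum>b\<in>Basis. g b b) * A v"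
proof -
  have "g b b * A v - (\<Sum>i\<le>p. (- 1) ^ i * (g b (v i) * A (case_nat b (omit i v)))) = 0" for b
  proof -
    \<comment> \<open>W is the wedge product of the covector g b with A. Its degree exceeds the
      dimension, so it vanishes; evaluated with b in the first slot it gives the identity for this
      b.\<close>
    define W where "W v = (\<Sum>i\<le>Suc p. (- 1) ^ i * (g b (v i) * A (omit i v)))" for v
    have "alternating (Suc (Suc p)) W"
      unfolding W_def[abs_def]
      by (rule alternating_wedge, rule alternating_cmult[OF A])
        (use lin[of b] in \<open>auto intro!: linearI simp: linear_add linear_scale algebra_simps\<close>)
    then have "W (case_nat b v) = 0" by (rule alternating_above_dimension) (use p in simp)
    moreover have "omit 0 (case_nat b v) = v" "omit (Suc i) (case_nat b v) = case_nat b (omit i v)" for i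
      by (auto simp: omit_def fun_eq_iff split: nat.split)
    ultimately show ?thesis
      unfolding W_def sum.atMost_Suc_shift by (simp add: sum_negf)
  qed
  then have "g b b * A v = (\<Sum>i\<le>p. (- 1) ^ i * (g b (v i) * A (case_nat b (omit i v))))" for b by simp
  then have "(\<Sum>b\<in>Basis. g b b) * A v = (\<Sum>b\<in>Basis. \<Sum>i\<le>p. (- 1) ^ i * (g b (v i) * A (case_nat b (omit i v))))"
    by (simp add: sum_distrib_right)
  also have "\<dots> = (\<Sum>i\<le>p. \<Sum>b\<in>Basis. (- 1) ^ i * (g b (v i) * A (case_nat b (omit i v))))" by (rule sum.swap)
  finally show ?thesis by (simp add: sum_distrib_left)
qed

section \<open>Integration by parts\<close>

lemma integral_translate:
  fixes g :: "'a::euclidean_space \<Rightarrow> real"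
  assumes "g \<in> borel_measurable borel"
  shows "(\<integral>x. g (x + c) \<partial>lborel) = (\<integral>x. g x \<partial>lborel)"
proof -
  have "(\<integral>x. g x \<partial>lborel) = (\<integral>x. g x \<partial>(distr lborel borel ((+) c)))" by (simp add: lborel_distr_plus)
  also have "\<dots> = (\<integral>x. g (c + x) \<partial>lborel)" by (rule integral_distr) (use assms in simp_all)
  finally show ?thesis by (simp add: add.commute)
qed

lemma integrable_compact_support:
  fixes f :: "'a::euclidean_space \<Rightarrow> real"
  assumes "continuous_on UNIV f" "compact K" "\<And>x. x \<notin> K \<Longrightarrow> f x = 0"
  shows "integrable lborel f"
proof -
  have "integrable lborel (\<lambda>x. indicator K x *\<^sub>R f x)"
    by (rule borel_integrable_compact[OF assms(2)]) (rule continuous_on_subset[OF assms(1) subset_UNIV])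
  moreover have "(\<lambda>x. indicator K x *\<^sub>R f x) = f" using assms(3) by (auto simp: indicator_def fun_eq_iff)
  ultimately show ?thesis by simp
qed

text \<open>Averaging over the translations by s b with 0 <= s <= 1 leaves the integral unchanged.
  By Fubini and the fundamental theorem on each segment, the average is the integral of f (x + b) -
  f x, which is 0 by translation invariance.\<close>

lemma integral_pd_compact_support:
  fixes f :: "'a::euclidean_space \<Rightarrow> real"
  assumes d: "\<And>x. f differentiable (at x)" and c: "continuous_on UNIV (pd b f)"
    and K: "compact K" "\<And>x. x \<notin> K \<Longrightarrow> f x = 0"
  shows "(\<integral>x. pd b f x \<partial>lborel) = 0"
proof -
  have cf: "continuous_on UNIV f" using d by (auto intro!: continuous_at_imp_continuous_on differentiable_imp_continuous_within)
  have pz: "pd b f x = 0" if "x \<notin> K" for x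
  proof -
    have "pd b f x = pd b (\<lambda>_. 0) x"
      using frechet_cong[of "- K" x f "\<lambda>_. 0"] that K(2) open_Compl[OF compact_imp_closed[OF K(1)]] by simp
    then show ?thesis by simp
  qed
  define G where "G x s = indicator {0..1} s * pd b f (x + s *\<^sub>R b)" for x and s :: real
  \<comment> \<open>The pairs (x, s) with s in [0, 1] and x + s b in K. They form a compact set that
    carries G, which gives the integrability that Fubini needs.\<close>
  define K' where "K' = (\<lambda>p. (fst p - snd p *\<^sub>R b, snd p)) ` (K \<times> {0..1::real})"
  have K': "compact K'"
    unfolding K'_def by (intro compact_continuous_image continuous_intros compact_Times K compact_Icc)
  have inK': "(x, s) \<in> K'" if "s \<in> {0..1}" "x + s *\<^sub>R b \<in> K" for x s
    unfolding K'_def by (rule image_eqI[of _ _ "(x + s *\<^sub>R b, s)"]) (use that in auto)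
  have "integrable lborel (\<lambda>p. indicator K' p *\<^sub>R pd b f (fst p + snd p *\<^sub>R b))"
    by (rule borel_integrable_compact[OF K']) (auto intro!: continuous_on_compose2[OF c] continuous_intros)
  moreover have "(\<lambda>p. indicator K' p *\<^sub>R pd b f (fst p + snd p *\<^sub>R b)) = (\<lambda>(x, s). G x s)"
  proof (rule ext, clarify)
    fix x s
    show "indicator K' (x, s) *\<^sub>R pd b f (fst (x, s) + snd (x, s) *\<^sub>R b) = G x s"
    proof (cases "x + s *\<^sub>R b \<in> K")
      case True
      then have "(x, s) \<in> K' \<longleftrightarrow> s \<in> {0..1}" using inK' by (auto simp: K'_def)
      then show ?thesis by (simp add: G_def indicator_def)
    qed (simp add: G_def pz)
  qed
  ultimately have int: "integrable (lborel \<Otimes>\<^sub>M lborel) (\<lambda>(x, s). G x s)" by (simp add: lborel_prod)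
  have m: "pd b f \<in> borel_measurable borel" using c by (rule borel_measurable_continuous_onI)
  have mf: "f \<in> borel_measurable borel" using cf by (rule borel_measurable_continuous_onI)
  have intf: "integrable lborel f" by (rule integrable_compact_support[OF cf K])
  have "(\<integral>s. (\<integral>x. G x s \<partial>lborel) \<partial>lborel) = (\<integral>s. indicator {0..1::real} s * (\<integral>x. pd b f x \<partial>lborel) \<partial>lborel)"
    unfolding G_def by (simp add: integral_translate[OF m])
  also have "\<dots> = (\<integral>x. pd b f x \<partial>lborel)" by (simp add: content_real)
  finally have 1: "(\<integral>s. (\<integral>x. G x s \<partial>lborel) \<partial>lborel) = (\<integral>x. pd b f x \<partial>lborel)" .
  have "(\<integral>s. G x s \<partial>lborel) = f (x + 1 *\<^sub>R b) - f (x + 0 *\<^sub>R b)" for x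
  proof -
    have der: "((\<lambda>s. f (x + s *\<^sub>R b)) has_real_derivative pd b f (x + s *\<^sub>R b)) (at s)" for s
    proof -
      have "((\<lambda>s. f (x + s *\<^sub>R b)) has_derivative (\<lambda>h. pd (h *\<^sub>R b) f (x + s *\<^sub>R b))) (at s)"
        by (rule has_derivative_compose[where f="\<lambda>s. x + s *\<^sub>R b" and g=f, OF _ differentiable_has_pd[OF d]])
          (auto intro!: derivative_eq_intros)
      then show ?thesis
        unfolding has_field_derivative_def by (rule has_derivative_eq_rhs) (simp add: pd_scaleR[OF d] fun_eq_iff)
    qed
    have "(\<integral>s. indicator {0..1} s *\<^sub>R pd b f (x + s *\<^sub>R b) \<partial>lborel) = f (x + 1 *\<^sub>R b) - f (x + 0 *\<^sub>R b)"
      by (rule integral_FTC_Icc)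
        (auto simp: has_real_derivative_iff_has_vector_derivative[symmetric]
          intro!: has_field_derivative_at_within[OF der] continuous_on_compose2[OF c] continuous_intros)
    then show ?thesis by (simp add: G_def)
  qed
  then have "(\<integral>x. (\<integral>s. G x s \<partial>lborel) \<partial>lborel) = (\<integral>x. f (x + b) - f x \<partial>lborel)" by simp
  also have "\<dots> = (\<integral>x. f (x + b) \<partial>lborel) - (\<integral>x. f x \<partial>lborel)"
  proof (rule Bochner_Integration.integral_diff[OF _ intf])
    show "integrable lborel (\<lambda>x. f (x + b))"
    proof (rule integrable_compact_support)
      show "continuous_on UNIV (\<lambda>x. f (x + b))" by (auto intro!: continuous_on_compose2[OF cf] continuous_intros)
      show "compact ((\<lambda>x. x - b) ` K)" by (intro compact_continuous_image continuous_intros K)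
      show "f (x + b) = 0" if "x \<notin> (\<lambda>x. x - b) ` K" for x
        using K(2)[of "x + b"] that by (metis add_diff_cancel imageI)
    qed
  qed
  also have "\<dots> = 0" by (simp add: integral_translate[OF mf])
  finally have 2: "(\<integral>x. (\<integral>s. G x s \<partial>lborel) \<partial>lborel) = 0" .
  show ?thesis using lborel_pair.Fubini_integral[OF int] 1 2 by simp
qed

section \<open>The codifferential\<close>

lemma open_hyp_space: "open (hyp_space :: 'n::finite point set)"
  unfolding hyp_space_def by (intro open_Collect_less continuous_intros)

lemma linear_pd: "f differentiable (at x) \<Longrightarrow> linear (\<lambda>u. pd u f x)"
  by (rule has_derivative_linear[OF differentiable_has_pd])

lemma smooth_on_snd_powi: "smooth_on hyp_space (\<lambda>x. snd x powi a)"
  by (rule smooth_on_powi[OF open_hyp_space smooth_on_snd]) (simp add: hyp_space_def)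

lemma smooth_formD:
  assumes "smooth_form p \<omega>"
  shows "x \<in> hyp_space \<Longrightarrow> alternating p (\<omega> x)" "smooth_on hyp_space (\<lambda>x. \<omega> x v)"
  using assms by (auto simp: smooth_form_def)

lemma smooth_form_differentiable:
  assumes "smooth_form p \<omega>" "x \<in> hyp_space"
  shows "(\<lambda>x. \<omega> x v) differentiable (at x)"
  by (rule smooth_on_differentiable[OF smooth_formD(2)[OF assms(1)] assms(2)])

lemma smooth_form_ext_deriv:
  fixes \<omega> :: "'n::finite form"
  assumes "smooth_form p \<omega>"
  shows "smooth_form (Suc p) (ext_deriv p \<omega>)"
  unfolding smooth_form_def
proof (intro conjI ballI allI)
  fix x :: "'n point" assume x: "x \<in> hyp_space"
  show "alternating (Suc p) (ext_deriv p \<omega> x)"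
    unfolding ext_deriv_def[abs_def]
    by (intro alternating_wedge alternating_pd[OF open_hyp_space x] linear_pd smooth_formD[OF assms]
        smooth_form_differentiable[OF assms x])
next
  fix v
  show "smooth_on hyp_space (\<lambda>x. ext_deriv p \<omega> x v)"
    unfolding ext_deriv_def
    by (intro smooth_on_sum smooth_on_mult smooth_on_const smooth_on_pd smooth_formD[OF assms] open_hyp_space)
qed

text \<open>The exponents come from the metric. In degree p + 1 the inner product contributes
  y^(2p+2) and the volume y^(-n-1), which leaves y^(2p+1-n) under the derivative. The outer factor
  divides by the corresponding weight y^(2p-n-1) of degree p.\<close>

definition codifferential :: "nat \<Rightarrow> 'n::finite form \<Rightarrow> 'n form" where
  "codifferential p \<omega> x v = - (snd x powi (int CARD('n) + 1 - 2 * int p)) *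
     (\<Sum>b\<in>Basis. pd b (\<lambda>z. snd z powi (2 * int p + 1 - int CARD('n)) * \<omega> z (case_nat b v)) x)"

lemma smooth_form_codifferential:
  fixes \<omega> :: "'n::finite form"
  assumes "smooth_form (Suc p) \<omega>"
  shows "smooth_form p (codifferential p \<omega>)"
proof -
  let ?\<omega> = "\<lambda>b z v. snd z powi (2 * int p + 1 - int CARD('n)) * \<omega> z (case_nat b v)"
  have sm: "smooth_on hyp_space (\<lambda>z. ?\<omega> b z v)" for b v
    by (intro smooth_on_mult smooth_on_snd_powi smooth_formD[OF assms] open_hyp_space)
  show ?thesis
    unfolding smooth_form_def
  proof (intro conjI ballI allI)
    fix x :: "'n point" assume x: "x \<in> hyp_space"
    have "alternating p (?\<omega> b z)" if "z \<in> hyp_space" for b z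
      by (intro alternating_cmult alternating_contract smooth_formD[OF assms] that)
    then have "alternating p (\<lambda>v. pd b (\<lambda>z. ?\<omega> b z v) x)" for b
      by (rule alternating_pd[OF open_hyp_space x]) (assumption | rule smooth_on_differentiable[OF sm x])+
    then show "alternating p (codifferential p \<omega> x)"
      unfolding codifferential_def[abs_def] by (intro alternating_cmult alternating_sum)
  next
    fix v
    show "smooth_on hyp_space (\<lambda>x. codifferential p \<omega> x v)"
      unfolding codifferential_def
      by (intro smooth_on_sum smooth_on_mult smooth_on_minus smooth_on_snd_powi smooth_on_pd sm open_hyp_space)
  qed
qed

lemma form_inner_alternating:
  assumes "alternating p A" "alternating p B"
  shows "form_inner p x A B = snd x ^ (2 * p) * (\<Sum>e\<in>{..<p} \<rightarrow>\<^sub>E Basis. A e * B e) / fact p"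
  unfolding form_inner_def alternating_scale[OF assms(1)] alternating_scale[OF assms(2)] mult_2 power_add sum_distrib_left
  by (simp add: mult_ac)

lemma sum_PiE_omit:
  fixes B :: "'b set"
  assumes "i \<le> p"
  shows "(\<Sum>e\<in>{..<Suc p} \<rightarrow>\<^sub>E B. G (e i) (omit i e)) = (\<Sum>b\<in>B. \<Sum>w\<in>{..<p} \<rightarrow>\<^sub>E B. G b w)"
proof -
  define ins where "ins = (\<lambda>(b::'b, w::nat \<Rightarrow> 'b) j. if j < i then w j else if j = i then b else w (j - 1))"
  have "(\<Sum>e\<in>{..<Suc p} \<rightarrow>\<^sub>E B. G (e i) (omit i e)) = (\<Sum>q\<in>B \<times> ({..<p} \<rightarrow>\<^sub>E B). G (fst q) (snd q))"
  proof (rule sum.reindex_bij_witness[where i=ins and j="\<lambda>e. (e i, omit i e)"])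
    fix e assume e: "e \<in> {..<Suc p} \<rightarrow>\<^sub>E B"
    show "ins (e i, omit i e) = e" by (auto simp: ins_def omit_def fun_eq_iff)
    show "(e i, omit i e) \<in> B \<times> ({..<p} \<rightarrow>\<^sub>E B)"
      using e assms by (auto simp: omit_def PiE_iff extensional_def)
  next
    fix q assume q: "q \<in> B \<times> ({..<p} \<rightarrow>\<^sub>E B)"
    then obtain b w where bw: "q = (b, w)" "b \<in> B" "w \<in> {..<p} \<rightarrow>\<^sub>E B" by auto
    show "(ins q i, omit i (ins q)) = q" by (auto simp: bw ins_def omit_def fun_eq_iff)
    show "ins q \<in> {..<Suc p} \<rightarrow>\<^sub>E B"
      using bw assms by (auto simp: ins_def PiE_iff extensional_def)
  qed simp
  also have "\<dots> = (\<Sum>b\<in>B. \<Sum>w\<in>{..<p} \<rightarrow>\<^sub>E B. G b w)"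
    by (simp add: sum.cartesian_product case_prod_unfold)
  finally show ?thesis .
qed

text \<open>The zero extension is smooth on \<open>hyp_space\<close> and on the complement of K, and
  these two open sets cover everything.\<close>

lemma extend_by_zero:
  fixes h :: "'n::finite point \<Rightarrow> real"
  assumes h: "smooth_on hyp_space h" and K: "compact K" "K \<subseteq> hyp_space" "\<And>x. x \<in> hyp_space - K \<Longrightarrow> h x = 0"
  defines "h' \<equiv> (\<lambda>x. if x \<in> hyp_space then h x else 0)"
  shows "h' differentiable (at x)" "continuous_on UNIV h'" "pd b h' x = indicator hyp_space x * pd b h x"
    "continuous_on UNIV (pd b h')"
proof -
  have op: "open (- K)" using K by (simp add: compact_imp_closed open_Compl)
  have z: "h' x = 0" if "x \<in> - K" for x using that K by (auto simp: h'_def)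
  have U: "hyp_space \<union> - K = UNIV" using K by auto
  have sm: "smooth_on UNIV h'"
  proof -
    have 1: "smooth_on hyp_space h'"
      by (rule smooth_on_cong[OF open_hyp_space _ h]) (simp add: h'_def)
    have 2: "smooth_on (- K) h'"
      by (rule smooth_on_cong[OF op _ smooth_on_const[of _ 0]]) (simp add: z)
    have "smooth_on (\<Union>S\<in>{hyp_space, - K}. S) h'"
      by (rule smooth_on_UN) (use 1 2 op open_hyp_space in auto)
    then show ?thesis using U by simp
  qed
  show "h' differentiable (at x)" by (rule smooth_on_differentiable[OF sm]) simp
  show "continuous_on UNIV h'" by (rule smooth_on_continuous[OF sm])
  show "continuous_on UNIV (pd b h')" by (rule smooth_on_continuous[OF smooth_on_pd[OF sm]])
  show "pd b h' x = indicator hyp_space x * pd b h x"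
  proof (cases "x \<in> hyp_space")
    case True
    then show ?thesis using frechet_cong[OF open_hyp_space True, of h' h] by (simp add: h'_def)
  next
    case False
    then have "x \<in> - K" using K by auto
    from frechet_cong[OF op this, of h' "\<lambda>_. 0"] z False show ?thesis by simp
  qed
qed

lemma has_bochner_integral_pd_hyp:
  fixes h :: "'n::finite point \<Rightarrow> real"
  assumes "smooth_on hyp_space h" "compact K" "K \<subseteq> hyp_space" "\<And>x. x \<in> hyp_space - K \<Longrightarrow> h x = 0"
  shows "has_bochner_integral lborel (\<lambda>x. indicator hyp_space x * pd b h x) 0"
proof -
  let ?h = "\<lambda>x. if x \<in> hyp_space then h x else 0"
  note e = extend_by_zero[OF assms]
  have z: "?h x = 0" if "x \<notin> K" for x using that assms by auto
  have pz: "pd b ?h x = 0" if "x \<notin> K" for x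
  proof -
    have "pd b ?h x = pd b (\<lambda>_. 0) x"
      using frechet_cong[of "- K" x ?h "\<lambda>_. 0"] that z open_Compl[OF compact_imp_closed[OF assms(2)]] by simp
    then show ?thesis by simp
  qed
  have "integrable lborel (pd b ?h)"
    by (rule integrable_compact_support[OF e(4) assms(2) pz])
  moreover have "(\<integral>x. pd b ?h x \<partial>lborel) = 0"
    by (rule integral_pd_compact_support[OF e(1) e(4) assms(2) z])
  ultimately have "has_bochner_integral lborel (pd b ?h) 0" by (simp add: has_bochner_integral_iff)
  moreover have "pd b ?h = (\<lambda>x. indicator hyp_space x * pd b h x)" using e(3) by (intro ext)
  ultimately show ?thesis by simp
qed

lemma integrable_hyp:
  fixes h :: "'n::finite point \<Rightarrow> real"
  assumes "smooth_on hyp_space h" "compact K" "K \<subseteq> hyp_space" "\<And>x. x \<in> hyp_space - K \<Longrightarrow> h x = 0"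
  shows "integrable lborel (\<lambda>x. indicator hyp_space x * h x)"
proof -
  let ?h = "\<lambda>x. if x \<in> hyp_space then h x else 0"
  have "integrable lborel ?h"
    by (rule integrable_compact_support[OF extend_by_zero(2)[OF assms] assms(2)]) (use assms in auto)
  moreover have "?h = (\<lambda>x. indicator hyp_space x * h x)" by (auto simp: indicator_def)
  ultimately show ?thesis by simp
qed

text \<open>After the differentiated slot is moved to the front, all p + 1 terms of
  \<open>ext_deriv\<close> contribute the same sum. The factor p + 1 reduces the factorial of p + 1
  to that of p.\<close>

lemma ext_deriv_inner:
  fixes \<alpha> \<omega> :: "'n::finite form"
  assumes \<alpha>: "smooth_form p \<alpha>" and \<omega>: "smooth_form (Suc p) \<omega>" and x: "x \<in> hyp_space"
  shows "form_inner (Suc p) x (ext_deriv p \<alpha> x) (\<omega> x) =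
    snd x ^ (2 * p + 2) * (\<Sum>b\<in>Basis. \<Sum>w\<in>{..<p} \<rightarrow>\<^sub>E Basis. pd b (\<lambda>y. \<alpha> y w) x * \<omega> x (case_nat b w)) / fact p"
proof -
  note A\<omega> = smooth_formD(1)[OF \<omega> x]
  define G where "G b w = pd b (\<lambda>y. \<alpha> y w) x * \<omega> x (case_nat b w)" for b w
  let ?P = "{..<Suc p} \<rightarrow>\<^sub>E (Basis :: 'n point set)"
  have "(\<Sum>e\<in>?P. ext_deriv p \<alpha> x e * \<omega> x e) = (\<Sum>e\<in>?P. \<Sum>i\<le>p. G (e i) (omit i e))"
  proof (rule sum.cong[OF refl])
    fix e
    have "(- 1) ^ i * pd (e i) (\<lambda>y. \<alpha> y (omit i e)) x * \<omega> x e = G (e i) (omit i e)" if "i \<in> {..p}" for i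
      using alternating_move_front[OF A\<omega>, of i e] that by (simp add: G_def)
    then show "ext_deriv p \<alpha> x e * \<omega> x e = (\<Sum>i\<le>p. G (e i) (omit i e))"
      by (simp add: ext_deriv_def sum_distrib_right)
  qed
  also have "\<dots> = (\<Sum>i\<le>p. \<Sum>e\<in>?P. G (e i) (omit i e))" by (rule sum.swap)
  also have "\<dots> = (\<Sum>i\<le>p. \<Sum>b\<in>Basis. \<Sum>w\<in>{..<p} \<rightarrow>\<^sub>E Basis. G b w)"
    by (rule sum.cong[OF refl]) (rule sum_PiE_omit, simp)
  also have "\<dots> = (real p + 1) * (\<Sum>b\<in>Basis. \<Sum>w\<in>{..<p} \<rightarrow>\<^sub>E Basis. G b w)" by simp
  finally have e: "(\<Sum>e\<in>?P. ext_deriv p \<alpha> x e * \<omega> x e) = (real p + 1) * (\<Sum>b\<in>Basis. \<Sum>w\<in>{..<p} \<rightarrow>\<^sub>E Basis. G b w)" .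
  have f: "fact (Suc p) = (real p + 1) * fact p" by (simp add: algebra_simps)
  have gen: "a * (r * s) / (r * f) = a * s / f" if "r \<noteq> 0" for a r s f :: real using that by simp
  have p2: "2 * Suc p = 2 * p + 2" by simp
  show ?thesis
    unfolding form_inner_alternating[OF smooth_formD(1)[OF smooth_form_ext_deriv[OF \<alpha>] x] A\<omega>] e G_def[symmetric] f p2
    by (rule gen) simp
qed

text \<open>In flat coordinates the integrand f1 of the left side and the integrand f2 = g2 of the
  right side differ by a sum of partial derivatives of the compactly supported functions h b w, as
  the product rule shows in \<open>e3\<close>.\<close>

theorem is_codiff_codifferential:
  fixes \<omega> :: "'n::finite form"
  assumes \<omega>: "smooth_form (Suc p) \<omega>"
  shows "is_codiff p \<omega> (codifferential p \<omega>)"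
  unfolding is_codiff_def
proof (intro conjI allI impI)
  show "smooth_form p (codifferential p \<omega>)" by (rule smooth_form_codifferential[OF \<omega>])
  fix \<alpha> :: "'n form" assume "smooth_form p \<alpha> \<and> compactly_supported \<alpha>"
  then obtain K where \<alpha>: "smooth_form p \<alpha>" and K: "compact K" "K \<subseteq> hyp_space" "vanishes_on (hyp_space - K) \<alpha>"
    by (auto simp: compactly_supported_def)
  define N where "N = int CARD('n)"
  define Y where "Y x = snd x powi (2 * int p + 1 - N)" for x :: "'n point"
  define h where "h b w x = \<alpha> x w * (Y x * \<omega> x (case_nat b w))" for b w x
  let ?P = "{..<p} \<rightarrow>\<^sub>E (Basis :: 'n point set)"
  have smY: "smooth_on hyp_space (\<lambda>x. Y x * \<omega> x v)" for v
    unfolding Y_def by (intro smooth_on_mult smooth_on_snd_powi smooth_formD[OF \<omega>] open_hyp_space)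
  have smh: "smooth_on hyp_space (h b w)" for b w
    unfolding h_def by (intro smooth_on_mult smY smooth_formD[OF \<alpha>] open_hyp_space)
  have h0: "h b w x = 0" if "x \<in> hyp_space - K" for b w x
    using K(3) that by (simp add: h_def vanishes_on_def)
  define f1 where "f1 x = form_inner (Suc p) x (ext_deriv p \<alpha> x) (\<omega> x) / snd x ^ (CARD('n) + 1)" for x
  define f2 where "f2 x = form_inner p x (\<alpha> x) (codifferential p \<omega> x) / snd x ^ (CARD('n) + 1)" for x
  define g2 where "g2 x = - (\<Sum>b\<in>Basis. \<Sum>w\<in>?P. \<alpha> x w * pd b (\<lambda>z. Y z * \<omega> z (case_nat b w)) x) / fact p" for x
  have e1: "f1 x = (\<Sum>b\<in>Basis. \<Sum>w\<in>?P. pd b (\<lambda>y. \<alpha> y w) x * (Y x * \<omega> x (case_nat b w))) / fact p" if x: "x \<in> hyp_space" for x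
  proof -
    have y: "snd x > 0" using x by (simp add: hyp_space_def)
    have "Y x * snd x ^ (CARD('n) + 1) = snd x powi (2 * int p + 1 - N) * snd x powi (int (CARD('n) + 1))"
      by (simp only: Y_def power_int_of_nat)
    also have "\<dots> = snd x powi (int (2 * p + 2))"
      using y by (subst power_int_add[symmetric]) (auto simp: N_def algebra_simps)
    finally have Y: "snd x ^ (2 * p + 2) / snd x ^ (CARD('n) + 1) = Y x"
      using y by (simp only: power_int_of_nat) (simp add: field_simps)
    have "f1 x = (snd x ^ (2 * p + 2) / snd x ^ (CARD('n) + 1)) * (\<Sum>b\<in>Basis. \<Sum>w\<in>?P. pd b (\<lambda>y. \<alpha> y w) x * \<omega> x (case_nat b w)) / fact p"
    proof -
      have gen: "a * s / f / d = a / d * s / f" for a s f d :: real by simp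
      show ?thesis unfolding f1_def ext_deriv_inner[OF \<alpha> \<omega> x] by (rule gen)
    qed
    then show ?thesis unfolding Y by (simp add: sum_distrib_left mult_ac)
  qed
  have e2: "f2 x = g2 x" if x: "x \<in> hyp_space" for x
  proof -
    have y: "snd x > 0" using x by (simp add: hyp_space_def)
    have "snd x ^ (2 * p) * snd x powi (N + 1 - 2 * int p) = snd x powi (int (2 * p)) * snd x powi (N + 1 - 2 * int p)"
      by (simp only: power_int_of_nat)
    also have "\<dots> = snd x powi (int (CARD('n) + 1))"
      using y by (subst power_int_add[symmetric]) (auto simp: N_def algebra_simps)
    finally have yy: "snd x ^ (2 * p) * snd x powi (N + 1 - 2 * int p) = snd x ^ (CARD('n) + 1)" by (simp only: power_int_of_nat)
    define c where "c w = (\<Sum>b\<in>Basis. pd b (\<lambda>z. Y z * \<omega> z (case_nat b w)) x)" for w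
    have codifferential: "codifferential p \<omega> x w = - (snd x powi (N + 1 - 2 * int p)) * c w" for w
      by (simp add: codifferential_def c_def Y_def N_def)
    have "f2 x = snd x ^ (2 * p) * (\<Sum>w\<in>?P. \<alpha> x w * (- (snd x powi (N + 1 - 2 * int p)) * c w)) / fact p / snd x ^ (CARD('n) + 1)"
      unfolding f2_def form_inner_alternating[OF smooth_formD(1)[OF \<alpha> x] smooth_formD(1)[OF smooth_form_codifferential[OF \<omega>] x]] codifferential ..
    also have "snd x ^ (2 * p) * (\<Sum>w\<in>?P. \<alpha> x w * (- (snd x powi (N + 1 - 2 * int p)) * c w)) =
       - (snd x ^ (2 * p) * snd x powi (N + 1 - 2 * int p)) * (\<Sum>w\<in>?P. \<alpha> x w * c w)"
    proof -
      have gen: "a * (\<Sum>w\<in>?P. f w * (- b * c w)) = - (a * b) * (\<Sum>w\<in>?P. f w * c w)" for a b :: real and f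
        unfolding sum_distrib_left by (rule sum.cong) (simp_all add: algebra_simps)
      show ?thesis by (rule gen)
    qed
    also have "\<dots> / fact p / snd x ^ (CARD('n) + 1) = - (\<Sum>w\<in>?P. \<alpha> x w * c w) / fact p"
      unfolding yy using y by simp
    also have "(\<Sum>w\<in>?P. \<alpha> x w * c w) = (\<Sum>b\<in>Basis. \<Sum>w\<in>?P. \<alpha> x w * pd b (\<lambda>z. Y z * \<omega> z (case_nat b w)) x)"
      unfolding c_def sum_distrib_left by (rule sum.swap)
    finally show ?thesis by (simp add: g2_def)
  qed
  have ph: "pd b (h b w) x = \<alpha> x w * pd b (\<lambda>z. Y z * \<omega> z (case_nat b w)) x + pd b (\<lambda>y. \<alpha> y w) x * (Y x * \<omega> x (case_nat b w))"
    if x: "x \<in> hyp_space" for b w x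
    unfolding h_def by (rule pd_mult) (rule smooth_form_differentiable[OF \<alpha> x], rule smooth_on_differentiable[OF smY x])
  have e3: "f1 x = g2 x + (\<Sum>b\<in>Basis. \<Sum>w\<in>?P. pd b (h b w) x) / fact p" if x: "x \<in> hyp_space" for x
    unfolding e1[OF x] g2_def ph[OF x] sum.distrib by (simp add: add_divide_distrib)
  have "integrable lborel (\<lambda>x. indicator hyp_space x * g2 x)"
  proof (rule integrable_hyp[OF _ K(1,2)])
    show "smooth_on hyp_space g2"
      unfolding g2_def[abs_def] divide_inverse
      by (intro smooth_on_mult smooth_on_minus smooth_on_sum smooth_on_pd smY smooth_formD[OF \<alpha>] smooth_on_const open_hyp_space)
    show "g2 x = 0" if "x \<in> hyp_space - K" for x using K(3) that by (simp add: g2_def vanishes_on_def)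
  qed
  then have "has_bochner_integral lborel (\<lambda>x. indicator hyp_space x * g2 x) (\<integral>x. indicator hyp_space x * g2 x \<partial>lborel)"
    by (rule has_bochner_integral_integrable)
  moreover have "has_bochner_integral lborel (\<lambda>x. (\<Sum>b\<in>Basis. \<Sum>w\<in>?P. indicator hyp_space x * pd b (h b w) x)) (\<Sum>b\<in>(Basis::'n point set). \<Sum>w\<in>?P. 0)"
    by (intro has_bochner_integral_sum has_bochner_integral_pd_hyp[OF smh K(1,2) h0]) auto
  ultimately have "has_bochner_integral lborel (\<lambda>x. indicator hyp_space x * g2 x + (\<Sum>b\<in>Basis. \<Sum>w\<in>?P. indicator hyp_space x * pd b (h b w) x) / fact p)
      ((\<integral>x. indicator hyp_space x * g2 x \<partial>lborel) + (\<Sum>b\<in>(Basis::'n point set). \<Sum>w\<in>?P. 0) / fact p)"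
    by (intro has_bochner_integral_add has_bochner_integral_divide_zero)
  moreover have "(\<lambda>x. indicator hyp_space x * g2 x + (\<Sum>b\<in>Basis. \<Sum>w\<in>?P. indicator hyp_space x * pd b (h b w) x) / fact p)
      = (\<lambda>x. indicator hyp_space x *\<^sub>R f1 x)"
    by (auto simp: indicator_def e3 fun_eq_iff)
  ultimately have "has_bochner_integral lborel (\<lambda>x. indicator hyp_space x *\<^sub>R f1 x) (\<integral>x. indicator hyp_space x * g2 x \<partial>lborel)"
    by simp
  then have "(\<integral>x. indicator hyp_space x *\<^sub>R f1 x \<partial>lborel) = (\<integral>x. indicator hyp_space x * g2 x \<partial>lborel)"
    by (rule has_bochner_integral_integral_eq)
  also have "(\<lambda>x. indicator hyp_space x * g2 x) = (\<lambda>x. indicator hyp_space x *\<^sub>R f2 x)"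
    using e2 by (auto simp: indicator_def fun_eq_iff)
  finally show "form_L2_inner (Suc p) (ext_deriv p \<alpha>) \<omega> = form_L2_inner p \<alpha> (codifferential p \<omega>)"
    by (simp only: form_L2_inner_def set_lebesgue_integral_def f1_def f2_def)
qed

section \<open>Coclosed forms\<close>

lemma omit_case_nat:
  "omit 0 (case_nat b v) = v" "omit (Suc i) (case_nat b v) = case_nat b (omit i v)"
  by (auto simp: omit_def fun_eq_iff split: nat.split)

lemma comp_case_nat: "(\<lambda>i. f (case_nat b v i)) = case_nat (f b) (\<lambda>i. f (v i))"
  by (auto simp: fun_eq_iff split: nat.split)

lemma comp_omit: "(\<lambda>i. f (omit j v i)) = omit j (\<lambda>i. f (v i))"
  by (auto simp: fun_eq_iff omit_def)

lemma alternating_linear_front: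
  assumes "alternating (Suc p) A"
  shows "linear (\<lambda>u. A (case_nat u w))"
proof -
  have "(case_nat 0 w)(0 := u) = case_nat u w" for u by (auto simp: fun_eq_iff split: nat.split)
  then show ?thesis using alternating_linear[OF assms, of 0 "case_nat 0 w"] by simp
qed

lemma alternating_front_swap:
  assumes "alternating (Suc (Suc p)) A"
  shows "A (case_nat u (case_nat w v)) = - A (case_nat w (case_nat u v))"
proof -
  have "(case_nat w (case_nat u v))(0 := case_nat w (case_nat u v) 1, 1 := case_nat w (case_nat u v) 0) = case_nat u (case_nat w v)"
    by (auto simp: fun_eq_iff split: nat.split)
  then show ?thesis using alternating_swap[OF assms, of 0 1 "case_nat w (case_nat u v)"] by simp
qed

lemma sum_Basis_inner_linear:
  fixes L :: "'a::euclidean_space \<Rightarrow> real"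
  assumes "linear L"
  shows "(\<Sum>i\<in>Basis. (\<xi> \<bullet> i) * L i) = L \<xi>"
proof -
  have "L \<xi> = L (\<Sum>i\<in>Basis. (\<xi> \<bullet> i) *\<^sub>R i)" by (simp add: euclidean_representation)
  then show ?thesis by (simp add: linear_sum[OF assms] linear_scale[OF assms])
qed

lemma sum_Basis_point:
  fixes f :: "'n::finite point \<Rightarrow> real"
  shows "(\<Sum>b\<in>Basis. f b) = (\<Sum>i\<in>Basis. f (i, 0)) + f (0, 1)"
proof -
  have "inj_on (\<lambda>u. (u::real^'n, 0::real)) Basis" "inj_on (\<lambda>u. (0::real^'n, u::real)) Basis"
    by (auto intro!: inj_onI)
  then show ?thesis
    unfolding Basis_prod_def
    by (subst sum.union_disjoint) (auto simp: sum.reindex)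
qed

lemma frechet_cong_hyp:
  fixes f g :: "'n::finite point \<Rightarrow> real"
  assumes "x \<in> hyp_space" "\<And>y. y \<in> hyp_space \<Longrightarrow> f y = g y"
  shows "pd v f x = pd v g x"
  using frechet_cong[OF open_hyp_space assms] by simp

lemma codifferential_cong:
  fixes \<omega> \<eta> :: "'n::finite form"
  assumes "x \<in> hyp_space" "\<And>y v. y \<in> hyp_space \<Longrightarrow> \<omega> y v = \<eta> y v"
  shows "codifferential p \<omega> x v = codifferential p \<eta> x v"
  unfolding codifferential_def by (intro arg_cong2[where f="(*)"] refl sum.cong frechet_cong_hyp[OF assms(1)]) (simp add: assms(2))

lemma ext_deriv_cong:
  fixes \<omega> \<eta> :: "'n::finite form"
  assumes "x \<in> hyp_space" "\<And>y v. y \<in> hyp_space \<Longrightarrow> \<omega> y v = \<eta> y v"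
  shows "ext_deriv p \<omega> x v = ext_deriv p \<eta> x v"
  unfolding ext_deriv_def by (intro arg_cong2[where f="(*)"] refl sum.cong frechet_cong_hyp[OF assms(1)]) (simp add: assms(2))

lemma affine_derivative:
  fixes L :: "real^'n \<Rightarrow> real" and a :: "real^'n"
  assumes "linear L"
  shows "(\<lambda>z::(real^'n) \<times> real. L (fst z - a)) differentiable (at x)" "pd u (\<lambda>z::(real^'n) \<times> real. L (fst z - a)) x = L (fst u)"
    "smooth_on S (\<lambda>z::(real^'n) \<times> real. L (fst z - a))"
proof -
  have bl: "bounded_linear (\<lambda>z::(real^'n) \<times> real. L (fst z))"
    by (rule bounded_linear_compose[OF linear_conv_bounded_linear[THEN iffD1, OF assms] bounded_linear_fst])
  have eq: "(\<lambda>z::(real^'n) \<times> real. L (fst z - a)) = (\<lambda>z. L (fst z) - L a)"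
    by (simp add: linear_diff[OF assms])
  have "((\<lambda>z::(real^'n) \<times> real. L (fst z) - L a) has_derivative (\<lambda>u. L (fst u) - 0)) (at x)"
    by (rule has_derivative_diff[OF bounded_linear_imp_has_derivative[OF bl] has_derivative_const])
  then have h: "((\<lambda>z::(real^'n) \<times> real. L (fst z - a)) has_derivative (\<lambda>u. L (fst u))) (at x)" unfolding eq by simp
  show "(\<lambda>z::(real^'n) \<times> real. L (fst z - a)) differentiable (at x)" by (rule differentiableI[OF h])
  show "pd u (\<lambda>z::(real^'n) \<times> real. L (fst z - a)) x = L (fst u)" by (rule pd_eq[OF h])
  have "smooth_on UNIV (\<lambda>z::(real^'n) \<times> real. L (fst z) - L a)"
    by (intro smooth_on_diff smooth_on_bounded_linear[OF bl] smooth_on_const open_UNIV)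
  then show "smooth_on S (\<lambda>z::(real^'n) \<times> real. L (fst z - a))" unfolding eq by (rule smooth_on_subset) simp
qed

lemma pd_horizontal_powi:
  assumes "x \<in> hyp_space"
  shows "pd (i, 0) (\<lambda>z. snd z powi c) x = 0"
proof -
  have "((\<lambda>z. snd z powi c) has_derivative (\<lambda>v. snd v * (of_int c * snd x powi (c - 1)))) (at x)"
    by (rule has_derivative_power_int[THEN has_derivative_eq_rhs, OF _ has_derivative_snd[OF has_derivative_ident]])
      (use assms in \<open>auto simp: hyp_space_def\<close>)
  then show ?thesis by (simp add: pd_eq)
qed

lemma powi_differentiable:
  assumes "x \<in> hyp_space" shows "(\<lambda>z. snd z powi c) differentiable (at x)"
  by (rule smooth_on_differentiable[OF smooth_on_snd_powi assms])

text \<open>Write \<xi> for fst x - a. The assumptions say that the horizontal gradients of f and g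
  are g \<xi> and g2 \<xi>, as for functions of |\<xi>| and the height. \<open>\<beta>\<close> is
  the contraction of A with \<xi>, so \<omega> has no vertical component.\<close>

locale coclosed_ansatz =
  fixes a :: "real^'n::finite" and A :: "(nat \<Rightarrow> real^'n) \<Rightarrow> real" and p :: nat
    and f g g2 :: "'n point \<Rightarrow> real"
  assumes A: "alternating (Suc p) A"
    and sf: "smooth_on hyp_space f" and sg: "smooth_on hyp_space g"
    and fg: "\<And>x i. x \<in> hyp_space \<Longrightarrow> pd (i, 0) f x = g x * ((fst x - a) \<bullet> i)"
    and gg: "\<And>x i. x \<in> hyp_space \<Longrightarrow> pd (i, 0) g x = g2 x * ((fst x - a) \<bullet> i)"
begin

definition \<beta> :: "'n form" where "\<beta> x v = A (case_nat (fst x - a) (\<lambda>i. fst (v i)))"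
definition \<omega> :: "'n form" where "\<omega> x v = f x * \<beta> x v"

lemma \<beta>_deriv:
  "(\<lambda>x. \<beta> x v) differentiable (at x)" "pd u (\<lambda>x. \<beta> x v) x = A (case_nat (fst u) (\<lambda>i. fst (v i)))"
  "smooth_on S (\<lambda>x. \<beta> x v)"
  unfolding \<beta>_def by (rule affine_derivative[OF alternating_linear_front[OF A]])+

lemma alternating_\<omega>: "alternating p (\<omega> x)"
  unfolding \<omega>_def[abs_def] \<beta>_def[abs_def]
  by (intro alternating_cmult alternating_compose_linear[OF alternating_contract[OF A]] linear_fst)

lemma smooth_form_\<omega>: "smooth_form p \<omega>"
  unfolding smooth_form_def
  by (intro conjI ballI allI alternating_\<omega>) (simp add: \<omega>_def smooth_on_mult open_hyp_space sf \<beta>_deriv(3))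

lemma df: "x \<in> hyp_space \<Longrightarrow> f differentiable (at x)" by (rule smooth_on_differentiable[OF sf])
lemma dg: "x \<in> hyp_space \<Longrightarrow> g differentiable (at x)" by (rule smooth_on_differentiable[OF sg])
lemma dpf: "x \<in> hyp_space \<Longrightarrow> pd v f differentiable (at x)" by (rule smooth_on_differentiable[OF smooth_on_pd[OF sf]])

lemma pd_\<omega>: "x \<in> hyp_space \<Longrightarrow> pd u (\<lambda>x. \<omega> x v) x = f x * A (case_nat (fst u) (\<lambda>i. fst (v i))) + pd u f x * \<beta> x v"
  unfolding \<omega>_def by (simp add: pd_mult df \<beta>_deriv)

lemma sum_contract: "(\<Sum>i\<in>Basis. (\<xi> \<bullet> i) * A (case_nat i w)) = A (case_nat \<xi> w)"
  by (rule sum_Basis_inner_linear[OF alternating_linear_front[OF A]])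

text \<open>The divergence produces f A (i, i, ...) and g A (\<xi>, \<xi>, ...), and both vanish
  because A is alternating; a vertical argument is killed as well.\<close>

lemma coclosed:
  assumes p: "p = Suc q" and x: "x \<in> hyp_space"
  shows "codifferential q \<omega> x v = 0"
proof -
  define Y where "Y z = snd z powi (2 * int q + 1 - int CARD('n))" for z :: "'n point"
  have AA: "A (case_nat u (case_nat u w)) = 0" for u w
    by (rule alternating_zero[OF A, of 0 1]) (use p in auto)
  have A0: "A (case_nat u (case_nat 0 w)) = 0" for u w
    using linear_0[OF alternating_linear_front[OF A, of "case_nat u w"]] alternating_front_swap[OF A[unfolded p], of u 0 w]
    by simp
  have Yd: "Y differentiable (at x)" unfolding Y_def by (rule powi_differentiable[OF x])
  have Y0: "pd (i, 0) Y x = 0" for i unfolding Y_def by (rule pd_horizontal_powi[OF x])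
  have \<omega>d: "(\<lambda>z. \<omega> z w) differentiable (at x)" for w by (rule smooth_form_differentiable[OF smooth_form_\<omega> x])
  have h: "pd (i, 0) (\<lambda>z. Y z * \<omega> z (case_nat (i, 0) v)) x = (Y x * g x) * (((fst x - a) \<bullet> i) * A (case_nat (fst x - a) (case_nat i (\<lambda>i. fst (v i)))))" for i
    by (simp add: pd_mult Yd Y0 \<omega>d pd_\<omega>[OF x] comp_case_nat[where f=fst] AA fg[OF x] \<beta>_def)
  have v: "(\<lambda>z. Y z * \<omega> z (case_nat (0, 1) v)) = (\<lambda>_. 0)"
    by (simp add: \<omega>_def \<beta>_def comp_case_nat[where f=fst] A0)
  have lin: "linear (\<lambda>i. A (case_nat \<xi> (case_nat i w)))" for \<xi> w
    unfolding alternating_front_swap[OF A[unfolded p], of \<xi>]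
    by (intro linear_compose_neg alternating_linear_front[OF A])
  have "(\<Sum>b\<in>Basis. pd b (\<lambda>z. Y z * \<omega> z (case_nat b v)) x) = (Y x * g x) * A (case_nat (fst x - a) (case_nat (fst x - a) (\<lambda>i. fst (v i))))"
    unfolding sum_Basis_point v h sum_distrib_left[symmetric] sum_Basis_inner_linear[OF lin] by simp
  then show ?thesis unfolding codifferential_def Y_def[symmetric] by (simp add: AA)
qed

text \<open>At fixed height \<omega> is coclosed on R^n, so horizontally the operator is minus the
  flat Laplacian of f \<beta>. The Laplacian of f is g2 |\<xi>|^2 + n g. As \<beta> is linear in
  \<xi>, the mixed term 2 grad f . grad \<beta> is 2 g \<beta>. This is the origin of n + 2.\<close>

lemma laplacian:
  assumes x: "x \<in> hyp_space"
  defines "Y \<equiv> (\<lambda>z::'n point. snd z powi (2 * int p + 1 - int CARD('n)))" and "\<xi> \<equiv> fst x - a"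
  shows "codifferential p (ext_deriv p \<omega>) x v = - (snd x powi (int CARD('n) + 1 - 2 * int p)) *
    (Y x * (g2 x * (\<xi> \<bullet> \<xi>) + (real CARD('n) + 2) * g x) + pd (0, 1) (\<lambda>z. Y z * pd (0, 1) f z) x) * \<beta> x v"
proof -
  let ?v = "\<lambda>i. fst (v i)"
  have Yd: "Y differentiable (at x)" unfolding Y_def by (rule powi_differentiable[OF x])
  have Y0: "pd (i, 0) Y x = 0" for i unfolding Y_def by (rule pd_horizontal_powi[OF x])
  \<comment> \<open>With b in the first slot, \<open>ext_deriv\<close> splits into the derivative
    along b and those along the v j. The latter contain p further copies of f A (b, v), hence the
    factor p + 1.\<close>
  have dw: "ext_deriv p \<omega> z (case_nat b v) = (real p + 1) * (f z * A (case_nat (fst b) ?v)) + pd b f z * \<beta> z v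
      - (\<Sum>j<p. (- 1) ^ j * (pd (v j) f z * A (case_nat (fst z - a) (case_nat (fst b) (omit j ?v)))))"
    if z: "z \<in> hyp_space" for z b
  proof -
    have "ext_deriv p \<omega> z (case_nat b v) = f z * A (case_nat (fst b) ?v) + pd b f z * \<beta> z v
      - (\<Sum>j<p. (- 1) ^ j * (f z * A (case_nat (fst (v j)) (case_nat (fst b) (omit j ?v))) + pd (v j) f z * A (case_nat (fst z - a) (case_nat (fst b) (omit j ?v)))))"
    proof (cases p)
      case 0
      then show ?thesis by (simp add: ext_deriv_def omit_case_nat pd_\<omega>[OF z])
    next
      case (Suc q)
      have "ext_deriv p \<omega> z (case_nat b v) = pd b (\<lambda>y. \<omega> y v) z - (\<Sum>j\<le>q. (- 1) ^ j * pd (v j) (\<lambda>y. \<omega> y (case_nat b (omit j v))) z)"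
        unfolding ext_deriv_def Suc sum.atMost_Suc_shift by (simp add: omit_case_nat sum_negf)
      then show ?thesis
        unfolding pd_\<omega>[OF z] \<beta>_def comp_case_nat[where f=fst] comp_omit[where f=fst] Suc lessThan_Suc_atMost .
    qed
    moreover have "(- 1) ^ j * A (case_nat (fst (v j)) (case_nat (fst b) (omit j ?v))) = - A (case_nat (fst b) ?v)" if "j < p" for j
    proof -
      obtain q where q: "p = Suc q" using \<open>j < p\<close> by (cases p) auto
      have alt: "alternating (Suc q) (\<lambda>w. A (case_nat (fst b) w))"
        using alternating_contract[OF A] q by simp
      have "A (case_nat (fst (v j)) (case_nat (fst b) (omit j ?v))) = - A (case_nat (fst b) (case_nat (?v j) (omit j ?v)))"
        by (rule alternating_front_swap[OF A[unfolded q]])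
      also have "A (case_nat (fst b) (case_nat (?v j) (omit j ?v))) = (- 1) ^ j * A (case_nat (fst b) ?v)"
        by (rule alternating_move_front[OF alt]) (use \<open>j < p\<close> q in simp)
      finally show ?thesis by simp
    qed
    then have c: "(\<Sum>j<p. f z * ((- 1) ^ j * A (case_nat (fst (v j)) (case_nat (fst b) (omit j ?v))))) = - (real p * (f z * A (case_nat (fst b) ?v)))"
      by simp
    have "(\<Sum>j<p. (- 1) ^ j * (f z * A (case_nat (fst (v j)) (case_nat (fst b) (omit j ?v))) + pd (v j) f z * A (case_nat (fst z - a) (case_nat (fst b) (omit j ?v)))))
      = (\<Sum>j<p. f z * ((- 1) ^ j * A (case_nat (fst (v j)) (case_nat (fst b) (omit j ?v)))))
       + (\<Sum>j<p. (- 1) ^ j * (pd (v j) f z * A (case_nat (fst z - a) (case_nat (fst b) (omit j ?v)))))"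
      unfolding sum.distrib[symmetric] by (rule sum.cong) (simp_all add: algebra_simps)
    moreover have "c + x - (- (r * c) + t) = (r + 1) * c + x - t" for c x r t :: real by (simp add: algebra_simps)
    ultimately show ?thesis unfolding c by presburger
  qed
  have lin2: "linear (\<lambda>i. A (case_nat u (case_nat i w)))" if pos: "p > 0" for u w
  proof -
    obtain q where q: "p = Suc q" using pos by (cases p) auto
    show ?thesis
      unfolding alternating_front_swap[OF A[unfolded q], of u]
      by (intro linear_compose_neg alternating_linear_front[OF A])
  qed
  have AA: "A (case_nat u (case_nat u w)) = 0" if "p > 0" for u w
    by (rule alternating_zero[OF A, of 0 1]) (use that in auto)
  have A0: "A (case_nat 0 w) = 0" for w by (rule linear_0[OF alternating_linear_front[OF A]])
  have A00: "A (case_nat u (case_nat 0 w)) = 0" if "p > 0" for u w by (rule linear_0[OF lin2[OF that]])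
  have dA: "(\<lambda>z. A (case_nat (fst z - a) w)) differentiable (at x)"
    "pd u (\<lambda>z. A (case_nat (fst z - a) w)) x = A (case_nat (fst u) w)" for w and u :: "'n point"
    by (rule affine_derivative[OF alternating_linear_front[OF A]])+
  have vert: "pd (0, 1) (\<lambda>z. Y z * ext_deriv p \<omega> z (case_nat (0, 1) v)) x = pd (0, 1) (\<lambda>z. Y z * pd (0, 1) f z) x * \<beta> x v"
  proof -
    have "ext_deriv p \<omega> z (case_nat (0, 1) v) = pd (0, 1) f z * \<beta> z v" if "z \<in> hyp_space" for z
    proof -
      have "(\<Sum>j<p. (- 1) ^ j * (pd (v j) f z * A (case_nat (fst z - a) (case_nat 0 (omit j ?v))))) = 0"
        by (rule sum.neutral) (auto simp: A00)
      then show ?thesis unfolding dw[OF that] fst_conv A0 by simp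
    qed
    then have "pd (0, 1) (\<lambda>z. Y z * ext_deriv p \<omega> z (case_nat (0, 1) v)) x = pd (0, 1) (\<lambda>z. (Y z * pd (0, 1) f z) * \<beta> z v) x"
      by (intro frechet_cong_hyp[OF x]) simp
    also have "\<dots> = (Y x * pd (0, 1) f x) * A (case_nat 0 ?v) + pd (0, 1) (\<lambda>z. Y z * pd (0, 1) f z) x * \<beta> x v"
      using differentiable_mult[OF Yd dpf[OF x, of "(0, 1)"]] by (subst pd_mult) (simp_all add: \<beta>_deriv)
    finally show ?thesis by (simp add: A0)
  qed
  have hor: "pd (i, 0) (\<lambda>z. Y z * ext_deriv p \<omega> z (case_nat (i, 0) v)) x = Y x *
      ((real p + 2) * g x * ((\<xi> \<bullet> i) * A (case_nat i ?v)) + (g2 x * ((\<xi> \<bullet> i) * (\<xi> \<bullet> i)) + g x * (i \<bullet> i)) * \<beta> x v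
       - (\<Sum>j<p. (- 1) ^ j * (pd (v j) g x * ((\<xi> \<bullet> i) * A (case_nat \<xi> (case_nat i (omit j ?v))))
            + g x * ((fst (v j) \<bullet> i) * A (case_nat \<xi> (case_nat i (omit j ?v)))))))" for i
  proof -
    have li: "linear (\<lambda>u::real^'n. u \<bullet> i)" by (simp add: linear_iff inner_left_distrib)
    define E where "E z = (real p + 1) * (f z * A (case_nat i ?v)) + (g z * ((fst z - a) \<bullet> i)) * \<beta> z v
      - (\<Sum>j<p. (- 1) ^ j * (pd (v j) f z * A (case_nat (fst z - a) (case_nat i (omit j ?v)))))" for z
    have h0: "pd (i, 0) (\<lambda>z. Y z * ext_deriv p \<omega> z (case_nat (i, 0) v)) x = pd (i, 0) (\<lambda>z. Y z * E z) x"
      by (rule frechet_cong_hyp[OF x]) (simp add: dw E_def fg)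
    \<comment> \<open>The two derivatives are exchanged so that the horizontal one acts on f first,
      where \<open>fg\<close> evaluates it.\<close>
    have pdvf: "pd (i, 0) (pd (v j) f) x = pd (v j) g x * (\<xi> \<bullet> i) + g x * (fst (v j) \<bullet> i)" for j
    proof -
      have "pd (i, 0) (pd (v j) f) x = pd (v j) (pd (i, 0) f) x"
        by (rule pd_symmetric[OF open_hyp_space sf x])
      also have "\<dots> = pd (v j) (\<lambda>z. g z * ((fst z - a) \<bullet> i)) x"
        by (rule frechet_cong_hyp[OF x]) (rule fg)
      also have "\<dots> = g x * (fst (v j) \<bullet> i) + pd (v j) g x * (\<xi> \<bullet> i)"
        by (subst pd_mult) (simp_all add: dg[OF x] affine_derivative[OF li] \<xi>_def)
      finally show ?thesis by simp
    qed
    define T1 T2 T3 where "T1 = (\<lambda>z. (real p + 1) * (f z * A (case_nat i ?v)))"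
      and "T2 = (\<lambda>z. (g z * ((fst z - a) \<bullet> i)) * \<beta> z v)"
      and "T3 = (\<lambda>z. \<Sum>j<p. (- 1) ^ j * (pd (v j) f z * A (case_nat (fst z - a) (case_nat i (omit j ?v)))))"
    have d1: "T1 differentiable (at x)" unfolding T1_def by (intro differentiable_mult differentiable_const df[OF x])
    have d20: "(\<lambda>z. g z * ((fst z - a) \<bullet> i)) differentiable (at x)"
      by (intro differentiable_mult dg[OF x] affine_derivative(1)[OF li])
    have d2: "T2 differentiable (at x)" unfolding T2_def by (intro differentiable_mult d20 \<beta>_deriv)
    have d30: "(\<lambda>z. pd (v j) f z * A (case_nat (fst z - a) (case_nat i (omit j ?v)))) differentiable (at x)" for j
      by (intro differentiable_mult dpf[OF x] dA)
    have d3: "T3 differentiable (at x)" unfolding T3_def by (intro differentiable_sum differentiable_mult differentiable_const d30 ballI) simp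
    have p1: "pd (i, 0) T1 x = (real p + 1) * g x * ((\<xi> \<bullet> i) * A (case_nat i ?v))"
      unfolding T1_def using df[OF x] by (simp add: pd_cmult pd_mult fg[OF x] \<xi>_def)
    have p2: "pd (i, 0) T2 x = g x * ((\<xi> \<bullet> i) * A (case_nat i ?v)) + (g2 x * ((\<xi> \<bullet> i) * (\<xi> \<bullet> i)) + g x * (i \<bullet> i)) * \<beta> x v"
      unfolding T2_def by (subst pd_mult[OF d20 \<beta>_deriv(1)], subst pd_mult[OF dg[OF x] affine_derivative(1)[OF li]])
        (simp only: \<beta>_deriv(2) affine_derivative(2)[OF li] gg[OF x] fst_conv \<xi>_def, simp only: algebra_simps)
    have p3: "pd (i, 0) T3 x = (\<Sum>j<p. (- 1) ^ j * (pd (v j) g x * ((\<xi> \<bullet> i) * A (case_nat \<xi> (case_nat i (omit j ?v))))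
            + g x * ((fst (v j) \<bullet> i) * A (case_nat \<xi> (case_nat i (omit j ?v))))))"
    proof -
      have "pd (i, 0) T3 x = (\<Sum>j<p. pd (i, 0) (\<lambda>z. (- 1) ^ j * (pd (v j) f z * A (case_nat (fst z - a) (case_nat i (omit j ?v))))) x)"
        unfolding T3_def by (rule pd_sum) (intro differentiable_mult differentiable_const d30)
      also have "\<dots> = (\<Sum>j<p. (- 1) ^ j * (pd (v j) g x * ((\<xi> \<bullet> i) * A (case_nat \<xi> (case_nat i (omit j ?v))))
            + g x * ((fst (v j) \<bullet> i) * A (case_nat \<xi> (case_nat i (omit j ?v))))))"
      proof (rule sum.cong[OF refl])
        fix j assume "j \<in> {..<p}"
        then have "p > 0" by auto
        show "pd (i, 0) (\<lambda>z. (- 1) ^ j * (pd (v j) f z * A (case_nat (fst z - a) (case_nat i (omit j ?v))))) x =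
          (- 1) ^ j * (pd (v j) g x * ((\<xi> \<bullet> i) * A (case_nat \<xi> (case_nat i (omit j ?v))))
            + g x * ((fst (v j) \<bullet> i) * A (case_nat \<xi> (case_nat i (omit j ?v)))))"
          unfolding pd_cmult[OF d30] pd_mult[OF dpf[OF x] dA(1)] dA(2) fst_conv AA[OF \<open>p > 0\<close>] pdvf \<xi>_def[symmetric]
          by (simp add: algebra_simps)
      qed
      finally show ?thesis .
    qed
    have E: "E = (\<lambda>z. T1 z + T2 z + - T3 z)" by (simp add: E_def T1_def T2_def T3_def fun_eq_iff)
    have dE: "E differentiable (at x)" unfolding E by (intro differentiable_add differentiable_minus d1 d2 d3)
    have pE: "pd (i, 0) E x = pd (i, 0) T1 x + pd (i, 0) T2 x + - pd (i, 0) T3 x"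
      unfolding E by (simp only: pd_add pd_minus differentiable_add differentiable_minus d1 d2 d3)
    have "pd (i, 0) (\<lambda>z. Y z * E z) x = Y x * pd (i, 0) E x"
      by (simp add: pd_mult[OF Yd dE] Y0)
    also have "pd (i, 0) E x = (real p + 2) * g x * ((\<xi> \<bullet> i) * A (case_nat i ?v)) + (g2 x * ((\<xi> \<bullet> i) * (\<xi> \<bullet> i)) + g x * (i \<bullet> i)) * \<beta> x v
       - (\<Sum>j<p. (- 1) ^ j * (pd (v j) g x * ((\<xi> \<bullet> i) * A (case_nat \<xi> (case_nat i (omit j ?v))))
            + g x * ((fst (v j) \<bullet> i) * A (case_nat \<xi> (case_nat i (omit j ?v))))))"
      unfolding pE p1 p2 p3 by (simp add: algebra_simps)
    finally show ?thesis unfolding h0 .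
  qed
  have S1: "(\<Sum>i\<in>Basis. (\<xi> \<bullet> i) * A (case_nat i ?v)) = \<beta> x v"
    unfolding sum_contract by (simp add: \<beta>_def \<xi>_def)
  have S2: "(\<Sum>i\<in>Basis. (\<xi> \<bullet> i) * (\<xi> \<bullet> i)) = \<xi> \<bullet> \<xi>" by (simp add: euclidean_inner[of \<xi> \<xi>])
  have S3: "(\<Sum>i\<in>(Basis :: (real^'n) set). i \<bullet> i) = real CARD('n)" by (simp add: inner_Basis)
  have S4: "(\<Sum>i\<in>Basis. \<Sum>j<p. (- 1) ^ j * (pd (v j) g x * ((\<xi> \<bullet> i) * A (case_nat \<xi> (case_nat i (omit j ?v))))
            + g x * ((fst (v j) \<bullet> i) * A (case_nat \<xi> (case_nat i (omit j ?v)))))) = real p * (g x * \<beta> x v)"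
  proof -
    have "(\<Sum>i\<in>Basis. (- 1) ^ j * (pd (v j) g x * ((\<xi> \<bullet> i) * A (case_nat \<xi> (case_nat i (omit j ?v))))
            + g x * ((fst (v j) \<bullet> i) * A (case_nat \<xi> (case_nat i (omit j ?v)))))) = g x * \<beta> x v" if "j \<in> {..<p}" for j
    proof -
      have pos: "p > 0" using that by auto
      obtain q where q: "p = Suc q" using pos by (cases p) auto
      have alt: "alternating (Suc q) (\<lambda>w. A (case_nat \<xi> w))"
        using alternating_contract[OF A] q by simp
      have mv: "A (case_nat \<xi> (case_nat (?v j) (omit j ?v))) = (- 1) ^ j * A (case_nat \<xi> ?v)"
        by (rule alternating_move_front[OF alt]) (use that q in simp)
      have "(\<Sum>i\<in>Basis. (- 1) ^ j * (pd (v j) g x * ((\<xi> \<bullet> i) * A (case_nat \<xi> (case_nat i (omit j ?v))))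
            + g x * ((fst (v j) \<bullet> i) * A (case_nat \<xi> (case_nat i (omit j ?v)))))) =
         (- 1) ^ j * (pd (v j) g x * (\<Sum>i\<in>Basis. (\<xi> \<bullet> i) * A (case_nat \<xi> (case_nat i (omit j ?v))))
            + g x * (\<Sum>i\<in>Basis. (fst (v j) \<bullet> i) * A (case_nat \<xi> (case_nat i (omit j ?v)))))"
        by (simp only: sum_distrib_left sum.distrib distrib_left)
      also have "\<dots> = (- 1) ^ j * (g x * ((- 1) ^ j * A (case_nat \<xi> ?v)))"
        unfolding sum_Basis_inner_linear[OF lin2[OF pos]] mv AA[OF pos] by simp
      also have "\<dots> = g x * \<beta> x v" by (simp add: \<beta>_def \<xi>_def)
      finally show ?thesis .
    qed
    then show ?thesis by (subst sum.swap) simp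
  qed
  have H: "(\<Sum>i\<in>Basis. pd (i, 0) (\<lambda>z. Y z * ext_deriv p \<omega> z (case_nat (i, 0) v)) x) =
      Y x * ((real p + 2) * g x * \<beta> x v + (g2 x * (\<xi> \<bullet> \<xi>) + g x * real CARD('n)) * \<beta> x v - real p * (g x * \<beta> x v))"
  proof -
    have "(\<Sum>i\<in>Basis. pd (i, 0) (\<lambda>z. Y z * ext_deriv p \<omega> z (case_nat (i, 0) v)) x) =
      Y x * ((real p + 2) * g x * (\<Sum>i\<in>Basis. (\<xi> \<bullet> i) * A (case_nat i ?v))
        + (g2 x * (\<Sum>i\<in>Basis. (\<xi> \<bullet> i) * (\<xi> \<bullet> i)) + g x * (\<Sum>i\<in>(Basis :: (real^'n) set). i \<bullet> i)) * \<beta> x v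
       - (\<Sum>i\<in>Basis. \<Sum>j<p. (- 1) ^ j * (pd (v j) g x * ((\<xi> \<bullet> i) * A (case_nat \<xi> (case_nat i (omit j ?v))))
            + g x * ((fst (v j) \<bullet> i) * A (case_nat \<xi> (case_nat i (omit j ?v)))))))"
      unfolding hor by (simp only: sum_distrib_left[symmetric] sum.distrib sum_subtractf sum_distrib_right[symmetric])
    then show ?thesis unfolding S1 S2 S3 S4 .
  qed
  have "codifferential p (ext_deriv p \<omega>) x v = - (snd x powi (int CARD('n) + 1 - 2 * int p)) *
     (\<Sum>b\<in>Basis. pd b (\<lambda>z. Y z * ext_deriv p \<omega> z (case_nat b v)) x)"
    by (simp only: codifferential_def Y_def)
  then show ?thesis
    unfolding sum_Basis_point H vert by (simp add: algebra_simps)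
qed

end

section \<open>Waves of forms\<close>

definition time_form :: "nat \<Rightarrow> (real \<Rightarrow> 'n::finite form) \<Rightarrow> bool" where
  "time_form p \<omega> \<longleftrightarrow> (\<forall>t. \<forall>x\<in>hyp_space. alternating p (\<omega> t x)) \<and> (\<forall>v. smooth_on (UNIV \<times> hyp_space) (\<lambda>(t, x). \<omega> t x v))"

definition time_deriv :: "(real \<Rightarrow> 'n::finite form) \<Rightarrow> real \<Rightarrow> 'n form" where
  "time_deriv \<omega> t x v = deriv (\<lambda>s. \<omega> s x v) t"

lemma open_spacetime: "open (UNIV \<times> hyp_space :: (real \<times> 'n::finite point) set)"
  by (intro open_Times open_UNIV open_hyp_space)

lemma spacetime_slices:
  fixes W :: "real \<times> 'n::finite point \<Rightarrow> real"
  assumes W: "smooth_on (UNIV \<times> hyp_space) W" and x: "x \<in> hyp_space"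
  shows "((\<lambda>s. W (s, x)) has_real_derivative pd (1, 0) W (t, x)) (at t)"
    and "(\<lambda>x. W (t, x)) differentiable (at x)"
    and "pd u (\<lambda>x. W (t, x)) x = pd (0, u) W (t, x)"
proof -
  have d: "W differentiable (at (t, x))" by (rule smooth_on_differentiable[OF W]) (use x in simp)
  note h = differentiable_has_pd[OF d]
  have "((\<lambda>s. W (s, x)) has_derivative (\<lambda>h. pd (h, 0) W (t, x))) (at t)"
    by (rule has_derivative_compose[where f="\<lambda>s. (s, x)" and g=W, OF _ h]) (auto intro!: derivative_eq_intros)
  then show "((\<lambda>s. W (s, x)) has_real_derivative pd (1, 0) W (t, x)) (at t)"
    unfolding has_field_derivative_def
  proof (rule has_derivative_eq_rhs)
    show "(\<lambda>h. pd (h, 0) W (t, x)) = (*) (pd (1, 0) W (t, x))"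
    proof
      fix h :: real
      show "pd (h, 0) W (t, x) = pd (1, 0) W (t, x) * h" using pd_scaleR[OF d, of h "(1, 0)"] by simp
    qed
  qed
  have s: "((\<lambda>x. W (t, x)) has_derivative (\<lambda>u. pd (0, u) W (t, x))) (at x)"
    by (rule has_derivative_compose[where f="\<lambda>x. (t, x)" and g=W, OF _ h]) (auto intro!: derivative_eq_intros)
  show "(\<lambda>x. W (t, x)) differentiable (at x)" by (rule differentiableI[OF s])
  show "pd u (\<lambda>x. W (t, x)) x = pd (0, u) W (t, x)" by (rule pd_eq[OF s])
qed

lemma smooth_on_slice:
  fixes W :: "real \<times> 'n::finite point \<Rightarrow> real"
  assumes "smooth_on (UNIV \<times> hyp_space) W"
  shows "smooth_on hyp_space (\<lambda>x. W (t, x))"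
proof (rule smooth_on_compose[where f=W and g="\<lambda>x. (t, x)", OF open_hyp_space _ assms])
  fix c :: "real \<times> 'n point" assume "c \<in> Basis"
  have "smooth_on hyp_space (\<lambda>x::'n point. t * fst c + x \<bullet> snd c)"
    by (intro smooth_on_add smooth_on_const smooth_on_bounded_linear bounded_linear_inner_left open_hyp_space)
  then show "smooth_on hyp_space (\<lambda>x::'n point. (t, x) \<bullet> c)" by (simp add: inner_prod_def)
qed simp

lemma smooth_on_extend_time:
  fixes h :: "'n::finite point \<Rightarrow> real"
  assumes "smooth_on hyp_space h"
  shows "smooth_on (UNIV \<times> hyp_space) (\<lambda>p::real \<times> 'n point. h (snd p))"
proof (rule smooth_on_compose[where f=h and g=snd, OF open_spacetime _ assms])
  fix c :: "'n point"
  show "smooth_on (UNIV \<times> hyp_space) (\<lambda>p::real \<times> 'n point. snd p \<bullet> c)"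
    by (intro smooth_on_bounded_linear bounded_linear_compose[OF bounded_linear_inner_left bounded_linear_snd])
qed auto

lemma time_formD:
  assumes "time_form p \<omega>"
  shows "x \<in> hyp_space \<Longrightarrow> alternating p (\<omega> t x)" "smooth_on (UNIV \<times> hyp_space) (\<lambda>q. \<omega> (fst q) (snd q) v)"
  using assms by (auto simp: time_form_def case_prod_unfold)

lemma time_form_slices:
  fixes \<omega> :: "real \<Rightarrow> 'n::finite form"
  assumes "time_form p \<omega>" and x: "x \<in> hyp_space"
  shows "((\<lambda>s. \<omega> s x v) has_real_derivative time_deriv \<omega> t x v) (at t)"
    and "time_deriv \<omega> t x v = pd (1, 0) (\<lambda>q. \<omega> (fst q) (snd q) v) (t, x)"
    and "(\<lambda>x. \<omega> t x v) differentiable (at x)"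
    and "pd u (\<lambda>x. \<omega> t x v) x = pd (0, u) (\<lambda>q. \<omega> (fst q) (snd q) v) (t, x)"
proof -
  note s = spacetime_slices[OF time_formD(2)[OF assms(1), where v=v] x]
  have d: "((\<lambda>s. \<omega> s x v) has_real_derivative pd (1, 0) (\<lambda>q. \<omega> (fst q) (snd q) v) (t, x)) (at t)"
    using s(1)[where t=t] by (simp only: fst_conv snd_conv)
  then show e: "time_deriv \<omega> t x v = pd (1, 0) (\<lambda>q. \<omega> (fst q) (snd q) v) (t, x)"
    unfolding time_deriv_def by (rule DERIV_imp_deriv)
  show "((\<lambda>s. \<omega> s x v) has_real_derivative time_deriv \<omega> t x v) (at t)" unfolding e by (rule d)
  show "(\<lambda>x. \<omega> t x v) differentiable (at x)" using s(2)[where t=t] by (simp only: fst_conv snd_conv)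
  show "pd u (\<lambda>x. \<omega> t x v) x = pd (0, u) (\<lambda>q. \<omega> (fst q) (snd q) v) (t, x)"
    using s(3)[where t=t and u=u] by (simp only: fst_conv snd_conv)
qed

lemma smooth_form_slice:
  assumes "time_form p \<omega>"
  shows "smooth_form p (\<omega> t)"
  unfolding smooth_form_def
proof (intro conjI ballI allI)
  show "alternating p (\<omega> t x)" if "x \<in> hyp_space" for x by (rule time_formD(1)[OF assms that])
  show "smooth_on hyp_space (\<lambda>x. \<omega> t x v)" for v
    using smooth_on_slice[OF time_formD(2)[OF assms, where v=v], where t=t] by (simp only: fst_conv snd_conv)
qed

lemma time_form_time_deriv:
  fixes \<omega> :: "real \<Rightarrow> 'n::finite form"
  assumes "time_form p \<omega>"
  shows "time_form p (time_deriv \<omega>)"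
  unfolding time_form_def
proof (intro conjI allI ballI)
  fix t and x :: "'n point" assume x: "x \<in> hyp_space"
  have "alternating p (\<lambda>v. pd (1, 0) (\<lambda>q. \<omega> (fst q) (snd q) v) (t, x))"
    by (rule alternating_pd[OF open_spacetime, where p=p])
      (use x time_formD[OF assms] smooth_on_differentiable[OF time_formD(2)[OF assms]] in auto)
  moreover have "time_deriv \<omega> t x = (\<lambda>v. pd (1, 0) (\<lambda>q. \<omega> (fst q) (snd q) v) (t, x))"
    by (rule ext) (rule time_form_slices(2)[OF assms x])
  ultimately show "alternating p (time_deriv \<omega> t x)" by (simp only:)
next
  fix v
  show "smooth_on (UNIV \<times> hyp_space) (\<lambda>(t, x). time_deriv \<omega> t x v)"
    by (rule smooth_on_cong[OF open_spacetime _ smooth_on_pd[OF time_formD(2)[OF assms]]])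
      (auto simp: time_form_slices(2)[OF assms])
qed

lemma time_form_ext_deriv:
  fixes \<omega> :: "real \<Rightarrow> 'n::finite form"
  assumes "time_form p \<omega>"
  shows "time_form (Suc p) (\<lambda>t. ext_deriv p (\<omega> t))"
  unfolding time_form_def
proof (intro conjI allI ballI)
  fix t and x :: "'n point" assume x: "x \<in> hyp_space"
  show "alternating (Suc p) (ext_deriv p (\<omega> t) x)"
    by (rule smooth_formD(1)[OF smooth_form_ext_deriv[OF smooth_form_slice[OF assms]] x])
next
  fix v
  show "smooth_on (UNIV \<times> hyp_space) (\<lambda>(t, x). ext_deriv p (\<omega> t) x v)"
  proof (rule smooth_on_cong[OF open_spacetime])
    show "smooth_on (UNIV \<times> hyp_space) (\<lambda>q. \<Sum>i\<le>p. (- 1) ^ i * pd (0, v i) (\<lambda>q. \<omega> (fst q) (snd q) (omit i v)) q)"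
      by (intro smooth_on_sum smooth_on_mult smooth_on_const smooth_on_pd time_formD(2)[OF assms] open_spacetime)
  qed (auto simp: ext_deriv_def time_form_slices(4)[OF assms])
qed

lemma time_deriv_ext_deriv:
  fixes \<omega> :: "real \<Rightarrow> 'n::finite form"
  assumes "time_form p \<omega>" and x: "x \<in> hyp_space"
  shows "time_deriv (\<lambda>t. ext_deriv p (\<omega> t)) t x v = ext_deriv p (time_deriv \<omega> t) x v"
proof -
  let ?W = "\<lambda>i q. \<omega> (fst q) (snd q) (omit i v)"
  have "((\<lambda>s. \<Sum>i\<le>p. (- 1) ^ i * pd (v i) (\<lambda>x. \<omega> s x (omit i v)) x) has_real_derivative
      (\<Sum>i\<le>p. (- 1) ^ i * pd (1, 0) (pd (0, v i) (?W i)) (t, x))) (at t)"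
    unfolding time_form_slices(4)[OF assms]
    by (intro DERIV_sum DERIV_cmult spacetime_slices(1)[OF smooth_on_pd[OF time_formD(2)[OF assms(1)]] x])
  then have "time_deriv (\<lambda>t. ext_deriv p (\<omega> t)) t x v = (\<Sum>i\<le>p. (- 1) ^ i * pd (1, 0) (pd (0, v i) (?W i)) (t, x))"
    unfolding time_deriv_def ext_deriv_def by (rule DERIV_imp_deriv)
  also have "\<dots> = (\<Sum>i\<le>p. (- 1) ^ i * pd (v i) (\<lambda>x. time_deriv \<omega> t x (omit i v)) x)"
  proof (rule sum.cong[OF refl])
    fix i
    have "pd (1, 0) (pd (0, v i) (?W i)) (t, x) = pd (0, v i) (pd (1, 0) (?W i)) (t, x)"
      by (rule pd_symmetric[OF open_spacetime time_formD(2)[OF assms(1)]]) (use x in simp)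
    also have "\<dots> = pd (v i) (\<lambda>x. pd (1, 0) (?W i) (t, x)) x"
      by (rule spacetime_slices(3)[OF smooth_on_pd[OF time_formD(2)[OF assms(1)]] x, symmetric])
    also have "\<dots> = pd (v i) (\<lambda>x. time_deriv \<omega> t x (omit i v)) x"
      by (rule frechet_cong_hyp[OF x]) (rule time_form_slices(2)[OF assms(1), symmetric])
    finally show "(- 1) ^ i * pd (1, 0) (pd (0, v i) (?W i)) (t, x) = (- 1) ^ i * pd (v i) (\<lambda>x. time_deriv \<omega> t x (omit i v)) x"
      by simp
  qed
  finally show ?thesis by (simp only: ext_deriv_def)
qed

lemma wave_solutionI:
  assumes "time_form p \<omega>"
    and "\<And>t. \<exists>\<theta>. is_laplacian p (\<omega> t) \<theta> \<and> (\<forall>x\<in>hyp_space. \<forall>v. \<theta> x v = - time_deriv (time_deriv \<omega>) t x v)"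
  shows "wave_solution p (\<omega> 0) (time_deriv \<omega> 0) \<omega>"
proof -
  have "deriv (deriv (\<lambda>s. \<omega> s x v)) t = time_deriv (time_deriv \<omega>) t x v" for t x v by (simp add: time_deriv_def)
  then show ?thesis
    using assms unfolding wave_solution_def time_form_def by (fastforce simp: time_deriv_def)
qed

lemma ext_deriv_zero:
  fixes \<eta> :: "'n::finite form"
  assumes "x \<in> hyp_space" "\<And>y v. y \<in> hyp_space \<Longrightarrow> \<eta> y v = 0"
  shows "ext_deriv p \<eta> x v = 0"
proof -
  have "ext_deriv p \<eta> x v = ext_deriv p (\<lambda>_ _. 0) x v" by (rule ext_deriv_cong[OF assms(1)]) (rule assms(2))
  then show ?thesis by (simp add: ext_deriv_def)
qed

lemma codifferential_zero:
  fixes \<eta> :: "'n::finite form"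
  assumes "x \<in> hyp_space" "\<And>y v. y \<in> hyp_space \<Longrightarrow> \<eta> y v = 0"
  shows "codifferential p \<eta> x v = 0"
proof -
  have "codifferential p \<eta> x v = codifferential p (\<lambda>_ _. 0) x v" by (rule codifferential_cong[OF assms(1)]) (rule assms(2))
  then show ?thesis by (simp add: codifferential_def)
qed

lemma coclosed_wave:
  fixes \<omega> :: "real \<Rightarrow> 'n::finite form"
  assumes tf: "time_form p \<omega>"
    and cc: "\<And>q t x v. p = Suc q \<Longrightarrow> x \<in> hyp_space \<Longrightarrow> codifferential q (\<omega> t) x v = 0"
    and eq: "\<And>t x v. x \<in> hyp_space \<Longrightarrow> codifferential p (ext_deriv p (\<omega> t)) x v = - time_deriv (time_deriv \<omega>) t x v"
  shows "wave_solution p (\<omega> 0) (time_deriv \<omega> 0) \<omega>"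
proof (rule wave_solutionI[OF tf])
  fix t
  have 1: "is_codiff p (ext_deriv p (\<omega> t)) (codifferential p (ext_deriv p (\<omega> t)))"
    by (rule is_codiff_codifferential[OF smooth_form_ext_deriv[OF smooth_form_slice[OF tf]]])
  have "is_laplacian p (\<omega> t) (codifferential p (ext_deriv p (\<omega> t)))"
  proof (cases p)
    case 0
    then show ?thesis using 1 unfolding is_laplacian_def by auto
  next
    case (Suc q)
    have 2: "is_codiff q (\<omega> t) (codifferential q (\<omega> t))"
      by (rule is_codiff_codifferential) (use smooth_form_slice[OF tf] Suc in simp)
    have z: "ext_deriv q (codifferential q (\<omega> t)) x v = 0" if "x \<in> hyp_space" for x v
      by (rule ext_deriv_zero[OF that]) (rule cc[OF Suc])
    show ?thesis
      unfolding is_laplacian_def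
      by (rule exI[of _ "codifferential p (ext_deriv p (\<omega> t))"], rule conjI[OF 1], simp only: Suc nat.case,
          rule exI[of _ "codifferential q (\<omega> t)"], rule conjI[OF 2]) (simp add: z)
  qed
  then show "\<exists>\<theta>. is_laplacian p (\<omega> t) \<theta> \<and> (\<forall>x\<in>hyp_space. \<forall>v. \<theta> x v = - time_deriv (time_deriv \<omega>) t x v)"
    using eq by blast
qed

lemma closed_wave:
  fixes \<omega> :: "real \<Rightarrow> 'n::finite form"
  assumes tf: "time_form (Suc q) \<omega>"
    and cl: "\<And>t x v. x \<in> hyp_space \<Longrightarrow> ext_deriv (Suc q) (\<omega> t) x v = 0"
    and eq: "\<And>t x v. x \<in> hyp_space \<Longrightarrow> ext_deriv q (codifferential q (\<omega> t)) x v = - time_deriv (time_deriv \<omega>) t x v"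
  shows "wave_solution (Suc q) (\<omega> 0) (time_deriv \<omega> 0) \<omega>"
proof (rule wave_solutionI[OF tf])
  fix t
  let ?\<zeta> = "codifferential (Suc q) (ext_deriv (Suc q) (\<omega> t))"
  have 1: "is_codiff (Suc q) (ext_deriv (Suc q) (\<omega> t)) ?\<zeta>"
    by (rule is_codiff_codifferential[OF smooth_form_ext_deriv[OF smooth_form_slice[OF tf]]])
  have 2: "is_codiff q (\<omega> t) (codifferential q (\<omega> t))" by (rule is_codiff_codifferential[OF smooth_form_slice[OF tf]])
  have z: "?\<zeta> x v = 0" if "x \<in> hyp_space" for x v by (rule codifferential_zero[OF that]) (rule cl)
  have "is_laplacian (Suc q) (\<omega> t) (ext_deriv q (codifferential q (\<omega> t)))"
    unfolding is_laplacian_def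
    by (rule exI[of _ ?\<zeta>], rule conjI[OF 1], simp only: nat.case,
        rule exI[of _ "codifferential q (\<omega> t)"], rule conjI[OF 2]) (simp add: z)
  then show "\<exists>\<theta>. is_laplacian (Suc q) (\<omega> t) \<theta> \<and> (\<forall>x\<in>hyp_space. \<forall>v. \<theta> x v = - time_deriv (time_deriv \<omega>) t x v)"
    using eq by blast
qed

text \<open>The involution \<tau> pairs the terms of the double sum. Omitting i and then j < i is
  the same as omitting j and then i - 1; the signs are opposite and the second derivatives
  commute.\<close>

lemma ext_deriv_ext_deriv:
  fixes \<omega> :: "'n::finite form"
  assumes \<omega>: "smooth_form p \<omega>" and x: "x \<in> hyp_space"
  shows "ext_deriv (Suc p) (ext_deriv p \<omega>) x v = 0"
proof -
  define T where "T = (\<lambda>(i, j). (- 1) ^ (i + j) * pd (v i) (pd (omit i v j) (\<lambda>y. \<omega> y (omit j (omit i v)))) x)"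
  define \<tau> :: "nat \<times> nat \<Rightarrow> nat \<times> nat" where "\<tau> = (\<lambda>(i, j). if j < i then (j, i - 1) else (Suc j, i))"
  have d: "pd u (\<lambda>y. \<omega> y w) differentiable (at x)" for u w
    by (rule smooth_on_differentiable[OF smooth_on_pd[OF smooth_formD(2)[OF \<omega>]] x])
  have "ext_deriv (Suc p) (ext_deriv p \<omega>) x v = (\<Sum>i\<le>Suc p. \<Sum>j\<le>p. T (i, j))"
  proof -
    have "(- 1) ^ i * pd (v i) (\<lambda>y. ext_deriv p \<omega> y (omit i v)) x = (\<Sum>j\<le>p. T (i, j))" for i
    proof -
      have "pd (v i) (\<lambda>y. ext_deriv p \<omega> y (omit i v)) x =
        (\<Sum>j\<le>p. pd (v i) (\<lambda>y. (- 1) ^ j * pd (omit i v j) (\<lambda>y. \<omega> y (omit j (omit i v))) y) x)"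
        unfolding ext_deriv_def by (rule pd_sum) (intro differentiable_mult differentiable_const d)
      also have "\<dots> = (\<Sum>j\<le>p. (- 1) ^ j * pd (v i) (pd (omit i v j) (\<lambda>y. \<omega> y (omit j (omit i v)))) x)"
        unfolding pd_cmult[OF d] ..
      finally show ?thesis by (simp add: T_def sum_distrib_left power_add mult.assoc)
    qed
    then show ?thesis by (simp only: ext_deriv_def)
  qed
  also have "\<dots> = (\<Sum>q\<in>{..Suc p} \<times> {..p}. T q)" by (simp add: sum.cartesian_product)
  finally have e: "ext_deriv (Suc p) (ext_deriv p \<omega>) x v = (\<Sum>q\<in>{..Suc p} \<times> {..p}. T q)" .
  have "(\<Sum>q\<in>{..Suc p} \<times> {..p}. T q) = - (\<Sum>q\<in>{..Suc p} \<times> {..p}. T q)"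
  proof -
    have key: "T (j, i - 1) = - T (i, j)" if "j < i" for i j
    proof -
      have "omit (i - 1) (omit j v) = omit j (omit i v)" "omit j v (i - 1) = v i" "omit i v j = v j"
        using that by (auto simp: omit_def fun_eq_iff)
      moreover have "(- 1) ^ (j + (i - 1)) = - ((- 1) ^ (i + j) :: real)"
        using that by (cases i) (auto simp: power_add)
      moreover have "pd (v j) (pd (v i) (\<lambda>y. \<omega> y (omit j (omit i v)))) x = pd (v i) (pd (v j) (\<lambda>y. \<omega> y (omit j (omit i v)))) x"
        by (rule pd_symmetric[OF open_hyp_space smooth_formD(2)[OF \<omega>] x])
      ultimately show ?thesis by (simp add: T_def)
    qed
    have \<tau>: "\<tau> (\<tau> q) = q \<and> \<tau> q \<in> {..Suc p} \<times> {..p} \<and> - T (\<tau> q) = T q" if q: "q \<in> {..Suc p} \<times> {..p}" for q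
    proof -
      obtain i j where q: "q = (i, j)" "i \<le> Suc p" "j \<le> p" using q by auto
      show ?thesis using q key[of j i] key[of i "Suc j"] by (auto simp: \<tau>_def not_less)
    qed
    have "(\<Sum>q\<in>{..Suc p} \<times> {..p}. T q) = (\<Sum>q\<in>{..Suc p} \<times> {..p}. - T q)"
      by (rule sum.reindex_bij_witness[where i=\<tau> and j=\<tau>]) (simp_all only: \<tau>)
    then show ?thesis by (simp add: sum_negf)
  qed
  then show ?thesis unfolding e by linarith
qed

text \<open>Apply d to the equation for \<omega>: for the closed form d\<omega> the operator d
  \<delta> is d applied to \<delta> d \<omega>, and d commutes with the time derivatives.\<close>

lemma ext_deriv_wave:
  fixes \<omega> :: "real \<Rightarrow> 'n::finite form"
  assumes tf: "time_form q \<omega>"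
    and eq: "\<And>t x v. x \<in> hyp_space \<Longrightarrow> codifferential q (ext_deriv q (\<omega> t)) x v = - time_deriv (time_deriv \<omega>) t x v"
  shows "wave_solution (Suc q) (ext_deriv q (\<omega> 0)) (time_deriv (\<lambda>t. ext_deriv q (\<omega> t)) 0) (\<lambda>t. ext_deriv q (\<omega> t))"
proof (rule closed_wave[OF time_form_ext_deriv[OF tf]])
  fix t v and x :: "'n point" assume x: "x \<in> hyp_space"
  show "ext_deriv (Suc q) (ext_deriv q (\<omega> t)) x v = 0"
    by (rule ext_deriv_ext_deriv[OF smooth_form_slice[OF tf] x])
  have "ext_deriv q (codifferential q (ext_deriv q (\<omega> t))) x v = ext_deriv q (\<lambda>x v. - time_deriv (time_deriv \<omega>) t x v) x v"
    by (rule ext_deriv_cong[OF x]) (rule eq)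
  also have "\<dots> = - ext_deriv q (time_deriv (time_deriv \<omega>) t) x v"
    unfolding ext_deriv_def
    by (simp add: pd_minus time_form_slices(3)[OF time_form_time_deriv[OF time_form_time_deriv[OF tf]] x] sum_negf)
  also have "ext_deriv q (time_deriv (time_deriv \<omega>) t) x v = time_deriv (\<lambda>t. ext_deriv q (time_deriv \<omega> t)) t x v"
    by (rule time_deriv_ext_deriv[OF time_form_time_deriv[OF tf] x, symmetric])
  also have "\<dots> = time_deriv (time_deriv (\<lambda>t. ext_deriv q (\<omega> t))) t x v"
    unfolding time_deriv_def[of "\<lambda>t. ext_deriv q (time_deriv \<omega> t)"] time_deriv_def[of "time_deriv (\<lambda>t. ext_deriv q (\<omega> t))"]
    by (simp only: time_deriv_ext_deriv[OF tf x])
  finally show "ext_deriv q (codifferential q (ext_deriv q (\<omega> t))) x v = - time_deriv (time_deriv (\<lambda>t. ext_deriv q (\<omega> t))) t x v" .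
qed

text \<open>For a scalar \<open>u\<close> and a top-degree form \<open>A\<close>, the form below is \<open>*du\<close> up to a constant, and
  \<open>y\<^sup>-\<^sup>(\<^sup>n\<^sup>+\<^sup>1\<^sup>) u A\<close> is \<open>*u\<close>.\<close>

definition star_d :: "((nat \<Rightarrow> 'n point) \<Rightarrow> real) \<Rightarrow> ('n::finite point \<Rightarrow> real) \<Rightarrow> 'n form" where
  "star_d A u x v = snd x powi (1 - int CARD('n)) * (\<Sum>b\<in>Basis. pd b u x * A (case_nat b v))"

text \<open>This is y^(-n-1) times minus the nonnegative Laplacian of u.\<close>

definition div_y :: "('n::finite point \<Rightarrow> real) \<Rightarrow> 'n point \<Rightarrow> real" where
  "div_y u x = (\<Sum>b\<in>Basis. pd b (\<lambda>z. snd z powi (1 - int CARD('n)) * pd b u z) x)"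

lemma star_d_contract:
  assumes "alternating (Suc p) A" "u differentiable (at x)"
  shows "star_d A u x v = snd x powi (1 - int CARD('n)) * A (case_nat (\<Sum>b\<in>Basis. pd b u x *\<^sub>R b) (v :: nat \<Rightarrow> 'n::finite point))"
  unfolding star_d_def
  by (simp add: linear_sum[OF alternating_linear_front[OF assms(1)]] linear_scale[OF alternating_linear_front[OF assms(1)]])

text \<open>The derivative of the weighted gradient is an endomorphism inserted into each slot of
  the top-degree form A in turn, so \<open>alternating_trace\<close> leaves its trace, the
  divergence.\<close>

lemma ext_deriv_star_d:
  fixes u :: "'n::finite point \<Rightarrow> real"
  assumes A: "alternating (Suc CARD('n)) A" and u: "smooth_on hyp_space u" and x: "x \<in> hyp_space"
  shows "ext_deriv CARD('n) (star_d A u) x v = div_y u x * A v"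
proof -
  let ?h = "\<lambda>b z. snd z powi (1 - int CARD('n)) * pd b u z"
  have sm: "smooth_on hyp_space (?h b)" for b
    by (intro smooth_on_mult smooth_on_snd_powi smooth_on_pd u open_hyp_space)
  note d = smooth_on_differentiable[OF sm x]
  have "pd w (\<lambda>y. star_d A u y (omit i v)) x = (\<Sum>b\<in>Basis. pd w (?h b) x * A (case_nat b (omit i v)))" for i w
  proof -
    have e: "(\<lambda>y. star_d A u y (omit i v)) = (\<lambda>y. \<Sum>b\<in>Basis. ?h b y * A (case_nat b (omit i v)))"
      by (simp add: star_d_def sum_distrib_left mult.assoc)
    show ?thesis unfolding e
      by (subst pd_sum) (simp_all add: pd_mult d differentiable_mult)
  qed
  then have "ext_deriv CARD('n) (star_d A u) x v = (\<Sum>i\<le>CARD('n). (- 1) ^ i * (\<Sum>b\<in>Basis. pd (v i) (?h b) x * A (case_nat b (omit i v))))"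
    by (simp only: ext_deriv_def)
  also have "\<dots> = (\<Sum>b\<in>Basis. pd b (?h b) x) * A v"
    by (rule alternating_trace[OF A, of "\<lambda>b w. pd w (?h b) x" v, OF _ linear_pd[OF d]]) simp
  finally show ?thesis by (simp add: div_y_def)
qed

text \<open>The weight under the derivative is y^(n+1) in this degree and cancels that of the
  form.\<close>

lemma codifferential_top:
  fixes u :: "'n::finite point \<Rightarrow> real"
  assumes u: "smooth_on hyp_space u" and x: "x \<in> hyp_space"
  shows "codifferential CARD('n) (\<lambda>z v. snd z powi (- 1 - int CARD('n)) * u z * A v) x v = - star_d A u x v"
proof -
  have d: "u differentiable (at x)" by (rule smooth_on_differentiable[OF u x])
  have "pd b (\<lambda>z. snd z powi (2 * int CARD('n) + 1 - int CARD('n)) * (snd z powi (- 1 - int CARD('n)) * u z * A (case_nat b v))) x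
      = pd b u x * A (case_nat b v)" for b
  proof -
    have "pd b (\<lambda>z. snd z powi (2 * int CARD('n) + 1 - int CARD('n)) * (snd z powi (- 1 - int CARD('n)) * u z * A (case_nat b v))) x
      = pd b (\<lambda>z. u z * A (case_nat b v)) x"
    proof (rule frechet_cong_hyp[OF x])
      fix z :: "'n point" assume "z \<in> hyp_space"
      then have "snd z > 0" by (simp add: hyp_space_def)
      then have "snd z powi (2 * int CARD('n) + 1 - int CARD('n)) * snd z powi (- 1 - int CARD('n)) = 1"
        by (subst power_int_add[symmetric]; simp)
      then show "snd z powi (2 * int CARD('n) + 1 - int CARD('n)) * (snd z powi (- 1 - int CARD('n)) * u z * A (case_nat b v)) = u z * A (case_nat b v)"
        by (simp only: mult.assoc[symmetric])
    qed
    also have "\<dots> = pd b u x * A (case_nat b v)" by (simp add: pd_mult d)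
    finally show ?thesis .
  qed
  moreover have "int CARD('n) + 1 - 2 * int CARD('n) = 1 - int CARD('n)" by simp
  ultimately show ?thesis unfolding codifferential_def star_d_def by simp
qed

text \<open>The weights cancel again, and what remains is the symmetric Hessian of u contracted with
  two slots of A.\<close>

lemma star_d_coclosed:
  fixes u :: "'n::finite point \<Rightarrow> real"
  assumes A: "alternating (Suc (Suc q)) A" and q: "CARD('n) = Suc q" and u: "smooth_on hyp_space u" and x: "x \<in> hyp_space"
  shows "codifferential q (star_d A u) x v = 0"
proof -
  define S where "S = (\<Sum>b\<in>Basis. \<Sum>c\<in>Basis. pd b (pd c u) x * A (case_nat c (case_nat b v)))"
  have d: "pd c u differentiable (at x)" for c by (rule smooth_on_differentiable[OF smooth_on_pd[OF u] x])
  have "pd b (\<lambda>z. snd z powi (2 * int q + 1 - int CARD('n)) * star_d A u z (case_nat b v)) x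
      = (\<Sum>c\<in>Basis. pd b (pd c u) x * A (case_nat c (case_nat b v)))" for b
  proof -
    have "pd b (\<lambda>z. snd z powi (2 * int q + 1 - int CARD('n)) * star_d A u z (case_nat b v)) x =
      pd b (\<lambda>z. \<Sum>c\<in>Basis. pd c u z * A (case_nat c (case_nat b v))) x"
    proof (rule frechet_cong_hyp[OF x])
      fix z :: "'n point" assume "z \<in> hyp_space"
      then have "snd z > 0" by (simp add: hyp_space_def)
      then have "snd z powi (2 * int q + 1 - int CARD('n)) * snd z powi (1 - int CARD('n)) = 1"
        by (subst power_int_add[symmetric]; simp add: q)
      then show "snd z powi (2 * int q + 1 - int CARD('n)) * star_d A u z (case_nat b v) = (\<Sum>c\<in>Basis. pd c u z * A (case_nat c (case_nat b v)))"
        unfolding star_d_def by (simp only: mult.assoc[symmetric])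
    qed
    also have "\<dots> = (\<Sum>c\<in>Basis. pd b (pd c u) x * A (case_nat c (case_nat b v)))"
      by (subst pd_sum) (simp_all add: pd_mult d differentiable_mult)
    finally show ?thesis .
  qed
  then have "codifferential q (star_d A u) x v = - (snd x powi (int CARD('n) + 1 - 2 * int q)) * S"
    unfolding codifferential_def S_def by simp
  moreover have "S = - S"
  proof -
    have "S = (\<Sum>c\<in>Basis. \<Sum>b\<in>Basis. pd b (pd c u) x * A (case_nat c (case_nat b v)))"
      unfolding S_def by (rule sum.swap)
    also have "\<dots> = (\<Sum>c\<in>Basis. \<Sum>b\<in>Basis. - (pd c (pd b u) x * A (case_nat b (case_nat c v))))"
    proof (intro sum.cong refl)
      fix b c
      have "pd b (pd c u) x = pd c (pd b u) x" by (rule pd_symmetric[OF open_hyp_space u x])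
      then show "pd b (pd c u) x * A (case_nat c (case_nat b v)) = - (pd c (pd b u) x * A (case_nat b (case_nat c v)))"
        using alternating_front_swap[OF A, of c b v] by simp
    qed
    also have "\<dots> = - S" unfolding S_def by (simp only: sum_negf)
    finally show ?thesis .
  qed
  ultimately show ?thesis by simp
qed

section \<open>Waves around a point\<close>

lemma hyp_length_nonneg: "hyp_length \<gamma> \<ge> 0"
proof -
  let ?f = "\<lambda>t. sqrt (hyp_metric (\<gamma> t) (vector_derivative \<gamma> (at t)) (vector_derivative \<gamma> (at t)))"
  show ?thesis
  proof (cases "?f integrable_on {0..1}")
    case True
    then show ?thesis unfolding hyp_length_def by (rule integral_nonneg) (simp add: hyp_metric_def)
  next
    case False
    then show ?thesis unfolding hyp_length_def by (simp add: not_integrable_integral)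
  qed
qed

lemma hyp_dist_le_segment:
  fixes a :: "real^'n::finite" and b :: real and x :: "'n point"
  assumes b: "b > 0" and x: "x \<in> hyp_space"
  shows "hyp_dist (a, b) x \<le> integral {0..1} (\<lambda>\<tau>. norm (x - (a, b)) / (b + \<tau> * (snd x - b)))"
proof -
  define d where "d = x - (a, b)"
  define \<gamma> where "\<gamma> \<tau> = (a, b) + \<tau> *\<^sub>R d" for \<tau> :: real
  have pos: "b + \<tau> * (snd x - b) > 0" if "\<tau> \<in> {0..1}" for \<tau>
  proof -
    have "b + \<tau> * (snd x - b) = (1 - \<tau>) * b + \<tau> * snd x" by (simp add: algebra_simps)
    moreover have "(1 - \<tau>) * b + \<tau> * snd x > 0"
      using that b x by (cases "\<tau> = 1") (auto simp: hyp_space_def intro!: add_pos_nonneg)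
    ultimately show ?thesis by simp
  qed
  have sd: "snd (\<gamma> \<tau>) = b + \<tau> * (snd x - b)" for \<tau> by (simp add: \<gamma>_def d_def)
  have vd: "(\<gamma> has_vector_derivative d) (at \<tau>)" for \<tau>
    unfolding \<gamma>_def by (auto intro!: derivative_eq_intros)
  have C1: "\<gamma> C1_differentiable_on {0..1}"
    unfolding C1_differentiable_on_def by (rule exI[of _ "\<lambda>_. d"]) (simp add: vd)
  have "hyp_length \<gamma> \<in> {hyp_length \<gamma> | \<gamma>. \<gamma> C1_differentiable_on {0..1} \<and> \<gamma> ` {0..1} \<subseteq> hyp_space \<and> \<gamma> 0 = (a, b) \<and> \<gamma> 1 = x}"
    using C1 pos sd by (auto simp: hyp_space_def \<gamma>_def[of 0] \<gamma>_def[of 1] d_def intro!: exI[of _ \<gamma>])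
  then have "hyp_dist (a, b) x \<le> hyp_length \<gamma>"
    unfolding hyp_dist_def by (rule cInf_lower) (auto intro!: bdd_belowI[of _ 0] hyp_length_nonneg)
  also have "hyp_length \<gamma> = integral {0..1} (\<lambda>\<tau>. norm d / (b + \<tau> * (snd x - b)))"
    unfolding hyp_length_def
  proof (rule integral_cong)
    fix \<tau> :: real assume "\<tau> \<in> {0..1}"
    then show "sqrt (hyp_metric (\<gamma> \<tau>) (vector_derivative \<gamma> (at \<tau>)) (vector_derivative \<gamma> (at \<tau>))) = norm d / (b + \<tau> * (snd x - b))"
      using pos[of \<tau>] by (simp add: hyp_metric_def vector_derivative_at[OF vd] sd real_sqrt_divide flip: norm_eq_sqrt_inner)
  qed
  finally show ?thesis by (simp add: d_def)
qed

lemma hyp_dist_le_coarse: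
  fixes a :: "real^'n::finite" and b :: real and x :: "'n point"
  assumes b: "b > 0" and x: "x \<in> hyp_space" and c: "0 < c" "c \<le> b" "c \<le> snd x"
  shows "hyp_dist (a, b) x \<le> norm (x - (a, b)) / c"
proof -
  have le: "c \<le> b + \<tau> * (snd x - b)" if "\<tau> \<in> {0..1}" for \<tau>
  proof -
    have "c = (1 - \<tau>) * c + \<tau> * c" by (simp add: algebra_simps)
    also have "\<dots> \<le> (1 - \<tau>) * b + \<tau> * snd x" using that c by (intro add_mono mult_left_mono) auto
    finally show ?thesis by (simp add: algebra_simps)
  qed
  have "integral {0..1} (\<lambda>\<tau>. norm (x - (a, b)) / (b + \<tau> * (snd x - b))) \<le> integral {0..1::real} (\<lambda>\<tau>. norm (x - (a, b)) / c)"
  proof (rule integral_le)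
    have "b + \<tau> * (snd x - b) \<noteq> 0" if "\<tau> \<in> {0..1}" for \<tau> using le[OF that] c by simp
    then show "(\<lambda>\<tau>. norm (x - (a, b)) / (b + \<tau> * (snd x - b))) integrable_on {0..1}"
      by (intro integrable_continuous_interval continuous_intros) auto
    show "norm (x - (a, b)) / (b + \<tau> * (snd x - b)) \<le> norm (x - (a, b)) / c" if "\<tau> \<in> {0..1}" for \<tau>
      using le[OF that] c by (intro divide_left_mono) auto
  qed auto
  with hyp_dist_le_segment[OF b x, of a] show ?thesis by simp
qed

text \<open>On the vertical line through (a, b) the quotient is 1 and the bound is the exact
  distance ln (snd x / b). By continuity little is lost at nearby points, which
  \<open>near_vertical\<close> exploits.\<close>

lemma hyp_dist_le_above:
  fixes a :: "real^'n::finite" and b :: real and x :: "'n point"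
  assumes b: "b > 0" and x: "snd x > b"
  shows "hyp_dist (a, b) x \<le> norm (x - (a, b)) / (snd x - b) * ln (snd x / b)"
proof -
  define h where "h = snd x - b"
  have h: "h > 0" using x by (simp add: h_def)
  have pos: "b + \<tau> * h > 0" if "\<tau> \<in> {0..1}" for \<tau> using that b h by (auto intro!: add_pos_nonneg)
  have "((\<lambda>\<tau>. norm (x - (a, b)) / (b + \<tau> * h)) has_integral
     norm (x - (a, b)) / h * ln (b + 1 * h) - norm (x - (a, b)) / h * ln (b + 0 * h)) {0..1}"
  proof (rule fundamental_theorem_of_calculus)
    fix \<tau> :: real assume "\<tau> \<in> {0..1}"
    then have "((\<lambda>\<tau>. norm (x - (a, b)) / h * ln (b + \<tau> * h)) has_real_derivative norm (x - (a, b)) / (b + \<tau> * h)) (at \<tau>)"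
      using pos[of \<tau>] h by (auto intro!: derivative_eq_intros)
    then show "((\<lambda>\<tau>. norm (x - (a, b)) / h * ln (b + \<tau> * h)) has_vector_derivative norm (x - (a, b)) / (b + \<tau> * h)) (at \<tau> within {0..1})"
      by (simp add: has_real_derivative_iff_has_vector_derivative[symmetric] has_field_derivative_at_within)
  qed simp
  then have "integral {0..1} (\<lambda>\<tau>. norm (x - (a, b)) / (b + \<tau> * h)) = norm (x - (a, b)) / h * (ln (snd x) - ln b)"
    by (simp add: integral_unique h_def right_diff_distrib)
  also have "ln (snd x) - ln b = ln (snd x / b)" using b x by (simp add: ln_div)
  finally have e: "integral {0..1} (\<lambda>\<tau>. norm (x - (a, b)) / (b + \<tau> * h)) = norm (x - (a, b)) / h * ln (snd x / b)" .
  show ?thesis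
    using hyp_dist_le_segment[OF b, of x a] x b unfolding e[unfolded h_def] by (simp add: hyp_space_def)
qed

text \<open>The algebra behind \<open>coclosed_radial_equation\<close>: Z stands for
  \<open>cosh_radius\<close>, k1 and k2 for D k and D^2 k, and 1 / b - Z / y is the y-derivative of
  Z. The coefficient of k on the left is (p + 1)(n + 1 - p), and rewriting it as on the right
  exhibits the mass.\<close>

lemma radial_identity:
  fixes y b Z k k1 k2 n p :: real
  assumes "y \<noteq> 0" "b \<noteq> 0"
  shows "k2 * (2 * y * b * Z - y\<^sup>2 - b\<^sup>2) / b\<^sup>2 + (n + 2) * y * k1 / b
      + (- p - 1) * ((p - 1 - n) * k + y * k1 * (1 / b - Z / y))
      + ((1 / b - Z / y) * ((p - n) * y * k1 + y\<^sup>2 * k2 * (1 / b - Z / y)) + y\<^sup>2 * k1 * (Z / y\<^sup>2 - (1 / b - Z / y) / y))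
     = (Z\<^sup>2 - 1) * k2 + (n + 3) * Z * k1 + ((n + 2)\<^sup>2 / 4 - (n / 2 - p)\<^sup>2) * k"
  using assms by (simp add: field_simps power2_eq_square)

section \<open>Radial forms around a point\<close>

locale hyp_center =
  fixes a :: "real^'n::finite" and b :: real
  assumes b: "b > 0"
begin

text \<open>The classical formula for the cosh of the distance to (a, b). It is linked to
  \<open>hyp_dist\<close> only through the one-sided estimates \<open>dist_bounded_on_ball\<close>
  and \<open>near_vertical\<close>.\<close>

definition cosh_radius :: "'n point \<Rightarrow> real" where
  "cosh_radius x = ((fst x - a) \<bullet> (fst x - a) + (snd x)\<^sup>2 + b\<^sup>2) / (2 * snd x * b)"
definition radius :: "'n point \<Rightarrow> real" where "radius x = arcosh (cosh_radius x)"
definition weighted_radial :: "int \<Rightarrow> (real \<times> real \<Rightarrow> real) \<Rightarrow> real \<Rightarrow> 'n point \<Rightarrow> real" where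
  "weighted_radial c \<phi> t x = snd x powi c * \<phi> (t, radius x)"

lemma cosh_radius_ge_1: assumes "x \<in> hyp_space" shows "cosh_radius x \<ge> 1"
proof -
  have "snd x > 0" using assms by (simp add: hyp_space_def)
  moreover have "2 * snd x * b \<le> (snd x)\<^sup>2 + b\<^sup>2"
    using zero_le_power2[of "snd x - b"] by (simp add: power2_diff)
  moreover have "0 \<le> (fst x - a) \<bullet> (fst x - a)" by (rule inner_ge_zero)
  ultimately have "2 * snd x * b \<le> (fst x - a) \<bullet> (fst x - a) + (snd x)\<^sup>2 + b\<^sup>2" by linarith
  then show ?thesis using b \<open>snd x > 0\<close> by (simp add: cosh_radius_def)
qed

lemma horizontal_sq: "x \<in> hyp_space \<Longrightarrow> (fst x - a) \<bullet> (fst x - a) = 2 * snd x * b * cosh_radius x - (snd x)\<^sup>2 - b\<^sup>2"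
  using b by (simp add: cosh_radius_def hyp_space_def)

lemma cosh_radius_deriv:
  assumes "x \<in> hyp_space"
  shows "(cosh_radius has_derivative (\<lambda>v. ((fst x - a) \<bullet> fst v) / (snd x * b) + (1 / b - cosh_radius x / snd x) * snd v)) (at x)"
proof -
  have y: "snd x > 0" using assms by (simp add: hyp_space_def)
  have "(cosh_radius has_derivative (\<lambda>v. ((2 * ((fst x - a) \<bullet> fst v) + 2 * snd x * snd v) * (2 * snd x * b)
      - ((fst x - a) \<bullet> (fst x - a) + (snd x)\<^sup>2 + b\<^sup>2) * (2 * snd v * b)) / ((2 * snd x * b) * (2 * snd x * b)))) (at x)"
    unfolding cosh_radius_def[abs_def] using y b
    by (auto intro!: derivative_eq_intros simp: inner_commute algebra_simps)
  then show ?thesis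
    by (rule has_derivative_eq_rhs) (use y b in \<open>auto simp: fun_eq_iff cosh_radius_def field_simps power2_eq_square\<close>)
qed

lemma cosh_radius_pd: "x \<in> hyp_space \<Longrightarrow> pd v cosh_radius x = ((fst x - a) \<bullet> fst v) / (snd x * b) + (1 / b - cosh_radius x / snd x) * snd v"
  by (rule pd_eq[OF cosh_radius_deriv])

lemma cosh_radius_differentiable: "x \<in> hyp_space \<Longrightarrow> cosh_radius differentiable (at x)"
  by (rule differentiableI[OF cosh_radius_deriv])

lemma smooth_cosh_radius: "smooth_on hyp_space cosh_radius"
proof -
  have "smooth_on hyp_space (\<lambda>x::'n point. (fst x - a) \<bullet> (fst x - a))"
  proof -
    have "smooth_on hyp_space (\<lambda>x::'n point. \<Sum>i\<in>Basis. ((fst x - a) \<bullet> i) * ((fst x - a) \<bullet> i))"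
      by (intro smooth_on_sum smooth_on_mult affine_derivative(3) open_hyp_space) (simp add: linear_iff inner_left_distrib)+
    moreover have "(\<Sum>i\<in>Basis. ((fst x - a) \<bullet> i) * ((fst x - a) \<bullet> i)) = (fst x - a) \<bullet> (fst x - a)" for x :: "'n point"
      by (rule euclidean_inner[symmetric])
    ultimately show ?thesis by simp
  qed
  then show ?thesis
    unfolding cosh_radius_def[abs_def]
    by (intro smooth_on_divide smooth_intros open_hyp_space) (use b in \<open>auto simp: hyp_space_def\<close>)
qed

lemma weighted_radial_smooth: assumes "even_smooth \<phi>" shows "smooth_on (UNIV \<times> hyp_space) (\<lambda>q. weighted_radial c \<phi> (fst q) (snd q))"
  unfolding weighted_radial_def radius_def
  by (intro smooth_on_mult open_spacetime smooth_on_extend_time[OF smooth_on_snd_powi]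
      smooth_on_even_smooth_arcosh[OF assms] smooth_on_fst smooth_on_extend_time[OF smooth_cosh_radius]) (auto intro: cosh_radius_ge_1)

lemma weighted_radial_smooth_slice: assumes "even_smooth \<phi>" shows "smooth_on hyp_space (weighted_radial c \<phi> t)"
  using smooth_on_slice[OF weighted_radial_smooth[OF assms, where c=c], where t=t] by (simp only: fst_conv snd_conv)

lemma weighted_radial_pd:
  assumes "even_smooth \<phi>" and x: "x \<in> hyp_space"
  shows "pd v (weighted_radial c \<phi> t) x = of_int c * weighted_radial (c - 1) \<phi> t x * snd v
     + weighted_radial c (sinh_deriv \<phi>) t x * (((fst x - a) \<bullet> fst v) / (snd x * b) + (1 / b - cosh_radius x / snd x) * snd v)"
proof -
  have "((\<lambda>x. \<phi> (t, arcosh (cosh_radius x))) has_derivative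
     (\<lambda>v. dt \<phi> (t, arcosh (cosh_radius x)) * pd v (\<lambda>_. t) x + sinh_deriv \<phi> (t, arcosh (cosh_radius x)) * pd v cosh_radius x)) (at x)"
    by (rule even_smooth_arcosh[OF assms(1) _ cosh_radius_differentiable[OF x] open_hyp_space x cosh_radius_ge_1]) simp_all
  then have 1: "((\<lambda>x. \<phi> (t, radius x)) has_derivative
     (\<lambda>v. sinh_deriv \<phi> (t, radius x) * (((fst x - a) \<bullet> fst v) / (snd x * b) + (1 / b - cosh_radius x / snd x) * snd v))) (at x)"
    unfolding radius_def by (rule has_derivative_eq_rhs) (simp add: cosh_radius_pd[OF x])
  have 2: "((\<lambda>z. snd z powi c) has_derivative (\<lambda>v. snd v * (of_int c * snd x powi (c - 1)))) (at x)"
    by (rule has_derivative_power_int[THEN has_derivative_eq_rhs, OF _ has_derivative_snd[OF has_derivative_ident]])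
      (use x in \<open>auto simp: hyp_space_def\<close>)
  have "pd v (weighted_radial c \<phi> t) x = snd x powi c * (sinh_deriv \<phi> (t, radius x) * (((fst x - a) \<bullet> fst v) / (snd x * b) + (1 / b - cosh_radius x / snd x) * snd v))
     + snd v * (of_int c * snd x powi (c - 1)) * \<phi> (t, radius x)"
    unfolding weighted_radial_def[abs_def] by (rule pd_eq[OF has_derivative_mult[OF 2 1]])
  then show ?thesis by (simp add: weighted_radial_def mult_ac)
qed

lemma weighted_radial_time: "even_smooth \<phi> \<Longrightarrow> ((\<lambda>s. weighted_radial c \<phi> s x) has_real_derivative weighted_radial c (dt \<phi>) t x) (at t)"
  unfolding weighted_radial_def by (intro DERIV_cmult even_smooth_deriv(2))

lemma weighted_radial_shift: "x \<in> hyp_space \<Longrightarrow> e = c + d \<Longrightarrow> weighted_radial e \<phi> t x = snd x powi d * weighted_radial c \<phi> t x"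
  by (simp add: weighted_radial_def hyp_space_def power_int_add)

definition coclosed_radial :: "((nat \<Rightarrow> real^'n) \<Rightarrow> real) \<Rightarrow> nat \<Rightarrow> (real \<times> real \<Rightarrow> real) \<Rightarrow> real \<Rightarrow> 'n form" where
  "coclosed_radial A p k t x v = weighted_radial (- int p - 1) k t x * A (case_nat (fst x - a) (\<lambda>i. fst (v i)))"

text \<open>The horizontal gradient of \<open>cosh_radius\<close> is \<xi> / (y b). Each horizontal
  derivative therefore replaces k by D k, lowers the power of y by one and divides by b.\<close>

lemma ansatz:
  assumes "alternating (Suc p) A" "even_smooth k"
  shows "coclosed_ansatz a A p (weighted_radial (- int p - 1) k t) (\<lambda>x. weighted_radial (- int p - 2) (sinh_deriv k) t x / b) (\<lambda>x. weighted_radial (- int p - 3) (sinh_deriv (sinh_deriv k)) t x / b\<^sup>2)"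
proof (rule coclosed_ansatz.intro)
  note es = assms(2) and es1 = even_smooth_sinh_deriv[OF assms(2)]
  show "alternating (Suc p) A" by (rule assms)
  show "smooth_on hyp_space (weighted_radial (- int p - 1) k t)" by (rule weighted_radial_smooth_slice[OF es])
  show "smooth_on hyp_space (\<lambda>x. weighted_radial (- int p - 2) (sinh_deriv k) t x / b)"
    unfolding divide_inverse by (intro smooth_on_mult weighted_radial_smooth_slice es1 smooth_on_const open_hyp_space)
  fix x :: "'n point" and i assume x: "x \<in> hyp_space"
  then have y: "snd x > 0" by (simp add: hyp_space_def)
  have "weighted_radial (- int p - 1) (sinh_deriv k) t x = snd x powi 1 * weighted_radial (- int p - 2) (sinh_deriv k) t x"
    by (rule weighted_radial_shift[OF x]) simp
  then show "pd (i, 0) (weighted_radial (- int p - 1) k t) x = weighted_radial (- int p - 2) (sinh_deriv k) t x / b * ((fst x - a) \<bullet> i)"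
    using y by (simp add: weighted_radial_pd[OF es x])
  have "weighted_radial (- int p - 2) (sinh_deriv (sinh_deriv k)) t x = snd x powi 1 * weighted_radial (- int p - 3) (sinh_deriv (sinh_deriv k)) t x"
    by (rule weighted_radial_shift[OF x]) simp
  moreover have "pd (i, 0) (\<lambda>x. weighted_radial (- int p - 2) (sinh_deriv k) t x / b) x = (1 / b) * pd (i, 0) (weighted_radial (- int p - 2) (sinh_deriv k) t) x"
    using pd_cmult[OF smooth_on_differentiable[OF weighted_radial_smooth_slice[OF es1] x], where v="(i, 0)" and c="1 / b"] by simp
  ultimately show "pd (i, 0) (\<lambda>x. weighted_radial (- int p - 2) (sinh_deriv k) t x / b) x = weighted_radial (- int p - 3) (sinh_deriv (sinh_deriv k)) t x / b\<^sup>2 * ((fst x - a) \<bullet> i)"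
    using y by (simp add: weighted_radial_pd[OF es1 x] power2_eq_square)
qed

lemma coclosed_radial_eq:
  assumes "alternating (Suc p) A" "even_smooth k"
  shows "coclosed_radial A p k t = coclosed_ansatz.\<omega> a A (weighted_radial (- int p - 1) k t)"
  by (simp add: fun_eq_iff coclosed_radial_def coclosed_ansatz.\<omega>_def[OF ansatz[OF assms]] coclosed_ansatz.\<beta>_def[OF ansatz[OF assms]])

lemma coclosed_radial_time_form:
  assumes "alternating (Suc p) A" "even_smooth k"
  shows "time_form p (coclosed_radial A p k)"
  unfolding time_form_def
proof (intro conjI allI ballI)
  show "alternating p (coclosed_radial A p k t x)" for t x
    unfolding coclosed_radial_eq[OF assms] by (rule coclosed_ansatz.alternating_\<omega>[OF ansatz[OF assms]])
  fix v :: "nat \<Rightarrow> 'n point"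
  have "smooth_on (UNIV \<times> hyp_space) (\<lambda>q. weighted_radial (- int p - 1) k (fst q) (snd q) * A (case_nat (fst (snd q) - a) (\<lambda>i. fst (v i))))"
    by (intro smooth_on_mult open_spacetime weighted_radial_smooth assms(2) smooth_on_extend_time
        affine_derivative(3)[OF alternating_linear_front[OF assms(1)]])
  then show "smooth_on (UNIV \<times> hyp_space) (\<lambda>(t, x). coclosed_radial A p k t x v)"
    by (simp add: coclosed_radial_def case_prod_unfold)
qed

lemma coclosed_radial_time_deriv: assumes "even_smooth k" shows "time_deriv (coclosed_radial A p k) = coclosed_radial A p (dt k)"
  unfolding fun_eq_iff time_deriv_def
  by (intro allI DERIV_imp_deriv) (simp add: coclosed_radial_def DERIV_cmult_right weighted_radial_time[OF assms])

lemma coclosed_radial_equation: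
  assumes A: "alternating (Suc p) A" and rw: "radial_wave k CARD('n) \<bar>real CARD('n) / 2 - real p\<bar>" and x: "x \<in> hyp_space"
  shows "codifferential p (ext_deriv p (coclosed_radial A p k t)) x v = - time_deriv (time_deriv (coclosed_radial A p k)) t x v"
proof -
  interpret radial_wave k "CARD('n)" "\<bar>real CARD('n) / 2 - real p\<bar>" by (rule rw)
  note es1 = even_smooth_sinh_deriv[OF es] and es2 = even_smooth_sinh_deriv[OF even_smooth_sinh_deriv[OF es]]
  define N where "N = int CARD('n)"
  define P where "P = int p"
  interpret an: coclosed_ansatz a A p "weighted_radial (- int p - 1) k t" "\<lambda>x. weighted_radial (- int p - 2) (sinh_deriv k) t x / b" "\<lambda>x. weighted_radial (- int p - 3) (sinh_deriv (sinh_deriv k)) t x / b\<^sup>2"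
    by (rule ansatz[OF A es])
  define y where "y = snd x"
  have y: "y > 0" using x by (simp add: y_def hyp_space_def)
  define zy where "zy z = 1 / b - cosh_radius z / snd z" for z
  \<comment> \<open>The power of y common to all terms. Together with the outer factor of
    \<open>codifferential\<close> it restores the weight -p - 1 of the ansatz.\<close>
  define Q where "Q = y powi (P - 2 - N)"
  define k0 k1 k2 where "k0 = k (t, radius x)" and "k1 = sinh_deriv k (t, radius x)" and "k2 = sinh_deriv (sinh_deriv k) (t, radius x)"
  let ?Y = "\<lambda>z::'n point. snd z powi (2 * int p + 1 - int CARD('n))"
  have Fz: "?Y z * pd (0, 1) (weighted_radial (- int p - 1) k t) z = (of_int (- P - 1)) * weighted_radial (P - 1 - N) k t z + weighted_radial (P - N) (sinh_deriv k) t z * zy z" if z: "z \<in> hyp_space" for z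
  proof -
    have f1: "snd z powi (2 * int p + 1 - int CARD('n)) * weighted_radial (- int p - 2) k t z = weighted_radial (P - 1 - N) k t z"
      by (rule weighted_radial_shift[OF z, symmetric]) (simp add: P_def N_def)
    have f2: "snd z powi (2 * int p + 1 - int CARD('n)) * weighted_radial (- int p - 1) (sinh_deriv k) t z = weighted_radial (P - N) (sinh_deriv k) t z"
      by (rule weighted_radial_shift[OF z, symmetric]) (simp add: P_def N_def)
    have e: "- int p - 1 - 1 = - int p - 2" "- int p - 1 = - P - 1" by (simp_all add: P_def)
    have pdz: "pd (0, 1) (weighted_radial (- int p - 1) k t) z = of_int (- P - 1) * weighted_radial (- int p - 2) k t z + weighted_radial (- int p - 1) (sinh_deriv k) t z * zy z"
      unfolding weighted_radial_pd[OF es z] zy_def e(1) by (simp add: P_def)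
    have gen: "Y * (c * F + G * w) = c * (Y * F) + (Y * G) * w" for Y c F G w :: real by (simp add: algebra_simps)
    show ?thesis unfolding pdz gen f1 f2 ..
  qed
  have dzy: "zy differentiable (at x)" "pd (0, 1) zy x = cosh_radius x / y\<^sup>2 - zy x / y"
  proof -
    have "(zy has_derivative (\<lambda>v. 0 - (((((fst x - a) \<bullet> fst v) / (snd x * b) + (1 / b - cosh_radius x / snd x) * snd v) * snd x - cosh_radius x * snd v) / (snd x * snd x)))) (at x)"
      unfolding zy_def[abs_def]
      by (rule has_derivative_diff[OF has_derivative_const has_derivative_divide'[OF cosh_radius_deriv[OF x] has_derivative_snd[OF has_derivative_ident]]])
        (use y in \<open>simp add: y_def\<close>)
    from differentiableI[OF this] pd_eq[OF this, of "(0, 1)"]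
    show "zy differentiable (at x)" "pd (0, 1) zy x = cosh_radius x / y\<^sup>2 - zy x / y"
      using y by (simp_all add: zy_def y_def[symmetric] power2_eq_square diff_divide_distrib)
  qed
  have Fd: "weighted_radial c \<phi> t differentiable (at x)" if "even_smooth \<phi>" for c \<phi>
    by (rule smooth_on_differentiable[OF weighted_radial_smooth_slice[OF that] x])
  have pFn: "pd (0, 1) (weighted_radial c \<phi> t) x = of_int c * weighted_radial (c - 1) \<phi> t x + weighted_radial c (sinh_deriv \<phi>) t x * zy x" if "even_smooth \<phi>" for c \<phi>
    unfolding weighted_radial_pd[OF that x] zy_def by simp
  have FQ: "weighted_radial (P - 2 - N) \<phi> t x = Q * \<phi> (t, radius x)" "weighted_radial (P - 1 - N) \<phi> t x = Q * (y * \<phi> (t, radius x))" "weighted_radial (P - N) \<phi> t x = Q * (y\<^sup>2 * \<phi> (t, radius x))" for \<phi>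
  proof -
    show "weighted_radial (P - 2 - N) \<phi> t x = Q * \<phi> (t, radius x)" by (simp add: weighted_radial_def Q_def y_def)
    have "y powi (P - 1 - N) = Q * y powi 1" unfolding Q_def using y by (subst power_int_add[symmetric]) (auto simp: algebra_simps)
    then show "weighted_radial (P - 1 - N) \<phi> t x = Q * (y * \<phi> (t, radius x))" by (simp add: weighted_radial_def y_def)
    have "y powi (P - N) = Q * y powi 2" unfolding Q_def using y by (subst power_int_add[symmetric]) (auto simp: algebra_simps)
    then show "weighted_radial (P - N) \<phi> t x = Q * (y\<^sup>2 * \<phi> (t, radius x))" by (simp add: weighted_radial_def y_def)
  qed
  have "pd (0, 1) (\<lambda>z. ?Y z * pd (0, 1) (weighted_radial (- int p - 1) k t) z) x =
      pd (0, 1) (\<lambda>z. (of_int (- P - 1)) * weighted_radial (P - 1 - N) k t z + weighted_radial (P - N) (sinh_deriv k) t z * zy z) x"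
    by (rule frechet_cong_hyp[OF x Fz])
  also have "\<dots> = (of_int (- P - 1)) * pd (0, 1) (weighted_radial (P - 1 - N) k t) x
      + (weighted_radial (P - N) (sinh_deriv k) t x * pd (0, 1) zy x + pd (0, 1) (weighted_radial (P - N) (sinh_deriv k) t) x * zy x)"
    by (subst pd_add) (auto intro!: differentiable_mult differentiable_const Fd es es1 dzy simp: pd_cmult[OF Fd[OF es]] pd_mult[OF Fd[OF es1] dzy(1)])
  also have "\<dots> = Q * ((- real p - 1) * ((real p - 1 - real CARD('n)) * k0 + y * k1 * zy x)
      + (zy x * ((real p - real CARD('n)) * y * k1 + y\<^sup>2 * k2 * zy x) + y\<^sup>2 * k1 * (cosh_radius x / y\<^sup>2 - zy x / y)))"
  proof -
    have e: "P - 1 - N - 1 = P - 2 - N" "P - N - 1 = P - 1 - N" by simp_all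
    show ?thesis
      unfolding pFn[OF es] pFn[OF es1] e FQ dzy(2) k0_def[symmetric] k1_def[symmetric] k2_def[symmetric]
      by (simp add: P_def N_def algebra_simps)
  qed
  finally have v: "pd (0, 1) (\<lambda>z. ?Y z * pd (0, 1) (weighted_radial (- int p - 1) k t) z) x =
     Q * ((- real p - 1) * ((real p - 1 - real CARD('n)) * k0 + y * k1 * zy x)
      + (zy x * ((real p - real CARD('n)) * y * k1 + y\<^sup>2 * k2 * zy x) + y\<^sup>2 * k1 * (cosh_radius x / y\<^sup>2 - zy x / y)))" .
  have h: "?Y x * (weighted_radial (- int p - 3) (sinh_deriv (sinh_deriv k)) t x / b\<^sup>2 * ((fst x - a) \<bullet> (fst x - a)) + (real CARD('n) + 2) * (weighted_radial (- int p - 2) (sinh_deriv k) t x / b))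
     = Q * (k2 * (2 * y * b * cosh_radius x - y\<^sup>2 - b\<^sup>2) / b\<^sup>2 + (real CARD('n) + 2) * y * k1 / b)"
  proof -
    have h1: "?Y x * weighted_radial (- int p - 3) (sinh_deriv (sinh_deriv k)) t x = Q * k2"
      unfolding k2_def FQ(1)[symmetric] by (rule weighted_radial_shift[OF x, symmetric]) (simp add: P_def N_def)
    have h2: "?Y x * weighted_radial (- int p - 2) (sinh_deriv k) t x = Q * (y * k1)"
      unfolding k1_def FQ(2)[symmetric] by (rule weighted_radial_shift[OF x, symmetric]) (simp add: P_def N_def)
    have gen: "Y * (u / c * s + r * (w / d)) = (Y * u) * s / c + r * (Y * w) / d" for Y u s r w c d :: real
      by (simp add: algebra_simps)
    have gen': "q * k * s / c + r * (q * (y * l)) / d = q * (k * s / c + r * y * l / d)" for q k s c r y l d :: real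
      by (simp add: algebra_simps)
    show ?thesis unfolding gen h1 h2 horizontal_sq[OF x] unfolding y_def[symmetric] by (rule gen')
  qed
  have rid: "k2 * (2 * y * b * cosh_radius x - y\<^sup>2 - b\<^sup>2) / b\<^sup>2 + (real CARD('n) + 2) * y * k1 / b
      + ((- real p - 1) * ((real p - 1 - real CARD('n)) * k0 + y * k1 * zy x)
      + (zy x * ((real p - real CARD('n)) * y * k1 + y\<^sup>2 * k2 * zy x) + y\<^sup>2 * k1 * (cosh_radius x / y\<^sup>2 - zy x / y))) = dt (dt k) (t, radius x)"
  proof -
    have "(sinh (radius x))\<^sup>2 = (cosh_radius x)\<^sup>2 - 1" "cosh (radius x) = cosh_radius x"
      using cosh_radius_ge_1[OF x] by (simp_all add: radius_def sinh_square_eq)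
    then show ?thesis
      unfolding pde zy_def y_def[symmetric] add.assoc[symmetric]
      using radial_identity[of y b k2 "cosh_radius x" "real CARD('n)" k1 "real p" k0] y b
      by (simp add: k0_def k1_def k2_def add.assoc)
  qed
  have "codifferential p (ext_deriv p (coclosed_radial A p k t)) x v =
     - (snd x powi (int CARD('n) + 1 - 2 * int p)) * (Q * dt (dt k) (t, radius x)) * an.\<beta> x v"
    unfolding coclosed_radial_eq[OF A es] an.laplacian[OF x] h v distrib_left[symmetric] rid ..
  also have "snd x powi (int CARD('n) + 1 - 2 * int p) * (Q * dt (dt k) (t, radius x)) = weighted_radial (- int p - 1) (dt (dt k)) t x"
  proof -
    have "snd x powi (int CARD('n) + 1 - 2 * int p) * Q = snd x powi (- int p - 1)"
    proof -
      have e: "(int CARD('n) + 1 - 2 * int p) + (P - 2 - N) = - int p - 1" by (simp add: P_def N_def)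
      show ?thesis
        unfolding Q_def y_def[symmetric] e[symmetric] by (rule power_int_add[symmetric]) (use y in simp)
    qed
    then show ?thesis by (simp add: weighted_radial_def mult.assoc[symmetric])
  qed
  then have "- (snd x powi (int CARD('n) + 1 - 2 * int p)) * (Q * dt (dt k) (t, radius x)) * an.\<beta> x v = - (weighted_radial (- int p - 1) (dt (dt k)) t x * an.\<beta> x v)"
    by simp
  finally show ?thesis
    unfolding coclosed_radial_time_deriv[OF es] coclosed_radial_time_deriv[OF even_smooth_dt[OF es]] by (simp add: coclosed_radial_def an.\<beta>_def)
qed

end

section \<open>The star of du for time-dependent functions u\<close>

lemma time_form_star_d:
  fixes u :: "real \<Rightarrow> 'n::finite point \<Rightarrow> real"
  assumes A: "alternating (Suc p) A" and u: "smooth_on (UNIV \<times> hyp_space) (\<lambda>q. u (fst q) (snd q))"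
  shows "time_form p (\<lambda>t. star_d A (u t))"
  unfolding time_form_def
proof (intro conjI allI ballI)
  show "alternating p (star_d A (u t) x)" for t x
    unfolding star_d_def[abs_def] by (intro alternating_cmult alternating_sum alternating_contract A)
  fix v
  show "smooth_on (UNIV \<times> hyp_space) (\<lambda>(t, x). star_d A (u t) x v)"
  proof (rule smooth_on_cong[OF open_spacetime])
    show "smooth_on (UNIV \<times> hyp_space) (\<lambda>q::real \<times> 'n point. snd (snd q) powi (1 - int CARD('n)) *
        (\<Sum>b\<in>Basis. pd (0, b) (\<lambda>q. u (fst q) (snd q)) q * A (case_nat b v)))"
      by (intro smooth_on_mult smooth_on_sum smooth_on_const smooth_on_pd u open_spacetime
          smooth_on_extend_time[OF smooth_on_snd_powi])
    fix q :: "real \<times> 'n point" assume "q \<in> UNIV \<times> hyp_space"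
    then have x: "snd q \<in> hyp_space" by auto
    have "pd b (u (fst q)) (snd q) = pd (0, b) (\<lambda>q. u (fst q) (snd q)) q" for b
      using spacetime_slices(3)[OF u x, where t="fst q" and u=b] by simp
    then show "snd (snd q) powi (1 - int CARD('n)) * (\<Sum>b\<in>Basis. pd (0, b) (\<lambda>q. u (fst q) (snd q)) q * A (case_nat b v))
        = (case q of (t, x) \<Rightarrow> star_d A (u t) x v)"
      by (simp add: star_d_def case_prod_unfold)
  qed
qed

lemma time_deriv_star_d:
  fixes u :: "real \<Rightarrow> 'n::finite point \<Rightarrow> real"
  assumes u: "smooth_on (UNIV \<times> hyp_space) (\<lambda>q. u (fst q) (snd q))"
    and u': "\<And>t x. x \<in> hyp_space \<Longrightarrow> ((\<lambda>s. u s x) has_real_derivative u' t x) (at t)"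
    and x: "x \<in> hyp_space"
  shows "time_deriv (\<lambda>t. star_d A (u t)) t x v = star_d A (u' t) x v"
proof -
  let ?U = "\<lambda>q. u (fst q) (snd q)"
  have s: "pd b (u t) x = pd (0, b) ?U (t, x)" for b t
    using spacetime_slices(3)[OF u x, where t=t and u=b] by simp
  have "pd (1, 0) (pd (0, b) ?U) (t, x) = pd b (u' t) x" for b
  proof -
    have "pd (1, 0) (pd (0, b) ?U) (t, x) = pd (0, b) (pd (1, 0) ?U) (t, x)"
      by (rule pd_symmetric[OF open_spacetime u]) (use x in simp)
    also have "\<dots> = pd b (\<lambda>x. pd (1, 0) ?U (t, x)) x"
      by (rule spacetime_slices(3)[OF smooth_on_pd[OF u] x, symmetric])
    also have "\<dots> = pd b (u' t) x"
    proof (rule frechet_cong_hyp[OF x])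
      fix z :: "'n point" assume z: "z \<in> hyp_space"
      show "pd (1, 0) ?U (t, z) = u' t z"
        using DERIV_unique[OF spacetime_slices(1)[OF u z, where t=t]] u'[OF z, of t] by simp
    qed
    finally show ?thesis .
  qed
  then have "((\<lambda>t. pd b (u t) x) has_real_derivative pd b (u' t) x) (at t)" for b
    using spacetime_slices(1)[OF smooth_on_pd[OF u, of "(0, b)"] x, where t=t] by (simp only: s)
  then show ?thesis
    unfolding time_deriv_def star_d_def
    by (intro DERIV_imp_deriv DERIV_cmult DERIV_sum) (auto intro!: DERIV_cmult_right)
qed

text \<open>Let G be the gradient. The assumption says that A vanishes when G is put in its first
  slot. \<open>alternating_trace\<close> for the endomorphism v -> (G . v) G, whose trace is |G|^2,
  then gives |G|^2 A w = 0.\<close>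

lemma star_d_zero_gradient:
  fixes u :: "'n::finite point \<Rightarrow> real"
  assumes A: "alternating (Suc CARD('n)) A" "A w \<noteq> 0" and u: "u differentiable (at x)" and x: "x \<in> hyp_space"
    and z: "\<And>v. star_d A u x v = 0"
  shows "pd b u x = 0"
proof -
  define G where "G = (\<Sum>b\<in>Basis. pd b u x *\<^sub>R b)"
  have AG: "A (case_nat G v) = 0" for v
    using z[of v] x unfolding star_d_contract[OF A(1) u] G_def[symmetric] by (simp add: hyp_space_def)
  have lin: "linear (\<lambda>v. (c \<bullet> G) * (G \<bullet> v))" for c
    by (simp add: linear_iff inner_right_distrib algebra_simps)
  have "(\<Sum>i\<le>CARD('n). (- 1) ^ i * (\<Sum>c\<in>Basis. ((c \<bullet> G) * (G \<bullet> w i)) * A (case_nat c (omit i w)))) = (\<Sum>c\<in>Basis. (c \<bullet> G) * (G \<bullet> c)) * A w"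
    by (rule alternating_trace[OF A(1), of "\<lambda>c v. (c \<bullet> G) * (G \<bullet> v)" w, OF _ lin]) simp
  moreover have "(\<Sum>c\<in>Basis. ((c \<bullet> G) * (G \<bullet> y)) * A (case_nat c v)) = 0" for y v
  proof -
    have "(\<Sum>c\<in>Basis. ((c \<bullet> G) * (G \<bullet> y)) * A (case_nat c v)) = (G \<bullet> y) * (\<Sum>c\<in>Basis. (G \<bullet> c) * A (case_nat c v))"
      by (simp add: sum_distrib_left inner_commute mult_ac)
    also have "\<dots> = 0" unfolding sum_Basis_inner_linear[OF alternating_linear_front[OF A(1)]] AG by simp
    finally show ?thesis .
  qed
  moreover have "(\<Sum>c\<in>Basis. (c \<bullet> G) * (G \<bullet> c)) = G \<bullet> G" by (simp add: euclidean_inner[of G G] inner_commute)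
  ultimately have "G = 0" using A(2) by simp
  have "b = (\<Sum>c\<in>Basis. (b \<bullet> c) *\<^sub>R c)" by (simp add: euclidean_representation)
  then have "pd b u x = (\<Sum>c\<in>Basis. pd ((b \<bullet> c) *\<^sub>R c) u x)" using pd_sum_vector[OF u, of "\<lambda>c. (b \<bullet> c) *\<^sub>R c" Basis] by metis
  also have "\<dots> = b \<bullet> G" by (simp add: pd_scaleR[OF u] G_def inner_sum_right mult.commute)
  finally show ?thesis using \<open>G = 0\<close> by simp
qed

context hyp_center
begin

section \<open>From Huygens' principle to a lacuna of k\<close>

lemma dist_bounded_on_ball:
  obtains R where "R > 0" "\<And>x. x \<in> hyp_space \<Longrightarrow> radius x < 3 \<Longrightarrow> hyp_dist (a, b) x < R"
proof -
  \<comment> \<open>If the radius is below 3, then |\<xi>|^2 + y^2 + b^2 <= 2 y b C. This confines y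
    between b / (2 C) and 2 b C and |\<xi>| below 2 b C, so c bounds all heights from below and
    \<open>hyp_dist_le_coarse\<close> applies.\<close>
  define C :: real where "C = cosh 3"
  have C: "C \<ge> 1" unfolding C_def by (rule cosh_real_ge_1)
  define c where "c = b / (2 * C)"
  have c: "c > 0" "c \<le> b" using b C by (simp_all add: c_def divide_le_eq)
  have "hyp_dist (a, b) x < 4 * b * C / c + 1" if x: "x \<in> hyp_space" "radius x < 3" for x
  proof -
    have y: "snd x > 0" using x by (simp add: hyp_space_def)
    have "cosh (radius x) < cosh 3"
      using x cosh_radius_ge_1[OF x(1)] by (subst cosh_real_nonneg_less_iff) (auto simp: radius_def)
    then have "cosh_radius x < C" using cosh_radius_ge_1[OF x(1)] by (simp add: radius_def C_def)
    then have "2 * snd x * b * cosh_radius x \<le> 2 * snd x * b * C" using y b by simp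
    then have le: "(fst x - a) \<bullet> (fst x - a) + (snd x)\<^sup>2 + b\<^sup>2 \<le> 2 * snd x * b * C" using horizontal_sq[OF x(1)] by simp
    have p: "0 \<le> (fst x - a) \<bullet> (fst x - a)" "0 \<le> (snd x)\<^sup>2" "0 \<le> b\<^sup>2" by simp_all
    have "(snd x)\<^sup>2 \<le> 2 * snd x * b * C" using le p by linarith
    then have "snd x * snd x \<le> snd x * (2 * b * C)" by (simp only: power2_eq_square mult_ac)
    then have y1: "snd x \<le> 2 * b * C" using y by simp
    have "b\<^sup>2 \<le> 2 * snd x * b * C" using le p by linarith
    then have "b * b \<le> b * (2 * snd x * C)" by (simp only: power2_eq_square mult_ac)
    then have "b \<le> 2 * snd x * C" using b by simp
    then have y2: "c \<le> snd x" using C by (simp add: c_def divide_le_eq mult_ac)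
    have "(norm (fst x - a))\<^sup>2 \<le> 2 * snd x * b * C" unfolding power2_norm_eq_inner using le p by linarith
    also have "\<dots> \<le> 2 * (2 * b * C) * b * C" using y1 b C by (intro mult_right_mono mult_left_mono) auto
    also have "\<dots> = (2 * b * C)\<^sup>2" by (simp add: power2_eq_square)
    finally have n1: "norm (fst x - a) \<le> 2 * b * C" using b C by (intro power2_le_imp_le[of "norm (fst x - a)"]) auto
    have bC: "b \<le> b * C" using b C by simp
    have "norm (x - (a, b)) \<le> norm (fst x - a) + norm (snd x - b)"
      using norm_Pair_le[of "fst x - a" "snd x - b"] by (simp add: minus_prod_def)
    also have "\<dots> \<le> 4 * b * C" using n1 y1 y bC b by (simp only: real_norm_def)
    finally have "norm (x - (a, b)) / c \<le> 4 * b * C / c" using c by (intro divide_right_mono) auto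
    with hyp_dist_le_coarse[OF b x(1) c y2, of a] show ?thesis by simp
  qed
  moreover have "4 * b * C / c + 1 > 0" using b C c by (intro add_nonneg_pos divide_nonneg_pos) auto
  ultimately show thesis using that by blast
qed

text \<open>The number 3 behind the choice of R is the margin 2 of the support plus 1: for |t| < 1
  the form vanishes beyond radius 3, hence so does its time derivative at 0. Both data then vanish
  outside the ball of radius R, as condition (2) requires.\<close>

lemma huygens_tail:
  assumes hp: "huygens_principle p (a, b)" and tf: "time_form p \<omega>" and ws: "wave_solution p (\<omega> 0) (time_deriv \<omega> 0) \<omega>"
    and supp: "\<And>t x v. x \<in> hyp_space \<Longrightarrow> radius x \<ge> \<bar>t\<bar> + 2 \<Longrightarrow> \<omega> t x v = 0"
  obtains R where "R > 0" "\<And>t x v. x \<in> hyp_space \<Longrightarrow> hyp_dist (a, b) x < \<bar>t\<bar> - R \<Longrightarrow> \<omega> t x v = 0"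
proof -
  obtain R where R: "R > 0" "\<And>x. x \<in> hyp_space \<Longrightarrow> radius x < 3 \<Longrightarrow> hyp_dist (a, b) x < R"
    using dist_bounded_on_ball by blast
  have far: "radius x \<ge> 3" if "x \<in> hyp_space - hyp_ball (a, b) R" for x
    using R(2)[of x] that by (force simp: hyp_ball_def)
  have v1: "vanishes_on (hyp_space - hyp_ball (a, b) R) (\<omega> 0)"
    unfolding vanishes_on_def
  proof (intro ballI allI)
    fix x v assume x: "x \<in> hyp_space - hyp_ball (a, b) R"
    show "\<omega> 0 x v = 0" by (rule supp) (use x far[OF x] in auto)
  qed
  have v2: "vanishes_on (hyp_space - hyp_ball (a, b) R) (time_deriv \<omega> 0)"
    unfolding vanishes_on_def
  proof (intro ballI allI)
    fix x v assume x: "x \<in> hyp_space - hyp_ball (a, b) R"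
    have "((\<lambda>s. \<omega> s x v) has_real_derivative 0) (at 0)"
    proof (rule DERIV_locally_zero[of "{-1<..<1}"])
      fix s :: real assume "s \<in> {-1<..<1}"
      then show "\<omega> s x v = 0" by (intro supp) (use x far[OF x] in auto)
    qed simp_all
    then show "time_deriv \<omega> 0 x v = 0" unfolding time_deriv_def by (rule DERIV_imp_deriv)
  qed
  have "vanishes_on (hyp_ball (a, b) (\<bar>t\<bar> - R)) (\<omega> t)" for t
    using hp[unfolded huygens_principle_def, rule_format, of "\<omega> 0" "time_deriv \<omega> 0" \<omega> R t]
      smooth_form_slice[OF tf] smooth_form_slice[OF time_form_time_deriv[OF tf]] ws R(1) v1 v2 by blast
  then show thesis using that[OF R(1)] by (auto simp: vanishes_on_def hyp_ball_def)
qed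

lemma vertical_point:
  assumes "r > 0"
  shows "(a, b * exp r) \<in> hyp_space" "radius (a, b * exp r) = r"
proof -
  show "(a, b * exp r) \<in> hyp_space" using b by (simp add: hyp_space_def)
  have "cosh_radius (a, b * exp r) = cosh r"
    using b by (simp add: cosh_radius_def cosh_def exp_minus field_simps power2_eq_square)
  then show "radius (a, b * exp r) = r" using assms by (simp add: radius_def arcosh_cosh_real)
qed

text \<open>The bound of \<open>hyp_dist_le_above\<close> is continuous in the horizontal
  displacement and equals r at displacement 0.\<close>

lemma near_vertical:
  assumes "r > 0" "r < T"
  shows "\<forall>\<^sub>F \<epsilon> in nhds 0. hyp_dist (a, b) (a + \<epsilon> *\<^sub>R u, b * exp r) < T"
proof -
  define h where "h = b * exp r - b"
  have h: "h > 0" using b assms(1) by (simp add: h_def)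
  define B where "B \<epsilon> = norm ((a + \<epsilon> *\<^sub>R u, b * exp r) - (a, b)) / h * r" for \<epsilon> :: real
  have le: "hyp_dist (a, b) (a + \<epsilon> *\<^sub>R u, b * exp r) \<le> B \<epsilon>" for \<epsilon>
    using hyp_dist_le_above[OF b, of "(a + \<epsilon> *\<^sub>R u, b * exp r)" a] b assms(1) by (simp add: B_def h_def)
  have "B 0 = r" using h by (simp add: B_def norm_Pair flip: h_def)
  moreover have "isCont B 0" unfolding B_def using h by (intro continuous_intros) auto
  then have "(B \<longlongrightarrow> B 0) (nhds 0)" by (simp add: isCont_def tendsto_at_iff_tendsto_nhds)
  ultimately have "\<forall>\<^sub>F \<epsilon> in nhds 0. B \<epsilon> < T" using assms(2) by (auto dest: order_tendstoD)
  then show ?thesis by eventually_elim (use le in \<open>auto intro: le_less_trans\<close>)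
qed

text \<open>On the vertical line \<xi> = 0 and the form says nothing about k. It is therefore
  evaluated beside the line, where it is a nonzero multiple of \<epsilon> k; divide by \<epsilon>
  and let \<epsilon> tend to 0.\<close>

lemma coclosed_radial_lacuna:
  assumes A: "alternating (Suc p) A" "A w \<noteq> 0" and es: "even_smooth k"
    and van: "\<And>t x v. x \<in> hyp_space \<Longrightarrow> hyp_dist (a, b) x < \<bar>t\<bar> - R \<Longrightarrow> coclosed_radial A p k t x v = 0"
    and r: "0 < r" "r < \<bar>t\<bar> - R"
  shows "k (t, r) = 0"
proof -
  define X where "X \<epsilon> = (a + \<epsilon> *\<^sub>R w 0, b * exp r)" for \<epsilon> :: real
  have XH: "X \<epsilon> \<in> hyp_space" for \<epsilon> using b by (simp add: X_def hyp_space_def)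
  have wc: "case_nat (w 0) (\<lambda>i. w (Suc i)) = w" by (auto simp: fun_eq_iff split: nat.split)
  have "\<forall>\<^sub>F \<epsilon> in at_right 0. k (t, radius (X \<epsilon>)) = 0"
  proof -
    have "\<forall>\<^sub>F \<epsilon> in at_right 0. hyp_dist (a, b) (X \<epsilon>) < \<bar>t\<bar> - R"
      using near_vertical[OF r, of "w 0"] unfolding X_def[symmetric] eventually_at_filter
      by (rule eventually_mono) simp
    moreover have "\<forall>\<^sub>F \<epsilon> in at_right 0. \<epsilon> > (0::real)" by (rule eventually_at_right_less)
    ultimately show ?thesis
    proof eventually_elim
      case (elim \<epsilon>)
      have "coclosed_radial A p k t (X \<epsilon>) (\<lambda>i. (w (Suc i), 0)) = 0" by (rule van[OF XH elim(1)])
      moreover have "A (case_nat (\<epsilon> *\<^sub>R w 0) (\<lambda>i. w (Suc i))) = \<epsilon> * A w"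
        using linear_scale[OF alternating_linear_front[OF A(1)], of \<epsilon> "w 0" "\<lambda>i. w (Suc i)"] wc by simp
      moreover have "snd (X \<epsilon>) powi (- int p - 1) \<noteq> 0" using b by (simp add: X_def)
      ultimately show "k (t, radius (X \<epsilon>)) = 0" using elim(2) A(2) by (simp add: coclosed_radial_def weighted_radial_def X_def)
    qed
  qed
  moreover have "((\<lambda>\<epsilon>. k (t, radius (X \<epsilon>))) \<longlongrightarrow> k (t, r)) (at_right 0)"
  proof -
    have "continuous_on UNIV (\<lambda>\<epsilon>::real. k (t, radius (X \<epsilon>)))"
    proof -
      have "continuous_on hyp_space (\<lambda>x. k (t, radius x))"
        using smooth_on_continuous[OF weighted_radial_smooth_slice[OF es, of 0 t]] by (simp add: weighted_radial_def)
      then show ?thesis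
        by (rule continuous_on_compose2) (use XH in \<open>auto simp: X_def intro!: continuous_intros\<close>)
    qed
    then have "isCont (\<lambda>\<epsilon>. k (t, radius (X \<epsilon>))) 0" by (simp add: continuous_on_eq_continuous_at)
    then have "((\<lambda>\<epsilon>. k (t, radius (X \<epsilon>))) \<longlongrightarrow> k (t, radius (X 0))) (at_right 0)"
      by (auto simp: isCont_def filterlim_at_split)
    then show ?thesis using vertical_point(2)[OF r(1)] by (simp add: X_def)
  qed
  ultimately show ?thesis
    using tendsto_unique[OF _ _ tendsto_eventually] trivial_limit_at_right_real by blast
qed

text \<open>Here the vertical line itself suffices: where \<xi> = 0 only the derivative of \<xi>
  survives, and on horizontal vectors the exterior derivative is (p + 1) y^(-p-1) k A.\<close>

lemma ext_deriv_coclosed_radial_lacuna: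
  assumes A: "alternating (Suc p) A" "A w \<noteq> 0" and es: "even_smooth k"
    and van: "\<And>t x v. x \<in> hyp_space \<Longrightarrow> hyp_dist (a, b) x < \<bar>t\<bar> - R \<Longrightarrow> ext_deriv p (coclosed_radial A p k t) x v = 0"
    and r: "0 < r" "r < \<bar>t\<bar> - R"
  shows "k (t, r) = 0"
proof -
  interpret an: coclosed_ansatz a A p "weighted_radial (- int p - 1) k t" "\<lambda>x. weighted_radial (- int p - 2) (sinh_deriv k) t x / b" "\<lambda>x. weighted_radial (- int p - 3) (sinh_deriv (sinh_deriv k)) t x / b\<^sup>2"
    by (rule ansatz[OF A(1) es])
  define x where "x = (a, b * exp r)"
  have x: "x \<in> hyp_space" "radius x = r" using vertical_point[OF r(1)] by (simp_all add: x_def)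
  have "hyp_dist (a, b) x < \<bar>t\<bar> - R"
    using eventually_nhds_x_imp_x[OF near_vertical[OF r, of 0]] by (simp add: x_def)
  from van[OF x(1) this, of "\<lambda>i. (w i, 0)"]
  have 0: "ext_deriv p (coclosed_radial A p k t) x (\<lambda>i. (w i, 0)) = 0" .
  have \<beta>0: "an.\<beta> x v = 0" for v
    unfolding an.\<beta>_def x_def using linear_0[OF alternating_linear_front[OF A(1)]] by simp
  have "ext_deriv p (coclosed_radial A p k t) x (\<lambda>i. (w i, 0)) = (\<Sum>i\<le>p. (- 1) ^ i * (weighted_radial (- int p - 1) k t x * ((- 1) ^ i * A w)))"
    unfolding ext_deriv_def coclosed_radial_eq[OF A(1) es] an.pd_\<omega>[OF x(1)] \<beta>0
  proof (rule sum.cong[OF refl])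
    fix i assume i: "i \<in> {..p}"
    have "(\<lambda>j. fst (omit i (\<lambda>i. (w i, 0::real)) j)) = omit i w" by (simp add: omit_def fun_eq_iff)
    then show "(- 1) ^ i * (weighted_radial (- int p - 1) k t x * A (case_nat (fst (w i, 0::real)) (\<lambda>j. fst (omit i (\<lambda>i. (w i, 0::real)) j))) + pd (w i, 0) (weighted_radial (- int p - 1) k t) x * 0)
      = (- 1) ^ i * (weighted_radial (- int p - 1) k t x * ((- 1) ^ i * A w))"
      using alternating_move_front[OF A(1), of i w] i by simp
  qed
  also have "\<dots> = (real p + 1) * (weighted_radial (- int p - 1) k t x * A w)"
  proof -
    have sgn: "(- 1) ^ i * (F * ((- 1) ^ i * y)) = F * y" for i and F y :: real
    proof -
      have "(- 1) ^ i * (F * ((- 1) ^ i * y)) = ((- 1) ^ i * (- 1) ^ i) * (F * y)" by (simp only: mult_ac)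
      then show ?thesis by (simp flip: power_mult_distrib)
    qed
    show ?thesis unfolding sgn by simp
  qed
  finally have "weighted_radial (- int p - 1) k t x = 0" using 0 A(2) by simp
  moreover have "snd x powi (- int p - 1) \<noteq> 0" using b by (simp add: x_def)
  ultimately show ?thesis using x(2) by (simp add: weighted_radial_def)
qed

text \<open>A scalar wave of mass n / 2: the ansatz in degree 0, with the covector e as A. Being
  linear in \<xi> rather than radial, it lets the equation and the lacuna lemma of
  \<open>coclosed_radial\<close> be reused, with the same k.\<close>

definition dipole :: "real^'n \<Rightarrow> (real \<times> real \<Rightarrow> real) \<Rightarrow> real \<Rightarrow> 'n point \<Rightarrow> real" where
  "dipole e k t x = weighted_radial (- 1) k t x * ((fst x - a) \<bullet> e)"

lemma linear_inner_right: "linear (\<lambda>v::real^'n. v \<bullet> e)"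
  by (simp add: linear_iff inner_left_distrib)

lemma alternating_inner: "alternating (Suc 0) (\<lambda>v. (v 0 :: real^'n) \<bullet> e)"
  by (rule alternatingI) (auto simp: linear_iff inner_left_distrib)

lemma coclosed_radial_dipole: "coclosed_radial (\<lambda>v. v 0 \<bullet> e) 0 k t x v = dipole e k t x"
  by (simp add: coclosed_radial_def dipole_def)

lemma dipole_smooth: "even_smooth k \<Longrightarrow> smooth_on (UNIV \<times> hyp_space) (\<lambda>q. dipole e k (fst q) (snd q))"
  unfolding dipole_def by (intro smooth_on_mult weighted_radial_smooth smooth_on_extend_time affine_derivative(3) linear_inner_right open_spacetime)

lemma dipole_smooth_slice: assumes "even_smooth k" shows "smooth_on hyp_space (dipole e k t)"
  using smooth_on_slice[OF dipole_smooth[OF assms, where e=e], where t=t] by (simp only: fst_conv snd_conv)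

lemma dipole_time: "even_smooth k \<Longrightarrow> ((\<lambda>s. dipole e k s x) has_real_derivative dipole e (dt k) t x) (at t)"
  unfolding dipole_def by (intro DERIV_cmult_right weighted_radial_time)

lemma dipole_wave:
  assumes rw: "radial_wave k CARD('n) (real CARD('n) / 2)" and x: "x \<in> hyp_space"
  shows "div_y (dipole e k t) x = snd x powi (- 1 - int CARD('n)) * dipole e (dt (dt k)) t x"
proof -
  have es: "even_smooth k" using rw by (simp add: radial_wave_def)
  have y: "snd x > 0" using x by (simp add: hyp_space_def)
  let ?A = "\<lambda>v. (v 0 :: real^'n) \<bullet> e"
  have "codifferential 0 (ext_deriv 0 (coclosed_radial ?A 0 k t)) x (\<lambda>_. 0) = - time_deriv (time_deriv (coclosed_radial ?A 0 k)) t x (\<lambda>_. 0)"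
    by (rule coclosed_radial_equation[OF alternating_inner _ x]) (use rw in simp)
  moreover have "ext_deriv 0 (coclosed_radial ?A 0 k t) z (case_nat c v) = pd c (dipole e k t) z" for z c v
    by (simp add: ext_deriv_def coclosed_radial_dipole[abs_def])
  ultimately have "snd x powi (int CARD('n) + 1) * div_y (dipole e k t) x = dipole e (dt (dt k)) t x"
    by (simp add: codifferential_def div_y_def coclosed_radial_time_deriv[OF es] coclosed_radial_time_deriv[OF even_smooth_dt[OF es]] coclosed_radial_dipole)
  then have "snd x powi (- 1 - int CARD('n)) * dipole e (dt (dt k)) t x =
      (snd x powi (- 1 - int CARD('n)) * snd x powi (int CARD('n) + 1)) * div_y (dipole e k t) x" by simp
  also have "snd x powi (- 1 - int CARD('n)) * snd x powi (int CARD('n) + 1) = 1"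
    using y by (subst power_int_add[symmetric]; simp)
  finally show ?thesis by simp
qed

text \<open>By the wave equation for the scalar u, d turns the star of du into the star of u_tt, and
  \<open>codifferential_top\<close> turns that into minus the star of d u_tt.\<close>

lemma star_wave:
  assumes rw: "radial_wave k CARD('n) (real CARD('n) / 2)" and A: "alternating (Suc CARD('n)) A"
  shows "time_form CARD('n) (\<lambda>t. star_d A (dipole e k t))"
    and "wave_solution CARD('n) (star_d A (dipole e k 0)) (time_deriv (\<lambda>t. star_d A (dipole e k t)) 0) (\<lambda>t. star_d A (dipole e k t))"
proof -
  have es: "even_smooth k" using rw by (simp add: radial_wave_def)
  note es2 = even_smooth_dt[OF even_smooth_dt[OF es]]
  show tf: "time_form CARD('n) (\<lambda>t. star_d A (dipole e k t))" by (rule time_form_star_d[OF A dipole_smooth[OF es]])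
  show "wave_solution CARD('n) (star_d A (dipole e k 0)) (time_deriv (\<lambda>t. star_d A (dipole e k t)) 0) (\<lambda>t. star_d A (dipole e k t))"
  proof (rule coclosed_wave[OF tf])
    fix q t v and x :: "'n point" assume q: "CARD('n) = Suc q" and x: "x \<in> hyp_space"
    show "codifferential q (star_d A (dipole e k t)) x v = 0"
      by (rule star_d_coclosed[OF A[unfolded q] q dipole_smooth_slice[OF es] x])
  next
    fix t v and x :: "'n point" assume x: "x \<in> hyp_space"
    have "codifferential CARD('n) (ext_deriv CARD('n) (star_d A (dipole e k t))) x v =
        codifferential CARD('n) (\<lambda>z v. snd z powi (- 1 - int CARD('n)) * dipole e (dt (dt k)) t z * A v) x v"
    proof (rule codifferential_cong[OF x])
      fix z :: "'n point" and v assume z: "z \<in> hyp_space"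
      show "ext_deriv CARD('n) (star_d A (dipole e k t)) z v = snd z powi (- 1 - int CARD('n)) * dipole e (dt (dt k)) t z * A v"
        unfolding ext_deriv_star_d[OF A dipole_smooth_slice[OF es] z] dipole_wave[OF rw z] ..
    qed
    also have "\<dots> = - star_d A (dipole e (dt (dt k)) t) x v" by (rule codifferential_top[OF dipole_smooth_slice[OF es2] x])
    also have "star_d A (dipole e (dt (dt k)) t) x v = time_deriv (\<lambda>t. star_d A (dipole e (dt k) t)) t x v"
      by (rule time_deriv_star_d[OF dipole_smooth[OF even_smooth_dt[OF es]] dipole_time[OF even_smooth_dt[OF es]] x, symmetric])
    also have "\<dots> = time_deriv (time_deriv (\<lambda>t. star_d A (dipole e k t))) t x v"
      unfolding time_deriv_def[of "\<lambda>t. star_d A (dipole e (dt k) t)"] time_deriv_def[of "time_deriv (\<lambda>t. star_d A (dipole e k t))"]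
      by (simp only: time_deriv_star_d[OF dipole_smooth[OF es] dipole_time[OF es] x])
    finally show "codifferential CARD('n) (ext_deriv CARD('n) (star_d A (dipole e k t))) x v = - time_deriv (time_deriv (\<lambda>t. star_d A (dipole e k t))) t x v" .
  qed
qed

definition top_form :: "((nat \<Rightarrow> 'n point) \<Rightarrow> real) \<Rightarrow> real^'n \<Rightarrow> (real \<times> real \<Rightarrow> real) \<Rightarrow> real \<Rightarrow> 'n form" where
  "top_form A e k t x v = snd x powi (- 1 - int CARD('n)) * dipole e k t x * A v"

text \<open>The codifferential of the star of u is minus the star of du, and d of the latter is the
  star of u_tt. The form is closed because there are no forms above the dimension.\<close>

lemma top_form_wave:
  assumes rw: "radial_wave k CARD('n) (real CARD('n) / 2)" and A: "alternating (Suc CARD('n)) A"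
  shows "time_form (Suc CARD('n)) (top_form A e k)"
    and "wave_solution (Suc CARD('n)) (top_form A e k 0) (time_deriv (top_form A e k) 0) (top_form A e k)"
proof -
  have es: "even_smooth k" using rw by (simp add: radial_wave_def)
  show tf: "time_form (Suc CARD('n)) (top_form A e k)"
    unfolding time_form_def
  proof (intro conjI allI ballI)
    show "alternating (Suc CARD('n)) (top_form A e k t x)" for t x
      unfolding top_form_def[abs_def] by (intro alternating_cmult A)
    fix v :: "nat \<Rightarrow> 'n point"
    have "smooth_on (UNIV \<times> hyp_space) (\<lambda>q. snd (snd q) powi (- 1 - int CARD('n)) * dipole e k (fst q) (snd q) * A v)"
      by (intro smooth_on_mult smooth_on_const dipole_smooth es open_spacetime smooth_on_extend_time[OF smooth_on_snd_powi])
    then show "smooth_on (UNIV \<times> hyp_space) (\<lambda>(t, x). top_form A e k t x v)"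
      by (simp add: top_form_def case_prod_unfold)
  qed
  have tt: "time_deriv (top_form A e k) = top_form A e (dt k)" if "even_smooth k" for k
  proof (intro ext)
    fix t x v
    have "((\<lambda>s. top_form A e k s x v) has_real_derivative top_form A e (dt k) t x v) (at t)"
      unfolding top_form_def by (intro DERIV_cmult_right DERIV_cmult dipole_time that)
    then show "time_deriv (top_form A e k) t x v = top_form A e (dt k) t x v" unfolding time_deriv_def by (rule DERIV_imp_deriv)
  qed
  show "wave_solution (Suc CARD('n)) (top_form A e k 0) (time_deriv (top_form A e k) 0) (top_form A e k)"
  proof (rule closed_wave[OF tf])
    fix t v and x :: "'n point" assume x: "x \<in> hyp_space"
    show "ext_deriv (Suc CARD('n)) (top_form A e k t) x v = 0"
      by (rule alternating_above_dimension[OF smooth_formD(1)[OF smooth_form_ext_deriv[OF smooth_form_slice[OF tf]] x]]) simp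
    have d: "(\<lambda>z. star_d A (dipole e k t) z w) differentiable (at x)" for w
      by (rule time_form_slices(3)[OF star_wave(1)[OF rw A] x])
    have "ext_deriv CARD('n) (codifferential CARD('n) (top_form A e k t)) x v = ext_deriv CARD('n) (\<lambda>z v. - star_d A (dipole e k t) z v) x v"
      by (rule ext_deriv_cong[OF x]) (simp only: top_form_def[abs_def] codifferential_top[OF dipole_smooth_slice[OF es]])
    also have "\<dots> = - ext_deriv CARD('n) (star_d A (dipole e k t)) x v"
      unfolding ext_deriv_def by (simp add: pd_minus d sum_negf)
    also have "ext_deriv CARD('n) (star_d A (dipole e k t)) x v = top_form A e (dt (dt k)) t x v"
      unfolding ext_deriv_star_d[OF A dipole_smooth_slice[OF es] x] dipole_wave[OF rw x] top_form_def ..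
    finally show "ext_deriv CARD('n) (codifferential CARD('n) (top_form A e k t)) x v = - time_deriv (time_deriv (top_form A e k)) t x v"
      by (simp only: tt[OF es] tt[OF even_smooth_dt[OF es]])
  qed
qed

text \<open>The vanishing of \<open>star_d\<close> forces the gradient to vanish, and on the
  vertical line its component along e is y^(-1) k |e|^2.\<close>

lemma star_d_lacuna:
  assumes A: "alternating (Suc CARD('n)) A" "A w \<noteq> 0" and es: "even_smooth k" and e: "e \<noteq> 0"
    and van: "\<And>t x v. x \<in> hyp_space \<Longrightarrow> hyp_dist (a, b) x < \<bar>t\<bar> - R \<Longrightarrow> star_d A (dipole e k t) x v = 0"
    and r: "0 < r" "r < \<bar>t\<bar> - R"
  shows "k (t, r) = 0"
proof -
  define x where "x = (a, b * exp r)"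
  have x: "x \<in> hyp_space" "radius x = r" using vertical_point[OF r(1)] by (simp_all add: x_def)
  have "hyp_dist (a, b) x < \<bar>t\<bar> - R"
    using eventually_nhds_x_imp_x[OF near_vertical[OF r, of 0]] by (simp add: x_def)
  then have "pd (e, 0) (dipole e k t) x = 0"
    by (intro star_d_zero_gradient[OF A smooth_on_differentiable[OF dipole_smooth_slice[OF es] x(1)] x(1)] van x)
  moreover have "pd (e, 0) (dipole e k t) x = weighted_radial (- 1) k t x * (e \<bullet> e)"
  proof -
    have "pd (e, 0) (dipole e k t) x = weighted_radial (- 1) k t x * pd (e, 0) (\<lambda>z. (fst z - a) \<bullet> e) x + pd (e, 0) (weighted_radial (- 1) k t) x * ((fst x - a) \<bullet> e)"
      unfolding dipole_def[abs_def]
      by (rule pd_mult[OF smooth_on_differentiable[OF weighted_radial_smooth_slice[OF es] x(1)] affine_derivative(1)[OF linear_inner_right]])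
    then show ?thesis unfolding affine_derivative(2)[OF linear_inner_right] by (simp add: x_def)
  qed
  moreover have "snd x powi (- 1) \<noteq> 0" using b by (simp add: x_def)
  ultimately show ?thesis using e x(2) by (simp add: weighted_radial_def)
qed

text \<open>For forms that contain x-derivatives the vanishing of k is wanted on a neighbourhood.
  This is why \<open>huygens_tail\<close> asks for the margin 2, although k vanishes from |t| + 1
  on.\<close>

lemma outside_cone_neighbourhood:
  assumes x: "x \<in> hyp_space" "radius x \<ge> \<bar>t\<bar> + 2"
  obtains S where "open S" "x \<in> S" "\<And>z. z \<in> S \<Longrightarrow> radius z \<ge> \<bar>t\<bar> + 1"
proof
  let ?S = "cosh_radius -` {cosh (\<bar>t\<bar> + 1)<..} \<inter> hyp_space"
  show "open ?S"
    using continuous_on_open_vimage[OF open_hyp_space, THEN iffD1, OF smooth_on_continuous[OF smooth_cosh_radius]] by simp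
  have "cosh (\<bar>t\<bar> + 1) < cosh (radius x)" by (subst cosh_real_nonneg_less_iff) (use x in auto)
  then show "x \<in> ?S" using x cosh_radius_ge_1[OF x(1)] by (simp add: radius_def)
  show "radius z \<ge> \<bar>t\<bar> + 1" if "z \<in> ?S" for z
  proof -
    have "arcosh (cosh (\<bar>t\<bar> + 1)) < arcosh (cosh_radius z)"
      using that by (intro arcosh_real_strict_mono) (auto simp: cosh_real_ge_1)
    then show ?thesis by (simp add: radius_def arcosh_cosh_real)
  qed
qed

end

section \<open>Conclusion\<close>

lemma no_lacuna:
  assumes "radial_wave k m M" "s > 0" "k (t, s) \<noteq> 0" "R > 0"
    and "\<And>t r. 0 < r \<Longrightarrow> r < \<bar>t\<bar> - R \<Longrightarrow> k (t, r) = 0"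
  shows False
proof -
  interpret lacunary_wave k m M R
    by (rule lacunary_wave.intro[OF assms(1)], unfold_locales) (use assms in auto)
  show False using lacunary_trivial[OF assms(2)] assms(3) by simp
qed

theorem theorem4p1:
  fixes n p :: nat and x\<^sub>0 :: "(real ^ 'n::finite) \<times> real"
  assumes "CARD('n) = n" and "n \<ge> 1" and "p \<le> n + 1"
    and "real p \<noteq> (real n + 1) / 2"
    and "x\<^sub>0 \<in> hyp_space"
  shows "\<not> huygens_principle p x\<^sub>0"
proof
  assume hp: "huygens_principle p x\<^sub>0"
  obtain a b where x0: "x\<^sub>0 = (a, b)" by (cases x\<^sub>0)
  interpret hyp_center a b by unfold_locales (use assms(5) x0 in \<open>simp add: hyp_space_def\<close>)
  note hp' = hp[unfolded x0]
  have n: "n = CARD('n)" using assms(1) by simp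
  define e :: "real^'n" where "e = axis undefined 1"
  have e: "e \<noteq> 0" by (simp add: e_def axis_eq_0_iff)
  have supp: "k (t, radius x) = 0" if "radial_wave k CARD('n) M" "radius x \<ge> \<bar>t\<bar> + 1" for k M t x
    using that by (simp add: radial_wave_def)
  \<comment> \<open>The ansatz needs a nonzero (p + 1)-form on R^n, so p < n, and a positive mass
    |n/2 - p|. If 2 p = n, the degree p - 1 has mass 1. In degrees n and n + 1 the scalar mass n / 2
    is used.\<close>
  consider (coclosed) "p < n" "2 * p \<noteq> n" | (middle) "2 * p = n" | (star) "p = n" "2 * p \<noteq> n" | (top) "p = n + 1"
    using assms(3) by linarith
  then show False
  proof cases
    case coclosed
    have "\<bar>real CARD('n) / 2 - real p\<bar> > 0" using coclosed n by (simp add: field_simps)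
    from radial_wave_exists[OF this, of "CARD('n)"]
    obtain k t s where k: "radial_wave k CARD('n) \<bar>real CARD('n) / 2 - real p\<bar>" "s > 0" "k (t, s) \<noteq> 0" by blast
    have es: "even_smooth k" using k(1) by (simp add: radial_wave_def)
    have "Suc p \<le> DIM(real^'n)" using coclosed n by simp
    then obtain A :: "(nat \<Rightarrow> real^'n) \<Rightarrow> real" and w where A: "alternating (Suc p) A" "A w \<noteq> 0"
      by (rule alternating_nontrivial_exists)
    note tf = coclosed_radial_time_form[OF A(1) es]
    have ws: "wave_solution p (coclosed_radial A p k 0) (time_deriv (coclosed_radial A p k) 0) (coclosed_radial A p k)"
    proof (rule coclosed_wave[OF tf])
      show "codifferential q (coclosed_radial A p k t) x v = 0" if "p = Suc q" "x \<in> hyp_space" for q t x v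
        unfolding coclosed_radial_eq[OF A(1) es] by (rule coclosed_ansatz.coclosed[OF ansatz[OF A(1) es] that])
    qed (rule coclosed_radial_equation[OF A(1) k(1)])
    have "coclosed_radial A p k t x v = 0" if "radius x \<ge> \<bar>t\<bar> + 2" for t x v
      using supp[OF k(1), of t x] that by (simp add: coclosed_radial_def weighted_radial_def)
    then obtain R where R: "R > 0" "\<And>t x v. x \<in> hyp_space \<Longrightarrow> hyp_dist (a, b) x < \<bar>t\<bar> - R \<Longrightarrow> coclosed_radial A p k t x v = 0"
      using huygens_tail[OF hp' tf ws] by blast
    show False by (rule no_lacuna[OF k R(1) coclosed_radial_lacuna[OF A es R(2)]])
  next
    case middle
    then obtain q where q: "p = Suc q" using assms(2) by (cases p) auto
    have M: "\<bar>real CARD('n) / 2 - real q\<bar> > 0" using middle n q by (simp add: field_simps)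
    from radial_wave_exists[OF this, of "CARD('n)"]
    obtain k t s where k: "radial_wave k CARD('n) \<bar>real CARD('n) / 2 - real q\<bar>" "s > 0" "k (t, s) \<noteq> 0" by blast
    have es: "even_smooth k" using k(1) by (simp add: radial_wave_def)
    have "Suc q \<le> DIM(real^'n)" using middle n q by simp
    then obtain A :: "(nat \<Rightarrow> real^'n) \<Rightarrow> real" and w where A: "alternating (Suc q) A" "A w \<noteq> 0"
      by (rule alternating_nontrivial_exists)
    note tf = coclosed_radial_time_form[OF A(1) es]
    have "ext_deriv q (coclosed_radial A q k t) x v = 0" if x: "x \<in> hyp_space" "radius x \<ge> \<bar>t\<bar> + 2" for t x v
    proof -
      obtain S where S: "open S" "x \<in> S" "\<And>z. z \<in> S \<Longrightarrow> radius z \<ge> \<bar>t\<bar> + 1"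
        using outside_cone_neighbourhood[OF x] by blast
      have "pd u (\<lambda>z. coclosed_radial A q k t z w) x = pd u (\<lambda>z. 0) x" for u w
        using frechet_cong[OF S(1,2), of "\<lambda>z. coclosed_radial A q k t z w" "\<lambda>z. 0"] supp[OF k(1) S(3)] by (simp add: coclosed_radial_def weighted_radial_def)
      then show ?thesis by (simp add: ext_deriv_def)
    qed
    then obtain R where R: "R > 0" "\<And>t x v. x \<in> hyp_space \<Longrightarrow> hyp_dist (a, b) x < \<bar>t\<bar> - R \<Longrightarrow> ext_deriv q (coclosed_radial A q k t) x v = 0"
      using huygens_tail[OF hp'[unfolded q] time_form_ext_deriv[OF tf] ext_deriv_wave[OF tf coclosed_radial_equation[OF A(1) k(1)]]] by blast
    show False by (rule no_lacuna[OF k R(1) ext_deriv_coclosed_radial_lacuna[OF A es R(2)]])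
  next
    case star
    have "real CARD('n) / 2 > 0" by simp
    from radial_wave_exists[OF this, of "CARD('n)"]
    obtain k t s where k: "radial_wave k CARD('n) (real CARD('n) / 2)" "s > 0" "k (t, s) \<noteq> 0" by blast
    have es: "even_smooth k" using k(1) by (simp add: radial_wave_def)
    have "Suc CARD('n) \<le> DIM('n point)" by simp
    then obtain A :: "(nat \<Rightarrow> 'n point) \<Rightarrow> real" and w where A: "alternating (Suc CARD('n)) A" "A w \<noteq> 0"
      by (rule alternating_nontrivial_exists)
    have "star_d A (dipole e k t) x v = 0" if x: "x \<in> hyp_space" "radius x \<ge> \<bar>t\<bar> + 2" for t x v
    proof -
      obtain S where S: "open S" "x \<in> S" "\<And>z. z \<in> S \<Longrightarrow> radius z \<ge> \<bar>t\<bar> + 1"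
        using outside_cone_neighbourhood[OF x] by blast
      have "pd u (dipole e k t) x = pd u (\<lambda>z. 0) x" for u
        using frechet_cong[OF S(1,2), of "dipole e k t" "\<lambda>z. 0"] supp[OF k(1) S(3)] by (simp add: dipole_def weighted_radial_def)
      then show ?thesis by (simp add: star_d_def)
    qed
    then obtain R where R: "R > 0" "\<And>t x v. x \<in> hyp_space \<Longrightarrow> hyp_dist (a, b) x < \<bar>t\<bar> - R \<Longrightarrow> star_d A (dipole e k t) x v = 0"
      using huygens_tail[OF hp'[unfolded star(1) n] star_wave[OF k(1) A(1)]] by blast
    show False by (rule no_lacuna[OF k R(1) star_d_lacuna[OF A es e R(2)]])
  next
    case top
    have "real CARD('n) / 2 > 0" by simp
    from radial_wave_exists[OF this, of "CARD('n)"]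
    obtain k t s where k: "radial_wave k CARD('n) (real CARD('n) / 2)" "s > 0" "k (t, s) \<noteq> 0" by blast
    have es: "even_smooth k" using k(1) by (simp add: radial_wave_def)
    have "Suc CARD('n) \<le> DIM('n point)" by simp
    then obtain A :: "(nat \<Rightarrow> 'n point) \<Rightarrow> real" and w where A: "alternating (Suc CARD('n)) A" "A w \<noteq> 0"
      by (rule alternating_nontrivial_exists)
    have p: "p = Suc CARD('n)" using top n by simp
    have "top_form A e k t x v = 0" if "radius x \<ge> \<bar>t\<bar> + 2" for t x v
      using supp[OF k(1), of t x] that by (simp add: top_form_def dipole_def weighted_radial_def)
    then obtain R where R: "R > 0" "\<And>t x v. x \<in> hyp_space \<Longrightarrow> hyp_dist (a, b) x < \<bar>t\<bar> - R \<Longrightarrow> top_form A e k t x v = 0"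
      using huygens_tail[OF hp'[unfolded p] top_form_wave[OF k(1) A(1)]] by blast
    \<comment> \<open>As A w is not 0, \<open>top_form\<close> vanishes only where
      \<open>dipole\<close> does, and \<open>dipole\<close> is the degree 0 case of
      \<open>coclosed_radial\<close>.\<close>
    have van: "coclosed_radial (\<lambda>v. v 0 \<bullet> e) 0 k t x v = 0" if "x \<in> hyp_space" "hyp_dist (a, b) x < \<bar>t\<bar> - R" for t x v
      using R(2)[OF that, of w] A(2) that(1) unfolding coclosed_radial_dipole top_form_def by (simp add: hyp_space_def)
    show False
      by (rule no_lacuna[OF k R(1) coclosed_radial_lacuna[OF alternating_inner[of e] _ es van, of "\<lambda>_. e"]]) (use e in simp)
  qed
qed

end
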